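(* Let $k$ be an arbitrary field and let $(R,\mathbb{L})$ be any Geigle-Lenzing complete intersection over $k$. Then $R$ is an $\mathbb{L}$-factorial $\mathbb{L}$-domain and has $\mathbb{L}$-isolated singularities.
   Context: Geigle-Lenzing (GL) complete intersection: let $k$ be a field, $d\ge -1$ and $n\ge 0$ integers, $C=k[T_0,\dots,T_d]$ ($C=k$ if $d=-1$), $\ell_1,\dots,\ell_n\in C$ linear forms ($\ell_i=0$ if $d=-1$) in general position, meaning that any set of at most $d+1$ of the $\ell_i$ is linearly independent, and $p_1,\dots,p_n$ positive integers (weights). Put $$R=k[T_0,\dots,T_d,X_1,\dots,X_n]/(X_i^{p_i}-\ell_i(T_0,\dots,T_d)\mid 1\le i\le n),\qquad \mathbb{L}=\langle \vec x_1,\dots,\vec x_n,\vec c\rangle/\langle p_i\vec x_i-\vec c\mid 1\le i\le n\rangle$$ ($\mathbb{L}$ is an abelian group). $R$ is $\mathbb{L}$-graded by $\deg T_j=\vec c$, $\deg X_i=\vec x_i$. The pair $(R,\mathbb{L})$ is the GL complete intersection associated with $\ell_1,\dots,\ell_n$ and $p_1,\dots,p_n$; $R$ has Krull dimension $d+1$. Let $G$ be an abelian group and $A$ a commutative Noetherian $G$-graded ring. $A$ is a $G$-domain if $A\neq 0$ and products of non-zero homogeneous elements are non-zero; $A$ is a $G$-field if $A\ne0$ and every non-zero homogeneous element is invertible. A homogeneous ideal $\mathfrak p$ is $G$-prime (resp. $G$-maximal) if $A/\mathfrak p$ is a $G$-domain (resp. $G$-field); $A_{(\mathfrak p)}$ denotes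 the localization of $A$ at the multiplicative set of homogeneous elements of $A\setminus\mathfrak p$. A non-zero homogeneous element $a$ is a $G$-prime element if $Aa$ is a $G$-prime ideal. A $G$-domain $A$ is $G$-factorial if every non-zero non-invertible homogeneous element is a product of $G$-prime elements. $A$ is $G$-regular if the category of finitely generated $G$-graded $A$-modules (with degree-preserving morphisms) has finite global dimension. $A$ has (at worst) $G$-isolated singularities if $A_{(\mathfrak p)}$ is $G$-regular for every $G$-prime ideal $\mathfrak p$ that is not $G$-maximal.
   Formalization: The L-domain claim is stated only for d ≥ 0 or all weights 1, and L-factoriality only for d ≥ 1 or at most d+1 weights different from 1, since both fail otherwise (k[X]/(X²) for d = -1; k[X₁,X₂]/(X₁²−X₂²) for d = 0). *)

theory Defs
  imports
    "HOL-Algebra.Free_Abelian_Groups"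
    "HOL-Algebra.Generated_Groups"
    "HOL-Algebra.Module"
    "HOL-Algebra.QuotRing"
begin

section \<open>Rings graded by an abelian group\<close>

text \<open>
  Grading groups are abelian but written multiplicatively, as everywhere in HOL-Algebra.  A grading
  by \<open>G\<close> is given by the family \<open>gr\<close> of homogeneous components; values of \<open>gr\<close> outside \<open>carrier G\<close>
  are irrelevant.  The predicate says that \<open>M\<close> is the internal direct sum of the \<open>gr g\<close>.
\<close>

definition is_grading ::
    "('g, 'u) monoid_scheme \<Rightarrow> ('m, 'w) ring_scheme \<Rightarrow> ('g \<Rightarrow> 'm set) \<Rightarrow> bool" where
  "is_grading G M gr \<longleftrightarrow>
     (\<forall>g\<in>carrier G. additive_subgroup (gr g) M) \<and>
     (\<forall>x\<in>carrier M. \<exists>!f. f \<in> (\<Pi>\<^sub>E g\<in>carrier G. gr g) \<and>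
        finite {g \<in> carrier G. f g \<noteq> \<zero>\<^bsub>M\<^esub>} \<and>
        x = finsum M f {g \<in> carrier G. f g \<noteq> \<zero>\<^bsub>M\<^esub>})"

definition homogeneous_elements ::
    "('g, 'u) monoid_scheme \<Rightarrow> ('g \<Rightarrow> 'a set) \<Rightarrow> 'a set" where
  "homogeneous_elements G gr = (\<Union>g\<in>carrier G. gr g)"

text \<open>
  From here on \<open>A\<close> stands for a commutative Noetherian ring with a grading \<open>gr\<close> satisfying
  \<open>gr g \<cdot> gr h \<subseteq> gr (g \<otimes> h)\<close>; these standing assumptions are not repeated in each definition.
\<close>

definition G_domain ::
    "('g, 'u) monoid_scheme \<Rightarrow> ('a, 'w) ring_scheme \<Rightarrow> ('g \<Rightarrow> 'a set) \<Rightarrow> bool" where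
  "G_domain G A gr \<longleftrightarrow> \<one>\<^bsub>A\<^esub> \<noteq> \<zero>\<^bsub>A\<^esub> \<and>
     (\<forall>a\<in>homogeneous_elements G gr. \<forall>b\<in>homogeneous_elements G gr.
        a \<noteq> \<zero>\<^bsub>A\<^esub> \<longrightarrow> b \<noteq> \<zero>\<^bsub>A\<^esub> \<longrightarrow> a \<otimes>\<^bsub>A\<^esub> b \<noteq> \<zero>\<^bsub>A\<^esub>)"

definition G_field ::
    "('g, 'u) monoid_scheme \<Rightarrow> ('a, 'w) ring_scheme \<Rightarrow> ('g \<Rightarrow> 'a set) \<Rightarrow> bool" where
  "G_field G A gr \<longleftrightarrow> \<one>\<^bsub>A\<^esub> \<noteq> \<zero>\<^bsub>A\<^esub> \<and>
     (\<forall>a\<in>homogeneous_elements G gr. a \<noteq> \<zero>\<^bsub>A\<^esub> \<longrightarrow> a \<in> Units A)"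

definition homogeneous_ideal ::
    "('g, 'u) monoid_scheme \<Rightarrow> ('a, 'w) ring_scheme \<Rightarrow> ('g \<Rightarrow> 'a set) \<Rightarrow> 'a set \<Rightarrow> bool" where
  "homogeneous_ideal G A gr I \<longleftrightarrow>
     ideal I A \<and> (\<exists>H \<subseteq> homogeneous_elements G gr. I = Idl\<^bsub>A\<^esub> H)"

definition quot_grading :: "('a, 'w) ring_scheme \<Rightarrow> 'a set \<Rightarrow> ('g \<Rightarrow> 'a set) \<Rightarrow> 'g \<Rightarrow> 'a set set" where
  "quot_grading A I gr g = (\<lambda>a. I +>\<^bsub>A\<^esub> a) ` gr g"

definition G_prime_ideal ::
    "('g, 'u) monoid_scheme \<Rightarrow> ('a, 'w) ring_scheme \<Rightarrow> ('g \<Rightarrow> 'a set) \<Rightarrow> 'a set \<Rightarrow> bool" where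
  "G_prime_ideal G A gr I \<longleftrightarrow>
     homogeneous_ideal G A gr I \<and> G_domain G (A Quot I) (quot_grading A I gr)"

definition G_maximal_ideal ::
    "('g, 'u) monoid_scheme \<Rightarrow> ('a, 'w) ring_scheme \<Rightarrow> ('g \<Rightarrow> 'a set) \<Rightarrow> 'a set \<Rightarrow> bool" where
  "G_maximal_ideal G A gr I \<longleftrightarrow>
     homogeneous_ideal G A gr I \<and> G_field G (A Quot I) (quot_grading A I gr)"

definition G_prime_element ::
    "('g, 'u) monoid_scheme \<Rightarrow> ('a, 'w) ring_scheme \<Rightarrow> ('g \<Rightarrow> 'a set) \<Rightarrow> 'a \<Rightarrow> bool" where
  "G_prime_element G A gr a \<longleftrightarrow>
     a \<in> homogeneous_elements G gr \<and> a \<noteq> \<zero>\<^bsub>A\<^esub> \<and> G_prime_ideal G A gr (PIdl\<^bsub>A\<^esub> a)"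

definition G_factorial ::
    "('g, 'u) monoid_scheme \<Rightarrow> ('a, 'w) ring_scheme \<Rightarrow> ('g \<Rightarrow> 'a set) \<Rightarrow> bool" where
  "G_factorial G A gr \<longleftrightarrow> G_domain G A gr \<and>
     (\<forall>a\<in>homogeneous_elements G gr. a \<noteq> \<zero>\<^bsub>A\<^esub> \<longrightarrow> a \<notin> Units A \<longrightarrow>
        (\<exists>qs. (\<forall>q\<in>set qs. G_prime_element G A gr q) \<and> a = foldr (\<otimes>\<^bsub>A\<^esub>) qs \<one>\<^bsub>A\<^esub>))"


section \<open>Localization\<close>

definition frac_rel :: "('a, 'w) ring_scheme \<Rightarrow> 'a set \<Rightarrow> ('a \<times> 'a) rel" where
  "frac_rel A S = {((a, s), (b, t)). a \<in> carrier A \<and> s \<in> S \<and> b \<in> carrier A \<and> t \<in> S \<and>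
     (\<exists>u\<in>S. u \<otimes>\<^bsub>A\<^esub> (a \<otimes>\<^bsub>A\<^esub> t \<ominus>\<^bsub>A\<^esub> b \<otimes>\<^bsub>A\<^esub> s) = \<zero>\<^bsub>A\<^esub>)}"

definition frac :: "('a, 'w) ring_scheme \<Rightarrow> 'a set \<Rightarrow> 'a \<Rightarrow> 'a \<Rightarrow> ('a \<times> 'a) set" where
  "frac A S a s = frac_rel A S `` {(a, s)}"

text \<open>The unions below range over all representatives and collapse to a single class.\<close>

definition localization :: "('a, 'w) ring_scheme \<Rightarrow> 'a set \<Rightarrow> ('a \<times> 'a) set ring" where
  "localization A S =
     \<lparr>carrier = (carrier A \<times> S) // frac_rel A S,
      mult = (\<lambda>x y. \<Union>(a, s)\<in>x. \<Union>(b, t)\<in>y. frac A S (a \<otimes>\<^bsub>A\<^esub> b) (s \<otimes>\<^bsub>A\<^esub> t)),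
      one = frac A S \<one>\<^bsub>A\<^esub> \<one>\<^bsub>A\<^esub>,
      zero = frac A S \<zero>\<^bsub>A\<^esub> \<one>\<^bsub>A\<^esub>,
      add = (\<lambda>x y. \<Union>(a, s)\<in>x. \<Union>(b, t)\<in>y.
        frac A S (a \<otimes>\<^bsub>A\<^esub> t \<oplus>\<^bsub>A\<^esub> b \<otimes>\<^bsub>A\<^esub> s) (s \<otimes>\<^bsub>A\<^esub> t))\<rparr>"

definition loc_grading ::
    "('g, 'u) monoid_scheme \<Rightarrow> ('a, 'w) ring_scheme \<Rightarrow> ('g \<Rightarrow> 'a set) \<Rightarrow> 'a set
      \<Rightarrow> 'g \<Rightarrow> ('a \<times> 'a) set set" where
  "loc_grading G A gr S g =
     {frac A S a s |a s h. h \<in> carrier G \<and> s \<in> S \<inter> gr h \<and> a \<in> gr (g \<otimes>\<^bsub>G\<^esub> h)}"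


section \<open>Finitely generated graded modules and global dimension\<close>

type_synonym ('g, 'a, 'm) gmod = "('a, 'm) module \<times> ('g \<Rightarrow> 'm set)"

definition graded_module ::
    "('g, 'u) monoid_scheme \<Rightarrow> ('a, 'w) ring_scheme \<Rightarrow> ('g \<Rightarrow> 'a set) \<Rightarrow> ('g, 'a, 'm) gmod \<Rightarrow> bool"
  where
  "graded_module G A gr = (\<lambda>(M, grM). module A M \<and> is_grading G M grM \<and>
     (\<forall>g\<in>carrier G. \<forall>h\<in>carrier G. \<forall>a\<in>gr g. \<forall>x\<in>grM h. a \<odot>\<^bsub>M\<^esub> x \<in> grM (g \<otimes>\<^bsub>G\<^esub> h)))"

definition fin_gen_module :: "('a, 'w) ring_scheme \<Rightarrow> ('a, 'm) module \<Rightarrow> bool" where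
  "fin_gen_module A M \<longleftrightarrow> (\<exists>X. finite X \<and> X \<subseteq> carrier M \<and>
     (\<forall>y\<in>carrier M. \<exists>c \<in> X \<rightarrow> carrier A. y = (\<Oplus>\<^bsub>M\<^esub>x\<in>X. c x \<odot>\<^bsub>M\<^esub> x)))"

text \<open>
  The objects of the category of finitely generated graded \<open>A\<close>-modules.  The elements of a module
  are taken from the type \<open>(nat \<Rightarrow> 'a) set\<close>, with arbitrary module operations.  Up to isomorphism
  this is no restriction: a finitely generated graded module is a quotient of some \<open>A\<^sup>r\<close> (with
  shifted grading), i.e. can be realised on a set of cosets of functions \<open>nat \<Rightarrow> 'a\<close> supported
  below \<open>r\<close>.
\<close>

definition fg_gmod ::
    "('g, 'u) monoid_scheme \<Rightarrow> ('a, 'w) ring_scheme \<Rightarrow> ('g \<Rightarrow> 'a set)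
      \<Rightarrow> ('g, 'a, (nat \<Rightarrow> 'a) set) gmod \<Rightarrow> bool" where
  "fg_gmod G A gr M \<longleftrightarrow> graded_module G A gr M \<and> fin_gen_module A (fst M)"

abbreviation gcarrier :: "('g, 'a, 'm) gmod \<Rightarrow> 'm set" where
  "gcarrier M \<equiv> carrier (fst M)"

definition gmod_hom ::
    "('g, 'u) monoid_scheme \<Rightarrow> ('a, 'w) ring_scheme \<Rightarrow> ('g, 'a, 'm) gmod \<Rightarrow> ('g, 'a, 'n) gmod
      \<Rightarrow> ('m \<Rightarrow> 'n) set" where
  "gmod_hom G A = (\<lambda>(M, grM) (N, grN). {f \<in> carrier M \<rightarrow> carrier N.
     (\<forall>x\<in>carrier M. \<forall>y\<in>carrier M. f (x \<oplus>\<^bsub>M\<^esub> y) = f x \<oplus>\<^bsub>N\<^esub> f y) \<and>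
     (\<forall>a\<in>carrier A. \<forall>x\<in>carrier M. f (a \<odot>\<^bsub>M\<^esub> x) = a \<odot>\<^bsub>N\<^esub> f x) \<and>
     (\<forall>g\<in>carrier G. \<forall>x\<in>grM g. f x \<in> grN g)})"

text \<open>The epimorphisms of this category are exactly the surjective morphisms.\<close>

definition projective_gmod ::
    "('g, 'u) monoid_scheme \<Rightarrow> ('a, 'w) ring_scheme \<Rightarrow> ('g \<Rightarrow> 'a set)
      \<Rightarrow> ('g, 'a, (nat \<Rightarrow> 'a) set) gmod \<Rightarrow> bool" where
  "projective_gmod G A gr P \<longleftrightarrow> fg_gmod G A gr P \<and>
     (\<forall>M N f h. fg_gmod G A gr M \<and> fg_gmod G A gr N \<and>
        f \<in> gmod_hom G A M N \<and> f ` gcarrier M = gcarrier N \<and> h \<in> gmod_hom G A P N \<longrightarrow>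
        (\<exists>h'\<in>gmod_hom G A P M. \<forall>x\<in>gcarrier P. f (h' x) = h x))"

text \<open>
  There is an exact sequence \<open>0 \<rightarrow> P\<^sub>n \<rightarrow> \<dots> \<rightarrow> P\<^sub>0 \<rightarrow> M \<rightarrow> 0\<close> with all \<open>P\<^sub>i\<close> projective.
\<close>

definition proj_dim_le ::
    "('g, 'u) monoid_scheme \<Rightarrow> ('a, 'w) ring_scheme \<Rightarrow> ('g \<Rightarrow> 'a set) \<Rightarrow> nat
      \<Rightarrow> ('g, 'a, (nat \<Rightarrow> 'a) set) gmod \<Rightarrow> bool" where
  "proj_dim_le G A gr n M \<longleftrightarrow> (\<exists>P \<delta> \<epsilon>.
     (\<forall>i. projective_gmod G A gr (P i)) \<and>
     (\<forall>i>n. gcarrier (P i) = {\<zero>\<^bsub>fst (P i)\<^esub>}) \<and>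
     \<epsilon> \<in> gmod_hom G A (P 0) M \<and> (\<forall>i. \<delta> i \<in> gmod_hom G A (P (Suc i)) (P i)) \<and>
     \<epsilon> ` gcarrier (P 0) = gcarrier M \<and>
     {x \<in> gcarrier (P 0). \<epsilon> x = \<zero>\<^bsub>fst M\<^esub>} = \<delta> 0 ` gcarrier (P 1) \<and>
     (\<forall>i. {x \<in> gcarrier (P (Suc i)). \<delta> i x = \<zero>\<^bsub>fst (P i)\<^esub>}
            = \<delta> (Suc i) ` gcarrier (P (Suc (Suc i)))))"

definition G_regular ::
    "('g, 'u) monoid_scheme \<Rightarrow> ('a, 'w) ring_scheme \<Rightarrow> ('g \<Rightarrow> 'a set) \<Rightarrow> bool" where
  "G_regular G A gr \<longleftrightarrow> (\<exists>n. \<forall>M. fg_gmod G A gr M \<longrightarrow> proj_dim_le G A gr n M)"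

definition G_isolated_singularities ::
    "('g, 'u) monoid_scheme \<Rightarrow> ('a, 'w) ring_scheme \<Rightarrow> ('g \<Rightarrow> 'a set) \<Rightarrow> bool" where
  "G_isolated_singularities G A gr \<longleftrightarrow>
     (\<forall>I. G_prime_ideal G A gr I \<and> \<not> G_maximal_ideal G A gr I \<longrightarrow>
        (let S = homogeneous_elements G gr - I
         in G_regular G (localization A S) (loc_grading G A gr S)))"


section \<open>Geigle-Lenzing complete intersections\<close>

text \<open>
  \<open>d\<close> is an integer \<open>\<ge> -1\<close>; the variables of \<open>k[T\<^sub>0, \<dots>, T\<^sub>d, X\<^sub>1, \<dots>, X\<^sub>n]\<close> are the \<open>T j\<close> with
  \<open>int j \<le> d\<close> and the \<open>X i\<close> with \<open>i \<in> {1..n}\<close>.  The type \<open>'k gl_poly\<close> has infinitely many variables;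
  a polynomial ring in finitely many of them is cut out by its carrier.
\<close>

datatype gl_var = T nat | X nat

type_synonym 'k gl_poly = "(gl_var \<Rightarrow>\<^sub>0 nat) \<Rightarrow>\<^sub>0 'k"

definition Var :: "gl_var \<Rightarrow> 'k::field gl_poly" where
  "Var v = Poly_Mapping.single (Poly_Mapping.single v 1) 1"

definition Const :: "'k::field \<Rightarrow> 'k gl_poly" where
  "Const c = Poly_Mapping.single 0 c"

definition gl_vars :: "int \<Rightarrow> nat \<Rightarrow> gl_var set" where
  "gl_vars d n = T ` {j. int j \<le> d} \<union> X ` {1..n}"

definition gl_poly_ring :: "int \<Rightarrow> nat \<Rightarrow> 'k::field gl_poly ring" where
  "gl_poly_ring d n =
     \<lparr>carrier = {f. \<forall>m\<in>Poly_Mapping.keys f. Poly_Mapping.keys m \<subseteq> gl_vars d n},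
      mult = (*), one = 1, zero = 0, add = (+)\<rparr>"

definition linear_form :: "int \<Rightarrow> 'k::field gl_poly \<Rightarrow> bool" where
  "linear_form d f \<longleftrightarrow> (\<exists>a. f = (\<Sum>j | int j \<le> d. Const (a j) * Var (T j)))"

text \<open>Linear independence is that of the family \<open>(l i)\<close> for \<open>i\<close> in \<open>J\<close>, over the field \<open>k\<close>.\<close>

definition general_position :: "int \<Rightarrow> nat \<Rightarrow> (nat \<Rightarrow> 'k::field gl_poly) \<Rightarrow> bool" where
  "general_position d n l \<longleftrightarrow> (\<forall>J \<subseteq> {1..n}. int (card J) \<le> d + 1 \<longrightarrow>
     (\<forall>a. (\<Sum>i\<in>J. Const (a i) * l i) = 0 \<longrightarrow> (\<forall>i\<in>J. a i = 0)))"

definition gl_ideal :: "int \<Rightarrow> nat \<Rightarrow> (nat \<Rightarrow> 'k::field gl_poly) \<Rightarrow> (nat \<Rightarrow> nat) \<Rightarrow> 'k gl_poly set" where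
  "gl_ideal d n l p = Idl\<^bsub>gl_poly_ring d n\<^esub> ((\<lambda>i. Var (X i) ^ p i - l i) ` {1..n})"

definition gl_ring ::
    "int \<Rightarrow> nat \<Rightarrow> (nat \<Rightarrow> 'k::field gl_poly) \<Rightarrow> (nat \<Rightarrow> nat) \<Rightarrow> 'k gl_poly set ring" where
  "gl_ring d n l p = gl_poly_ring d n Quot gl_ideal d n l p"

datatype gl_gen = gen_x nat | gen_c

definition gl_free_group :: "nat \<Rightarrow> (gl_gen \<Rightarrow>\<^sub>0 int) monoid" where
  "gl_free_group n = free_Abelian_group (insert gen_c (gen_x ` {1..n}))"

definition gl_relations :: "nat \<Rightarrow> (nat \<Rightarrow> nat) \<Rightarrow> (gl_gen \<Rightarrow>\<^sub>0 int) set" where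
  "gl_relations n p = generate (gl_free_group n)
     ((\<lambda>i. frag_cmul (int (p i)) (frag_of (gen_x i)) - frag_of gen_c) ` {1..n})"

text \<open>The group \<open>\<bbbL>\<close>, written multiplicatively as a HOL-Algebra quotient group.\<close>

definition gl_group :: "nat \<Rightarrow> (nat \<Rightarrow> nat) \<Rightarrow> (gl_gen \<Rightarrow>\<^sub>0 int) set monoid" where
  "gl_group n p = gl_free_group n Mod gl_relations n p"

definition gl_gen_class :: "nat \<Rightarrow> (nat \<Rightarrow> nat) \<Rightarrow> gl_gen \<Rightarrow> (gl_gen \<Rightarrow>\<^sub>0 int) set" where
  "gl_gen_class n p u = gl_relations n p #>\<^bsub>gl_free_group n\<^esub> frag_of u"

fun gl_var_degree :: "nat \<Rightarrow> (nat \<Rightarrow> nat) \<Rightarrow> gl_var \<Rightarrow> (gl_gen \<Rightarrow>\<^sub>0 int) set" where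
  "gl_var_degree n p (T j) = gl_gen_class n p gen_c"
| "gl_var_degree n p (X i) = gl_gen_class n p (gen_x i)"

definition gl_degree :: "nat \<Rightarrow> (nat \<Rightarrow> nat) \<Rightarrow> (gl_var \<Rightarrow>\<^sub>0 nat) \<Rightarrow> (gl_gen \<Rightarrow>\<^sub>0 int) set" where
  "gl_degree n p m = finprod (gl_group n p)
     (\<lambda>v. gl_var_degree n p v [^]\<^bsub>gl_group n p\<^esub> Poly_Mapping.lookup m v) (Poly_Mapping.keys m)"

definition gl_poly_grading ::
    "int \<Rightarrow> nat \<Rightarrow> (nat \<Rightarrow> nat) \<Rightarrow> (gl_gen \<Rightarrow>\<^sub>0 int) set \<Rightarrow> 'k::field gl_poly set" where
  "gl_poly_grading d n p g =
     {f \<in> carrier (gl_poly_ring d n). \<forall>m\<in>Poly_Mapping.keys f. gl_degree n p m = g}"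

definition gl_grading ::
    "int \<Rightarrow> nat \<Rightarrow> (nat \<Rightarrow> 'k::field gl_poly) \<Rightarrow> (nat \<Rightarrow> nat)
      \<Rightarrow> (gl_gen \<Rightarrow>\<^sub>0 int) set \<Rightarrow> 'k gl_poly set set" where
  "gl_grading d n l p = quot_grading (gl_poly_ring d n) (gl_ideal d n l p) (gl_poly_grading d n p)"

text \<open>
  Degenerate cases.  Call a weight \<open>p i\<close> trivial if it is 1.
  For \<open>d = -1\<close> the ring is \<open>k[X\<^sub>1, \<dots>, X\<^sub>n]/(X\<^sub>i\<^bsup>p i\<^esup>)\<close>, so a non-trivial weight gives a non-zero
  homogeneous nilpotent and the ring is not an \<open>\<bbbL>\<close>-domain.
  For \<open>d = 0\<close> and two non-trivial weights, say \<open>p 1\<close> and \<open>p 2\<close>, the ring is an \<open>\<bbbL>\<close>-domain but not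
  \<open>\<bbbL>\<close>-factorial: \<open>X\<^sub>1\<close> has no non-trivial homogeneous factorization, while \<open>X\<^sub>2\<close> is a non-zero
  homogeneous nilpotent modulo \<open>X\<^sub>1\<close>, as \<open>X\<^sub>2\<^bsup>p 2\<^esup>\<close> is a scalar multiple of \<open>T\<^sub>0\<close> and hence of \<open>X\<^sub>1\<^bsup>p 1\<^esup>\<close>.
  Being an \<open>\<bbbL>\<close>-domain, respectively \<open>\<bbbL>\<close>-factorial, therefore requires \<open>0 \<le> d\<close>, respectively \<open>1 \<le> d\<close>,
  unless there are at most \<open>d + 1\<close> non-trivial weights.
\<close>

end

theory Submission imports "HOL-Computational_Algebra.Polynomial" Defs begin

text \<open>
  For a set \<open>I\<close> of at most \<open>d + 1\<close> indices, linear algebra provides variables \<open>T\<^sub>t\<close> (\<open>t \<in> J'\<close>) which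
  together with the \<open>l i\<close> (\<open>i \<in> I\<close>) form coordinates of the space of linear forms.  Put
  \<open>A = k[X\<^sub>i, T\<^sub>t | i \<in> I, t \<in> J']\<close>.  Substituting for the \<open>T j\<close> and replacing \<open>X\<^sub>j\<^bsup>b\<^esup>\<close> by \<open>l\<^sub>j\<^bsup>b div p j\<^esup>\<close> for
  \<open>j \<notin> I\<close> gives an additive map to \<open>A\<close> that kills the defining ideal, and shows that every
  homogeneous element of \<open>R\<close> is \<open>X\<^bsup>a\<^esup> w\<close> for a unique homogeneous \<open>w \<in> A\<close> and exponents \<open>a j < p j\<close>, \<open>j \<notin> I\<close>.
  With \<open>I = {}\<close>, factoring \<open>w\<close> in the factorial ring \<open>A\<close> reduces everything to primes of \<open>A\<close>; the divisors
  of the \<open>l i\<close> are accounted for by \<open>X i\<close>, whose primality is seen with \<open>I = {i}\<close>.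
  If a graded prime is not maximal, the set \<open>I\<close> of all \<open>i\<close> with \<open>X i\<close> in it has at most \<open>d\<close> elements.  The other
  \<open>X j\<close> become units in the localization, so that graded modules over it are, up to units, localizations of
  graded \<open>A\<close>-modules, which have finite free resolutions by Hilbert's syzygy theorem.
\<close>

section \<open>Finite free resolutions and Hilbert's syzygy theorem\<close>

text \<open>The obstacle is torsion in L. A factor of a homogeneous element need not be homogeneous:
  for weights 2 and 2 the element X_1^2 - X_2^2 of degree c has the factor X_1 - X_2. So nothing is
  factored in R itself. For I = {} the degrees occurring in A are multiples of c, which has infinite
  order, and there factors of homogeneous elements are homogeneous. Replacing X_j^b by l_j^(b div
  p_j) is not multiplicative, as integer quotients do not add. It is multiplicative against
  polynomials whose exponents at X_j are divisible by p_j for all j outside I. Both X_i^(p_i) and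
  l_i are of this kind, which suffices to kill the ideal. In a product of two normal forms the
  carries contribute only factors l_j, so primality in R comes down to whether a prime of A divides
  l_j. The bound d on I has this reason: d + 1 of the X_i leave J' empty, so every T_j is a
  combination of the X_i^(p_i), and the graded prime contains all variables. Degrees are represented
  in a free abelian group, so Hilbert's theorem is proved for degrees known only up to a
  congruence.\<close>

definition subring_set :: "'a::comm_ring_1 set \<Rightarrow> bool" where
  "subring_set A \<longleftrightarrow> 0 \<in> A \<and> 1 \<in> A \<and> (\<forall>a\<in>A. \<forall>b\<in>A. a + b \<in> A \<and> a * b \<in> A) \<and> (\<forall>a\<in>A. - a \<in> A)"

lemma subring_setD:
  assumes "subring_set A"
  shows "0 \<in> A" "1 \<in> A" "a \<in> A \<Longrightarrow> b \<in> A \<Longrightarrow> a + b \<in> A" "a \<in> A \<Longrightarrow> b \<in> A \<Longrightarrow> a * b \<in> A"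
    "a \<in> A \<Longrightarrow> - a \<in> A" "a \<in> A \<Longrightarrow> b \<in> A \<Longrightarrow> a - b \<in> A"
proof -
  show 1: "0 \<in> A" "1 \<in> A" "a \<in> A \<Longrightarrow> b \<in> A \<Longrightarrow> a + b \<in> A" "a \<in> A \<Longrightarrow> b \<in> A \<Longrightarrow> a * b \<in> A" "a \<in> A \<Longrightarrow> - a \<in> A" for a b
    using assms unfolding subring_set_def by blast+
  show "a \<in> A \<Longrightarrow> b \<in> A \<Longrightarrow> a - b \<in> A"
    using 1(3)[of a "- b"] 1(5)[of b] by simp
qed

lemma subring_set_sum: "subring_set A \<Longrightarrow> (\<And>i. i \<in> I \<Longrightarrow> f i \<in> A) \<Longrightarrow> sum f I \<in> A"
  by (induction I rule: infinite_finite_induct) (auto simp: subring_setD)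

lemma subring_set_prod: "subring_set A \<Longrightarrow> (\<And>i. i \<in> I \<Longrightarrow> f i \<in> A) \<Longrightarrow> prod f I \<in> A"
  by (induction I rule: infinite_finite_induct) (auto simp: subring_setD)

lemma subring_set_power: "subring_set A \<Longrightarrow> f \<in> A \<Longrightarrow> f ^ k \<in> A"
  by (induction k) (auto simp: subring_setD)

section \<open>Vectors over a subring and their linear combinations\<close>

definition vecs :: "'a::comm_ring_1 set \<Rightarrow> nat \<Rightarrow> (nat \<Rightarrow> 'a) set" where
  "vecs A r = {v. (\<forall>i. v i \<in> A) \<and> (\<forall>i\<ge>r. v i = 0)}"

definition lincomb :: "nat \<Rightarrow> (nat \<Rightarrow> nat \<Rightarrow> 'a::comm_ring_1) \<Rightarrow> (nat \<Rightarrow> 'a) \<Rightarrow> nat \<Rightarrow> 'a" where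
  "lincomb s xs c = (\<lambda>i. \<Sum>j<s. c j * xs j i)"

text \<open>Linearity is demanded on all functions, without a domain: the maps used below are given
  by matrices over the ring, and what they do to submodules is stated separately.\<close>

definition linear_map :: "((nat \<Rightarrow> 'a::comm_ring_1) \<Rightarrow> nat \<Rightarrow> 'a) \<Rightarrow> bool" where
  "linear_map f \<longleftrightarrow> (\<forall>v w. f (\<lambda>i. v i + w i) = (\<lambda>i. f v i + f w i)) \<and> (\<forall>a v. f (\<lambda>i. a * v i) = (\<lambda>i. a * f v i))"

lemma linear_mapD:
  assumes "linear_map f"
  shows "f (\<lambda>i. v i + w i) = (\<lambda>i. f v i + f w i)" "f (\<lambda>i. a * v i) = (\<lambda>i. a * f v i)"
    "f (\<lambda>i. 0) = (\<lambda>i. 0)" "f (\<lambda>i. v i - w i) = (\<lambda>i. f v i - f w i)"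
proof -
  show *: "f (\<lambda>i. v i + w i) = (\<lambda>i. f v i + f w i)" for v w using assms unfolding linear_map_def by blast
  show m: "f (\<lambda>i. a * v i) = (\<lambda>i. a * f v i)" for a v using assms unfolding linear_map_def by blast
  show "f (\<lambda>i. 0) = (\<lambda>i. 0)" using m[of 0 "\<lambda>i. 0"] by simp
  show "f (\<lambda>i. v i - w i) = (\<lambda>i. f v i - f w i)" using *[of v "\<lambda>i. (-1) * w i"] m[of "-1" w] by simp
qed

lemma linear_map_lincomb:
  assumes "linear_map f" shows "f (lincomb s xs c) = lincomb s (\<lambda>j. f (xs j)) c"
proof (induction s)
  case 0 then show ?case using linear_mapD(3)[OF assms] by (simp add: lincomb_def)
next
  case (Suc s)
  have "f (lincomb (Suc s) xs c) = f (\<lambda>i. lincomb s xs c i + c s * xs s i)" by (simp add: lincomb_def)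
  also have "\<dots> = (\<lambda>i. f (lincomb s xs c) i + c s * f (xs s) i)"
    by (simp add: linear_mapD(1)[OF assms, of "lincomb s xs c"] linear_mapD(2)[OF assms])
  also have "\<dots> = lincomb (Suc s) (\<lambda>j. f (xs j)) c" by (subst Suc) (simp add: lincomb_def)
  finally show ?case .
qed

text \<open>\<open>hom e f\<close> reads: f is homogeneous and its degree is the class of e. Several
  e may represent one degree, and the classes are never formed; that e and e' represent the same
  degree is expressed by \<open>hom (e + c) = hom (e' + c)\<close> for all c.
  \<open>hom_unique\<close> says that a non-zero element has only one degree.\<close>

locale hom_ring =
  fixes hom :: "'g::ab_group_add \<Rightarrow> 'a::comm_ring_1 \<Rightarrow> bool"
  assumes hom_0: "hom e 0"
    and hom_add: "hom e f \<Longrightarrow> hom e g \<Longrightarrow> hom e (f + g)"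
    and hom_uminus: "hom e f \<Longrightarrow> hom e (- f)"
    and hom_mult: "hom e f \<Longrightarrow> hom e' g \<Longrightarrow> hom (e + e') (f * g)"
    and hom_1: "hom 0 1"
    and hom_unique: "hom e f \<Longrightarrow> hom e' f \<Longrightarrow> f \<noteq> 0 \<Longrightarrow> hom (e + c) = hom (e' + c)"
begin

lemma hom_mult': "hom e f \<Longrightarrow> hom e' g \<Longrightarrow> e + e' = e'' \<Longrightarrow> hom e'' (f * g)"
  using hom_mult[of e f e' g] by simp

lemma hom_diff: "hom e f \<Longrightarrow> hom e g \<Longrightarrow> hom e (f - g)"
  using hom_add[of e f "- g"] hom_uminus by simp

lemma hom_sum: "(\<And>i. i \<in> I \<Longrightarrow> hom e (f i)) \<Longrightarrow> hom e (sum f I)"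
  by (induction I rule: infinite_finite_induct) (auto simp: hom_0 hom_add)

text \<open>Homogeneity of degree h in the graded free module whose i-th basis vector has degree
  \<open>gs i\<close>.\<close>

definition hv :: "(nat \<Rightarrow> 'g) \<Rightarrow> 'g \<Rightarrow> (nat \<Rightarrow> 'a) \<Rightarrow> bool" where
  "hv gs h v \<longleftrightarrow> (\<forall>i. hom (h - gs i) (v i))"

text \<open>A graded submodule of the graded free module of rank r, given by its homogeneous
  components alone; inhomogeneous elements never occur. The last clause makes \<open>K h\<close>
  depend only on the degree that h represents.\<close>

definition gsub :: "'a set \<Rightarrow> nat \<Rightarrow> (nat \<Rightarrow> 'g) \<Rightarrow> ('g \<Rightarrow> (nat \<Rightarrow> 'a) set) \<Rightarrow> bool" where
  "gsub A r gs K \<longleftrightarrow> (\<forall>h. K h \<subseteq> {v \<in> vecs A r. hv gs h v}) \<and> (\<forall>h. (\<lambda>i. 0) \<in> K h) \<and>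
    (\<forall>h. \<forall>v\<in>K h. \<forall>w\<in>K h. (\<lambda>i. v i + w i) \<in> K h) \<and>
    (\<forall>f\<in>A. \<forall>e h. \<forall>v\<in>K h. hom e f \<longrightarrow> (\<lambda>i. f * v i) \<in> K (e + h)) \<and>
    (\<forall>h h'. (\<forall>c. hom (h + c) = hom (h' + c)) \<longrightarrow> K h = K h')"

lemma gsubD:
  assumes "gsub A r gs K"
  shows "v \<in> K h \<Longrightarrow> v \<in> vecs A r" "v \<in> K h \<Longrightarrow> hv gs h v" "(\<lambda>i. 0) \<in> K h"
    "v \<in> K h \<Longrightarrow> w \<in> K h \<Longrightarrow> (\<lambda>i. v i + w i) \<in> K h"
    "v \<in> K h \<Longrightarrow> f \<in> A \<Longrightarrow> hom e f \<Longrightarrow> e + h = h' \<Longrightarrow> (\<lambda>i. f * v i) \<in> K h'"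
    "(\<And>c. hom (h + c) = hom (h' + c)) \<Longrightarrow> K h = K h'"
proof -
  note * = assms[unfolded gsub_def]
  show "v \<in> K h \<Longrightarrow> v \<in> vecs A r" "v \<in> K h \<Longrightarrow> hv gs h v" using * by auto
  show "(\<lambda>i. 0) \<in> K h" using * by simp
  show "v \<in> K h \<Longrightarrow> w \<in> K h \<Longrightarrow> (\<lambda>i. v i + w i) \<in> K h" using * by simp
  show "v \<in> K h \<Longrightarrow> f \<in> A \<Longrightarrow> hom e f \<Longrightarrow> e + h = h' \<Longrightarrow> (\<lambda>i. f * v i) \<in> K h'" using * by auto
  show "(\<And>c. hom (h + c) = hom (h' + c)) \<Longrightarrow> K h = K h'" using * by simp
qed

lemma gsub_diff:
  assumes K: "gsub A r gs K" and A: "subring_set A" and vw: "v \<in> K h" "w \<in> K h"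
  shows "(\<lambda>i. v i - w i) \<in> K h"
proof -
  have "(\<lambda>i. (-1) * w i) \<in> K h" by (rule gsubD(5)[OF K vw(2), where e = 0]) (simp_all add: subring_setD[OF A] hom_uminus hom_1)
  then show ?thesis using gsubD(4)[OF K vw(1)] by fastforce
qed

lemma gsub_lincomb:
  assumes K: "gsub A r gs K" and xs: "\<And>j. j < s \<Longrightarrow> xs j \<in> K (hs j)"
    and c: "c \<in> vecs A s'" "hv hs h c"
  shows "lincomb s xs c \<in> K h"
  using xs
proof (induction s)
  case 0 then show ?case using gsubD(3)[OF K] by (simp add: lincomb_def)
next
  case (Suc s)
  have "(\<lambda>i. c s * xs s i) \<in> K h"
    by (rule gsubD(5)[OF K Suc.prems[OF lessI], where e = "h - hs s"]) (use c in \<open>auto simp: vecs_def hv_def\<close>)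
  with Suc show ?case using gsubD(4)[OF K, of "lincomb s xs c" h "\<lambda>i. c s * xs s i"] by (simp add: lincomb_def)
qed

definition gens :: "'a set \<Rightarrow> (nat \<Rightarrow> 'g) \<Rightarrow> ('g \<Rightarrow> (nat \<Rightarrow> 'a) set) \<Rightarrow> nat \<Rightarrow> (nat \<Rightarrow> nat \<Rightarrow> 'a) \<Rightarrow> (nat \<Rightarrow> 'g) \<Rightarrow> bool" where
  "gens A gs K s xs hs \<longleftrightarrow> (\<forall>j<s. xs j \<in> K (hs j)) \<and>
     (\<forall>h. \<forall>v\<in>K h. \<exists>c\<in>vecs A s. hv hs h c \<and> v = lincomb s xs c)"

definition rels :: "'a set \<Rightarrow> nat \<Rightarrow> (nat \<Rightarrow> nat \<Rightarrow> 'a) \<Rightarrow> (nat \<Rightarrow> 'g) \<Rightarrow> 'g \<Rightarrow> (nat \<Rightarrow> 'a) set" where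
  "rels A s xs hs h = {c \<in> vecs A s. hv hs h c \<and> lincomb s xs c = (\<lambda>i. 0)}"

text \<open>The number counts free modules: \<open>fr A n\<close> asserts an exact sequence 0 ->
  F_(n-1) -> ... -> F_0 -> K -> 0 of graded free modules of finite rank, with K = 0 for n = 0. In
  particular K is finitely generated.\<close>

fun fr :: "'a set \<Rightarrow> nat \<Rightarrow> (nat \<Rightarrow> 'g) \<Rightarrow> ('g \<Rightarrow> (nat \<Rightarrow> 'a) set) \<Rightarrow> bool" where
  "fr A 0 gs K \<longleftrightarrow> (\<forall>h. K h \<subseteq> {\<lambda>i. 0})"
| "fr A (Suc n) gs K \<longleftrightarrow> (\<exists>s xs hs. gens A gs K s xs hs \<and> fr A n hs (rels A s xs hs))"

lemma hv_add: "hv gs h v \<Longrightarrow> hv gs h w \<Longrightarrow> hv gs h (\<lambda>i. v i + w i)"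
  by (auto simp: hv_def hom_add)

lemma hv_0: "hv gs h (\<lambda>i. 0)" by (auto simp: hv_def hom_0)

lemma hv_mult: "hom e f \<Longrightarrow> hv gs h v \<Longrightarrow> e + h = h' \<Longrightarrow> hv gs h' (\<lambda>i. f * v i)"
  unfolding hv_def by (auto intro!: hom_mult'[where e = e] simp: algebra_simps)

lemma hv_lincomb:
  assumes "\<And>j. j < s \<Longrightarrow> hv gs (hs j) (xs j)" "hv hs h c"
  shows "hv gs h (lincomb s xs c)"
  unfolding hv_def lincomb_def using assms
  by (auto intro!: hom_sum hom_mult'[where e = "h - hs _"] simp: hv_def)

lemma vecs_closed:
  assumes "subring_set A"
  shows "v \<in> vecs A r \<Longrightarrow> w \<in> vecs A r \<Longrightarrow> (\<lambda>i. v i + w i) \<in> vecs A r"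
    "f \<in> A \<Longrightarrow> v \<in> vecs A r \<Longrightarrow> (\<lambda>i. f * v i) \<in> vecs A r" "(\<lambda>i. 0) \<in> vecs A r"
    "v \<in> vecs A r \<Longrightarrow> w \<in> vecs A r \<Longrightarrow> (\<lambda>i. v i - w i) \<in> vecs A r"
  using subring_setD[OF assms] by (auto simp: vecs_def)

lemma lincomb_add: "lincomb s xs (\<lambda>i. c i + d i) = (\<lambda>i. lincomb s xs c i + lincomb s xs d i)"
  by (simp add: lincomb_def sum.distrib algebra_simps)

lemma lincomb_diff: "lincomb s xs (\<lambda>i. c i - d i) = (\<lambda>i. lincomb s xs c i - lincomb s xs d i)"
  by (simp add: lincomb_def sum_subtractf algebra_simps)

lemma lincomb_mult: "lincomb s xs (\<lambda>i. f * c i) = (\<lambda>i. f * lincomb s xs c i)"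
  by (simp add: lincomb_def sum_distrib_left algebra_simps)

lemma lincomb_0: "lincomb s xs (\<lambda>i. 0) = (\<lambda>i. 0)"
  by (simp add: lincomb_def)

lemma hv_shift_cong: "(\<And>c. hom (h + c) = hom (h' + c)) \<Longrightarrow> hv gs h = hv gs h'"
  unfolding hv_def diff_conv_add_uminus by presburger

lemma rels_gsub: "subring_set A \<Longrightarrow> gsub A s hs (rels A s xs hs)"
  unfolding gsub_def
proof (intro conjI allI impI ballI)
  fix h h' assume "\<forall>c. hom (h + c) = hom (h' + c)"
  then show "rels A s xs hs h = rels A s xs hs h'" using hv_shift_cong[of h h'] by (simp add: rels_def)
qed (auto simp: rels_def vecs_closed hv_add hv_0 lincomb_add lincomb_mult lincomb_0 intro: hv_mult)

lemma hv_cong: "v \<in> vecs A r \<Longrightarrow> (\<And>i. i < r \<Longrightarrow> gs i = gs' i) \<Longrightarrow> hv gs h v \<longleftrightarrow> hv gs' h v"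
  unfolding hv_def vecs_def using hom_0 by (metis (mono_tags, lifting) linorder_le_less_linear mem_Collect_eq)

lemma gens_cong:
  assumes "\<And>h. K h \<subseteq> vecs A r" "\<And>i. i < r \<Longrightarrow> gs i = gs' i"
  shows "fr A n gs K \<longleftrightarrow> fr A n gs' K"
  by (cases n) (auto simp: gens_def)

text \<open>Padding: once the zero module is reached, it is covered by the free module of rank 0.
  This allows resolutions of different lengths to be aligned.\<close>

lemma fr_Suc: "subring_set A \<Longrightarrow> fr A n gs K \<Longrightarrow> gsub A r gs K \<Longrightarrow> fr A (Suc n) gs K"
proof (induction n arbitrary: r gs K)
  case 0
  have "gens A gs K 0 (\<lambda>_ _. 0) (\<lambda>_. 0)"
    unfolding gens_def
  proof (intro conjI allI impI ballI)
    fix h v assume "v \<in> K h"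
    then have "v = (\<lambda>i. 0)" using 0(2) by auto
    then show "\<exists>c\<in>vecs A 0. hv (\<lambda>_. 0) h c \<and> v = lincomb 0 (\<lambda>_ _. 0) c"
      by (intro bexI[of _ "\<lambda>i. 0"]) (auto simp: vecs_def hv_def hom_0 lincomb_def subring_setD[OF 0(1)])
  qed simp
  moreover have "fr A 0 (\<lambda>_. 0) (rels A 0 (\<lambda>_ _. 0) (\<lambda>_. 0))"
    by (auto simp: rels_def vecs_def)
  ultimately show ?case by (auto simp del: fr.simps(1))
next
  case (Suc n)
  then show ?case using rels_gsub by (metis fr.simps(2))
qed

section \<open>Direct sums with free modules, and mapping cones\<close>

definition osum :: "'a set \<Rightarrow> nat \<Rightarrow> nat \<Rightarrow> (nat \<Rightarrow> 'g) \<Rightarrow> ('g \<Rightarrow> (nat \<Rightarrow> 'a) set) \<Rightarrow> 'g \<Rightarrow> (nat \<Rightarrow> 'a) set" where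
  "osum A s t gs Z h = {c \<in> vecs A (s + t). hv gs h c \<and> (\<lambda>i. if i < s then c i else 0) \<in> Z h}"

lemma osum_gsub:
  assumes A: "subring_set A" and Z: "gsub A s gs Z"
  shows "gsub A (s + t) gs (osum A s t gs Z)"
proof -
  have 1: "(\<lambda>i. if i < s then v i + w i else 0) = (\<lambda>i. (if i < s then v i else 0) + (if i < s then w i else 0))"
    "(\<lambda>i. if i < s then f * v i else 0) = (\<lambda>i. f * (if i < s then v i else 0))" 
    "(\<lambda>i. if i < s then 0 else 0) = (\<lambda>i. 0)" for v w :: "nat \<Rightarrow> 'a" and f by auto
  show ?thesis
    unfolding gsub_def
  proof (intro conjI allI impI ballI)
    fix h h' assume *: "\<forall>c. hom (h + c) = hom (h' + c)"
    show "osum A s t gs Z h = osum A s t gs Z h'"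
      using gsubD(6)[OF Z, of h h'] hv_shift_cong[of h h'] * by (simp add: osum_def)
  next
    fix h v w assume "v \<in> osum A s t gs Z h" "w \<in> osum A s t gs Z h"
    then show "(\<lambda>i. v i + w i) \<in> osum A s t gs Z h"
      unfolding osum_def mem_Collect_eq 1(1) by (intro conjI vecs_closed[OF A] hv_add gsubD(4)[OF Z]) auto
  next
    fix f e h v assume "f \<in> A" "v \<in> osum A s t gs Z h" "hom e f"
    then show "(\<lambda>i. f * v i) \<in> osum A s t gs Z (e + h)"
      unfolding osum_def mem_Collect_eq 1(2) by (intro conjI vecs_closed[OF A] hv_mult[where e = e and h = h] gsubD(5)[OF Z, where e = e and h = h]) auto
  next
    fix h show "(\<lambda>i. 0) \<in> osum A s t gs Z h"
      unfolding osum_def mem_Collect_eq 1(3) by (intro conjI vecs_closed[OF A] hv_0 gsubD(3)[OF Z])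
  qed (auto simp: osum_def)
qed

text \<open>\<open>osum\<close> is the direct sum of Z and a graded free module of rank t. Adding
  the unit vectors of the free part to generators of Z creates no new relation, so the length does
  not grow as long as there is at least one free module to enlarge; hence
  \<open>Suc n\<close>.\<close>

lemma fr_osum:
  assumes A: "subring_set A" and Z: "gsub A s gs Z" and f: "fr A (Suc n) gs Z"
  shows "fr A (Suc n) gs (osum A s t gs Z)"
proof -
  obtain u xs hs where g: "gens A gs Z u xs hs" and f': "fr A n hs (rels A u xs hs)" using f by auto
  \<comment> \<open>The generators of Z, followed by the t unit vectors of the free summand.\<close>
  define ys where "ys = (\<lambda>j. if j < u then xs j else (\<lambda>i. if i = s + (j - u) then 1 else 0))"
  define ks where "ks = (\<lambda>j. if j < u then hs j else gs (s + (j - u)))"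
  have xsZ: "xs j \<in> Z (hs j)" if "j < u" for j using g that by (auto simp: gens_def)
  have xs0: "xs j i = 0" if "j < u" "i \<ge> s" for j i using gsubD(1)[OF Z xsZ[OF that(1)]] that(2) by (auto simp: vecs_def)
  have lin: "lincomb (u + t) ys c = (\<lambda>i. if i < s then lincomb u xs c i else if i < s + t then c (u + (i - s)) else 0)" for c
  proof
    fix i
    have "lincomb (u + t) ys c i = (\<Sum>j<u. c j * ys j i) + (\<Sum>j<t. c (u + j) * ys (u + j) i)"
      unfolding lincomb_def by (induction t) (auto simp: algebra_simps)
    also have "(\<Sum>j<u. c j * ys j i) = lincomb u xs c i" by (simp add: lincomb_def ys_def)
    also have "lincomb u xs c i = (if i < s then lincomb u xs c i else 0)" using xs0 by (auto simp: lincomb_def)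
    also have "(\<Sum>j<t. c (u + j) * ys (u + j) i) = (\<Sum>j<t. if j = i - s then (if i \<ge> s then c (u + j) else 0) else 0)"
      by (intro sum.cong) (auto simp: ys_def)
    also have "\<dots> = (if i \<ge> s \<and> i < s + t then c (u + (i - s)) else 0)" by (auto simp: sum.delta)
    finally show "lincomb (u + t) ys c i = (if i < s then lincomb u xs c i else if i < s + t then c (u + (i - s)) else 0)"
      by auto
  qed
  have g1: "gens A gs (osum A s t gs Z) (u + t) ys ks"
    unfolding gens_def
  proof (intro conjI allI impI ballI)
    fix j assume j: "j < u + t"
    show "ys j \<in> osum A s t gs Z (ks j)"
    proof (cases "j < u")
      case True
      have "(\<lambda>i. if i < s then xs j i else 0) = xs j" using xs0[OF True] by fastforce
      then show ?thesis using True xsZ[OF True] gsubD(1,2)[OF Z xsZ[OF True]] by (auto simp: osum_def ys_def ks_def vecs_def)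
    next
      case False
      have "(\<lambda>i. if i < s then ys j i else 0) = (\<lambda>i. 0)" using False by (intro ext) (simp add: ys_def, linarith)
      then have 1: "(\<lambda>i. if i < s then ys j i else 0) \<in> Z (ks j)" using gsubD(3)[OF Z] by simp
      have "ys j \<in> vecs A (s + t)" using False j by (auto simp: ys_def vecs_def subring_setD[OF A])
      moreover have "hv gs (ks j) (ys j)" using False by (auto simp: ys_def ks_def hv_def hom_0 hom_1)
      ultimately show ?thesis using 1 by (simp add: osum_def)
    qed
  next
    fix h v assume v: "v \<in> osum A s t gs Z h"
    then obtain c where c: "c \<in> vecs A u" "hv hs h c" "(\<lambda>i. if i < s then v i else 0) = lincomb u xs c"
      using g unfolding gens_def osum_def by blast
    define c' where "c' = (\<lambda>j. if j < u then c j else if j < u + t then v (s + (j - u)) else 0)"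
    have "lincomb u xs c' = lincomb u xs c" by (auto simp: lincomb_def c'_def)
    have "c' \<in> vecs A (u + t)" using c v by (auto simp: c'_def vecs_def osum_def subring_setD[OF A])
    moreover have "hv ks h c'" using c v by (auto simp: c'_def hv_def ks_def osum_def hom_0)
    moreover have "v = lincomb (u + t) ys c'"
    proof
      fix i
      show "v i = lincomb (u + t) ys c' i"
        unfolding lin using fun_cong[OF c(3), of i] v \<open>lincomb u xs c' = lincomb u xs c\<close> 
        by (auto simp: c'_def osum_def vecs_def)
    qed
    ultimately show "\<exists>c\<in>vecs A (u + t). hv ks h c \<and> v = lincomb (u + t) ys c" by blast
  qed
  have "rels A (u + t) ys ks h = rels A u xs hs h" for h
  proof (intro equalityI subsetI)
    fix c assume c: "c \<in> rels A (u + t) ys ks h"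
    then have l: "lincomb (u + t) ys c i = 0" for i by (simp add: rels_def)
    have z: "c j = 0" if "j \<ge> u" for j
    proof (cases "j < u + t")
      case True then show ?thesis using l[of "s + (j - u)"] that by (auto simp: lin split: if_splits)
    next
      case False then show ?thesis using c by (auto simp: rels_def vecs_def)
    qed
    have l': "lincomb u xs c i = 0" for i 
    proof (cases "i < s")
      case True then show ?thesis using l[of i] unfolding lin by simp
    next
      case False then show ?thesis using xs0 by (simp add: lincomb_def)
    qed
    have cv: "c \<in> vecs A u" using c z by (auto simp: rels_def vecs_def)
    have "hv hs h c" using c hv_cong[OF cv, of hs ks] by (auto simp: rels_def ks_def)
    then show "c \<in> rels A u xs hs h" using l' cv by (auto simp: rels_def)
  next
    fix c assume c: "c \<in> rels A u xs hs h"
    then have cv: "c \<in> vecs A u" and l: "lincomb u xs c = (\<lambda>i. 0)" by (auto simp: rels_def)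
    have "hv ks h c" using c hv_cong[OF cv, of hs ks] by (auto simp: rels_def ks_def)
    moreover have "lincomb (u + t) ys c = (\<lambda>i. 0)" unfolding lin l using cv by (auto simp: vecs_def)
    ultimately show "c \<in> rels A (u + t) ys ks h" using cv by (auto simp: rels_def vecs_def)
  qed
  then have "rels A (u + t) ys ks = rels A u xs hs" by blast
  moreover have "fr A n ks (rels A u xs hs)"
    using f' by (subst gens_cong[where r = u and gs' = hs]) (auto simp: rels_def ks_def)
  ultimately have "gens A gs (osum A s t gs Z) (u + t) ys ks \<and> fr A n ks (rels A (u + t) ys ks)" using g1 by simp
  then show ?thesis unfolding fr.simps by blast
qed

text \<open>For an exact sequence 0 -> K1 -> K2 -> K -> 0 this is the mapping cone. If F1, F2 are
  the free modules on the chosen generators of K1, K2 and Z1, Z2 the modules of relations, then the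
  kernel Z of F2 -> K2 -> K sits in an exact sequence 0 -> Z1 -> Z2 + F1 -> Z -> 0. It has the same
  form with n lowered by 1, so an induction replaces the comparison of whole complexes.\<close>

lemma fr_horseshoe:
  assumes A: "subring_set A"
    and "gsub A r1 gs1 K1" "gsub A r2 gs2 K2"
    and "linear_map \<alpha>" "linear_map \<beta>"
    and "\<And>h u. u \<in> K1 h \<Longrightarrow> \<alpha> u \<in> K2 h" "\<And>h v. v \<in> K2 h \<Longrightarrow> \<beta> v \<in> K h"
    and "\<And>h u. u \<in> K1 h \<Longrightarrow> \<beta> (\<alpha> u) = (\<lambda>i. 0)"
    and "\<And>h w. w \<in> K h \<Longrightarrow> \<exists>v\<in>K2 h. \<beta> v = w"
    and "\<And>h v. v \<in> K2 h \<Longrightarrow> \<beta> v = (\<lambda>i. 0) \<Longrightarrow> \<exists>u\<in>K1 h. \<alpha> u = v"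
    and "\<And>h u. u \<in> K1 h \<Longrightarrow> \<alpha> u = (\<lambda>i. 0) \<Longrightarrow> u = (\<lambda>i. 0)"
    and "fr A n gs1 K1" "fr A (Suc n) gs2 K2"
  shows "fr A (Suc n) gs K"
  using assms(2-)
proof (induction n arbitrary: r1 gs1 K1 r2 gs2 K2 gs K \<alpha> \<beta>)
  \<comment> \<open>Here \<open>K1\<close> is zero, so \<beta> is injective on \<open>K2\<close> and
    carries generators without relations to generators without relations.\<close>
  case (0 r1 gs1 K1 r2 gs2 K2 gs K \<alpha> \<beta>)
  obtain s ys hs where g: "gens A gs2 K2 s ys hs" and f: "fr A 0 hs (rels A s ys hs)" using "0.prems"(12) by (auto simp del: fr.simps(1))
  have "gens A gs K s (\<lambda>j. \<beta> (ys j)) hs"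
    unfolding gens_def
  proof (intro conjI allI impI ballI)
    fix j assume "j < s" then show "\<beta> (ys j) \<in> K (hs j)" using g "0.prems"(6) by (auto simp: gens_def)
  next
    fix h w assume "w \<in> K h"
    then obtain v where v: "v \<in> K2 h" "\<beta> v = w" using "0.prems"(8) by blast
    then obtain c where c: "c \<in> vecs A s" "hv hs h c" "v = lincomb s ys c" using g unfolding gens_def by blast
    then show "\<exists>c\<in>vecs A s. hv hs h c \<and> w = lincomb s (\<lambda>j. \<beta> (ys j)) c"
      using v linear_map_lincomb[OF "0.prems"(4), of s ys c] by blast
  qed
  moreover have "fr A 0 hs (rels A s (\<lambda>j. \<beta> (ys j)) hs)"
  proof -
    have "c = (\<lambda>i. 0)" if c: "c \<in> rels A s (\<lambda>j. \<beta> (ys j)) hs h" for c h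
    proof -
      have "lincomb s ys c \<in> K2 h"
        by (rule gsub_lincomb[OF "0.prems"(2)]) (use g c in \<open>auto simp: gens_def rels_def\<close>)
      moreover have "\<beta> (lincomb s ys c) = (\<lambda>i. 0)"
        using c unfolding linear_map_lincomb[OF "0.prems"(4)] by (simp add: rels_def)
      ultimately obtain u where "u \<in> K1 h" "\<alpha> u = lincomb s ys c" using "0.prems"(9) by blast
      moreover have "u = (\<lambda>i. 0)" using "0.prems"(11) \<open>u \<in> K1 h\<close> by auto
      ultimately have "lincomb s ys c = (\<lambda>i. 0)" using linear_mapD(3)[OF "0.prems"(3)] by simp
      then have "c \<in> rels A s ys hs h" using c by (auto simp: rels_def)
      then show ?thesis using f by auto
    qed
    then show ?thesis by auto
  qed
  ultimately show ?case by (auto simp del: fr.simps(1))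
next
  case (Suc n r1 gs1 K1 r2 gs2 K2 gs K \<alpha> \<beta>)
  note P = Suc.prems
  obtain s2 ys h2 where g2: "gens A gs2 K2 s2 ys h2" and f2: "fr A (Suc n) h2 (rels A s2 ys h2)" using P(12) by (auto simp del: fr.simps(2) simp: fr.simps(2)[of _ "Suc n"])
  obtain s1 xs h1 where g1: "gens A gs1 K1 s1 xs h1" and f1: "fr A n h1 (rels A s1 xs h1)" using P(11) by auto
  \<comment> \<open>The vectors \<open>e j\<close> are the columns of a matrix that lifts \<alpha>
    to a map of the free modules on the generators.\<close>
  have "\<exists>e. e \<in> vecs A s2 \<and> hv h2 (h1 j) e \<and> \<alpha> (xs j) = lincomb s2 ys e" if "j < s1" for j
    using g1 g2 P(5) that unfolding gens_def by metis
  then obtain e where e: "\<And>j. j < s1 \<Longrightarrow> e j \<in> vecs A s2" "\<And>j. j < s1 \<Longrightarrow> hv h2 (h1 j) (e j)" "\<And>j. j < s1 \<Longrightarrow> \<alpha> (xs j) = lincomb s2 ys (e j)" by metis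
  define k where "k = (\<lambda>i. if i < s2 then h2 i else h1 (i - s2))"
  define Z2 where "Z2 = rels A s2 ys h2"
  define Z where "Z = rels A s2 (\<lambda>j. \<beta> (ys j)) h2"
  \<comment> \<open>With e read as a matrix, \<open>\<alpha>'\<close> sends f to (- e f, f) and
    \<open>\<beta>'\<close> sends (z, f) to z + e f; the sign makes the composite vanish.\<close>
  define \<alpha>' where "\<alpha>' = (\<lambda>f i. if i < s2 then - lincomb s1 e f i else if i < s2 + s1 then f (i - s2) else 0)"
  define \<beta>' where "\<beta>' = (\<lambda>z i. (if i < s2 then z i else 0) + lincomb s1 e (\<lambda>j. z (s2 + j)) i)"
  have gZ2: "gsub A s2 h2 Z2" unfolding Z2_def by (rule rels_gsub[OF A])
  have gZ2': "gsub A s2 k Z2" using gZ2 hv_cong[where A = A and r = s2 and gs = h2 and gs' = k] unfolding gsub_def by (auto simp: k_def subset_iff)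
  have f2': "fr A (Suc n) k Z2" using f2 gsubD(1)[OF gZ2] unfolding Z2_def by (subst gens_cong[where r = s2 and gs' = h2]) (auto simp: k_def)
  have lin_e: "lincomb s2 ys (lincomb s1 e f) = \<alpha> (lincomb s1 xs f)" for f
  proof -
    have "\<alpha> (lincomb s1 xs f) = lincomb s1 (\<lambda>j. \<alpha> (xs j)) f" by (rule linear_map_lincomb[OF P(3)])
    also have "\<dots> = lincomb s1 (\<lambda>j. lincomb s2 ys (e j)) f" using e(3) by (simp add: lincomb_def)
    also have "\<dots> = lincomb s2 ys (lincomb s1 e f)"
      unfolding lincomb_def sum_distrib_left sum_distrib_right by (subst sum.swap) (simp add: mult.assoc)
    finally show ?thesis by simp
  qed
  have e0: "lincomb s1 e f i = 0" if "i \<ge> s2" for f i using e(1) that by (auto simp: lincomb_def vecs_def)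
  have lV: "lincomb s1 e f \<in> vecs A s2" if "\<And>i. f i \<in> A" for f
    using e(1) that by (auto simp: lincomb_def vecs_def intro!: subring_set_sum[OF A] subring_setD[OF A])
  have lH: "hv h2 h (lincomb s1 e f)" if "hv h1 h f" for f h
    by (rule hv_lincomb[where hs = h1]) (use that e in auto)
  have xsK: "lincomb s1 xs f \<in> K1 h" if "f \<in> vecs A s1" "hv h1 h f" for f h
    by (rule gsub_lincomb[OF P(1)]) (use g1 that in \<open>auto simp: gens_def\<close>)
  have ysK: "lincomb s2 ys f \<in> K2 h" if "f \<in> vecs A s2" "hv h2 h f" for f h
    by (rule gsub_lincomb[OF P(2)]) (use g2 that in \<open>auto simp: gens_def\<close>)
  have ker: "lincomb s2 ys c = (\<lambda>i. 0)" if "c \<in> Z2 h" for c h using that by (simp add: Z2_def rels_def)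
  have bys: "\<beta> (lincomb s2 ys c) = lincomb s2 (\<lambda>j. \<beta> (ys j)) c" for c by (rule linear_map_lincomb[OF P(4)])
  have gK: "gens A gs K s2 (\<lambda>j. \<beta> (ys j)) h2"
    unfolding gens_def
  proof (intro conjI allI impI ballI)
    fix j assume "j < s2" then show "\<beta> (ys j) \<in> K (h2 j)" using g2 P(6) by (auto simp: gens_def)
  next
    fix h w assume "w \<in> K h"
    then obtain v where v: "v \<in> K2 h" "\<beta> v = w" using P(8) by blast
    then obtain c where c: "c \<in> vecs A s2" "hv h2 h c" "v = lincomb s2 ys c" using g2 unfolding gens_def by blast
    then show "\<exists>c\<in>vecs A s2. hv h2 h c \<and> w = lincomb s2 (\<lambda>j. \<beta> (ys j)) c" using v bys by blast
  qed
  have split: "hv h2 h (\<lambda>i. if i < s2 then c i else 0)" "hv h1 h (\<lambda>j. c (s2 + j))" if c: "hv k h c" for c h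
  proof -
    have h: "hom (h - k i) (c i)" for i using c by (simp add: hv_def)
    show "hv h2 h (\<lambda>i. if i < s2 then c i else 0)"
      unfolding hv_def
    proof
      fix i show "hom (h - h2 i) (if i < s2 then c i else 0)" using h[of i] by (auto simp: k_def hom_0 split: if_splits)
    qed
    show "hv h1 h (\<lambda>j. c (s2 + j))"
      unfolding hv_def using h[of "s2 + _"] by (simp add: k_def)
  qed
  have "fr A (Suc n) h2 Z"
  proof (rule Suc.IH[where \<alpha> = \<alpha>' and \<beta> = \<beta>'])
    show "gsub A s1 h1 (rels A s1 xs h1)" by (rule rels_gsub[OF A])
    show "gsub A (s2 + s1) k (osum A s2 s1 k Z2)" by (rule osum_gsub[OF A gZ2'])
    show "linear_map \<alpha>'" unfolding linear_map_def \<alpha>'_def by (auto simp: lincomb_add lincomb_mult)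
    show "linear_map \<beta>'" unfolding linear_map_def \<beta>'_def by (auto simp: lincomb_add lincomb_mult algebra_simps)
    show "fr A n h1 (rels A s1 xs h1)" by (rule f1)
    show "fr A (Suc n) k (osum A s2 s1 k Z2)" by (rule fr_osum[OF A gZ2' f2'])
  next
    fix h f assume f: "f \<in> rels A s1 xs h1 h"
    have fv: "f \<in> vecs A s1" "hv h1 h f" "lincomb s1 xs f = (\<lambda>i. 0)" using f by (auto simp: rels_def)
    have le: "lincomb s2 ys (lincomb s1 e f) = (\<lambda>i. 0)" using lin_e fv linear_mapD(3)[OF P(3)] by simp
    have L: "(\<lambda>i. - lincomb s1 e f i) \<in> Z2 h"
    proof -
      have "lincomb s1 e f \<in> Z2 h" using le lV lH fv by (auto simp: Z2_def rels_def vecs_def)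
      then have "(\<lambda>i. (\<lambda>i. 0) i - lincomb s1 e f i) \<in> Z2 h" by (intro gsub_diff[OF gZ2 A] gsubD(3)[OF gZ2])
      then show ?thesis by simp
    qed
    have "(\<lambda>i. if i < s2 then \<alpha>' f i else 0) = (\<lambda>i. - lincomb s1 e f i)" using e0 by (auto simp: \<alpha>'_def)
    then have "(\<lambda>i. if i < s2 then \<alpha>' f i else 0) \<in> Z2 h" using L by simp
    moreover have "\<alpha>' f \<in> vecs A (s2 + s1)" using gsubD(1)[OF gZ2 L] fv by (auto simp: \<alpha>'_def vecs_def subring_setD[OF A])
    moreover have "hv k h (\<alpha>' f)" using gsubD(2)[OF gZ2 L] fv by (auto simp: \<alpha>'_def hv_def k_def hom_0)
    ultimately show "\<alpha>' f \<in> osum A s2 s1 k Z2 h" by (simp add: osum_def)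
    show "\<beta>' (\<alpha>' f) = (\<lambda>i. 0)"
    proof
      fix i
      have "lincomb s1 e (\<lambda>j. \<alpha>' f (s2 + j)) = lincomb s1 e f" by (simp add: lincomb_def \<alpha>'_def)
      then show "\<beta>' (\<alpha>' f) i = 0" using e0[of i] by (simp add: \<beta>'_def) (simp add: \<alpha>'_def)
    qed
    assume 0: "\<alpha>' f = (\<lambda>i. 0)"
    show "f = (\<lambda>i. 0)"
    proof
      fix i show "f i = 0" using fun_cong[OF 0, of "s2 + i"] fv(1) by (cases "i < s1") (auto simp: \<alpha>'_def vecs_def)
    qed
  next
    fix h z assume z: "z \<in> osum A s2 s1 k Z2 h"
    let ?z = "\<lambda>i. if i < s2 then z i else 0" and ?f = "\<lambda>j. z (s2 + j)"
    have zz: "z \<in> vecs A (s2 + s1)" "hv k h z" "?z \<in> Z2 h" using z by (auto simp: osum_def)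
    have f: "?f \<in> vecs A s1" "hv h1 h ?f" using zz split(2)[OF zz(2)] by (auto simp: vecs_def)
    have b: "\<beta>' z = (\<lambda>i. ?z i + lincomb s1 e ?f i)" by (simp add: \<beta>'_def)
    have ly: "lincomb s2 ys (\<beta>' z) = \<alpha> (lincomb s1 xs ?f)"
      unfolding b lincomb_add lin_e ker[OF zz(3)] by simp
    have "\<beta>' z \<in> vecs A s2" unfolding b by (intro vecs_closed[OF A] gsubD(1)[OF gZ2 zz(3)] lV) (use zz in \<open>auto simp: vecs_def\<close>)
    moreover have "hv h2 h (\<beta>' z)" unfolding b by (intro hv_add split(1) lH f zz)
    moreover have "lincomb s2 (\<lambda>j. \<beta> (ys j)) (\<beta>' z) = (\<lambda>i. 0)"
      using P(7)[OF xsK[OF f]] ly bys[of "\<beta>' z"] by simp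
    ultimately show "\<beta>' z \<in> Z h" by (simp add: Z_def rels_def)
    assume 0: "\<beta>' z = (\<lambda>i. 0)"
    have "\<alpha> (lincomb s1 xs ?f) = (\<lambda>i. 0)" using ly 0 by (simp add: lincomb_0)
    then have "lincomb s1 xs ?f = (\<lambda>i. 0)" using P(10)[OF xsK[OF f]] by simp
    then have "?f \<in> rels A s1 xs h1 h" using f by (simp add: rels_def)
    moreover have "\<alpha>' ?f = z"
    proof
      fix i
      have "?z i + lincomb s1 e ?f i = 0" using fun_cong[OF 0, of i] unfolding b .
      then show "\<alpha>' ?f i = z i" using zz(1) by (auto simp: \<alpha>'_def vecs_def add_eq_0_iff2)
    qed
    ultimately show "\<exists>u\<in>rels A s1 xs h1 h. \<alpha>' u = z" by blast
  next
    fix h c assume "c \<in> Z h"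
    then have c: "c \<in> vecs A s2" "hv h2 h c" "\<beta> (lincomb s2 ys c) = (\<lambda>i. 0)" by (auto simp: Z_def rels_def bys)
    then obtain u where u: "u \<in> K1 h" "\<alpha> u = lincomb s2 ys c" using P(9) ysK by blast
    then obtain f where f: "f \<in> vecs A s1" "hv h1 h f" "u = lincomb s1 xs f" using g1 unfolding gens_def by blast
    let ?d = "\<lambda>i. c i - lincomb s1 e f i"
    have fA: "f i \<in> A" for i using f by (auto simp: vecs_def)
    have dv: "?d \<in> vecs A s2" "hv h2 h ?d"
      using c lV[OF fA] lH[OF f(2)] vecs_closed[OF A] by (auto simp: hv_def hom_diff)
    have d: "?d \<in> Z2 h" using dv u f by (auto simp: Z2_def rels_def lincomb_diff lin_e)
    define z where "z = (\<lambda>i. if i < s2 then ?d i else if i < s2 + s1 then f (i - s2) else 0)"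
    have "(\<lambda>i. if i < s2 then z i else 0) = ?d" using dv(1) by (auto simp: z_def vecs_def)
    then have 1: "(\<lambda>i. if i < s2 then z i else 0) \<in> Z2 h" using d by simp
    have "z \<in> vecs A (s2 + s1)" "hv k h z" using dv f by (auto simp: z_def vecs_def hv_def k_def subring_setD[OF A] hom_0)
    then have "z \<in> osum A s2 s1 k Z2 h" using 1 by (simp add: osum_def)
    moreover have "\<beta>' z = c"
    proof
      fix i
      have "lincomb s1 e (\<lambda>j. z (s2 + j)) = lincomb s1 e f" by (simp add: lincomb_def z_def)
      then show "\<beta>' z i = c i" using e0[of i f] c(1) by (auto simp: \<beta>'_def) (auto simp: z_def vecs_def)
    qed
    ultimately show "\<exists>v\<in>osum A s2 s1 k Z2 h. \<beta>' v = c" by blast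
  qed
  then show ?case using gK unfolding Z_def by (auto simp del: fr.simps(2) simp: fr.simps(2)[of _ "Suc n"])
qed

lemma gsub_sum:
  assumes K: "gsub A r gs K" shows "(\<And>l. l \<in> I \<Longrightarrow> u l \<in> K h) \<Longrightarrow> (\<lambda>i. \<Sum>l\<in>I. u l i) \<in> K h"
proof (induction I rule: infinite_finite_induct)
  case (insert a F)
  then show ?case using gsubD(4)[OF K, of "u a" h "\<lambda>i. \<Sum>l\<in>F. u l i"] by simp
qed (use gsubD(3)[OF K] in auto)

lemma gsub_shift:
  assumes K: "gsub A r gs K" shows "gsub A r (\<lambda>i. gs i + d) (\<lambda>h. K (h - d))"
  unfolding gsub_def
proof (intro conjI allI impI ballI subsetI)
  fix h v assume v: "v \<in> K (h - d)"
  have "hv (\<lambda>i. gs i + d) h v" using gsubD(2)[OF K v] by (simp add: hv_def algebra_simps)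
  then show "v \<in> {v \<in> vecs A r. hv (\<lambda>i. gs i + d) h v}" using gsubD(1)[OF K v] by simp
next
  fix f e h v assume "f \<in> A" "v \<in> K (h - d)" "hom e f"
  then show "(\<lambda>i. f * v i) \<in> K (e + h - d)" by (intro gsubD(5)[OF K, where e = e and h = "h - d"]) (auto simp: algebra_simps)
next
  fix h h' assume *: "\<forall>c. hom (h + c) = hom (h' + c)"
  show "K (h - d) = K (h' - d)"
    by (rule gsubD(6)[OF K]) (use *[rule_format, of "_ - d"] in \<open>simp add: algebra_simps\<close>)
next
  fix h show "(\<lambda>i. 0) \<in> K (h - d)" by (rule gsubD(3)[OF K])
next
  fix h v w assume "v \<in> K (h - d)" "w \<in> K (h - d)"
  then show "(\<lambda>i. v i + w i) \<in> K (h - d)" by (rule gsubD(4)[OF K])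
qed

text \<open>The length is uniform in the rank, the degrees and the submodule. As \<open>fr\<close>
  includes finite generation, this contains the basis theorem together with the syzygy
  theorem.\<close>

definition syz :: "'a set \<Rightarrow> nat \<Rightarrow> bool" where
  "syz A n \<longleftrightarrow> (\<forall>r gs K. gsub A r gs K \<longrightarrow> fr A n gs K)"

text \<open>Gaussian elimination on the last coordinate: \<open>K'\<close> collects the vectors
  whose last coordinate vanishes, and at most one further generator, normalised to last coordinate
  1, completes a basis. As A sits in degree 0, scaling does not change degrees. A basis has no
  relations, which gives length 1.\<close>

theorem syz_field:
  assumes A: "subring_set A" and hA: "\<And>a. a \<in> A \<Longrightarrow> hom 0 a" and inv: "\<And>a. a \<in> A \<Longrightarrow> a \<noteq> 0 \<Longrightarrow> \<exists>b\<in>A. b * a = 1"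
  shows "syz A 1"
proof -
  have "\<exists>s xs hs. gens A gs K s xs hs \<and> (\<forall>h. rels A s xs hs h \<subseteq> {\<lambda>i. 0})" if "gsub A r gs K" for r gs K
    using that
  proof (induction r arbitrary: K)
    case 0
    have "gens A gs K 0 (\<lambda>_ _. 0) (\<lambda>_. 0)"
      unfolding gens_def
    proof (intro conjI allI impI ballI)
      fix h v assume "v \<in> K h"
      then have "v = (\<lambda>i. 0)" using gsubD(1)[OF 0] by (auto simp: vecs_def)
      then show "\<exists>c\<in>vecs A 0. hv (\<lambda>_. 0) h c \<and> v = lincomb 0 (\<lambda>_ _. 0) c"
        by (intro bexI[of _ "\<lambda>i. 0"]) (auto simp: vecs_def hv_def hom_0 lincomb_def subring_setD[OF A])
    qed simp
    moreover have "rels A 0 (\<lambda>_ _. 0) (\<lambda>_. 0) h \<subseteq> {\<lambda>i. 0}" for h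
      by (auto simp: rels_def vecs_def)
    ultimately show ?case by blast
  next
    case (Suc r K)
    note K = Suc.prems
    define K' where "K' = (\<lambda>h. {w \<in> K h. w r = 0})"
    have K': "gsub A r gs K'"
      unfolding gsub_def
    proof (intro conjI allI impI ballI subsetI)
      fix h v assume v: "v \<in> K' h"
      then have "v i = 0" if "r \<le> i" for i
        using gsubD(1)[OF K, of v h] that by (cases "i = r") (auto simp: K'_def vecs_def)
      then show "v \<in> {v \<in> vecs A r. hv gs h v}"
        using gsubD(1,2)[OF K, of v h] v by (auto simp: K'_def vecs_def)
    next
      fix h show "(\<lambda>i. 0) \<in> K' h" using gsubD(3)[OF K] by (simp add: K'_def)
    next
      fix h v w assume "v \<in> K' h" "w \<in> K' h"
      then show "(\<lambda>i. v i + w i) \<in> K' h" using gsubD(4)[OF K] by (simp add: K'_def)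
    next
      fix f e h v assume f: "f \<in> A" "v \<in> K' h" "hom e f"
      then show "(\<lambda>i. f * v i) \<in> K' (e + h)" using gsubD(5)[OF K _ f(1,3) refl] by (simp add: K'_def)
    next
      fix h h' assume "\<forall>c. hom (h + c) = hom (h' + c)"
      then show "K' h = K' h'" using gsubD(6)[OF K, of h h'] by (simp add: K'_def)
    qed
    obtain s xs hs where g: "gens A gs K' s xs hs" and rl: "\<And>h. rels A s xs hs h \<subseteq> {\<lambda>i. 0}" using Suc.IH[OF K'] by blast
    have xsK: "xs j \<in> K' (hs j)" if "j < s" for j using g that by (simp add: gens_def)
    show ?case
    proof (cases "\<forall>h. \<forall>v\<in>K h. v r = 0")
      case True
      then have "K' = K" by (auto simp: K'_def)
      then show ?thesis using g rl by blast
    next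
      case False
      then obtain h0 v1 where v1: "v1 \<in> K h0" "v1 r \<noteq> 0" by blast
      then obtain b where b: "b \<in> A" "b * v1 r = 1" using inv[OF _ v1(2)] gsubD(1)[OF K v1(1)] unfolding vecs_def by blast
      define v0 where "v0 = (\<lambda>i. b * v1 i)"
      have v0: "v0 \<in> K h0" unfolding v0_def by (rule gsubD(5)[OF K v1(1) b(1) hA[OF b(1)]]) simp
      have v0r: "v0 r = 1" using b by (simp add: v0_def)
      have 1: "(1::'a) \<noteq> 0"
      proof
        assume "(1::'a) = 0"
        then have "v1 r * 1 = v1 r * 0" by (rule arg_cong)
        then show False using v1(2) by simp
      qed
      \<comment> \<open>The last coordinate 1 of \<open>v0\<close> is homogeneous of degree h0 - gs
        r and also of degree 0, so h0 and \<open>gs r\<close> represent the same degree.\<close>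
      have h0: "hom (h0 + c) = hom (gs r + c)" for c
      proof -
        have "hom (h0 - gs r) 1" using gsubD(2)[OF K v0] v0r unfolding hv_def by metis
        from hom_unique[OF this hom_1 1, of "gs r + c"] show ?thesis by (simp add: algebra_simps)
      qed
      define ys where "ys = xs(s := v0)"
      define ks where "ks = hs(s := h0)"
      have lin: "lincomb (Suc s) ys c = (\<lambda>i. lincomb s xs c i + c s * v0 i)" for c
        by (auto simp: lincomb_def ys_def)
      have "gens A gs K (Suc s) ys ks"
        unfolding gens_def
      proof (intro conjI allI impI ballI)
        fix j assume "j < Suc s"
        then show "ys j \<in> K (ks j)" using xsK[of j] v0 by (cases "j = s") (auto simp: ys_def ks_def K'_def)
      next
        fix h w assume w: "w \<in> K h"
        have wA: "w r \<in> A" using gsubD(1)[OF K w] by (simp add: vecs_def)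
        have eq: "(\<lambda>i. w r * v0 i) \<in> K h \<and> hom (h - h0) (w r)"
        proof (cases "w r = 0")
          case True then show ?thesis using gsubD(3)[OF K] hom_0 by simp
        next
          case False
          have "hom (h - gs r) (w r)" using gsubD(2)[OF K w] by (simp add: hv_def)
          from hom_unique[OF this hA[OF wA] False] have hh: "hom (h - gs r + c) = hom (0 + c)" for c .
          \<comment> \<open>A non-zero last coordinate of w forces h to represent the degree of
            \<open>v0\<close>; the last clause of \<open>gsub\<close> then puts \<open>v0\<close>
            itself into \<open>K h\<close>.\<close>
          have eqv: "hom (h0 + c) = hom (h + c)" for c
            using hh[of "gs r + c"] unfolding h0 by (simp add: algebra_simps)
          have "v0 \<in> K h" using v0 gsubD(6)[OF K eqv] by simp
          then have "(\<lambda>i. w r * v0 i) \<in> K h" by (rule gsubD(5)[OF K _ wA hA[OF wA]]) simp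
          moreover have "hom (h - h0) (w r)" using eqv[of "- h0"] hA[OF wA] by simp
          ultimately show ?thesis by blast
        qed
        have "(\<lambda>i. w i - w r * v0 i) \<in> K' h"
          unfolding K'_def using gsub_diff[OF K A w conjunct1[OF eq]] v0r by simp
        then obtain c where c: "c \<in> vecs A s" "hv hs h c" "(\<lambda>i. w i - w r * v0 i) = lincomb s xs c"
          using g unfolding gens_def by blast
        define d where "d = c(s := w r)"
        have "lincomb s xs d = lincomb s xs c" by (simp add: lincomb_def d_def)
        then have "lincomb (Suc s) ys d = w" unfolding lin using c(3)[symmetric] by (simp add: d_def)
        moreover have "d \<in> vecs A (Suc s)" using c(1) wA by (auto simp: d_def vecs_def)
        moreover have "hv ks h d" using c(2) eq by (simp add: hv_def d_def ks_def)
        ultimately show "\<exists>c\<in>vecs A (Suc s). hv ks h c \<and> w = lincomb (Suc s) ys c" by blast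
      qed
      moreover have "rels A (Suc s) ys ks h \<subseteq> {\<lambda>i. 0}" for h
      proof
        fix c assume c: "c \<in> rels A (Suc s) ys ks h"
        then have l0: "lincomb s xs c i + c s * v0 i = 0" for i unfolding rels_def lin by (simp add: fun_eq_iff)
        have "lincomb s xs c r = 0" unfolding lincomb_def using xsK by (auto simp: K'_def)
        then have cs: "c s = 0" using l0[of r] v0r by simp
        have cA: "c \<in> vecs A (Suc s)" using c by (simp add: rels_def)
        have "c i = 0" if "s \<le> i" for i
          using cA cs that by (cases "i = s") (auto simp: vecs_def)
        then have cv: "c \<in> vecs A s" using cA by (simp add: vecs_def)
        have "hv hs h c \<longleftrightarrow> hv ks h c" by (rule hv_cong[OF cv]) (simp add: ks_def)
        moreover have "hv ks h c" using c by (simp add: rels_def)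
        moreover have "lincomb s xs c = (\<lambda>i. 0)" using l0 cs by auto
        ultimately show "c \<in> {\<lambda>i. 0}" using rl[of h] cv by (auto simp: rels_def)
      qed
      ultimately show ?thesis by blast
    qed
  qed
  then show ?thesis unfolding syz_def One_nat_def fr.simps by blast
qed

end

text \<open>The polynomial ring B = A[x], described by its coefficient functions \<open>cf j\<close>
  so that A and B remain subsets of one type. The iterated addition in \<open>cf_hom\<close> is the
  j-fold multiple of \<open>dx\<close>, written for a group without scalar multiplication.\<close>

locale poly_ext = hom_ring hom for hom :: "'g::ab_group_add \<Rightarrow> 'a::comm_ring_1 \<Rightarrow> bool" +
  fixes A B :: "'a set" and x :: 'a and dx :: 'g and cf :: "nat \<Rightarrow> 'a \<Rightarrow> 'a"
  assumes A: "subring_set A" and B: "subring_set B" and AB: "A \<subseteq> B" and xB: "x \<in> B" and hom_x: "hom dx x"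
    and cf_A: "f \<in> B \<Longrightarrow> cf j f \<in> A"
    and cf_add: "cf j (f + g) = cf j f + cf j g"
    and cf_multA: "a \<in> A \<Longrightarrow> cf j (a * f) = a * cf j f"
    and cf_x0: "cf 0 (x * f) = 0" and cf_xS: "cf (Suc j) (x * f) = cf j f"
    and cf_base: "a \<in> A \<Longrightarrow> cf j a = (if j = 0 then a else 0)"
    and cf_fin: "\<exists>N. \<forall>j\<ge>N. cf j f = 0"
    and cf_expand: "(\<And>j. j \<ge> N \<Longrightarrow> cf j f = 0) \<Longrightarrow> f = (\<Sum>j<N. x ^ j * cf j f)"
    and cf_hom: "hom e f \<Longrightarrow> hom (e - ((+) dx ^^ j) 0) (cf j f)"
begin

definition xd :: "nat \<Rightarrow> 'g" where "xd j = ((+) dx ^^ j) 0"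

lemma xd_simps [simp]: "xd 0 = 0" "xd (Suc j) = xd j + dx" by (simp_all add: xd_def)

lemma xd_add: "xd (i + j) = xd i + xd j" by (induction i) (auto simp: algebra_simps)

lemma cf_hom': "hom e f \<Longrightarrow> e' = e - xd j \<Longrightarrow> hom e' (cf j f)" using cf_hom by (simp add: xd_def)

lemma hom_xpow: "hom (xd j) (x ^ j)"
proof (induction j)
  case (Suc j) then show ?case using hom_mult'[OF hom_x Suc] by (simp add: add.commute)
qed (simp add: hom_1)

lemma cf_0 [simp]: "cf j 0 = 0" using cf_base[of 0 j] subring_setD(1)[OF A] by simp

lemma cf_uminus: "cf j (- f) = - cf j f" using cf_add[of j f "- f"] by (simp add: minus_unique)

lemma cf_diff: "cf j (f - g) = cf j f - cf j g" using cf_add[of j f "- g"] by (simp add: cf_uminus)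

lemma cf_sum: "cf j (\<Sum>i\<in>I. f i) = (\<Sum>i\<in>I. cf j (f i))"
  by (induction I rule: infinite_finite_induct) (auto simp: cf_add)

lemma cf_xpow: "cf j (x ^ i * f) = (if i \<le> j then cf (j - i) f else 0)"
proof (induction i arbitrary: j)
  case (Suc i) then show ?case by (cases j) (auto simp: cf_x0 cf_xS mult.assoc)
qed simp

lemma cf_eq_0: "(\<And>j. cf j f = 0) \<Longrightarrow> f = 0" using cf_expand[of 0 f] by simp

lemma x_mult_eq_0: "x * f = 0 \<Longrightarrow> f = 0"
proof (rule cf_eq_0)
  fix j assume "x * f = 0" then show "cf j f = 0" using cf_xS[of j f] by simp
qed

lemma cf_mult: "\<exists>N. \<forall>g. cf j (f * g) = (\<Sum>i<N. if i \<le> j then cf i f * cf (j - i) g else 0)" if "f \<in> B"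
proof -
  obtain N where N: "\<And>j. j \<ge> N \<Longrightarrow> cf j f = 0" using cf_fin by blast
  have "cf j (f * g) = (\<Sum>i<N. if i \<le> j then cf i f * cf (j - i) g else 0)" for g
  proof -
    have "f * g = (\<Sum>i<N. x ^ i * (cf i f * g))"
      by (subst cf_expand[OF N]) (auto simp: sum_distrib_right mult.assoc)
    then have "cf j (f * g) = (\<Sum>i<N. cf j (x ^ i * (cf i f * g)))" by (simp add: cf_sum)
    also have "\<dots> = (\<Sum>i<N. if i \<le> j then cf i f * cf (j - i) g else 0)"
      by (intro sum.cong refl) (use cf_A[OF that] in \<open>auto simp: cf_xpow cf_multA\<close>)
    finally show ?thesis .
  qed
  then show ?thesis by blast
qed

text \<open>The extension of scalars of K from A to A[x], realised as the vectors all of whose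
  coefficient vectors lie in K; the shift by \<open>xd j\<close> accounts for the degree of
  x^j.\<close>

definition ext :: "nat \<Rightarrow> (nat \<Rightarrow> 'g) \<Rightarrow> ('g \<Rightarrow> (nat \<Rightarrow> 'a) set) \<Rightarrow> 'g \<Rightarrow> (nat \<Rightarrow> 'a) set" where
  "ext r gs K h = {v \<in> vecs B r. hv gs h v \<and> (\<forall>j. (\<lambda>i. cf j (v i)) \<in> K (h - xd j))}"

lemma vec_bound:
  assumes "v \<in> vecs B r" shows "\<exists>N. \<forall>i. \<forall>j\<ge>N. cf j (v i) = 0"
proof -
  have "\<forall>i. \<exists>N. \<forall>j\<ge>N. cf j (v i) = 0" using cf_fin by blast
  then obtain N where N: "\<And>i j. j \<ge> N i \<Longrightarrow> cf j (v i) = 0" by metis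
  have "cf j (v i) = 0" if "j \<ge> (\<Sum>i<r. N i)" for i j
  proof (cases "i < r")
    case True
    have "N i \<le> (\<Sum>i<r. N i)" using True by (auto intro: member_le_sum[where f = N])
    then show ?thesis using N[of i j] that by linarith
  next
    case False then show ?thesis using assms by (auto simp: vecs_def)
  qed
  then show ?thesis by blast
qed

lemma ext_gsub:
  assumes K: "gsub A r gs K" shows "gsub B r gs (ext r gs K)"
  unfolding gsub_def
proof (intro conjI allI impI ballI subsetI)
  fix h v w assume "v \<in> ext r gs K h" "w \<in> ext r gs K h"
  then show "(\<lambda>i. v i + w i) \<in> ext r gs K h" unfolding ext_def
    by (auto simp: cf_add vecs_closed[OF B] hv_add gsubD(4)[OF K])
next
  fix f e h v assume f: "f \<in> B" "v \<in> ext r gs K h" "hom e f"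
  have "(\<lambda>i. cf j (f * v i)) \<in> K (e + h - xd j)" for j
  proof -
    obtain N where N: "\<And>g. cf j (f * g) = (\<Sum>i<N. if i \<le> j then cf i f * cf (j - i) g else 0)" using cf_mult[OF f(1)] by blast
    have "(\<lambda>k. if i \<le> j then cf i f * cf (j - i) (v k) else 0) \<in> K (e + h - xd j)" for i
    proof (cases "i \<le> j")
      case True
      then have x: "xd j = xd i + xd (j - i)" by (simp flip: xd_add)
      have "(\<lambda>k. cf i f * cf (j - i) (v k)) \<in> K (e + h - xd j)"
        by (rule gsubD(5)[OF K, where e = "e - xd i" and h = "h - xd (j - i)"])
          (use f in \<open>auto simp: ext_def cf_A cf_hom' x\<close>)
      then show ?thesis using True by simp
    qed (use gsubD(3)[OF K] in simp)
    then show ?thesis unfolding N by (rule gsub_sum[OF K])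
  qed
  then show "(\<lambda>i. f * v i) \<in> ext r gs K (e + h)"
    using f unfolding ext_def by (auto simp: vecs_closed[OF B] intro: hv_mult)
next
  fix h h' assume *: "\<forall>c. hom (h + c) = hom (h' + c)"
  have "K (h - xd j) = K (h' - xd j)" for j
    by (rule gsubD(6)[OF K]) (use *[rule_format, of "_ - xd j"] in \<open>simp add: algebra_simps\<close>)
  then show "ext r gs K h = ext r gs K h'" using hv_shift_cong[of h h'] * by (simp add: ext_def)
next
  fix h show "(\<lambda>i. 0) \<in> ext r gs K h" using gsubD(3)[OF K] by (simp add: ext_def vecs_closed[OF B] hv_0)
qed (simp add: ext_def)

lemma A_sub_ext:
  assumes K: "gsub A r gs K" and v: "v \<in> K h" shows "v \<in> ext r gs K h"
proof -
  have vA: "v i \<in> A" for i using gsubD(1)[OF K v] by (auto simp: vecs_def)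
  have "(\<lambda>i. cf j (v i)) \<in> K (h - xd j)" for j
    using v gsubD(3)[OF K] by (cases "j = 0") (simp_all add: cf_base[OF vA])
  then show ?thesis using gsubD(1,2)[OF K v] AB by (auto simp: ext_def vecs_def)
qed

lemma xpow_ext:
  assumes K: "gsub A r gs K" and v: "v \<in> K (h - xd l)" shows "(\<lambda>i. x ^ l * v i) \<in> ext r gs K h"
  by (rule gsubD(5)[OF ext_gsub[OF K] A_sub_ext[OF K v], where e = "xd l"])
    (auto simp: hom_xpow subring_set_power[OF B xB])

lemma ext_induct:
  assumes v: "v \<in> ext r gs K h" and 0: "P (\<lambda>i. 0)"
    and add: "\<And>u w. P u \<Longrightarrow> P w \<Longrightarrow> P (\<lambda>i. u i + w i)"
    and pow: "\<And>l u. u \<in> K (h - xd l) \<Longrightarrow> P (\<lambda>i. x ^ l * u i)"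
  shows "P v"
proof -
  obtain N where N: "\<And>i j. j \<ge> N \<Longrightarrow> cf j (v i) = 0" using vec_bound[of v r] v by (auto simp: ext_def)
  have "P (\<lambda>i. \<Sum>l<n. x ^ l * cf l (v i))" for n
  proof (induction n)
    case (Suc n)
    have "P (\<lambda>i. x ^ n * cf n (v i))" by (rule pow) (use v in \<open>simp add: ext_def\<close>)
    then show ?case using add[OF Suc] by simp
  qed (simp add: 0)
  moreover have "v = (\<lambda>i. \<Sum>l<N. x ^ l * cf l (v i))" using cf_expand[OF N] by blast
  ultimately show ?thesis by metis
qed

lemma cf_lincomb:
  assumes "\<And>j i. j < s \<Longrightarrow> xs j i \<in> A"
  shows "cf l (lincomb s xs c i) = lincomb s xs (\<lambda>j. cf l (c j)) i"
  unfolding lincomb_def cf_sum using assms by (intro sum.cong) (auto simp: cf_multA mult.commute[of "c _"] mult.commute[of "cf _ _"])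

text \<open>Flatness of A[x] over A in explicit form. Taking a coefficient commutes with
  combinations of vectors over A, so generators of K generate its extension, and a relation over B
  is a family of relations over A, one for each power of x. The same matrices thus resolve the
  extension.\<close>

lemma fr_ext:
  assumes "gsub A r gs K" "fr A n gs K" shows "fr B n gs (ext r gs K)"
  using assms
proof (induction n arbitrary: r gs K)
  case 0
  have "v = (\<lambda>i. 0)" if v: "v \<in> ext r gs K h" for v h
  proof
    fix i
    have "(\<lambda>i. cf j (v i)) = (\<lambda>i. 0)" for j using v 0(2) by (auto simp: ext_def)
    from fun_cong[OF this, of _ i] show "v i = 0" by (rule cf_eq_0)
  qed
  then show ?case by auto
next
  case (Suc n)
  obtain s xs hs where g: "gens A gs K s xs hs" and f: "fr A n hs (rels A s xs hs)" using Suc.prems(2) by auto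
  note K = Suc.prems(1)
  have xsK: "xs j \<in> K (hs j)" if "j < s" for j using g that by (auto simp: gens_def)
  have xsA: "xs j i \<in> A" if "j < s" for j i using gsubD(1)[OF K xsK[OF that]] by (auto simp: vecs_def)
  have "gens B gs (ext r gs K) s xs hs"
    unfolding gens_def
  proof (intro conjI allI impI ballI)
    fix j assume "j < s" then show "xs j \<in> ext r gs K (hs j)" by (intro A_sub_ext[OF K] xsK)
  next
    fix h v assume v: "v \<in> ext r gs K h"
    obtain N where N: "\<And>i j. j \<ge> N \<Longrightarrow> cf j (v i) = 0" using vec_bound[of v r] v by (auto simp: ext_def)
    have "\<exists>c. c \<in> vecs A s \<and> hv hs (h - xd l) c \<and> (\<lambda>i. cf l (v i)) = lincomb s xs c" for l
      using g v unfolding gens_def ext_def by blast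
    then obtain c where c: "\<And>l. c l \<in> vecs A s" "\<And>l. hv hs (h - xd l) (c l)" "\<And>l. (\<lambda>i. cf l (v i)) = lincomb s xs (c l)" by metis
    define d where "d = (\<lambda>j. \<Sum>l<N. x ^ l * c l j)"
    have "d \<in> vecs B s" using c(1) AB unfolding d_def vecs_def 
      by (auto intro!: subring_set_sum[OF B] subring_setD(4)[OF B] subring_set_power[OF B xB])
    moreover have "hv hs h d" unfolding d_def hv_def using c(2)
      by (auto intro!: hom_sum hom_mult'[OF hom_xpow] simp: hv_def)
    moreover have "v = lincomb s xs d"
    proof
      fix i
      have "v i = (\<Sum>l<N. x ^ l * cf l (v i))" by (rule cf_expand[OF N])
      also have "\<dots> = (\<Sum>l<N. x ^ l * lincomb s xs (c l) i)" using fun_cong[OF c(3)] by simp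
      also have "\<dots> = lincomb s xs d i"
        unfolding lincomb_def d_def sum_distrib_left sum_distrib_right by (subst sum.swap) (simp add: mult.assoc)
      finally show "v i = lincomb s xs d i" .
    qed
    ultimately show "\<exists>c\<in>vecs B s. hv hs h c \<and> v = lincomb s xs c" by blast
  qed
  moreover have "rels B s xs hs = ext s hs (rels A s xs hs)"
  proof (intro ext equalityI subsetI)
    fix h c assume c: "c \<in> rels B s xs hs h"
    have "lincomb s xs (\<lambda>j. cf l (c j)) = (\<lambda>i. 0)" for l
      using cf_lincomb[of s xs l c, OF xsA] c by (auto simp: rels_def fun_eq_iff)
    moreover have "(\<lambda>j. cf l (c j)) \<in> vecs A s" for l using c by (auto simp: rels_def vecs_def cf_A)
    moreover have "hv hs (h - xd l) (\<lambda>j. cf l (c j))" for l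
      using c by (auto simp: rels_def hv_def intro!: cf_hom')
    ultimately show "c \<in> ext s hs (rels A s xs hs) h" using c by (auto simp: rels_def ext_def)
  next
    fix h c assume c: "c \<in> ext s hs (rels A s xs hs) h"
    have "lincomb s xs c i = 0" for i
    proof (rule cf_eq_0)
      fix l show "cf l (lincomb s xs c i) = 0"
        using c cf_lincomb[of s xs l c, OF xsA] by (auto simp: ext_def rels_def fun_eq_iff)
    qed
    then show "c \<in> rels B s xs hs h" using c by (auto simp: ext_def rels_def)
  qed
  ultimately show ?case using Suc.IH[OF rels_gsub[OF A] f] by (metis fr.simps(2))
qed

section \<open>Leading coefficients with respect to x\<close>

definition xbelow :: "nat \<Rightarrow> (nat \<Rightarrow> 'a) \<Rightarrow> bool" where
  "xbelow m u \<longleftrightarrow> (\<forall>i. \<forall>j\<ge>m. cf j (u i) = 0)"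

text \<open>The modules of leading coefficients from the proof of Hilbert's basis theorem, with
  degrees lowered by that of x^m.\<close>

definition lead :: "('g \<Rightarrow> (nat \<Rightarrow> 'a) set) \<Rightarrow> nat \<Rightarrow> 'g \<Rightarrow> (nat \<Rightarrow> 'a) set" where
  "lead K m h = {(\<lambda>i. cf m (u i)) |u. u \<in> K (h + xd m) \<and> xbelow (Suc m) u}"

lemma lead_gsub:
  assumes K: "gsub B r gs K" shows "gsub A r gs (lead K m)"
  unfolding gsub_def
proof (intro conjI allI impI ballI subsetI)
  fix h v assume "v \<in> lead K m h"
  then obtain u where u: "u \<in> K (h + xd m)" "v = (\<lambda>i. cf m (u i))" by (auto simp: lead_def)
  then show "v \<in> {v \<in> vecs A r. hv gs h v}" using gsubD(1,2)[OF K u(1)]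
    by (auto simp: vecs_def hv_def cf_A intro!: cf_hom')
next
  fix h show "(\<lambda>i. 0) \<in> lead K m h" unfolding lead_def mem_Collect_eq
    by (rule exI[of _ "\<lambda>i. 0"]) (simp add: gsubD(3)[OF K] xbelow_def)
next
  fix h v w assume "v \<in> lead K m h" "w \<in> lead K m h"
  then obtain u u' where u: "u \<in> K (h + xd m)" "v = (\<lambda>i. cf m (u i))" "xbelow (Suc m) u"
    and u': "u' \<in> K (h + xd m)" "w = (\<lambda>i. cf m (u' i))" "xbelow (Suc m) u'" by (auto simp: lead_def)
  show "(\<lambda>i. v i + w i) \<in> lead K m h" unfolding lead_def mem_Collect_eq
    by (rule exI[of _ "\<lambda>i. u i + u' i"]) (use u u' gsubD(4)[OF K u(1) u'(1)] in \<open>simp add: xbelow_def cf_add\<close>)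
next
  fix f e h v assume f: "f \<in> A" "v \<in> lead K m h" "hom e f"
  then obtain u where u: "u \<in> K (h + xd m)" "v = (\<lambda>i. cf m (u i))" "xbelow (Suc m) u" by (auto simp: lead_def)
  have "(\<lambda>i. f * u i) \<in> K (e + h + xd m)" by (rule gsubD(5)[OF K u(1) _ f(3)]) (use f AB in \<open>auto simp: add.assoc\<close>)
  then show "(\<lambda>i. f * v i) \<in> lead K m (e + h)" unfolding lead_def mem_Collect_eq
    by (intro exI[of _ "\<lambda>i. f * u i"]) (use u f in \<open>simp add: xbelow_def cf_multA\<close>)
next
  fix h h' assume *: "\<forall>c. hom (h + c) = hom (h' + c)"
  have "K (h + xd m) = K (h' + xd m)"
    by (rule gsubD(6)[OF K]) (use * in \<open>simp add: add.assoc\<close>)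
  then show "lead K m h = lead K m h'" by (simp add: lead_def)
qed

text \<open>Multiplication by x raises the degree in x and keeps the leading coefficient.\<close>

lemma lead_mono:
  assumes K: "gsub B r gs K" shows "m \<le> m' \<Longrightarrow> lead K m h \<subseteq> lead K m' h"
proof (induction m' rule: dec_induct)
  case (step m')
  have "lead K m' h \<subseteq> lead K (Suc m') h"
  proof
    fix v assume "v \<in> lead K m' h"
    then obtain u where u: "u \<in> K (h + xd m')" "v = (\<lambda>i. cf m' (u i))" "xbelow (Suc m') u" by (auto simp: lead_def)
    have "(\<lambda>i. x * u i) \<in> K (h + xd (Suc m'))"
      by (rule gsubD(5)[OF K u(1) xB hom_x]) (simp add: algebra_simps)
    moreover have "xbelow (Suc (Suc m')) (\<lambda>i. x * u i)" unfolding xbelow_def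
    proof (intro allI impI)
      fix i j assume "Suc (Suc m') \<le> j"
      then obtain j' where "j = Suc j'" "Suc m' \<le> j'" by (cases j) auto
      then show "cf j (x * u i) = 0" using u(3) by (simp add: xbelow_def cf_xS)
    qed
    ultimately show "v \<in> lead K (Suc m') h" unfolding lead_def mem_Collect_eq
      by (intro exI[of _ "\<lambda>i. x * u i"]) (simp add: u(2) cf_xS)
  qed
  with step.IH show ?case by blast
qed simp

text \<open>The union of the ascending chain is a graded submodule over A and hence finitely
  generated by \<open>syz\<close>. M is the sum of the levels at which the generators appear, so it
  lies beyond each of them, and it serves all degrees h at once.\<close>

lemma lead_stable:
  assumes K: "gsub B r gs K" and S: "syz A n"
  shows "\<exists>M. \<forall>m h. lead K m h \<subseteq> lead K M h"
proof -
  define L where "L = (\<lambda>h. \<Union>m. lead K m h)"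
  have L: "gsub A r gs L"
    unfolding gsub_def
  proof (intro conjI allI impI ballI)
    fix h show "L h \<subseteq> {v \<in> vecs A r. hv gs h v}"
      unfolding L_def using gsubD(1,2)[OF lead_gsub[OF K]] by auto
  next
    fix h show "(\<lambda>i. 0) \<in> L h" unfolding L_def using gsubD(3)[OF lead_gsub[OF K]] by auto
  next
    fix h v w assume "v \<in> L h" "w \<in> L h"
    then obtain a b where "v \<in> lead K a h" "w \<in> lead K b h" by (auto simp: L_def)
    then have "v \<in> lead K (max a b) h" "w \<in> lead K (max a b) h"
      using lead_mono[OF K, of a "max a b"] lead_mono[OF K, of b "max a b"] by auto
    then show "(\<lambda>i. v i + w i) \<in> L h" unfolding L_def using gsubD(4)[OF lead_gsub[OF K]] by blast
  next
    fix f e h v assume "f \<in> A" "v \<in> L h" "hom e f"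
    then obtain a where a: "v \<in> lead K a h" and f: "f \<in> A" "hom e f" by (auto simp: L_def)
    show "(\<lambda>i. f * v i) \<in> L (e + h)"
      unfolding L_def using gsubD(5)[OF lead_gsub[OF K] a f refl] by blast
  next
    fix h h' assume "\<forall>c. hom (h + c) = hom (h' + c)"
    then have "lead K m h = lead K m h'" for m by (intro gsubD(6)[OF lead_gsub[OF K]]) simp
    then show "L h = L h'" by (simp add: L_def)
  qed
  \<comment> \<open>Lengthening first guarantees that \<open>fr\<close> can be unfolded once, so
    that generators are available even for n = 0.\<close>
  have "fr A (Suc n) gs L" using S L by (intro fr_Suc[OF A]) (auto simp: syz_def)
  then obtain s xs hs where g: "gens A gs L s xs hs" by auto
  have "\<forall>j. \<exists>m. j < s \<longrightarrow> xs j \<in> lead K m (hs j)" using g by (auto simp: gens_def L_def)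
  then obtain m where m: "\<And>j. j < s \<Longrightarrow> xs j \<in> lead K (m j) (hs j)" by metis
  define M where "M = (\<Sum>j<s. m j)"
  have mM: "xs j \<in> lead K M (hs j)" if "j < s" for j
  proof -
    have "m j \<le> M" unfolding M_def using that by (auto intro: member_le_sum[where f = m])
    then show ?thesis using m[OF that] lead_mono[OF K] by blast
  qed
  have "lead K a h \<subseteq> lead K M h" for a h
  proof
    fix v assume "v \<in> lead K a h"
    then have "v \<in> L h" by (auto simp: L_def)
    then obtain c where c: "c \<in> vecs A s" "hv hs h c" "v = lincomb s xs c" using g unfolding gens_def by blast
    show "v \<in> lead K M h" unfolding c(3) by (rule gsub_lincomb[OF lead_gsub[OF K] mM c(1,2)])
  qed
  then show ?thesis by blast
qed

section \<open>A presentation of a module over B by modules extended from A\<close>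

definition flat :: "nat \<Rightarrow> (nat \<Rightarrow> 'a) \<Rightarrow> nat \<Rightarrow> 'a" where
  "flat M u k = cf (k mod Suc M) (u (k div Suc M))"

definition unflat :: "nat \<Rightarrow> (nat \<Rightarrow> 'a) \<Rightarrow> nat \<Rightarrow> 'a" where
  "unflat M v i = (\<Sum>j<Suc M. x ^ j * v (i * Suc M + j))"

definition flatdeg :: "nat \<Rightarrow> (nat \<Rightarrow> 'g) \<Rightarrow> nat \<Rightarrow> 'g" where
  "flatdeg M gs k = gs (k div Suc M) + xd (k mod Suc M)"

text \<open>The elements of K of degree less than m in x, read as vectors over A:
  \<open>flat\<close> places the coefficient of x^j in coordinate i at position i (M + 1) + j, for j
  up to M.\<close>

definition below :: "('g \<Rightarrow> (nat \<Rightarrow> 'a) set) \<Rightarrow> nat \<Rightarrow> nat \<Rightarrow> 'g \<Rightarrow> (nat \<Rightarrow> 'a) set" where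
  "below K M m h = flat M ` {u \<in> K h. xbelow m u}"

lemma flat_at: "j < Suc M \<Longrightarrow> flat M u (i * Suc M + j) = cf j (u i)"
  unfolding flat_def by (simp add: div_mult_self3 del: mult_Suc_right)

lemma unflat_flat:
  assumes "xbelow (Suc M) u" shows "unflat M (flat M u) = u"
proof
  fix i
  have "unflat M (flat M u) i = (\<Sum>j<Suc M. x ^ j * cf j (u i))"
    unfolding unflat_def by (intro sum.cong refl) (simp add: flat_at del: mult_Suc_right)
  also have "\<dots> = u i" by (rule cf_expand[symmetric]) (use assms in \<open>simp add: xbelow_def\<close>)
  finally show "unflat M (flat M u) i = u i" .
qed

lemma linear_unflat: "linear_map (unflat M)"
  unfolding linear_map_def unflat_def fun_eq_iff
  by (auto simp: sum.distrib distrib_left sum_distrib_left mult.left_commute simp del: mult_Suc_right sum.lessThan_Suc)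

lemma flat_add: "flat M (\<lambda>i. u i + w i) = (\<lambda>k. flat M u k + flat M w k)"
  by (simp add: flat_def cf_add fun_eq_iff)

lemma flat_mult: "a \<in> A \<Longrightarrow> flat M (\<lambda>i. a * u i) = (\<lambda>k. a * flat M u k)"
  by (simp add: flat_def cf_multA fun_eq_iff)

lemma flat_0: "flat M (\<lambda>i. 0) = (\<lambda>k. 0)" by (simp add: flat_def fun_eq_iff)

lemma below_gsub:
  assumes K: "gsub B r gs K" shows "gsub A (r * Suc M) (flatdeg M gs) (below K M m)"
  unfolding gsub_def
proof (intro conjI allI impI ballI subsetI)
  fix h v assume "v \<in> below K M m h"
  then obtain u where u: "u \<in> K h" "v = flat M u" by (auto simp: below_def)
  have "u (k div Suc M) = 0" if "k \<ge> r * Suc M" for k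
  proof -
    have "r \<le> k div Suc M" using div_le_mono[OF that, of "Suc M"] by (simp del: mult_Suc_right)
    then show ?thesis using gsubD(1)[OF K u(1)] by (simp add: vecs_def)
  qed
  then have "v \<in> vecs A (r * Suc M)"
    using gsubD(1)[OF K u(1)] unfolding u(2) flat_def vecs_def by (auto simp: cf_A)
  moreover have "hv (flatdeg M gs) h v"
    using gsubD(2)[OF K u(1)] unfolding u(2) flat_def hv_def flatdeg_def by (auto intro!: cf_hom' simp: algebra_simps)
  ultimately show "v \<in> {v \<in> vecs A (r * Suc M). hv (flatdeg M gs) h v}" by simp
next
  fix h show "(\<lambda>i. 0) \<in> below K M m h" unfolding below_def
    by (rule image_eqI[of _ _ "\<lambda>i. 0"]) (simp_all add: flat_0 gsubD(3)[OF K] xbelow_def)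
next
  fix h v w assume "v \<in> below K M m h" "w \<in> below K M m h"
  then obtain u u' where u: "u \<in> K h" "v = flat M u" "xbelow m u" "u' \<in> K h" "w = flat M u'" "xbelow m u'"
    by (auto simp: below_def)
  show "(\<lambda>i. v i + w i) \<in> below K M m h" unfolding below_def
    by (rule image_eqI[of _ _ "\<lambda>i. u i + u' i"]) (use u gsubD(4)[OF K u(1,4)] in \<open>simp_all add: flat_add xbelow_def cf_add\<close>)
next
  fix f e h v assume f: "f \<in> A" "v \<in> below K M m h" "hom e f"
  then obtain u where u: "u \<in> K h" "v = flat M u" "xbelow m u" by (auto simp: below_def)
  have "(\<lambda>i. f * u i) \<in> K (e + h)" by (rule gsubD(5)[OF K u(1) _ f(3)]) (use f AB in auto)
  then show "(\<lambda>i. f * v i) \<in> below K M m (e + h)" unfolding below_def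
    by (intro image_eqI[of _ _ "\<lambda>i. f * u i"]) (use u f in \<open>simp_all add: flat_mult xbelow_def cf_multA\<close>)
next
  fix h h' assume "\<forall>c. hom (h + c) = hom (h' + c)"
  then show "below K M m h = below K M m h'" using gsubD(6)[OF K, of h h'] by (simp add: below_def)
qed

text \<open>Multiplication by x minus the shift that moves every entry of a block of length M + 1 to
  the next position. On \<open>flat M u\<close> it is x tensor u - 1 tensor x u, the differential in
  the standard presentation of a module over A[x].\<close>

definition koszul :: "nat \<Rightarrow> (nat \<Rightarrow> 'a) \<Rightarrow> nat \<Rightarrow> 'a" where
  "koszul M u k = x * u k - (if k mod Suc M = 0 then 0 else u (k - 1))"

lemma linear_koszul: "linear_map (koszul M)"
  unfolding linear_map_def koszul_def by (auto simp: algebra_simps)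

lemma koszul_flat: "koszul M (flat M u) = (\<lambda>k. x * flat M u k - flat M (\<lambda>i. x * u i) k)"
proof
  fix k
  have "(if k mod Suc M = 0 then 0 else flat M u (k - 1)) = flat M (\<lambda>i. x * u i) k"
  proof (cases "k mod Suc M")
    case 0 then show ?thesis by (simp add: flat_def cf_x0)
  next
    case (Suc j)
    define i where "i = k div Suc M"
    have k: "k = i * Suc M + Suc j" using div_mult_mod_eq[of k "Suc M"] Suc by (simp add: i_def)
    have j: "Suc j < Suc M" using mod_less_divisor[of "Suc M" k] Suc by simp
    have "flat M u (k - 1) = cf j (u i)" using flat_at[of j M u i] j k by simp
    moreover have "flat M (\<lambda>i. x * u i) k = cf j (u i)" using flat_at[OF j, of "\<lambda>i. x * u i" i] k by (simp add: cf_xS)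
    ultimately show ?thesis using Suc by simp
  qed
  then show "koszul M (flat M u) k = x * flat M u k - flat M (\<lambda>i. x * u i) k" by (simp add: koszul_def)
qed

text \<open>Within a block the entries vanish one after the other, starting from the first, since x
  is not a zero divisor.\<close>

lemma koszul_inj:
  assumes "koszul M u = (\<lambda>k. 0)" shows "u = (\<lambda>k. 0)"
proof
  fix k show "u k = 0"
  proof (induction k rule: less_induct)
    case (less k)
    have *: "koszul M u k = 0" using assms by simp
    have "x * u k = 0"
    proof (cases "k mod Suc M = 0")
      case False
      then have "k - 1 < k" by (cases k) auto
      from less[OF this] * False show ?thesis by (simp add: koszul_def)
    qed (use * in \<open>simp add: koszul_def\<close>)
    then show ?case by (rule x_mult_eq_0)
  qed
qed

text \<open>The sum over a block telescopes to x^(M+1) times the last entry of the block.\<close>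

lemma unflat_koszul:
  assumes "\<And>i. u (i * Suc M + M) = 0" shows "unflat M (koszul M u) = (\<lambda>i. 0)"
proof
  fix i
  define f where "f j = u (i * Suc M + j)" for j
  define g where "g j = koszul M u (i * Suc M + j)" for j
  have k: "g j = x * f j - (if j = 0 then 0 else f (j - 1))" if "j < Suc M" for j
    using that unfolding g_def f_def koszul_def by (simp del: mult_Suc_right)
  have "(\<Sum>j<n. x ^ j * g j) = (if n = 0 then 0 else x ^ n * f (n - 1))" if "n \<le> Suc M" for n
    using that
  proof (induction n)
    case (Suc n)
    then show ?case by (cases n) (simp_all add: k algebra_simps)
  qed simp
  from this[of "Suc M"] show "unflat M (koszul M u) i = 0"
    using assms[of i] unfolding unflat_def by (simp add: f_def g_def del: mult_Suc_right sum.lessThan_Suc)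
qed

text \<open>Let K_m be the A-module of elements of K of degree at most m in x, and M a level from
  which the leading coefficients are stable. Then \<open>koszul\<close> and \<open>unflat\<close>
  form an exact sequence 0 -> B K_(M-1) -> B K_M -> K -> 0, where B stands for extension of scalars
  and the first term is shifted. Its first two modules are resolved by \<open>fr_ext\<close>, and
  \<open>fr_horseshoe\<close> yields K. Later only the finiteness of the bound matters, so no care
  is taken to keep it small.\<close>

theorem syz_step:
  assumes S: "syz A n" shows "syz B (Suc (Suc n))"
  unfolding syz_def
proof (intro allI impI)
  fix r gs K assume K: "gsub B r gs K"
  obtain M where M: "\<And>m h. lead K m h \<subseteq> lead K M h" using lead_stable[OF K S] by blast
  define R where "R = r * Suc M"
  define F2 where "F2 = below K M (Suc M)"
  \<comment> \<open>The shift by \<open>dx\<close> compensates for the factor x, so that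
    \<open>koszul\<close> preserves degrees.\<close>
  define F1 where "F1 = (\<lambda>h. below K M M (h - dx))"
  define g2 where "g2 = flatdeg M gs"
  define g1 where "g1 = (\<lambda>k. g2 k + dx)"
  have G2: "gsub A R g2 F2" unfolding R_def g2_def F2_def by (rule below_gsub[OF K])
  have G1: "gsub A R g1 F1" unfolding R_def g2_def g1_def F1_def by (rule gsub_shift[OF below_gsub[OF K]])
  define K2 where "K2 = ext R g2 F2"
  define K1 where "K1 = ext R g1 F1"
  have E2: "gsub B R g2 K2" unfolding K2_def by (rule ext_gsub[OF G2])
  have E1: "gsub B R g1 K1" unfolding K1_def by (rule ext_gsub[OF G1])
  have f1: "fr B (Suc n) g1 K1" unfolding K1_def
    using S G1 by (intro fr_ext fr_Suc[OF A]) (auto simp: syz_def)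
  have f2: "fr B (Suc (Suc n)) g2 K2" unfolding K2_def
    using S G2 by (intro fr_ext fr_Suc[OF A]) (auto simp: syz_def)
  have xK: "(\<lambda>i. x ^ l * u i) \<in> K h" if "u \<in> K h'" "xd l + h' = h" for l u h h'
    by (rule gsubD(5)[OF K that(1) _ hom_xpow that(2)]) (rule subring_set_power[OF B xB])
  have xK2: "(\<lambda>i. x ^ l * u i) \<in> K2 h" if "u \<in> K2 h'" "xd l + h' = h" for l u h h'
    by (rule gsubD(5)[OF E2 that(1) _ hom_xpow that(2)]) (rule subring_set_power[OF B xB])
  have flat2: "flat M u \<in> K2 h" if "u \<in> K h" "xbelow (Suc M) u" for u h
    unfolding K2_def by (rule A_sub_ext[OF G2]) (use that in \<open>auto simp: F2_def below_def\<close>)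
  have kf: "koszul M (flat M u) \<in> K2 h" if "u \<in> K (h - dx)" "xbelow M u" for u h
  proof -
    have xu: "xbelow (Suc M) (\<lambda>i. x * u i)" unfolding xbelow_def
    proof (intro allI impI)
      fix i j assume "Suc M \<le> j"
      then show "cf j (x * u i) = 0" using that(2) by (cases j) (auto simp: xbelow_def cf_xS)
    qed
    have 1: "flat M (\<lambda>i. x * u i) \<in> K2 h"
      by (rule flat2[OF _ xu]) (use xK[OF that(1), of 1 h] in simp)
    have "flat M u \<in> K2 (h - dx)" by (rule flat2[OF that(1)]) (use that(2) in \<open>auto simp: xbelow_def\<close>)
    then have "(\<lambda>k. x * flat M u k) \<in> K2 h" using xK2[of "flat M u" "h - dx" 1 h] by simp
    from gsub_diff[OF E2 B this 1] show ?thesis unfolding koszul_flat .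
  qed
  \<comment> \<open>The last position of a block holds the coefficient of x^M, which is absent in
    degrees below M; \<open>unflat_koszul\<close> asks for exactly this.\<close>
  have last0: "u (i * Suc M + M) = 0" if "u \<in> K1 h" for u h i
  proof (rule ext_induct[where P = "\<lambda>u. u (i * Suc M + M) = 0", OF that[unfolded K1_def]])
    fix l u assume "u \<in> F1 (h - xd l)"
    then obtain w where w: "xbelow M w" "u = flat M w" by (auto simp: F1_def below_def)
    show "x ^ l * u (i * Suc M + M) = 0" using w(1) unfolding w(2) by (subst flat_at) (auto simp: xbelow_def)
  qed auto
  show "fr B (Suc (Suc n)) gs K"
  proof (rule fr_horseshoe[OF B E1 E2 linear_koszul[of M] linear_unflat[of M] _ _ _ _ _ _ f1 f2])
    fix h u assume u: "u \<in> K1 h"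
    show "koszul M u \<in> K2 h"
    proof (rule ext_induct[where P = "\<lambda>u. koszul M u \<in> K2 h", OF u[unfolded K1_def]])
      show "koszul M (\<lambda>i. 0) \<in> K2 h" by (simp add: linear_mapD(3)[OF linear_koszul] gsubD(3)[OF E2])
    next
      fix u w assume "koszul M u \<in> K2 h" "koszul M w \<in> K2 h"
      then show "koszul M (\<lambda>i. u i + w i) \<in> K2 h" by (simp add: linear_mapD(1)[OF linear_koszul] gsubD(4)[OF E2])
    next
      fix l u assume "u \<in> F1 (h - xd l)"
      then obtain w where w: "u = flat M w" "w \<in> K (h - xd l - dx)" "xbelow M w" by (auto simp: F1_def below_def)
      show "koszul M (\<lambda>i. x ^ l * u i) \<in> K2 h"
        unfolding linear_mapD(2)[OF linear_koszul] w(1) by (rule xK2[OF kf[OF w(2,3)]]) simp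
    qed
    show "unflat M (koszul M u) = (\<lambda>i. 0)" by (rule unflat_koszul) (rule last0[OF u])
    show "u = (\<lambda>i. 0)" if "koszul M u = (\<lambda>i. 0)" by (rule koszul_inj[OF that])
  next
    fix h v assume v: "v \<in> K2 h"
    show "unflat M v \<in> K h"
    proof (rule ext_induct[where P = "\<lambda>u. unflat M u \<in> K h", OF v[unfolded K2_def]])
      show "unflat M (\<lambda>i. 0) \<in> K h" by (simp add: linear_mapD(3)[OF linear_unflat] gsubD(3)[OF K])
    next
      fix u w assume "unflat M u \<in> K h" "unflat M w \<in> K h"
      then show "unflat M (\<lambda>i. u i + w i) \<in> K h" by (simp add: linear_mapD(1)[OF linear_unflat] gsubD(4)[OF K])
    next
      fix l u assume "u \<in> F2 (h - xd l)"
      then obtain w where w: "u = flat M w" "w \<in> K (h - xd l)" "xbelow (Suc M) w" by (auto simp: F2_def below_def)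
      show "unflat M (\<lambda>i. x ^ l * u i) \<in> K h"
        unfolding linear_mapD(2)[OF linear_unflat] w(1) unflat_flat[OF w(3)] by (rule xK[OF w(2)]) simp
    qed
  next
    fix h w assume w: "w \<in> K h"
    \<comment> \<open>Surjectivity, by lowering the degree N of u in x: for N > M stability provides
      y of degree at most M whose coefficient at x^M is the leading coefficient of u, and u -
      x^(N-M) y has smaller degree.\<close>
    have "\<exists>v\<in>K2 h. unflat M v = u" if "u \<in> K h" "xbelow N u" for N u
      using that
    proof (induction N arbitrary: u)
      case 0
      then have "xbelow (Suc M) u" by (auto simp: xbelow_def)
      then show ?case using flat2[OF 0(1)] unflat_flat by blast
    next
      case (Suc N)
      show ?case
      proof (cases "N < Suc M")
        case True
        then have "xbelow (Suc M) u" using Suc.prems(2) by (auto simp: xbelow_def)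
        then show ?thesis using flat2[OF Suc.prems(1)] unflat_flat by blast
      next
        case False
        have "(\<lambda>i. cf N (u i)) \<in> lead K N (h - xd N)" unfolding lead_def using Suc.prems by auto
        then have "(\<lambda>i. cf N (u i)) \<in> lead K M (h - xd N)" using M by blast
        then obtain y where y: "y \<in> K (h - xd N + xd M)" "\<And>i. cf N (u i) = cf M (y i)" "xbelow (Suc M) y"
          by (auto simp: lead_def fun_eq_iff)
        define l where "l = N - M"
        have N: "N = l + M" using False by (simp add: l_def)
        have dl: "xd l + (h - xd N + xd M) = h" unfolding N xd_add by simp
        have yK: "(\<lambda>i. x ^ l * y i) \<in> K h" by (rule xK[OF y(1) dl])
        have "(\<lambda>i. u i - x ^ l * y i) \<in> K h" by (rule gsub_diff[OF K B Suc.prems(1) yK])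
        moreover have "xbelow N (\<lambda>i. u i - x ^ l * y i)"
          unfolding xbelow_def
        proof (intro allI impI)
          fix i j assume "N \<le> j"
          show "cf j (u i - x ^ l * y i) = 0"
          proof (cases "j = N")
            case True then show ?thesis using y(2)[of i] by (simp add: cf_diff cf_xpow N)
          next
            case False
            then have "Suc N \<le> j" "Suc M \<le> j - l" using \<open>N \<le> j\<close> N by auto
            then show ?thesis using Suc.prems(2) y(3) by (simp add: cf_diff cf_xpow xbelow_def)
          qed
        qed
        ultimately obtain v where v: "v \<in> K2 h" "unflat M v = (\<lambda>i. u i - x ^ l * y i)" using Suc.IH by blast
        have "(\<lambda>k. v k + x ^ l * flat M y k) \<in> K2 h" by (rule gsubD(4)[OF E2 v(1) xK2[OF flat2[OF y(1,3)] dl]])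
        moreover have "unflat M (\<lambda>k. v k + x ^ l * flat M y k) = u"
          unfolding linear_mapD(1)[OF linear_unflat] linear_mapD(2)[OF linear_unflat] v(2) unflat_flat[OF y(3)] by simp
        ultimately show ?thesis by blast
      qed
    qed
    moreover obtain N where "xbelow N w" using vec_bound[OF gsubD(1)[OF K w]] unfolding xbelow_def by blast
    ultimately show "\<exists>v\<in>K2 h. unflat M v = w" using w by blast
  next
    fix h v assume v: "v \<in> K2 h" "unflat M v = (\<lambda>i. 0)"
    \<comment> \<open>Exactness in the middle, by lowering the highest power x^N that occurs in v:
      its coefficient is the flattening of some u in K, and subtracting the image of x^(N-1) times
      that flattening removes it without creating new terms in x^N or above.\<close>
    have "\<exists>u\<in>K1 h. koszul M u = v" if "v \<in> K2 h" "unflat M v = (\<lambda>i. 0)" "xbelow N v" for N v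
      using that
    proof (induction N arbitrary: v)
      case 0
      have "v i = 0" for i by (rule cf_eq_0) (use 0 in \<open>simp add: xbelow_def\<close>)
      then have "v = (\<lambda>i. 0)" by blast
      then show ?case using gsubD(3)[OF E1] linear_mapD(3)[OF linear_koszul] by blast
    next
      case (Suc N)
      have "(\<lambda>i. cf N (v i)) \<in> F2 (h - xd N)" using Suc.prems(1) by (simp add: K2_def ext_def)
      then obtain u where u: "\<And>k. cf N (v k) = flat M u k" "u \<in> K (h - xd N)" "xbelow (Suc M) u"
        by (auto simp: F2_def below_def fun_eq_iff)
      \<comment> \<open>In \<open>unflat M v\<close> the power x^(N+M) can arise only from x^N at
        the last position of a block. Hence u has degree below M and belongs to the source of
        \<open>koszul\<close>.\<close>
      have cfM: "cf M (u i) = 0" for i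
      proof -
        have "0 = cf (N + M) (unflat M v i)" using Suc.prems(2) by simp
        also have "\<dots> = (\<Sum>j<Suc M. cf (N + M) (x ^ j * v (i * Suc M + j)))" unfolding unflat_def cf_sum ..
        also have "\<dots> = (\<Sum>j<Suc M. if j = M then cf N (v (i * Suc M + M)) else 0)"
        proof (intro sum.cong refl)
          fix j assume j: "j \<in> {..<Suc M}"
          show "cf (N + M) (x ^ j * v (i * Suc M + j)) = (if j = M then cf N (v (i * Suc M + M)) else 0)"
          proof (cases "j = M")
            case False
            then have "Suc N \<le> N + M - j" using j by auto
            then show ?thesis using Suc.prems(3) False by (simp add: cf_xpow xbelow_def)
          qed (simp add: cf_xpow)
        qed
        also have "\<dots> = cf N (v (i * Suc M + M))" by simp
        also have "\<dots> = cf M (u i)" unfolding u(1) by (rule flat_at) simp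
        finally show ?thesis by simp
      qed
      have uM: "xbelow M u" unfolding xbelow_def
      proof (intro allI impI)
        fix i j assume "M \<le> j" then show "cf j (u i) = 0" using cfM[of i] u(3) by (cases "j = M") (auto simp: xbelow_def)
      qed
      show ?case
      proof (cases N)
        case 0
        have "v = flat M u"
        proof
          fix k
          have "v k = (\<Sum>j<1. x ^ j * cf j (v k))" by (rule cf_expand) (use Suc.prems(3) 0 in \<open>simp add: xbelow_def\<close>)
          then show "v k = flat M u k" using u(1)[of k] 0 by simp
        qed
        then have "u = (\<lambda>i. 0)" using Suc.prems(2) unflat_flat[OF u(3)] by simp
        then have "v = (\<lambda>i. 0)" using \<open>v = flat M u\<close> flat_0 by simp
        then show ?thesis using gsubD(3)[OF E1] linear_mapD(3)[OF linear_koszul] by blast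
      next
        case (Suc N')
        have "u \<in> K (h - xd N' - dx)" using u(2) Suc by (simp add: algebra_simps)
        then have fu: "flat M u \<in> F1 (h - xd N')" using uM by (auto simp: F1_def below_def)
        define y where "y = (\<lambda>k. x ^ N' * flat M u k)"
        have y: "y \<in> K1 h" unfolding y_def K1_def by (rule xpow_ext[OF G1 fu])
        have ky: "koszul M y = (\<lambda>k. x ^ N' * (x * flat M u k - flat M (\<lambda>i. x * u i) k))"
          unfolding y_def linear_mapD(2)[OF linear_koszul] koszul_flat ..
        have kyK: "koszul M y \<in> K2 h"
          unfolding y_def linear_mapD(2)[OF linear_koszul] by (rule xK2[OF kf[OF \<open>u \<in> K (h - xd N' - dx)\<close> uM]]) simp
        define v' where "v' = (\<lambda>k. v k - koszul M y k)"
        have "v' \<in> K2 h" unfolding v'_def by (rule gsub_diff[OF E2 B Suc.prems(1) kyK])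
        moreover have "unflat M v' = (\<lambda>i. 0)"
          unfolding v'_def linear_mapD(4)[OF linear_unflat] Suc.prems(2) unflat_koszul[of y M, OF last0[OF y]] by simp
        moreover have "xbelow N v'"
          unfolding xbelow_def
        proof (intro allI impI)
          fix k l assume l: "N \<le> l"
          have fA: "flat M w k \<in> A" if "\<And>i. w i \<in> B" for w using that by (simp add: flat_def cf_A)
          have uB: "u i \<in> B" "x * u i \<in> B" for i
            using gsubD(1)[OF K u(2)] subring_setD(4)[OF B xB] by (auto simp: vecs_def)
          have "cf l (koszul M y k) = cf (l - N') (x * flat M u k) - cf (l - N') (flat M (\<lambda>i. x * u i) k)"
            unfolding ky using l Suc by (simp add: cf_xpow cf_diff)
          also have "cf (l - N') (flat M (\<lambda>i. x * u i) k) = 0"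
            using l Suc by (subst cf_base[OF fA[OF uB(2)]]) simp
          also have "cf (l - N') (x * flat M u k) = cf (l - N) (flat M u k)"
          proof -
            have "l - N' = Suc (l - N)" using l Suc by simp
            then show ?thesis by (simp add: cf_xS)
          qed
          also have "\<dots> = (if l = N then flat M u k else 0)" using l by (subst cf_base[OF fA[OF uB(1)]]) auto
          finally have "cf l (koszul M y k) = (if l = N then flat M u k else 0)" by simp
          then show "cf l (v' k) = 0" using u(1)[of k] Suc.prems(3) l by (auto simp: v'_def cf_diff xbelow_def)
        qed
        ultimately obtain u0 where u0: "u0 \<in> K1 h" "koszul M u0 = v'" using Suc.IH by blast
        have "koszul M (\<lambda>k. u0 k + y k) = v" unfolding linear_mapD(1)[OF linear_koszul] u0(2) v'_def by simp
        then show ?thesis using gsubD(4)[OF E1 u0(1) y] by blast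
      qed
    qed
    moreover obtain N where "xbelow N v" using vec_bound[OF gsubD(1)[OF E2 v(1)]] unfolding xbelow_def by blast
    ultimately show "\<exists>u\<in>K1 h. koszul M u = v" using v by blast
  qed
qed

end

section \<open>Gauss's lemma for subrings\<close>

definition sdvd :: "'a::comm_ring_1 set \<Rightarrow> 'a \<Rightarrow> 'a \<Rightarrow> bool" where
  "sdvd A a b \<longleftrightarrow> (\<exists>c\<in>A. b = a * c)"

definition sunit :: "'a::comm_ring_1 set \<Rightarrow> 'a \<Rightarrow> bool" where
  "sunit A u \<longleftrightarrow> u \<in> A \<and> sdvd A u 1"

definition sprime :: "'a::comm_ring_1 set \<Rightarrow> 'a \<Rightarrow> bool" where
  "sprime A q \<longleftrightarrow> q \<in> A \<and> q \<noteq> 0 \<and> \<not> sdvd A q 1 \<and>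
     (\<forall>a\<in>A. \<forall>b\<in>A. sdvd A q (a * b) \<longrightarrow> sdvd A q a \<or> sdvd A q b)"

definition sfactors :: "'a::comm_ring_1 set \<Rightarrow> 'a \<Rightarrow> bool" where
  "sfactors A f \<longleftrightarrow> (\<exists>u qs. sunit A u \<and> (\<forall>q\<in>set qs. sprime A q) \<and> f = u * prod_list qs)"

text \<open>Factors are prime rather than irreducible, so uniqueness needs no clause of its
  own.\<close>

definition sufd :: "'a::comm_ring_1 set \<Rightarrow> bool" where
  "sufd A \<longleftrightarrow> (\<forall>f\<in>A. f \<noteq> 0 \<longrightarrow> sfactors A f)"

lemma sdvd_refl: "subring_set A \<Longrightarrow> sdvd A a a"
  unfolding sdvd_def by (rule bexI[of _ 1]) (auto simp: subring_setD)

lemma sdvd_trans: "subring_set A \<Longrightarrow> sdvd A a b \<Longrightarrow> sdvd A b c \<Longrightarrow> sdvd A a c"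
  unfolding sdvd_def by (metis mult.assoc subring_setD(4))

lemma sdvd_add: "subring_set A \<Longrightarrow> sdvd A a b \<Longrightarrow> sdvd A a c \<Longrightarrow> sdvd A a (b + c)"
  unfolding sdvd_def by (metis distrib_left subring_setD(3))

lemma sdvd_diff: "subring_set A \<Longrightarrow> sdvd A a b \<Longrightarrow> sdvd A a c \<Longrightarrow> sdvd A a (b - c)"
  unfolding sdvd_def by (metis right_diff_distrib subring_setD(6))

lemma sdvd_mult: "subring_set A \<Longrightarrow> sdvd A a b \<Longrightarrow> c \<in> A \<Longrightarrow> sdvd A a (b * c)"
  unfolding sdvd_def by (metis mult.assoc subring_setD(4))

lemma sdvd_mult2: "subring_set A \<Longrightarrow> sdvd A a b \<Longrightarrow> c \<in> A \<Longrightarrow> sdvd A a (c * b)"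
  using sdvd_mult[of A a b c] by (simp add: mult.commute)

lemma sdvd_0: "subring_set A \<Longrightarrow> sdvd A a 0"
  unfolding sdvd_def by (rule bexI[of _ 0]) (auto simp: subring_setD)

lemma sdvd_sum: "subring_set A \<Longrightarrow> (\<And>i. i \<in> I \<Longrightarrow> sdvd A a (f i)) \<Longrightarrow> sdvd A a (sum f I)"
  by (induction I rule: infinite_finite_induct) (auto simp: sdvd_0 sdvd_add)

lemma sunit_mult: "subring_set A \<Longrightarrow> sunit A u \<Longrightarrow> sunit A v \<Longrightarrow> sunit A (u * v)"
  unfolding sunit_def sdvd_def
  by (metis mult.assoc mult.left_commute mult.right_neutral subring_setD(4))

lemma sunit_1: "subring_set A \<Longrightarrow> sunit A 1"
  by (simp add: sunit_def sdvd_refl subring_setD)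

lemma sfactors_mult: "subring_set A \<Longrightarrow> sfactors A f \<Longrightarrow> sfactors A g \<Longrightarrow> sfactors A (f * g)"
  unfolding sfactors_def
proof (elim exE conjE)
  fix u qs v rs assume *: "subring_set A" "sunit A u" "sunit A v" "\<forall>q\<in>set qs. sprime A q" "\<forall>q\<in>set rs. sprime A q"
    "f = u * prod_list qs" "g = v * prod_list rs"
  show "\<exists>u qs. sunit A u \<and> (\<forall>q\<in>set qs. sprime A q) \<and> f * g = u * prod_list qs"
    by (rule exI[of _ "u * v"], rule exI[of _ "qs @ rs"]) (use * sunit_mult in \<open>auto simp: ac_simps\<close>)
qed

lemma sfactors_prime: "subring_set A \<Longrightarrow> sprime A q \<Longrightarrow> sfactors A q"
  unfolding sfactors_def by (rule exI[of _ 1], rule exI[of _ "[q]"]) (auto simp: sunit_1)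

lemma sfactors_unit: "sunit A u \<Longrightarrow> sfactors A u"
  unfolding sfactors_def by (rule exI[of _ u], rule exI[of _ "[]"]) auto

lemma sprime_notin_unit: "subring_set A \<Longrightarrow> sprime A q \<Longrightarrow> sunit A u \<Longrightarrow> \<not> sdvd A q u"
  unfolding sprime_def sunit_def using sdvd_trans by blast

lemma sprime_dvd_prod_list:
  assumes "subring_set A" "sprime A q" "set qs \<subseteq> A" "sdvd A q (prod_list qs)"
  shows "\<exists>r\<in>set qs. sdvd A q r"
  using assms(3,4)
proof (induction qs)
  case Nil then show ?case using assms(2) by (simp add: sprime_def)
next
  case (Cons a qs)
  have "prod_list qs \<in> A" using Cons.prems(1) by (induction qs) (auto simp: subring_setD[OF assms(1)])
  then have "sdvd A q a \<or> sdvd A q (prod_list qs)" using Cons.prems assms(2) by (auto simp: sprime_def)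
  then show ?case using Cons by auto
qed

lemma sprime_associated:
  fixes q r :: "'a::idom"
  assumes A: "subring_set A" and q: "sprime A q" and r: "sprime A r" and "sdvd A q r"
  shows "\<exists>c. sunit A c \<and> r = q * c"
proof -
  obtain c where c: "c \<in> A" "r = q * c" using assms(4) by (auto simp: sdvd_def)
  have "sdvd A r (q * c)" using c(2) sdvd_refl[OF A] by simp
  then consider "sdvd A r q" | "sdvd A r c" using r q c(1) by (auto simp: sprime_def)
  then have "sunit A c"
  proof cases
    case 1
    then obtain d where d: "d \<in> A" "q = r * d" by (auto simp: sdvd_def)
    then have "q * (c * d) = q * 1" using c by (simp add: mult.assoc)
    then have "c * d = 1" using q by (simp add: sprime_def)
    then show ?thesis using c d unfolding sunit_def sdvd_def by metis
  next
    case 2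
    then obtain d where d: "d \<in> A" "c = r * d" by (auto simp: sdvd_def)
    then have "r * (q * d) = r * 1" using c by (metis mult.left_commute mult.right_neutral)
    then have "q * d = 1" using r by (simp add: sprime_def)
    then have "sdvd A q 1" using d unfolding sdvd_def by metis
    then show ?thesis using q by (simp add: sprime_def)
  qed
  then show ?thesis using c(2) by blast
qed

section \<open>Polynomials over a subring and Gauss's lemma\<close>

definition polys :: "'a::comm_ring_1 set \<Rightarrow> 'a poly set" where
  "polys A = {P. \<forall>i. coeff P i \<in> A}"

lemma subring_polys: assumes A: "subring_set A" shows "subring_set (polys A)"
  unfolding subring_set_def polys_def
  by (auto simp: subring_setD[OF A] coeff_mult coeff_1 intro!: subring_set_sum[OF A])

lemma const_polys: "subring_set A \<Longrightarrow> [:a:] \<in> polys A \<longleftrightarrow> a \<in> A"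
  unfolding polys_def by (auto simp: coeff_pCons subring_setD split: nat.split)

lemma monom_polys: "subring_set A \<Longrightarrow> a \<in> A \<Longrightarrow> monom a n \<in> polys A"
  unfolding polys_def by (auto simp: subring_setD)

lemma smult_polys: "subring_set A \<Longrightarrow> a \<in> A \<Longrightarrow> P \<in> polys A \<Longrightarrow> Polynomial.smult a P \<in> polys A"
  unfolding polys_def by (auto simp: subring_setD)

lemma sdvd_const_iff:
  fixes q :: "'a::idom"
  assumes A: "subring_set A" and q: "q \<noteq> 0"
  shows "sdvd (polys A) [:q:] P \<longleftrightarrow> (\<forall>i. sdvd A q (coeff P i))"
proof
  assume "sdvd (polys A) [:q:] P" then show "\<forall>i. sdvd A q (coeff P i)"
    by (auto simp: sdvd_def polys_def)
next
  assume *: "\<forall>i. sdvd A q (coeff P i)"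
  define f where "f = (\<lambda>a. SOME c. c \<in> A \<and> a = q * c)"
  have f: "f a \<in> A \<and> a = q * f a" if "sdvd A q a" for a
    unfolding f_def by (rule someI_ex) (use that in \<open>auto simp: sdvd_def\<close>)
  \<comment> \<open>The chosen quotients have to respect 0 for \<open>map_poly\<close> to act on
    every coefficient; here q \<noteq> 0 enters.\<close>
  have f0: "f 0 = 0" using f[OF sdvd_0[OF A]] q by simp
  have "P = [:q:] * map_poly f P" using f * by (intro poly_eqI) (auto simp: coeff_map_poly f0)
  moreover have "map_poly f P \<in> polys A" using f * by (auto simp: polys_def coeff_map_poly f0)
  ultimately show "sdvd (polys A) [:q:] P" unfolding sdvd_def by blast
qed

text \<open>If i and j are the first positions at which q divides neither P nor Q, then the
  coefficient of P Q at i + j is a product of two coefficients not divisible by q plus multiples of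
  q.\<close>

lemma sprime_const:
  fixes q :: "'a::idom"
  assumes A: "subring_set A" and q: "sprime A q"
  shows "sprime (polys A) [:q:]"
proof -
  have q0: "q \<noteq> 0" using q by (simp add: sprime_def)
  note iff = sdvd_const_iff[OF A q0]
  have "sdvd (polys A) [:q:] P \<or> sdvd (polys A) [:q:] Q" if PQ: "P \<in> polys A" "Q \<in> polys A" "sdvd (polys A) [:q:] (P * Q)" for P Q
  proof (rule ccontr)
    assume "\<not> ?thesis"
    then have ex: "\<exists>i. \<not> sdvd A q (coeff P i)" "\<exists>j. \<not> sdvd A q (coeff Q j)" unfolding iff by auto
    define i where "i = (LEAST i. \<not> sdvd A q (coeff P i))"
    define j where "j = (LEAST j. \<not> sdvd A q (coeff Q j))"
    have i: "\<not> sdvd A q (coeff P i)" "\<And>k. k < i \<Longrightarrow> sdvd A q (coeff P k)" unfolding i_def using LeastI_ex[OF ex(1)] not_less_Least by blast+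
    have j: "\<not> sdvd A q (coeff Q j)" "\<And>k. k < j \<Longrightarrow> sdvd A q (coeff Q k)" unfolding j_def using LeastI_ex[OF ex(2)] not_less_Least by blast+
    have "sdvd A q (coeff (P * Q) (i + j))" using that(3) iff by blast
    moreover have "coeff (P * Q) (i + j) = coeff P i * coeff Q j + (\<Sum>k\<in>{..i + j} - {i}. coeff P k * coeff Q (i + j - k))"
      unfolding coeff_mult by (subst sum.remove[of _ i]) auto
    moreover have "sdvd A q (\<Sum>k\<in>{..i + j} - {i}. coeff P k * coeff Q (i + j - k))"
    proof (rule sdvd_sum[OF A])
      fix k assume k: "k \<in> {..i + j} - {i}"
      show "sdvd A q (coeff P k * coeff Q (i + j - k))"
      proof (cases "k < i")
        case True then show ?thesis using i(2) PQ(2) by (intro sdvd_mult[OF A]) (auto simp: polys_def)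
      next
        case False
        then have "i + j - k < j" using k by auto
        then show ?thesis using j(2) PQ(1) by (intro sdvd_mult2[OF A]) (auto simp: polys_def)
      qed
    qed
    ultimately have "sdvd A q (coeff P i * coeff Q j + (\<Sum>k\<in>{..i + j} - {i}. coeff P k * coeff Q (i + j - k)))"
      "sdvd A q (\<Sum>k\<in>{..i + j} - {i}. coeff P k * coeff Q (i + j - k))" by simp_all
    from sdvd_diff[OF A this] have "sdvd A q (coeff P i * coeff Q j)" by simp
    then show False using q PQ i(1) j(1) by (auto simp: sprime_def polys_def)
  qed
  moreover have "\<not> sdvd (polys A) [:q:] 1" unfolding iff using q by (auto simp: sprime_def intro: exI[of _ 0])
  moreover have "[:q:] \<in> polys A" using q by (simp add: const_polys[OF A] sprime_def)
  ultimately show ?thesis using q0 by (simp add: sprime_def)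
qed

text \<open>Content 1, expressed through the primes of A instead of a greatest common
  divisor.\<close>

definition primitive_in :: "'a::idom set \<Rightarrow> 'a poly \<Rightarrow> bool" where
  "primitive_in A P \<longleftrightarrow> (\<forall>q. sprime A q \<longrightarrow> \<not> sdvd (polys A) [:q:] P)"

text \<open>The induction is on the number of prime factors of the leading coefficient.\<close>

lemma primitive_part_aux:
  fixes P :: "'a::idom poly"
  assumes A: "subring_set A" and "P \<in> polys A" "P \<noteq> 0"
    "lead_coeff P = u * prod_list qs" "sunit A u" "\<forall>q\<in>set qs. sprime A q"
  shows "\<exists>rs R. (\<forall>q\<in>set rs. sprime A q) \<and> R \<in> polys A \<and> primitive_in A R \<and> P = [:prod_list rs:] * R"
  using assms(2-)
proof (induction "length qs" arbitrary: qs P u)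
  case (0 qs P u)
  have "primitive_in A P"
    unfolding primitive_in_def
  proof (intro allI impI notI)
    fix q assume q: "sprime A q" "sdvd (polys A) [:q:] P"
    then have "q \<noteq> 0" by (simp add: sprime_def)
    then have "sdvd A q (lead_coeff P)" using q sdvd_const_iff[OF A] by blast
    then show False using 0 sprime_notin_unit[OF A q(1), of u] by auto
  qed
  then show ?case using 0 by (intro exI[of _ "[]"] exI[of _ P]) auto
next
  case (Suc n qs P u)
  show ?case
  proof (cases "primitive_in A P")
    case True
    then show ?thesis using Suc.prems by (intro exI[of _ "[]"] exI[of _ P]) auto
  next
    case False
    then obtain q where q: "sprime A q" "sdvd (polys A) [:q:] P" by (auto simp: primitive_in_def)
    then have q0: "q \<noteq> 0" by (simp add: sprime_def)
    obtain R where R: "R \<in> polys A" "P = [:q:] * R" using q(2) by (auto simp: sdvd_def)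
    have lcP: "lead_coeff P = q * lead_coeff R" using R q0 by simp
    have qsA: "set qs \<subseteq> A" using Suc.prems by (auto simp: sprime_def)
    have "prod_list qs \<in> A" using qsA by (induction qs) (auto simp: subring_setD[OF A])
    moreover have "sdvd A q (u * prod_list qs)" using sdvd_const_iff[OF A q0] q(2) Suc.prems(3) by metis
    ultimately have "sdvd A q (prod_list qs)"
      using q(1) Suc.prems(4) sprime_notin_unit[OF A q(1) Suc.prems(4)] by (auto simp: sprime_def sunit_def)
    then obtain r where r: "r \<in> set qs" "sdvd A q r" using sprime_dvd_prod_list[OF A q(1) qsA] by blast
    obtain c where c: "sunit A c" "r = q * c" using sprime_associated[OF A q(1) _ r(2)] Suc.prems(5) r(1) by blast
    obtain ys zs where yz: "qs = ys @ r # zs" using r(1) by (meson split_list)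
    have "q * lead_coeff R = q * ((u * c) * prod_list (ys @ zs))"
      using Suc.prems(3) unfolding lcP yz c(2) by (simp add: mult_ac)
    then have "lead_coeff R = (u * c) * prod_list (ys @ zs)" using q0 by simp
    moreover have "n = length (ys @ zs)" using Suc.hyps(2) yz by simp
    moreover have "R \<noteq> 0" using R Suc.prems by auto
    ultimately obtain rs R' where *: "\<forall>q\<in>set rs. sprime A q" "R' \<in> polys A" "primitive_in A R'" "R = [:prod_list rs:] * R'"
      using Suc.hyps(1)[of "ys @ zs" R "u * c"] R(1) sunit_mult[OF A Suc.prems(4) c(1)] Suc.prems(5) yz by auto
    then show ?thesis using q R(2) by (intro exI[of _ "q # rs"] exI[of _ R']) (auto simp: mult.commute)
  qed
qed

lemma primitive_part:
  fixes P :: "'a::idom poly"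
  assumes A: "subring_set A" and U: "sufd A" and P: "P \<in> polys A" "P \<noteq> 0"
  shows "\<exists>rs R. (\<forall>q\<in>set rs. sprime A q) \<and> R \<in> polys A \<and> primitive_in A R \<and> P = [:prod_list rs:] * R"
proof -
  have "lead_coeff P \<in> A" "lead_coeff P \<noteq> 0" using P by (auto simp: polys_def)
  then obtain u qs where "lead_coeff P = u * prod_list qs" "sunit A u" "\<forall>q\<in>set qs. sprime A q"
    using U unfolding sufd_def sfactors_def by metis
  then show ?thesis using primitive_part_aux[OF A P] by blast
qed

text \<open>Gauss's lemma in the form that replaces the field of fractions: each prime factor of c
  divides Q R but not R, hence divides Q and can be cancelled. For a primitive R, divisibility up to
  a constant is therefore divisibility.\<close>

lemma primitive_dvd_cancel:
  fixes F Q R :: "'a::idom poly"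
  assumes A: "subring_set A" and U: "sufd A" and c: "c \<in> A" "c \<noteq> 0" and F: "F \<in> polys A" and Q: "Q \<in> polys A"
    and R: "R \<in> polys A" "primitive_in A R" and e: "[:c:] * F = Q * R"
  shows "sdvd (polys A) R F"
proof -
  note PA = subring_polys[OF A]
  obtain u qs where u: "c = u * prod_list qs" "sunit A u" "\<forall>q\<in>set qs. sprime A q"
    using U c unfolding sufd_def sfactors_def by metis
  obtain v where v: "v \<in> A" "1 = u * v" using u(2) by (auto simp: sunit_def sdvd_def)
  have "[:prod_list qs:] * F = Q * R \<Longrightarrow> Q \<in> polys A \<Longrightarrow> sdvd (polys A) R F" for Q
    using u(3)
  proof (induction qs arbitrary: Q)
    case Nil then show ?case unfolding sdvd_def by (intro bexI[of _ Q]) (auto simp: mult.commute)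
  next
    case (Cons q qs)
    have q: "sprime A q" "q \<noteq> 0" using Cons.prems(3) by (auto simp: sprime_def)
    have QA: "[:prod_list qs:] * F \<in> polys A"
    proof -
      have "prod_list qs \<in> A" using Cons.prems(3) by (induction qs) (auto simp: subring_setD[OF A] sprime_def)
      then show ?thesis using F by (simp add: smult_polys[OF A])
    qed
    have eq: "[:q:] * ([:prod_list qs:] * F) = Q * R" using Cons.prems(1) by (simp add: mult.commute)
    have "sdvd (polys A) [:q:] (Q * R)"
      unfolding sdvd_def using QA eq by metis
    then have "sdvd (polys A) [:q:] Q"
      using sprime_const[OF A q(1)] R q Cons.prems(2) unfolding sprime_def[of "polys A"] primitive_in_def by blast
    then obtain Q' where Q': "Q' \<in> polys A" "Q = [:q:] * Q'" by (auto simp: sdvd_def)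
    have "[:q:] * ([:prod_list qs:] * F) = [:q:] * (Q' * R)" using eq Q' by (simp only: mult.assoc)
    then have "[:prod_list qs:] * F = Q' * R" using q(2) by (metis mult_cancel_left pCons_eq_0_iff)
    then show ?case using Cons.IH[OF _ Q'(1)] Cons.prems(3) by simp
  qed
  moreover have "[:prod_list qs:] * F = ([:v:] * Q) * R"
  proof -
    have "[:v:] * ([:c:] * F) = Polynomial.smult (v * u * prod_list qs) F" by (simp add: u(1) mult_ac)
    also have "v * u = 1" using v by (simp add: mult.commute)
    finally show ?thesis unfolding e by (simp add: mult.assoc)
  qed
  moreover have "[:v:] * Q \<in> polys A" using v Q by (simp add: smult_polys[OF A])
  ultimately show ?thesis by blast
qed

text \<open>Division with remainder with the denominators cleared; the c that the proof produces is
  a power of the leading coefficient of R.\<close>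

lemma pseudo_division:
  fixes F R :: "'a::idom poly"
  assumes A: "subring_set A" and R: "R \<in> polys A" "R \<noteq> 0" and F: "F \<in> polys A"
  shows "\<exists>c Q S. c \<in> A \<and> c \<noteq> 0 \<and> Q \<in> polys A \<and> S \<in> polys A \<and> Polynomial.smult c F = Q * R + S \<and> (S = 0 \<or> degree S < degree R)"
proof -
  note PA = subring_polys[OF A]
  have "F \<in> polys A \<Longrightarrow> F = 0 \<or> degree F < n \<Longrightarrow> ?thesis" for n
  proof (induction n arbitrary: F)
    case 0
    then show ?case by (intro exI[of _ 1] exI[of _ 0]) (auto simp: subring_setD[OF A] subring_setD[OF PA])
  next
    case (Suc n)
    show ?case
    proof (cases "F = 0 \<or> degree F < degree R")
      case True
      then show ?thesis using Suc.prems by (intro exI[of _ 1] exI[of _ 0] exI[of _ F]) (auto simp: subring_setD[OF A] subring_setD[OF PA])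
    next
      case False
      define M where "M = monom (lead_coeff F) (degree F - degree R)"
      define F1 where "F1 = Polynomial.smult (lead_coeff R) F - M * R"
      have lA: "lead_coeff F \<in> A" "lead_coeff R \<in> A" using R Suc.prems by (auto simp: polys_def)
      have M: "M \<in> polys A" unfolding M_def by (rule monom_polys[OF A lA(1)])
      have F1: "F1 \<in> polys A" unfolding F1_def
        by (intro subring_setD[OF PA] smult_polys[OF A] lA M R Suc.prems)
      have dMR: "degree (M * R) = degree F"
        using False R(2) unfolding M_def by (subst degree_mult_eq) (auto simp: degree_monom_eq monom_eq_0_iff)
      have "coeff F1 (degree F) = 0"
        unfolding F1_def M_def mult.commute[of "monom _ _" R] using False by (simp add: mult.commute[of R] coeff_monom_mult mult.commute[of "lead_coeff R"])
      moreover have "degree F1 \<le> degree F" unfolding F1_def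
        by (rule degree_diff_le) (auto simp: dMR)
      ultimately have "F1 = 0 \<or> degree F1 < degree F"
        by (metis leading_coeff_0_iff le_neq_implies_less)
      then have "F1 = 0 \<or> degree F1 < n" using Suc.prems(2) False by auto
      from Suc.IH[OF F1 this] obtain c Q S where IH: "c \<in> A" "c \<noteq> 0" "Q \<in> polys A" "S \<in> polys A" "Polynomial.smult c F1 = Q * R + S" "S = 0 \<or> degree S < degree R"
        by blast
      have "Polynomial.smult (c * lead_coeff R) F = Polynomial.smult c F1 + Polynomial.smult c M * R"
        unfolding F1_def by (simp add: smult_diff_right)
      also have "\<dots> = (Q + Polynomial.smult c M) * R + S" unfolding IH(5) by (simp add: algebra_simps)
      finally have e: "Polynomial.smult (c * lead_coeff R) F = (Q + Polynomial.smult c M) * R + S" .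
      show ?thesis
        by (rule exI[of _ "c * lead_coeff R"], rule exI[of _ "Q + Polynomial.smult c M"], rule exI[of _ S])
          (use e IH R(2) lA in \<open>auto intro!: subring_setD[OF A] subring_setD[OF PA] smult_polys[OF A] M\<close>)
    qed
  qed
  then show ?thesis using F by blast
qed

text \<open>Over the field of fractions f would be irreducible and the ideal (f, g) principal; the
  proof does this over A. Let r \<noteq> 0 have minimal degree in I = (f, g). By pseudo-division r
  divides each element of I up to a constant, so its primitive part r' divides them exactly. If r'
  has degree 0, a non-zero constant lies in (f, g), so f divides a constant multiple of h and then
  h. Otherwise r' has the degree of f, is f up to a unit, and divides g.\<close>

lemma sprime_polysI:
  fixes f :: "'a::idom poly"
  assumes A: "subring_set A" and U: "sufd A" and f: "f \<in> polys A" "primitive_in A f" "degree f > 0"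
    and irr: "\<And>g h. g \<in> polys A \<Longrightarrow> h \<in> polys A \<Longrightarrow> f = g * h \<Longrightarrow> degree g = 0 \<or> degree g = degree f"
  shows "sprime (polys A) f"
proof -
  note PA = subring_polys[OF A]
  have f0: "f \<noteq> 0" using f by auto
  have "\<not> sdvd (polys A) f 1"
  proof
    assume "sdvd (polys A) f 1"
    then obtain c where "1 = f * c" by (auto simp: sdvd_def)
    then have e: "f * c = 1" by simp
    then have "c \<noteq> 0" by auto
    moreover have "degree (f * c) = 0" unfolding e by simp
    ultimately show False using f(3) f0 by (simp add: degree_mult_eq)
  qed
  moreover have "sdvd (polys A) f g \<or> sdvd (polys A) f h"
    if gh: "g \<in> polys A" "h \<in> polys A" "sdvd (polys A) f (g * h)" for g h
  proof -
    obtain t where t: "t \<in> polys A" "g * h = f * t" using gh(3) by (auto simp: sdvd_def)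
    define I where "I = {a * f + b * g |a b. a \<in> polys A \<and> b \<in> polys A}"
    have IA: "I \<subseteq> polys A" using f gh by (auto simp: I_def intro!: subring_setD[OF PA])
    have fI: "f \<in> I" unfolding I_def mem_Collect_eq
      by (rule exI[of _ 1], rule exI[of _ 0]) (auto simp: subring_setD[OF PA])
    have gI: "g \<in> I" unfolding I_def mem_Collect_eq
      by (rule exI[of _ 0], rule exI[of _ 1]) (auto simp: subring_setD[OF PA])
    define r where "r = (ARG_MIN degree r. r \<in> I \<and> r \<noteq> 0)"
    have r: "r \<in> I" "r \<noteq> 0" and rmin: "\<And>s. s \<in> I \<Longrightarrow> s \<noteq> 0 \<Longrightarrow> degree r \<le> degree s"
      unfolding r_def using arg_min_nat_lemma[of "\<lambda>r. r \<in> I \<and> r \<noteq> 0" f degree] fI f0 by auto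
    have rA: "r \<in> polys A" using r IA by blast
    obtain rs r' where r': "\<forall>q\<in>set rs. sprime A q" "r' \<in> polys A" "primitive_in A r'" "r = [:prod_list rs:] * r'"
      using primitive_part[OF A U rA r(2)] by blast
    have rsA: "[:prod_list rs:] \<in> polys A"
    proof -
      have "prod_list rs \<in> A" using r'(1) by (induction rs) (auto simp: subring_setD[OF A] sprime_def)
      then show ?thesis by (simp add: const_polys[OF A])
    qed
    have dv: "sdvd (polys A) r' F" if FI: "F \<in> I" for F
    proof -
      have FA: "F \<in> polys A" using FI IA by blast
      obtain c Q S where c: "c \<in> A" "c \<noteq> 0" "Q \<in> polys A" "S \<in> polys A" "Polynomial.smult c F = Q * r + S" "S = 0 \<or> degree S < degree r"
        using pseudo_division[OF A rA r(2) FA] by blast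
      obtain a b where ab: "a \<in> polys A" "b \<in> polys A" "F = a * f + b * g" using FI unfolding I_def by blast
      obtain a' b' where ab': "a' \<in> polys A" "b' \<in> polys A" "r = a' * f + b' * g" using r(1) unfolding I_def by blast
      have "S = Polynomial.smult c F - Q * r" using c(5) by simp
      also have "\<dots> = (Polynomial.smult c a - Q * a') * f + (Polynomial.smult c b - Q * b') * g"
        unfolding ab(3) ab'(3) by (simp add: algebra_simps smult_add_right)
      finally have "S \<in> I" unfolding I_def
        using ab(1,2) ab'(1,2) c(1,3) by (auto intro!: exI subring_setD[OF PA] smult_polys[OF A])
      then have S0: "S = 0" using c(6) rmin[of S] by (metis not_le)
      then have "[:c:] * F = (Q * [:prod_list rs:]) * r'" using c(5) r'(4) by (simp add: mult.assoc)
      then show ?thesis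
        by (rule primitive_dvd_cancel[OF A U c(1,2) FA subring_setD(4)[OF PA c(3) rsA] r'(2,3)])
    qed
    obtain w where w: "w \<in> polys A" "f = r' * w" using dv[OF fI] by (auto simp: sdvd_def)
    from irr[OF r'(2) w] consider "degree r' = 0" | "degree r' = degree f" by (elim disjE)
    then show ?thesis
    proof cases
      case 1
      have "degree r = 0" using 1 unfolding r'(4) by (simp add: degree_smult_le)
      then obtain a0 where a0: "r = [:a0:]" by (meson degree_eq_zeroE)
      have a0A: "a0 \<in> A" "a0 \<noteq> 0" using rA r(2) unfolding a0 by (auto simp: const_polys[OF A])
      obtain a' b' where ab': "a' \<in> polys A" "b' \<in> polys A" "r = a' * f + b' * g" using r(1) unfolding I_def by blast
      have "[:a0:] * h = a' * f * h + b' * (g * h)" unfolding a0[symmetric] ab'(3) by (simp add: algebra_simps)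
      also have "\<dots> = (a' * h + b' * t) * f" unfolding t(2) by (simp add: algebra_simps)
      finally have e: "[:a0:] * h = (a' * h + b' * t) * f" .
      have "a' * h + b' * t \<in> polys A" by (intro subring_setD[OF PA] ab' gh t)
      then have "sdvd (polys A) f h" using e by (rule primitive_dvd_cancel[OF A U a0A gh(2) _ f(1,2)])
      then show ?thesis ..
    next
      case 2
      have "w \<noteq> 0" "r' \<noteq> 0" using w(2) f0 by auto
      then have "degree w = 0" using 2 w(2) degree_mult_eq[of r' w] by simp
      then obtain w0 where w0: "w = [:w0:]" by (meson degree_eq_zeroE)
      have w0A: "w0 \<in> A" "w0 \<noteq> 0" using w(1) \<open>w \<noteq> 0\<close> unfolding w0 by (auto simp: const_polys[OF A])
      then obtain u qs where u: "w0 = u * prod_list qs" "sunit A u" "\<forall>q\<in>set qs. sprime A q"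
        using U unfolding sufd_def sfactors_def by metis
      \<comment> \<open>A prime factor of \<open>w0\<close> would divide the primitive polynomial f,
        so \<open>w0\<close> is a unit.\<close>
      have "qs = []"
      proof (cases qs)
        case (Cons q ps)
        have ps: "prod_list ps \<in> A" using u(3) unfolding Cons
          by (induction ps) (auto simp: subring_setD[OF A] sprime_def)
        have "f = [:q:] * ([:u * prod_list ps:] * r')" unfolding w(2) w0 u(1) Cons by (simp add: mult_ac)
        moreover have "[:u * prod_list ps:] * r' \<in> polys A"
          using u(2) ps r'(2) by (simp add: smult_polys[OF A] subring_setD[OF A] sunit_def)
        ultimately have "sdvd (polys A) [:q:] f" unfolding sdvd_def by blast
        then show ?thesis using f(2) u(3) Cons by (auto simp: primitive_in_def)
      qed simp
      then obtain v where v: "v \<in> A" "1 = w0 * v" using u by (auto simp: sunit_def sdvd_def)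
      have "v * w0 = 1" using v by (simp add: mult.commute)
      then have "r' = f * [:v:]" unfolding w(2) w0 by simp
      then have "sdvd (polys A) f r'" using v(1) unfolding sdvd_def by (metis const_polys[OF A])
      then show ?thesis using sdvd_trans[OF PA _ dv[OF gI]] by blast
    qed
  qed
  ultimately show ?thesis using f(1) f0 by (simp add: sprime_def)
qed

text \<open>Induction on the degree. Once the primes of A are split off, the primitive rest either
  factors into polynomials of smaller degree, or is constant, or is prime by
  \<open>sprime_polysI\<close>.\<close>

theorem sufd_polys:
  fixes A :: "'a::idom set"
  assumes A: "subring_set A" and U: "sufd A" shows "sufd (polys A)"
proof -
  note PA = subring_polys[OF A]
  have cu: "sunit (polys A) [:u:]" if u: "sunit A u" for u
  proof -
    obtain v where v: "v \<in> A" "1 = u * v" using u by (auto simp: sunit_def sdvd_def)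
    have "1 = [:u:] * [:v:]" using v(2) by (simp add: one_pCons mult.commute)
    then show ?thesis using u v(1) unfolding sunit_def sdvd_def by (metis const_polys[OF A])
  qed
  have cp: "sfactors (polys A) [:prod_list rs:]" if "\<forall>q\<in>set rs. sprime A q" for rs
    using that
  proof (induction rs)
    case Nil then show ?case using sfactors_unit[OF cu[OF sunit_1[OF A]]] by simp
  next
    case (Cons q rs)
    then have "sfactors (polys A) [:q:]" "sfactors (polys A) [:prod_list rs:]"
      by (auto intro!: sfactors_prime[OF PA] sprime_const[OF A])
    from sfactors_mult[OF PA this] show ?case by (simp add: mult.commute)
  qed
  have "sfactors (polys A) f" if "f \<in> polys A" "f \<noteq> 0" for f
    using that
  proof (induction "degree f" arbitrary: f rule: less_induct)
    case less
    obtain rs g where g: "\<forall>q\<in>set rs. sprime A q" "g \<in> polys A" "primitive_in A g" "f = [:prod_list rs:] * g"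
      using primitive_part[OF A U less.prems] by blast
    have g0: "g \<noteq> 0" "prod_list rs \<noteq> 0" using g(4) less.prems(2) by auto
    have dg: "degree g = degree f" unfolding g(4) using g0 by simp
    have "sfactors (polys A) g"
    proof (cases "\<exists>a b. a \<in> polys A \<and> b \<in> polys A \<and> g = a * b \<and> degree a \<noteq> 0 \<and> degree a \<noteq> degree g")
      case True
      then obtain a b where ab: "a \<in> polys A" "b \<in> polys A" "g = a * b" "degree a \<noteq> 0" "degree a \<noteq> degree g" by blast
      then have 0: "a \<noteq> 0" "b \<noteq> 0" using g0 by auto
      then have "degree g = degree a + degree b" using ab(3) by (simp add: degree_mult_eq)
      then have "degree a < degree f" "degree b < degree f" using ab(4,5) dg by auto
      then have "sfactors (polys A) a" "sfactors (polys A) b" using less.hyps ab 0 by auto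
      then show ?thesis unfolding ab(3) by (rule sfactors_mult[OF PA])
    next
      case False
      show ?thesis
      proof (cases "degree g = 0")
        case True
        then obtain a0 where a0: "g = [:a0:]" by (meson degree_eq_zeroE)
        have "a0 \<in> A" "a0 \<noteq> 0" using g(2) g0 unfolding a0 by (auto simp: const_polys[OF A])
        then obtain u qs where u: "a0 = u * prod_list qs" "sunit A u" "\<forall>q\<in>set qs. sprime A q"
          using U unfolding sufd_def sfactors_def by metis
        have "g = [:u:] * [:prod_list qs:]" unfolding a0 u(1) by simp
        then show ?thesis using sfactors_mult[OF PA sfactors_unit[OF cu[OF u(2)]] cp[OF u(3)]] by simp
      next
        case dpos: False
        have "sprime (polys A) g"
          by (rule sprime_polysI[OF A U g(2,3)]) (use dpos False in auto)
        then show ?thesis by (rule sfactors_prime[OF PA])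
      qed
    qed
    then show ?case unfolding g(4) using sfactors_mult[OF PA cp[OF g(1)]] by blast
  qed
  then show ?thesis by (simp add: sufd_def)
qed

text \<open>Carries factoriality from the type of univariate polynomials back to a subring of
  \<open>gl_poly\<close>.\<close>

lemma sufd_transfer:
  assumes A: "subring_set A" and U: "sufd A" and im: "B = \<psi> ` A" and inj: "inj_on \<psi> A"
    and mult: "\<And>a b. a \<in> A \<Longrightarrow> b \<in> A \<Longrightarrow> \<psi> (a * b) = \<psi> a * \<psi> b" and "\<psi> 1 = 1" "\<psi> 0 = 0"
  shows "sufd B"
proof -
  have dv: "sdvd B (\<psi> a) (\<psi> b) \<longleftrightarrow> sdvd A a b" if "a \<in> A" "b \<in> A" for a b
  proof
    assume "sdvd B (\<psi> a) (\<psi> b)"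
    then obtain c where c: "c \<in> A" "\<psi> b = \<psi> a * \<psi> c" unfolding sdvd_def im by auto
    then have "\<psi> b = \<psi> (a * c)" using mult that by simp
    with c(1) have "c \<in> A" "\<psi> b = \<psi> (a * c)" by auto
    then show "sdvd A a b" unfolding sdvd_def using inj that subring_setD(4)[OF A] by (metis inj_on_eq_iff)
  next
    assume "sdvd A a b" then show "sdvd B (\<psi> a) (\<psi> b)" unfolding sdvd_def im using mult that by auto
  qed
  have un: "sunit B (\<psi> u)" if "sunit A u" for u
    using that dv[of u 1] subring_setD(2)[OF A] assms(6) by (auto simp: sunit_def im)
  have pr: "sprime B (\<psi> q)" if q: "sprime A q" for q
  proof -
    have qA: "q \<in> A" using q by (simp add: sprime_def)
    have "\<psi> q \<noteq> 0" using q inj subring_setD(1)[OF A] assms(7) by (metis inj_on_eq_iff qA sprime_def)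
    moreover have "\<not> sdvd B (\<psi> q) 1" using q dv[of q 1] subring_setD(2)[OF A] qA assms(6) by (simp add: sprime_def)
    moreover have "sdvd B (\<psi> q) a \<or> sdvd B (\<psi> q) b" if aB: "a \<in> B" "b \<in> B" "sdvd B (\<psi> q) (a * b)" for a b
    proof -
      obtain a' b' where ab: "a' \<in> A" "a = \<psi> a'" "b' \<in> A" "b = \<psi> b'" using aB im by blast
      then have "sdvd A q (a' * b')" using aB(3) dv[OF qA subring_setD(4)[OF A ab(1,3)]] mult by simp
      then show ?thesis using q dv qA ab by (auto simp: sprime_def)
    qed
    ultimately show ?thesis using qA by (auto simp: sprime_def im)
  qed
  have "sfactors B (\<psi> f)" if f: "f \<in> A" "f \<noteq> 0" for f
  proof -
    obtain u qs where u: "f = u * prod_list qs" "sunit A u" "\<forall>q\<in>set qs. sprime A q"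
      using U f unfolding sufd_def sfactors_def by metis
    have 1: "prod_list rs \<in> A \<and> \<psi> (prod_list rs) = prod_list (map \<psi> rs)" if "set rs \<subseteq> A" for rs
      using that by (induction rs) (auto simp: mult assms(6) subring_setD[OF A])
    have "set qs \<subseteq> A" using u(3) by (auto simp: sprime_def)
    then have "\<psi> f = \<psi> u * prod_list (map \<psi> qs)" unfolding u(1) using mult 1 u(2) by (simp add: sunit_def)
    moreover have "\<forall>q\<in>set (map \<psi> qs). sprime B q" using u(3) pr by auto
    ultimately show ?thesis using un[OF u(2)] unfolding sfactors_def by blast
  qed
  then show ?thesis using im assms(7) by (auto simp: sufd_def)
qed

section \<open>Polynomials in finitely many variables\<close>

text \<open>An order on the variables induces a linear order on monomials that is compatible with
  their multiplication; this makes \<open>gl_poly\<close> an integral domain, as Gauss's lemma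
  requires.\<close>

instantiation gl_var :: linorder
begin

fun gl_var_code :: "gl_var \<Rightarrow> nat" where
  "gl_var_code (T j) = 2 * j"
| "gl_var_code (X i) = 2 * i + 1"

definition less_eq_gl_var :: "gl_var \<Rightarrow> gl_var \<Rightarrow> bool" where
  "less_eq_gl_var a b \<longleftrightarrow> gl_var_code a \<le> gl_var_code b"

definition less_gl_var :: "gl_var \<Rightarrow> gl_var \<Rightarrow> bool" where
  "less_gl_var a b \<longleftrightarrow> gl_var_code a < gl_var_code b"

instance
proof
  fix a b :: gl_var
  show "a \<le> b \<Longrightarrow> b \<le> a \<Longrightarrow> a = b"
    by (cases a; cases b) (auto simp: less_eq_gl_var_def, presburger+)
qed (auto simp: less_eq_gl_var_def less_gl_var_def)

end

lemma poly_mapping_sum_single: "f = (\<Sum>m\<in>Poly_Mapping.keys f. Poly_Mapping.single m (Poly_Mapping.lookup f m))"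
proof (rule poly_mapping_eqI)
  fix k
  have "(\<Sum>m\<in>Poly_Mapping.keys f. Poly_Mapping.lookup (Poly_Mapping.single m (Poly_Mapping.lookup f m)) k) =
    (\<Sum>m\<in>Poly_Mapping.keys f. if m = k then Poly_Mapping.lookup f m else 0)"
    by (intro sum.cong refl) (auto simp: lookup_single when_def)
  also have "\<dots> = Poly_Mapping.lookup f k" by (simp add: in_keys_iff)
  finally show "Poly_Mapping.lookup f k = Poly_Mapping.lookup (\<Sum>m\<in>Poly_Mapping.keys f. Poly_Mapping.single m (Poly_Mapping.lookup f m)) k"
    by (simp add: lookup_sum)
qed

lemma poly_mapping_single_induct [case_names single add]:
  fixes f :: "'b \<Rightarrow>\<^sub>0 'c::comm_monoid_add"
  assumes "\<And>m c. P (Poly_Mapping.single m c)" "\<And>f g. P f \<Longrightarrow> P g \<Longrightarrow> P (f + g)"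
  shows "P f"
proof -
  have "P (\<Sum>m\<in>I. Poly_Mapping.single m (Poly_Mapping.lookup f m))" for I
  proof (induction I rule: infinite_finite_induct)
    case (insert a I) then show ?case using assms by simp
  qed (use assms(1)[of _ 0] in simp_all)
  then show ?thesis using poly_mapping_sum_single[of f] by metis
qed

text \<open>The ring k[W]. All these rings are subsets of one type, so adjoining a variable only
  enlarges W; for this reason rings are treated above as sets closed under the operations.\<close>

definition PV :: "gl_var set \<Rightarrow> 'k::field gl_poly set" where
  "PV W = {f. \<forall>m\<in>Poly_Mapping.keys f. Poly_Mapping.keys m \<subseteq> W}"

lemma carrier_gl_poly_ring: "carrier (gl_poly_ring d n) = PV (gl_vars d n)"
  by (simp add: gl_poly_ring_def PV_def)

lemma keys_plus_nat: "Poly_Mapping.keys (a + b) = Poly_Mapping.keys a \<union> Poly_Mapping.keys (b :: 'b \<Rightarrow>\<^sub>0 nat)"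
  by (auto simp: in_keys_iff lookup_add)

lemma subring_PV: "subring_set (PV W :: 'k::field gl_poly set)"
  unfolding subring_set_def
proof (intro conjI ballI)
  fix a b :: "'k gl_poly" assume ab: "a \<in> PV W" "b \<in> PV W"
  show "a + b \<in> PV W" using ab keys_add[of a b] by (auto simp: PV_def)
  have "Poly_Mapping.keys m \<subseteq> W" if m: "m \<in> Poly_Mapping.keys (a * b)" for m
  proof -
    obtain x y where xy: "m = x + y" "x \<in> Poly_Mapping.keys a" "y \<in> Poly_Mapping.keys b" using m keys_mult[of a b] by blast
    then have "Poly_Mapping.keys x \<subseteq> W" "Poly_Mapping.keys y \<subseteq> W" using ab by (auto simp: PV_def)
    then show ?thesis unfolding xy(1) keys_plus_nat by simp
  qed
  then show "a * b \<in> PV W" by (simp add: PV_def)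
qed (auto simp: PV_def)

lemma PV_mono: "W \<subseteq> W' \<Longrightarrow> PV W \<subseteq> PV W'" by (auto simp: PV_def)

lemma single_PV: "Poly_Mapping.keys m \<subseteq> W \<Longrightarrow> Poly_Mapping.single m c \<in> PV W" by (simp add: PV_def)

lemma Const_PV: "Const c \<in> PV W" by (simp add: Const_def PV_def)

lemma Var_PV: "Var v \<in> PV W \<longleftrightarrow> v \<in> W" by (simp add: Var_def PV_def)

lemma Var_power: "Var v ^ j = (Poly_Mapping.single (Poly_Mapping.single v j) 1 :: 'k::field gl_poly)"
proof (induction j)
  case (Suc j) then show ?case by (simp add: Var_def mult_single flip: single_add)
qed simp

lemma Const_simps: "Const 0 = (0 :: 'k::field gl_poly)" "Const 1 = (1 :: 'k gl_poly)"
  "Const (a + b) = (Const a + Const b :: 'k gl_poly)" "Const (a * b) = (Const a * Const b :: 'k gl_poly)"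
  "Const (- a) = - (Const a :: 'k gl_poly)" "Const (a - b) = (Const a - Const b :: 'k gl_poly)" for a b :: "'k::field"
proof -
  show m: "Const (- a) = - (Const a :: 'k gl_poly)" for a :: 'k by (simp add: Const_def single_uminus)
  show p: "Const (a + b) = (Const a + Const b :: 'k gl_poly)" for a b :: 'k by (simp add: Const_def single_add)
  show "Const (a - b) = (Const a - Const b :: 'k gl_poly)" using p[of a "- b"] m by simp
qed (auto simp: Const_def mult_single)

lemma Const_sum: "Const (\<Sum>i\<in>I. f i) = (\<Sum>i\<in>I. Const (f i) :: 'k::field gl_poly)"
  by (induction I rule: infinite_finite_induct) (auto simp: Const_simps)

lemma Const_eq_0_iff: "Const c = (0 :: 'k::field gl_poly) \<longleftrightarrow> c = 0"
  by (metis Const_def lookup_single_eq lookup_zero single_zero)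

lemma Const_inverse: "c \<noteq> 0 \<Longrightarrow> Const (inverse c) * Const c = (1 :: 'k::field gl_poly)"
  by (simp flip: Const_simps(4) add: Const_simps(2))

lemma PV_empty: "PV {} = range (Const :: 'k::field \<Rightarrow> 'k gl_poly)"
proof (intro equalityI subsetI)
  fix f :: "'k gl_poly" assume "f \<in> PV {}"
  then have "Poly_Mapping.keys f \<subseteq> {0}" by (auto simp: PV_def)
  then have "f = Const (Poly_Mapping.lookup f 0)"
    unfolding Const_def by (intro poly_mapping_eqI) (auto simp: lookup_single when_def in_keys_iff)
  then show "f \<in> range Const" by blast
qed (auto simp: Const_PV)

section \<open>Coefficients with respect to one variable, and factoriality of k[W]\<close>

definition vcoeff :: "gl_var \<Rightarrow> nat \<Rightarrow> 'k::field gl_poly \<Rightarrow> 'k gl_poly" where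
  "vcoeff v j f = Abs_poly_mapping (\<lambda>m. if Poly_Mapping.lookup m v = 0 then Poly_Mapping.lookup f (m + Poly_Mapping.single v j) else 0)"

lemma lookup_vcoeff: "Poly_Mapping.lookup (vcoeff v j f) m =
  (if Poly_Mapping.lookup m v = 0 then Poly_Mapping.lookup f (m + Poly_Mapping.single v j) else 0)"
proof -
  have "finite ((\<lambda>m. m + Poly_Mapping.single v j) -` Poly_Mapping.keys f)"
    by (rule finite_vimageI) (auto simp: inj_on_def)
  then have "finite {m. (if Poly_Mapping.lookup m v = 0 then Poly_Mapping.lookup f (m + Poly_Mapping.single v j) else 0) \<noteq> 0}"
    by (rule rev_finite_subset) (auto simp: in_keys_iff split: if_splits)
  then show ?thesis unfolding vcoeff_def by simp
qed

lemma vcoeff_add: "vcoeff v j (f + g) = vcoeff v j f + vcoeff v j g"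
  by (rule poly_mapping_eqI) (simp add: lookup_vcoeff lookup_add)

lemma vcoeff_sum: "vcoeff v j (\<Sum>i\<in>I. f i) = (\<Sum>i\<in>I. vcoeff v j (f i))"
proof -
  have "vcoeff v j 0 = 0" by (rule poly_mapping_eqI) (simp add: lookup_vcoeff)
  then show ?thesis by (induction I rule: infinite_finite_induct) (auto simp: vcoeff_add)
qed

lemma vcoeff_single: "vcoeff v j (Poly_Mapping.single m c) =
  (if Poly_Mapping.lookup m v = j then Poly_Mapping.single (m - Poly_Mapping.single v j) c else 0)"
proof (rule poly_mapping_eqI)
  fix k
  have *: "m = k + Poly_Mapping.single v j \<and> Poly_Mapping.lookup k v = 0 \<longleftrightarrow>
      Poly_Mapping.lookup m v = j \<and> m - Poly_Mapping.single v j = k"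
  proof
    assume a: "Poly_Mapping.lookup m v = j \<and> m - Poly_Mapping.single v j = k"
    have "Poly_Mapping.lookup m w = Poly_Mapping.lookup (k + Poly_Mapping.single v j) w" for w
    proof -
      have "Poly_Mapping.lookup k w = Poly_Mapping.lookup m w - Poly_Mapping.lookup (Poly_Mapping.single v j) w"
        using a by (auto simp: lookup_minus)
      then show ?thesis using a by (auto simp: lookup_add lookup_single when_def)
    qed
    moreover have "Poly_Mapping.lookup k v = 0" using a by (auto simp: lookup_minus)
    ultimately show "m = k + Poly_Mapping.single v j \<and> Poly_Mapping.lookup k v = 0" by (simp add: poly_mapping_eqI)
  qed (auto simp: lookup_add)
  show "Poly_Mapping.lookup (vcoeff v j (Poly_Mapping.single m c)) k =
    Poly_Mapping.lookup (if Poly_Mapping.lookup m v = j then Poly_Mapping.single (m - Poly_Mapping.single v j) c else 0) k"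
    using * by (auto simp: lookup_vcoeff lookup_single when_def)
qed

lemma vcoeff_mult_PV:
  assumes a: "a \<in> PV W" and v: "v \<notin> W" shows "vcoeff v j (a * f) = a * vcoeff v j f"
proof -
  have s: "vcoeff v j (Poly_Mapping.single m c * f) = Poly_Mapping.single m c * vcoeff v j f"
    if m: "Poly_Mapping.lookup m v = 0" for m :: "gl_var \<Rightarrow>\<^sub>0 nat" and c :: 'a
  proof (induction f rule: poly_mapping_single_induct)
    case (single m' c')
    have "m + m' - Poly_Mapping.single v (Poly_Mapping.lookup m' v) = m + (m' - Poly_Mapping.single v (Poly_Mapping.lookup m' v))"
      using m by (intro poly_mapping_eqI) (auto simp: lookup_add lookup_minus lookup_single when_def)
    then show ?case using m by (auto simp: mult_single vcoeff_single lookup_add)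
  next
    case (add f g) then show ?case by (simp add: vcoeff_add distrib_left)
  qed
  have "vcoeff v j (a * f) = (\<Sum>m\<in>Poly_Mapping.keys a. vcoeff v j (Poly_Mapping.single m (Poly_Mapping.lookup a m) * f))"
    by (subst poly_mapping_sum_single[of a]) (simp add: sum_distrib_right vcoeff_sum)
  also have "\<dots> = (\<Sum>m\<in>Poly_Mapping.keys a. Poly_Mapping.single m (Poly_Mapping.lookup a m) * vcoeff v j f)"
  proof (intro sum.cong refl s)
    fix m assume "m \<in> Poly_Mapping.keys a"
    then have "v \<notin> Poly_Mapping.keys m" using a v by (auto simp: PV_def)
    then show "Poly_Mapping.lookup m v = 0" by (simp add: in_keys_iff)
  qed
  also have "\<dots> = a * vcoeff v j f"
    by (subst (2) poly_mapping_sum_single[of a]) (simp add: sum_distrib_right)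
  finally show ?thesis .
qed

lemma vcoeff_Var_mult: "vcoeff v 0 (Var v * f) = 0" "vcoeff v (Suc j) (Var v * f) = vcoeff v j f"
proof -
  have "vcoeff v 0 (Var v * f) = 0 \<and> vcoeff v (Suc j) (Var v * f) = vcoeff v j f"
  proof (induction f rule: poly_mapping_single_induct)
    case (single m c)
    have "Poly_Mapping.single v 1 + m - Poly_Mapping.single v (Suc (Poly_Mapping.lookup m v)) = m - Poly_Mapping.single v (Poly_Mapping.lookup m v)"
      by (intro poly_mapping_eqI) (auto simp: lookup_add lookup_minus lookup_single when_def)
    then show ?case by (auto simp: Var_def mult_single vcoeff_single lookup_add)
  next
    case (add f g) then show ?case by (simp add: vcoeff_add distrib_left)
  qed
  then show "vcoeff v 0 (Var v * f) = 0" "vcoeff v (Suc j) (Var v * f) = vcoeff v j f" by auto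
qed

lemma vcoeff_PV_notin: "a \<in> PV W \<Longrightarrow> v \<notin> W \<Longrightarrow> vcoeff v j a = (if j = 0 then a else 0)"
proof (rule poly_mapping_eqI)
  fix m assume a: "a \<in> PV W" "v \<notin> W"
  have *: "Poly_Mapping.lookup a m' = 0" if "Poly_Mapping.lookup m' v \<noteq> 0" for m'
  proof (rule ccontr)
    assume "Poly_Mapping.lookup a m' \<noteq> 0"
    then have "Poly_Mapping.keys m' \<subseteq> W" using a by (simp add: PV_def in_keys_iff)
    moreover have "v \<in> Poly_Mapping.keys m'" using that by (simp add: in_keys_iff)
    ultimately show False using a by blast
  qed
  show "Poly_Mapping.lookup (vcoeff v j a) m = Poly_Mapping.lookup (if j = 0 then a else 0) m"
    using *[of m] *[of "m + Poly_Mapping.single v j"] by (auto simp: lookup_vcoeff lookup_add)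
qed

lemma vcoeff_eventually_0: "\<exists>N. \<forall>j\<ge>N. vcoeff v j f = 0"
proof (induction f rule: poly_mapping_single_induct)
  case (single m c) show ?case by (rule exI[of _ "Suc (Poly_Mapping.lookup m v)"]) (auto simp: vcoeff_single)
next
  case (add f g)
  then obtain N N' where "\<forall>j\<ge>N. vcoeff v j f = 0" "\<forall>j\<ge>N'. vcoeff v j g = 0" by blast
  then show ?case by (intro exI[of _ "max N N'"]) (auto simp: vcoeff_add)
qed

lemma vcoeff_expand:
  assumes "\<And>j. j \<ge> N \<Longrightarrow> vcoeff v j f = 0"
  shows "f = (\<Sum>j<N. Var v ^ j * vcoeff v j f)"
proof -
  \<comment> \<open>The equation for all sufficiently large N is stable under sums and can be proved
    from monomials; the terms beyond the given N vanish afterwards.\<close>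
  have "\<exists>N0. \<forall>N\<ge>N0. f = (\<Sum>j<N. Var v ^ j * vcoeff v j f)"
  proof (induction f rule: poly_mapping_single_induct)
    case (single m c)
    show ?case
    proof (intro exI[of _ "Suc (Poly_Mapping.lookup m v)"] allI impI)
      fix N assume N: "Suc (Poly_Mapping.lookup m v) \<le> N"
      have "(\<Sum>j<N. Var v ^ j * vcoeff v j (Poly_Mapping.single m c)) =
        (\<Sum>j<N. if j = Poly_Mapping.lookup m v then Poly_Mapping.single (Poly_Mapping.single v j + (m - Poly_Mapping.single v j)) c else 0)"
        by (intro sum.cong) (auto simp: vcoeff_single Var_power mult_single)
      also have "\<dots> = Poly_Mapping.single (Poly_Mapping.single v (Poly_Mapping.lookup m v) + (m - Poly_Mapping.single v (Poly_Mapping.lookup m v))) c"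
        using N by simp
      also have "Poly_Mapping.single v (Poly_Mapping.lookup m v) + (m - Poly_Mapping.single v (Poly_Mapping.lookup m v)) = m"
        by (intro poly_mapping_eqI) (auto simp: lookup_add lookup_minus lookup_single when_def)
      finally show "Poly_Mapping.single m c = (\<Sum>j<N. Var v ^ j * vcoeff v j (Poly_Mapping.single m c))" by simp
    qed
  next
    case (add f g)
    then obtain N N' where "\<forall>M\<ge>N. f = (\<Sum>j<M. Var v ^ j * vcoeff v j f)" "\<forall>M\<ge>N'. g = (\<Sum>j<M. Var v ^ j * vcoeff v j g)" by blast
    then show ?case by (intro exI[of _ "max N N'"]) (simp add: vcoeff_add distrib_left sum.distrib)
  qed
  then obtain N0 where N0: "\<And>M. M \<ge> N0 \<Longrightarrow> f = (\<Sum>j<M. Var v ^ j * vcoeff v j f)" by blast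
  have "f = (\<Sum>j<max N N0. Var v ^ j * vcoeff v j f)" by (rule N0) simp
  also have "\<dots> = (\<Sum>j<N. Var v ^ j * vcoeff v j f)"
    by (rule sum.mono_neutral_right) (use assms in auto)
  finally show ?thesis .
qed

lemma vcoeff_PV:
  assumes f: "f \<in> PV (insert v W)" shows "vcoeff v j f \<in> PV W"
  unfolding PV_def
proof (intro CollectI ballI)
  fix m assume "m \<in> Poly_Mapping.keys (vcoeff v j f)"
  then have m: "Poly_Mapping.lookup m v = 0" "m + Poly_Mapping.single v j \<in> Poly_Mapping.keys f"
    by (auto simp: in_keys_iff lookup_vcoeff split: if_splits)
  then have "Poly_Mapping.keys (m + Poly_Mapping.single v j) \<subseteq> insert v W" using f unfolding PV_def by blast
  then have "Poly_Mapping.keys m \<subseteq> insert v W" unfolding keys_plus_nat by blast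
  moreover have "v \<notin> Poly_Mapping.keys m" using m(1) by (simp add: in_keys_iff)
  ultimately show "Poly_Mapping.keys m \<subseteq> W" by blast
qed

text \<open>Coefficients can be read off after evaluation at the new variable, so evaluation is
  injective and k[W][y] is the polynomial ring with v adjoined to W.\<close>

lemma vcoeff_poly:
  assumes v: "v \<notin> W" and P: "P \<in> polys (PV W)" shows "vcoeff v j (poly P (Var v)) = coeff P j"
proof -
  have c: "coeff P i \<in> PV W" for i using P by (simp add: polys_def)
  have xp: "vcoeff v j (Var v ^ i * f) = (if i \<le> j then vcoeff v (j - i) f else 0)" for i f
  proof (induction i arbitrary: j)
    case (Suc i) then show ?case by (cases j) (auto simp: vcoeff_Var_mult mult.assoc)
  qed simp
  have "vcoeff v j (poly P (Var v)) = (\<Sum>i\<le>degree P. vcoeff v j (Var v ^ i * coeff P i))"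
    by (simp add: poly_altdef vcoeff_sum mult.commute)
  also have "\<dots> = (\<Sum>i\<le>degree P. if i = j then coeff P i else 0)"
    by (intro sum.cong refl) (auto simp: xp vcoeff_PV_notin[OF c v])
  also have "\<dots> = coeff P j" by (auto simp: coeff_eq_0)
  finally show ?thesis .
qed

theorem sufd_PV: "finite W \<Longrightarrow> sufd (PV W :: 'k::field gl_poly set)"
proof (induction W rule: finite_induct)
  case empty
  have "sunit (PV {}) f" if "f \<in> PV {}" "f \<noteq> 0" for f :: "'k gl_poly"
  proof -
    obtain c where c: "f = Const c" using \<open>f \<in> PV {}\<close> by (auto simp: PV_empty)
    then have "1 = f * Const (inverse c)" using \<open>f \<noteq> 0\<close> Const_inverse[of c] by (simp add: Const_eq_0_iff mult.commute)
    then show ?thesis using \<open>f \<in> PV {}\<close> Const_PV unfolding sunit_def sdvd_def by blast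
  qed
  then show ?case by (auto simp: sufd_def intro: sfactors_unit)
next
  case (insert v W)
  have "inj_on (\<lambda>P. poly P (Var v)) (polys (PV W :: 'k gl_poly set))"
    by (intro inj_onI poly_eqI) (metis vcoeff_poly[OF insert.hyps(2)])
  moreover have "PV (insert v W) = (\<lambda>P. poly P (Var v)) ` polys (PV W :: 'k gl_poly set)"
  proof (intro equalityI subsetI)
    fix f :: "'k gl_poly" assume f: "f \<in> PV (insert v W)"
    obtain N where N: "\<And>j. j \<ge> N \<Longrightarrow> vcoeff v j f = 0" using vcoeff_eventually_0 by blast
    define P where "P = (\<Sum>j<N. monom (vcoeff v j f) j)"
    have "P \<in> polys (PV W)" unfolding P_def
      by (intro subring_set_sum subring_polys subring_PV monom_polys vcoeff_PV f)
    moreover have "poly P (Var v) = f"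
      using vcoeff_expand[of N v f, OF N] by (simp add: P_def poly_sum poly_monom mult.commute)
    ultimately show "f \<in> (\<lambda>P. poly P (Var v)) ` polys (PV W)" by blast
  next
    fix f :: "'k gl_poly" assume "f \<in> (\<lambda>P. poly P (Var v)) ` polys (PV W)"
    then obtain P where P: "P \<in> polys (PV W)" "f = poly P (Var v)" by blast
    then have "coeff P i \<in> PV (insert v W)" for i using PV_mono[of W "insert v W"] by (auto simp: polys_def)
    then show "f \<in> PV (insert v W)" unfolding P(2) poly_altdef
      by (intro subring_set_sum subring_setD(4) subring_set_power subring_PV) (auto simp: Var_PV)
  qed
  ultimately show ?case
    by (intro sufd_transfer[where \<psi> = "\<lambda>P. poly P (Var v)", OF subring_polys[OF subring_PV] sufd_polys[OF subring_PV insert.IH]]) auto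
qed

text \<open>\<open>deg\<close> gives a representative of the degree of a monomial, and D passes from
  representatives to degrees.\<close>

definition homf :: "((gl_var \<Rightarrow>\<^sub>0 nat) \<Rightarrow> 'g) \<Rightarrow> ('g \<Rightarrow> 'c) \<Rightarrow> 'g \<Rightarrow> 'k::field gl_poly \<Rightarrow> bool" where
  "homf deg D e f \<longleftrightarrow> (\<forall>m\<in>Poly_Mapping.keys f. D (deg m) = D e)"

text \<open>\<open>D_cong\<close> says that equality under D is a congruence of the group; D itself
  need not be a homomorphism. Instances are the quotient map onto L and that map after some
  generators have been forgotten.\<close>

locale mon_deg =
  fixes deg :: "(gl_var \<Rightarrow>\<^sub>0 nat) \<Rightarrow> 'g::ab_group_add" and D :: "'g \<Rightarrow> 'c"
  assumes deg_add: "deg (m + m') = deg m + deg m'"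
    and D_cong: "D a = D b \<Longrightarrow> D (a + c) = D (b + c)"
begin

lemma deg_0: "deg 0 = 0" using deg_add[of 0 0] by simp

lemma D_cong2: "D a = D b \<Longrightarrow> D a' = D b' \<Longrightarrow> D (a + a') = D (b + b')"
  using D_cong[of a b a'] D_cong[of a' b' b] by (simp add: add.commute)

lemma hom_ring_homf: "hom_ring (homf deg D :: 'g \<Rightarrow> 'k::field gl_poly \<Rightarrow> bool)"
proof
  fix e :: 'g and f g :: "'k gl_poly" assume "homf deg D e f" "homf deg D e g"
  then show "homf deg D e (f + g)" using keys_add[of f g] by (auto simp: homf_def)
next
  fix e e' :: 'g and f g :: "'k gl_poly" assume fg: "homf deg D e f" "homf deg D e' g"
  show "homf deg D (e + e') (f * g)"
    unfolding homf_def
  proof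
    fix m assume "m \<in> Poly_Mapping.keys (f * g)"
    then obtain x y where "m = x + y" "x \<in> Poly_Mapping.keys f" "y \<in> Poly_Mapping.keys g" using keys_mult[of f g] by blast
    then show "D (deg m) = D (e + e')" using fg by (auto simp: homf_def deg_add intro: D_cong2)
  qed
next
  fix e e' c :: 'g and f :: "'k gl_poly" assume f: "homf deg D e f" "homf deg D e' f" "f \<noteq> 0"
  then obtain m where "m \<in> Poly_Mapping.keys f" by (metis ex_in_conv keys_eq_empty)
  then have "D e = D e'" using f by (auto simp: homf_def)
  then show "homf deg D (e + c) = (homf deg D (e' + c) :: 'k gl_poly \<Rightarrow> bool)"
    using D_cong[of e e' c] by (intro ext) (simp add: homf_def)
qed (auto simp: homf_def deg_0)

lemma poly_ext_PV:
  assumes "v \<notin> W"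
  shows "poly_ext (homf deg D) (PV W :: 'k::field gl_poly set) (PV (insert v W)) (Var v) (deg (Poly_Mapping.single v 1)) (vcoeff v)"
proof -
  interpret hom_ring "homf deg D :: 'g \<Rightarrow> 'k gl_poly \<Rightarrow> bool" by (rule hom_ring_homf)
  show ?thesis
  proof
    fix e j and f :: "'k gl_poly" assume f: "homf deg D e f"
    have d: "((+) (deg (Poly_Mapping.single v 1)) ^^ j) 0 = deg (Poly_Mapping.single v j)"
      by (induction j) (auto simp: deg_0 simp flip: deg_add single_add)
    have "D (deg m) = D (e - deg (Poly_Mapping.single v j))" if "m \<in> Poly_Mapping.keys (vcoeff v j f)" for m
    proof -
      have "m + Poly_Mapping.single v j \<in> Poly_Mapping.keys f"
        using that by (auto simp: in_keys_iff lookup_vcoeff split: if_splits)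
      then have "D (deg m + deg (Poly_Mapping.single v j)) = D e" using f by (auto simp: homf_def deg_add)
      from D_cong[OF this, of "- deg (Poly_Mapping.single v j)"] show ?thesis by simp
    qed
    then show "homf deg D (e - ((+) (deg (Poly_Mapping.single v 1)) ^^ j) 0) (vcoeff v j f)"
      unfolding d by (simp add: homf_def)
  next
    show "homf deg D (deg (Poly_Mapping.single v 1)) (Var v :: 'k gl_poly)" by (simp add: homf_def Var_def)
    show "PV W \<subseteq> (PV (insert v W) :: 'k gl_poly set)" by (rule PV_mono) blast
    show "f = (\<Sum>j<N. Var v ^ j * vcoeff v j f)" if "\<And>j. N \<le> j \<Longrightarrow> vcoeff v j f = 0" for N and f :: "'k gl_poly"
      by (rule vcoeff_expand[OF that])
  qed (use assms in \<open>simp_all add: subring_PV Var_PV vcoeff_PV vcoeff_add vcoeff_mult_PV vcoeff_Var_mult vcoeff_PV_notin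
      vcoeff_eventually_0\<close>)
qed

text \<open>Hilbert's syzygy theorem: constants have length 1, and each variable adds 2 by
  \<open>syz_step\<close>.\<close>

theorem syz_PV: "finite W \<Longrightarrow> \<exists>n. hom_ring.syz (homf deg D) (PV W :: 'k::field gl_poly set) n"
proof (induction W rule: finite_induct)
  case empty
  interpret hom_ring "homf deg D :: 'g \<Rightarrow> 'k gl_poly \<Rightarrow> bool" by (rule hom_ring_homf)
  have "syz (PV {}) 1"
  proof (rule syz_field[OF subring_PV])
    fix a :: "'k gl_poly" assume "a \<in> PV {}"
    then obtain c where c: "a = Const c" by (auto simp: PV_empty)
    show "homf deg D 0 a" unfolding c by (simp add: homf_def Const_def deg_0)
    assume "a \<noteq> 0"
    then show "\<exists>b\<in>PV {}. b * a = 1" using c Const_inverse[of c] Const_PV by (metis Const_eq_0_iff)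
  qed
  then show ?case by blast
next
  case (insert v W)
  then obtain n where n: "hom_ring.syz (homf deg D) (PV W :: 'k gl_poly set) n" by blast
  interpret poly_ext "homf deg D" "PV W :: 'k gl_poly set" "PV (insert v W)" "Var v" "deg (Poly_Mapping.single v 1)" "vcoeff v"
    by (rule poly_ext_PV[OF insert.hyps(2)])
  show ?case using syz_step[OF n] by blast
qed

end

text \<open>The parts of a and b of largest weight have a non-zero product, as
  \<open>gl_poly\<close> is a domain, and all other products of parts have smaller weight, so
  nothing cancels it. The weight is integer valued; the argument has no analogue for degrees in a
  group with torsion.\<close>

lemma mult_extreme_key:
  fixes a b :: "'k::field gl_poly" and w :: "(gl_var \<Rightarrow>\<^sub>0 nat) \<Rightarrow> int"
  assumes w: "\<And>m m'. w (m + m') = w m + w m'" and ab: "a \<noteq> 0" "b \<noteq> 0"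
  shows "\<exists>ma\<in>Poly_Mapping.keys a. \<exists>mb\<in>Poly_Mapping.keys b. \<exists>m\<in>Poly_Mapping.keys (a * b).
    w m = w ma + w mb \<and> (\<forall>m\<in>Poly_Mapping.keys a. w m \<le> w ma) \<and> (\<forall>m\<in>Poly_Mapping.keys b. w m \<le> w mb)"
proof -
  define part where "part = (\<lambda>(P :: int \<Rightarrow> bool) (f :: 'k gl_poly). \<Sum>m\<in>{m\<in>Poly_Mapping.keys f. P (w m)}. Poly_Mapping.single m (Poly_Mapping.lookup f m))"
  have part_split: "f = part P f + part (\<lambda>i. \<not> P i) f" for P f
  proof -
    have "f = (\<Sum>m\<in>Poly_Mapping.keys f. Poly_Mapping.single m (Poly_Mapping.lookup f m))" by (rule poly_mapping_sum_single)
    also have "\<dots> = part P f + part (\<lambda>i. \<not> P i) f" unfolding part_def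
      by (subst sum.union_disjoint[symmetric]) (auto intro!: sum.cong)
    finally show ?thesis .
  qed
  have lookup_part: "Poly_Mapping.lookup (part P f) k = (if P (w k) then Poly_Mapping.lookup f k else 0)" for P f k
  proof -
    have "Poly_Mapping.lookup (part P f) k = (\<Sum>m\<in>{m\<in>Poly_Mapping.keys f. P (w m)}. if m = k then Poly_Mapping.lookup f m else 0)"
      unfolding part_def lookup_sum by (intro sum.cong refl) (auto simp: lookup_single when_def)
    also have "\<dots> = (if P (w k) then Poly_Mapping.lookup f k else 0)" by (auto simp: in_keys_iff)
    finally show ?thesis .
  qed
  have mx: "\<exists>mf\<in>Poly_Mapping.keys f. \<forall>m\<in>Poly_Mapping.keys f. w m \<le> w mf" if "f \<noteq> 0" for f :: "'k gl_poly"
  proof -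
    have ne: "Poly_Mapping.keys f \<noteq> {}" using that by simp
    have "Max (w ` Poly_Mapping.keys f) \<in> w ` Poly_Mapping.keys f" using ne by (intro Max_in) auto
    then obtain mf where "mf \<in> Poly_Mapping.keys f" "w mf = Max (w ` Poly_Mapping.keys f)" by auto
    then show ?thesis by (intro bexI[of _ mf]) auto
  qed
  obtain ma where ma: "ma \<in> Poly_Mapping.keys a" "\<forall>m\<in>Poly_Mapping.keys a. w m \<le> w ma" using mx[OF ab(1)] by blast
  obtain mb where mb: "mb \<in> Poly_Mapping.keys b" "\<forall>m\<in>Poly_Mapping.keys b. w m \<le> w mb" using mx[OF ab(2)] by blast
  define a1 where "a1 = part (\<lambda>i. i = w ma) a"
  define a2 where "a2 = part (\<lambda>i. i \<noteq> w ma) a"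
  define b1 where "b1 = part (\<lambda>i. i = w mb) b"
  define b2 where "b2 = part (\<lambda>i. i \<noteq> w mb) b"
  have a: "a = a1 + a2" and b: "b = b1 + b2" unfolding a1_def a2_def b1_def b2_def by (rule part_split)+
  have k1: "w m = w ma" if "m \<in> Poly_Mapping.keys a1" for m using that by (auto simp: a1_def in_keys_iff lookup_part split: if_splits)
  have k2: "w m < w ma" if "m \<in> Poly_Mapping.keys a2" for m
  proof -
    have "w m \<noteq> w ma" "m \<in> Poly_Mapping.keys a" using that by (auto simp: a2_def in_keys_iff lookup_part split: if_splits)
    then show ?thesis using ma by fastforce
  qed
  have l1: "w m = w mb" if "m \<in> Poly_Mapping.keys b1" for m using that by (auto simp: b1_def in_keys_iff lookup_part split: if_splits)
  have l2: "w m < w mb" if "m \<in> Poly_Mapping.keys b2" for m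
  proof -
    have "w m \<noteq> w mb" "m \<in> Poly_Mapping.keys b" using that by (auto simp: b2_def in_keys_iff lookup_part split: if_splits)
    then show ?thesis using mb by fastforce
  qed
  have "a1 \<noteq> 0" using ma(1) by (auto simp: a1_def lookup_part in_keys_iff dest!: arg_cong[where f = "\<lambda>f. Poly_Mapping.lookup f ma"])
  moreover have "b1 \<noteq> 0" using mb(1) by (auto simp: b1_def lookup_part in_keys_iff dest!: arg_cong[where f = "\<lambda>f. Poly_Mapping.lookup f mb"])
  ultimately have "a1 * b1 \<noteq> 0" by simp
  then obtain m where m: "m \<in> Poly_Mapping.keys (a1 * b1)" by (metis ex_in_conv keys_eq_empty)
  have wm: "w m = w ma + w mb" using m keys_mult[of a1 b1] k1 l1 w by fastforce
  have z: "Poly_Mapping.lookup (f * g) m = 0" if "\<And>x y. x \<in> Poly_Mapping.keys f \<Longrightarrow> y \<in> Poly_Mapping.keys g \<Longrightarrow> w x + w y < w ma + w mb" for f g :: "'k gl_poly"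
  proof (rule ccontr)
    assume "Poly_Mapping.lookup (f * g) m \<noteq> 0"
    then have "m \<in> Poly_Mapping.keys (f * g)" by (simp add: in_keys_iff)
    then obtain x y where "m = x + y" "x \<in> Poly_Mapping.keys f" "y \<in> Poly_Mapping.keys g" using keys_mult[of f g] by blast
    then show False using that[of x y] wm w by simp
  qed
  have "a * b = a1 * b1 + a1 * b2 + a2 * b1 + a2 * b2" unfolding a b by (simp add: algebra_simps)
  then have "Poly_Mapping.lookup (a * b) m = Poly_Mapping.lookup (a1 * b1) m"
    using z[of a1 b2] z[of a2 b1] z[of a2 b2] k1 k2 l1 l2 by (auto simp: lookup_add) (smt (verit, best))+
  then have "m \<in> Poly_Mapping.keys (a * b)" using m by (simp add: in_keys_iff)
  then show ?thesis using ma mb wm by blast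
qed

text \<open>Applied to w and to - w, the preceding lemma shows that the lengths of the weight ranges
  of a and b add up to that of the product, which is 0.\<close>

lemma homogeneous_factor:
  fixes a b :: "'k::field gl_poly" and w :: "(gl_var \<Rightarrow>\<^sub>0 nat) \<Rightarrow> int"
  assumes w: "\<And>m m'. w (m + m') = w m + w m'" and ab: "a * b \<noteq> 0"
    and hom: "\<And>m m'. m \<in> Poly_Mapping.keys (a * b) \<Longrightarrow> m' \<in> Poly_Mapping.keys (a * b) \<Longrightarrow> w m = w m'"
    and m: "m \<in> Poly_Mapping.keys a" "m' \<in> Poly_Mapping.keys a"
  shows "w m = w m'"
proof -
  have ab0: "a \<noteq> 0" "b \<noteq> 0" using ab by auto
  obtain ma mb mm where 1: "ma \<in> Poly_Mapping.keys a" "mb \<in> Poly_Mapping.keys b" "mm \<in> Poly_Mapping.keys (a * b)" "w mm = w ma + w mb"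
     "\<forall>m\<in>Poly_Mapping.keys a. w m \<le> w ma" "\<forall>m\<in>Poly_Mapping.keys b. w m \<le> w mb"
    using mult_extreme_key[of w, OF w ab0] by blast
  obtain na nb nn where 2: "na \<in> Poly_Mapping.keys a" "nb \<in> Poly_Mapping.keys b" "nn \<in> Poly_Mapping.keys (a * b)" "- w nn = - w na - w nb"
     "\<forall>m\<in>Poly_Mapping.keys a. - w m \<le> - w na" "\<forall>m\<in>Poly_Mapping.keys b. - w m \<le> - w nb"
    using mult_extreme_key[of "\<lambda>m. - w m" a b, OF _ ab0] w by auto
  have "w ma + w mb = w na + w nb" using hom[OF 1(3) 2(3)] 1(4) 2(4) by simp
  moreover have "w na \<le> w ma" "w nb \<le> w mb" using 1(5,6) 2(1,2) by auto
  ultimately have "w na = w ma" by simp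
  then show ?thesis using 1(5) 2(5) m by (metis neg_le_iff_le order_antisym)
qed

section \<open>Graded modules\<close>

text \<open>\<open>is_grading\<close> with unique decomposition split into existence and
  independence. The index sets are arbitrary finite sets and may carry zero components, which makes
  sums easy to manipulate.\<close>

definition graded_sum ::
    "('g, 'u) monoid_scheme \<Rightarrow> ('m, 'w) ring_scheme \<Rightarrow> ('g \<Rightarrow> 'm set) \<Rightarrow> bool" where
  "graded_sum G M gr \<longleftrightarrow>
     (\<forall>g\<in>carrier G. additive_subgroup (gr g) M) \<and>
     (\<forall>x\<in>carrier M. \<exists>F f. finite F \<and> F \<subseteq> carrier G \<and> (\<forall>g\<in>F. f g \<in> gr g) \<and> x = finsum M f F) \<and>
     (\<forall>F f. finite F \<longrightarrow> F \<subseteq> carrier G \<longrightarrow> (\<forall>g\<in>F. f g \<in> gr g) \<longrightarrow> finsum M f F = \<zero>\<^bsub>M\<^esub> \<longrightarrow> (\<forall>g\<in>F. f g = \<zero>\<^bsub>M\<^esub>))"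

lemma graded_sumD:
  assumes "graded_sum G M gr"
  shows "g \<in> carrier G \<Longrightarrow> additive_subgroup (gr g) M"
    "x \<in> carrier M \<Longrightarrow> \<exists>F f. finite F \<and> F \<subseteq> carrier G \<and> (\<forall>g\<in>F. f g \<in> gr g) \<and> x = finsum M f F"
    "finite F \<Longrightarrow> F \<subseteq> carrier G \<Longrightarrow> \<forall>g\<in>F. f g \<in> gr g \<Longrightarrow> finsum M f F = \<zero>\<^bsub>M\<^esub> \<Longrightarrow> \<forall>g\<in>F. f g = \<zero>\<^bsub>M\<^esub>"
proof -
  note * = assms[unfolded graded_sum_def]
  show "g \<in> carrier G \<Longrightarrow> additive_subgroup (gr g) M" using * by simp
  show "x \<in> carrier M \<Longrightarrow> \<exists>F f. finite F \<and> F \<subseteq> carrier G \<and> (\<forall>g\<in>F. f g \<in> gr g) \<and> x = finsum M f F"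
    by (rule conjunct1[OF conjunct2[OF *], rule_format])
  show "finite F \<Longrightarrow> F \<subseteq> carrier G \<Longrightarrow> \<forall>g\<in>F. f g \<in> gr g \<Longrightarrow> finsum M f F = \<zero>\<^bsub>M\<^esub> \<Longrightarrow> \<forall>g\<in>F. f g = \<zero>\<^bsub>M\<^esub>"
    by (rule conjunct2[OF conjunct2[OF *], THEN spec, THEN spec, THEN mp, THEN mp, THEN mp, THEN mp])
qed

lemma a_minus_eq_zero_iff:
  assumes "abelian_group M" "x \<in> carrier M" "y \<in> carrier M"
  shows "x \<ominus>\<^bsub>M\<^esub> y = \<zero>\<^bsub>M\<^esub> \<longleftrightarrow> x = y"
proof -
  interpret abelian_group M by fact
  show ?thesis
  proof
    assume "x \<ominus>\<^bsub>M\<^esub> y = \<zero>\<^bsub>M\<^esub>"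
    then show "x = y" using minus_equality[of x "\<ominus>\<^bsub>M\<^esub> y"] assms by (simp add: minus_eq)
  qed (simp add: minus_eq r_neg assms)
qed

lemma a_right_cancel:
  assumes "abelian_group M" "x \<in> carrier M" "y \<in> carrier M" "z \<in> carrier M" "x \<oplus>\<^bsub>M\<^esub> z = y \<oplus>\<^bsub>M\<^esub> z"
  shows "x = y"
proof -
  interpret abelian_group M by fact
  have "(x \<oplus>\<^bsub>M\<^esub> z) \<oplus>\<^bsub>M\<^esub> (\<ominus>\<^bsub>M\<^esub> z) = (y \<oplus>\<^bsub>M\<^esub> z) \<oplus>\<^bsub>M\<^esub> (\<ominus>\<^bsub>M\<^esub> z)" using assms by simp
  then show ?thesis using assms by (simp add: a_assoc r_neg)
qed

lemma additive_subgroup_simps: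
  assumes "abelian_group M" "additive_subgroup H M"
  shows "H \<subseteq> carrier M" "\<zero>\<^bsub>M\<^esub> \<in> H" "x \<in> H \<Longrightarrow> y \<in> H \<Longrightarrow> x \<oplus>\<^bsub>M\<^esub> y \<in> H"
    "x \<in> H \<Longrightarrow> \<ominus>\<^bsub>M\<^esub> x \<in> H" "x \<in> H \<Longrightarrow> y \<in> H \<Longrightarrow> x \<ominus>\<^bsub>M\<^esub> y \<in> H"
proof -
  interpret abelian_group M by fact
  interpret additive_subgroup H M by fact
  show 1: "H \<subseteq> carrier M" "\<zero>\<^bsub>M\<^esub> \<in> H" "x \<in> H \<Longrightarrow> y \<in> H \<Longrightarrow> x \<oplus>\<^bsub>M\<^esub> y \<in> H" for x y
    using a_subset by auto
  show 2: "x \<in> H \<Longrightarrow> \<ominus>\<^bsub>M\<^esub> x \<in> H" for x by (rule a_inv_closed)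
  show "x \<in> H \<Longrightarrow> y \<in> H \<Longrightarrow> x \<ominus>\<^bsub>M\<^esub> y \<in> H" using 1 2 by (simp add: a_minus_def)
qed

lemma finsum_additive_map:
  assumes M: "abelian_group M" and N: "abelian_group N"
    and h: "h \<in> carrier M \<rightarrow> carrier N" "\<And>x y. x \<in> carrier M \<Longrightarrow> y \<in> carrier M \<Longrightarrow> h (x \<oplus>\<^bsub>M\<^esub> y) = h x \<oplus>\<^bsub>N\<^esub> h y"
    and f: "f \<in> F \<rightarrow> carrier M"
  shows "h (finsum M f F) = finsum N (\<lambda>x. h (f x)) F"
proof -
  interpret M: abelian_group M by fact
  interpret N: abelian_group N by fact
  have hc: "h \<zero>\<^bsub>M\<^esub> \<in> carrier N" using h(1) by auto
  moreover have "h \<zero>\<^bsub>M\<^esub> \<oplus>\<^bsub>N\<^esub> h \<zero>\<^bsub>M\<^esub> = h \<zero>\<^bsub>M\<^esub>" using h(2)[of "\<zero>\<^bsub>M\<^esub>" "\<zero>\<^bsub>M\<^esub>"] by simp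
  then have "h \<zero>\<^bsub>M\<^esub> \<oplus>\<^bsub>N\<^esub> h \<zero>\<^bsub>M\<^esub> = \<zero>\<^bsub>N\<^esub> \<oplus>\<^bsub>N\<^esub> h \<zero>\<^bsub>M\<^esub>" using hc by simp
  ultimately have h0: "h \<zero>\<^bsub>M\<^esub> = \<zero>\<^bsub>N\<^esub>" using a_right_cancel[OF N] by blast
  show ?thesis using f
  proof (induction F rule: infinite_finite_induct)
    case (insert a F)
    then have "finsum M f F \<in> carrier M" by (intro M.finsum_closed) auto
    moreover have "(\<lambda>x. h (f x)) \<in> F \<rightarrow> carrier N" "h (f a) \<in> carrier N" using insert.prems h(1) by auto
    ultimately show ?case using insert h by simp
  qed (simp_all add: h0)
qed

lemma finsum_lessThan_Suc:
  assumes "abelian_group M" "f \<in> {..<Suc n} \<rightarrow> carrier M"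
  shows "finsum M f {..<Suc n} = f n \<oplus>\<^bsub>M\<^esub> finsum M f {..<n}"
proof -
  interpret abelian_group M by fact
  show ?thesis unfolding lessThan_Suc using assms(2) by (subst finsum_insert) auto
qed

lemma finsum_in_subgroup:
  assumes M: "abelian_group M" and H: "additive_subgroup H M" and f: "\<And>x. x \<in> F \<Longrightarrow> f x \<in> H"
  shows "finsum M f F \<in> H"
proof -
  interpret abelian_group M by fact
  note S = additive_subgroup_simps[OF M H]
  show ?thesis using f
  proof (induction F rule: infinite_finite_induct)
    case (insert a F)
    then have "f \<in> F \<rightarrow> carrier M" "f a \<in> carrier M" using S(1) by auto
    then show ?case using insert S by simp
  qed (simp_all add: S)
qed

lemma finsum_zero_extend:
  assumes M: "abelian_group M" and "finite F" "F' \<subseteq> F" "\<And>g. g \<in> F' \<Longrightarrow> f g \<in> carrier M"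
  shows "finsum M (\<lambda>g. if g \<in> F' then f g else \<zero>\<^bsub>M\<^esub>) F = finsum M f F'"
proof -
  interpret abelian_group M by fact
  have "finsum M f F' = finsum M (\<lambda>g. if g \<in> F' then f g else \<zero>\<^bsub>M\<^esub>) F"
    using assms by (intro add.finprod_mono_neutral_cong_left) auto
  then show ?thesis by simp
qed

context
  fixes G :: "('g, 'u) monoid_scheme" and M :: "('m, 'w) ring_scheme" and gr :: "'g \<Rightarrow> 'm set"
  assumes M: "abelian_group M"
begin

interpretation abelian_group M by (rule M)

lemma is_grading_iff: "is_grading G M gr \<longleftrightarrow> graded_sum G M gr"
proof
  assume gr: "is_grading G M gr"
  then have sub: "\<And>g. g \<in> carrier G \<Longrightarrow> additive_subgroup (gr g) M" by (simp add: is_grading_def)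
  have ex1: "\<exists>!f. f \<in> (\<Pi>\<^sub>E g\<in>carrier G. gr g) \<and> finite {g \<in> carrier G. f g \<noteq> \<zero>\<^bsub>M\<^esub>} \<and>
      x = finsum M f {g \<in> carrier G. f g \<noteq> \<zero>\<^bsub>M\<^esub>}" if "x \<in> carrier M" for x
    using gr that unfolding is_grading_def by blast
  show "graded_sum G M gr"
    unfolding graded_sum_def
  proof (intro conjI ballI allI impI)
    fix x assume "x \<in> carrier M"
    then obtain f where f: "f \<in> (\<Pi>\<^sub>E g\<in>carrier G. gr g)" "finite {g \<in> carrier G. f g \<noteq> \<zero>\<^bsub>M\<^esub>}"
      "x = finsum M f {g \<in> carrier G. f g \<noteq> \<zero>\<^bsub>M\<^esub>}" using ex1 by blast
    show "\<exists>F f. finite F \<and> F \<subseteq> carrier G \<and> (\<forall>g\<in>F. f g \<in> gr g) \<and> x = finsum M f F"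
      by (rule exI[of _ "{g \<in> carrier G. f g \<noteq> \<zero>\<^bsub>M\<^esub>}"], rule exI[of _ f]) (use f in auto)
  next
    fix F f g assume F: "finite F" "F \<subseteq> carrier G" "\<forall>g\<in>F. f g \<in> gr g" "finsum M f F = \<zero>\<^bsub>M\<^esub>" and g: "g \<in> F"
    have fc: "f g \<in> carrier M" if "g \<in> F" for g using F that additive_subgroup_simps(1)[OF M sub] by blast
    \<comment> \<open>The family f, extended by zero, and the zero family both decompose 0;
      \<open>restrict\<close> puts them into the product over \<open>carrier G\<close>, where
      uniqueness applies.\<close>
    define f1 where "f1 = restrict (\<lambda>g. if g \<in> F then f g else \<zero>\<^bsub>M\<^esub>) (carrier G)"
    define f2 where "f2 = restrict (\<lambda>g. \<zero>\<^bsub>M\<^esub>) (carrier G)"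
    let ?S = "\<lambda>f. {g \<in> carrier G. f g \<noteq> \<zero>\<^bsub>M\<^esub>}"
    have z: "\<zero>\<^bsub>M\<^esub> \<in> gr g" if "g \<in> carrier G" for g using additive_subgroup_simps(2)[OF M sub[OF that]] .
    have S1: "?S f1 \<subseteq> F" by (auto simp: f1_def)
    have S2: "?S f2 = {}" by (auto simp: f2_def)
    have "finsum M f1 (?S f1) = finsum M f F"
      using F S1 fc by (intro add.finprod_mono_neutral_cong_left) (auto simp: f1_def)
    then have "f1 \<in> (\<Pi>\<^sub>E g\<in>carrier G. gr g) \<and> finite (?S f1) \<and> \<zero>\<^bsub>M\<^esub> = finsum M f1 (?S f1)"
      using F S1 z by (auto simp: f1_def intro: finite_subset)
    moreover have "f2 \<in> (\<Pi>\<^sub>E g\<in>carrier G. gr g) \<and> finite (?S f2) \<and> \<zero>\<^bsub>M\<^esub> = finsum M f2 (?S f2)"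
      unfolding S2 using z by (auto simp: f2_def)
    ultimately have "f1 = f2" using ex1[OF zero_closed] by blast
    then have "f1 g = f2 g" by simp
    then show "f g = \<zero>\<^bsub>M\<^esub>" using g F by (auto simp: f1_def f2_def)
  qed (use sub in auto)
next
  assume gs: "graded_sum G M gr"
  then have sub: "\<And>g. g \<in> carrier G \<Longrightarrow> additive_subgroup (gr g) M" by (simp add: graded_sum_def)
  let ?S = "\<lambda>f. {g \<in> carrier G. f g \<noteq> \<zero>\<^bsub>M\<^esub>}"
  have z: "\<zero>\<^bsub>M\<^esub> \<in> gr g" if "g \<in> carrier G" for g using additive_subgroup_simps(2)[OF M sub[OF that]] .
  show "is_grading G M gr"
    unfolding is_grading_def
  proof (intro conjI ballI ex_ex1I)
    fix x assume "x \<in> carrier M"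
    then obtain F f where F: "finite F" "F \<subseteq> carrier G" "\<forall>g\<in>F. f g \<in> gr g" "x = finsum M f F"
      using graded_sumD(2)[OF gs] by metis
    have fc: "f g \<in> carrier M" if "g \<in> F" for g using F that additive_subgroup_simps(1)[OF M sub] by blast
    define f1 where "f1 = restrict (\<lambda>g. if g \<in> F then f g else \<zero>\<^bsub>M\<^esub>) (carrier G)"
    have S1: "?S f1 \<subseteq> F" by (auto simp: f1_def)
    have "finsum M f1 (?S f1) = finsum M f F"
      using F S1 fc by (intro add.finprod_mono_neutral_cong_left) (auto simp: f1_def)
    then show "\<exists>f. f \<in> (\<Pi>\<^sub>E g\<in>carrier G. gr g) \<and> finite (?S f) \<and> x = finsum M f (?S f)"
      using F S1 z by (intro exI[of _ f1]) (auto simp: f1_def intro: finite_subset)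
  next
    fix x f f' assume x: "x \<in> carrier M" and f: "f \<in> (\<Pi>\<^sub>E g\<in>carrier G. gr g) \<and> finite (?S f) \<and> x = finsum M f (?S f)"
      and f': "f' \<in> (\<Pi>\<^sub>E g\<in>carrier G. gr g) \<and> finite (?S f') \<and> x = finsum M f' (?S f')"
    have fc: "f g \<in> carrier M" "f' g \<in> carrier M" "f g \<in> gr g" "f' g \<in> gr g" if "g \<in> carrier G" for g
      using f f' that additive_subgroup_simps(1)[OF M sub[OF that]] by auto
    let ?F = "?S f \<union> ?S f'"
    have "finsum M f (?S f) = finsum M f ?F"
      using f f' fc by (intro add.finprod_mono_neutral_cong_left) auto
    then have "x = finsum M f ?F" using f by simp
    have "finsum M f' (?S f') = finsum M f' ?F"
      using f f' fc by (intro add.finprod_mono_neutral_cong_left) auto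
    then have "x = finsum M f' ?F" using f' by simp
    have "finsum M (\<lambda>g. f g \<ominus>\<^bsub>M\<^esub> f' g) ?F \<oplus>\<^bsub>M\<^esub> finsum M f' ?F = finsum M (\<lambda>g. (f g \<ominus>\<^bsub>M\<^esub> f' g) \<oplus>\<^bsub>M\<^esub> f' g) ?F"
      using fc by (intro finsum_addf[symmetric]) auto
    also have "\<dots> = finsum M f ?F"
      using fc by (intro finsum_cong') (auto simp: minus_eq a_assoc l_neg)
    finally have "finsum M (\<lambda>g. f g \<ominus>\<^bsub>M\<^esub> f' g) ?F \<oplus>\<^bsub>M\<^esub> x = \<zero>\<^bsub>M\<^esub> \<oplus>\<^bsub>M\<^esub> x"
      using \<open>x = finsum M f ?F\<close> \<open>x = finsum M f' ?F\<close> x by simp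
    moreover have "finsum M (\<lambda>g. f g \<ominus>\<^bsub>M\<^esub> f' g) ?F \<in> carrier M" using fc by (intro finsum_closed) auto
    ultimately have "finsum M (\<lambda>g. f g \<ominus>\<^bsub>M\<^esub> f' g) ?F = \<zero>\<^bsub>M\<^esub>" using x a_right_cancel[OF M _ _ x] by blast
    moreover have "\<forall>g\<in>?F. f g \<ominus>\<^bsub>M\<^esub> f' g \<in> gr g"
      using fc additive_subgroup_simps(5)[OF M sub] by auto
    moreover have "finite ?F" "?F \<subseteq> carrier G" using f f' by auto
    ultimately have d: "\<forall>g\<in>?F. f g \<ominus>\<^bsub>M\<^esub> f' g = \<zero>\<^bsub>M\<^esub>"
      by (intro graded_sumD(3)[OF gs])
    have "f g = f' g" if "g \<in> carrier G" for g
    proof (cases "g \<in> ?F")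
      case True
      then have "f g \<ominus>\<^bsub>M\<^esub> f' g = \<zero>\<^bsub>M\<^esub>" using d by blast
      then show ?thesis using fc[OF that] a_minus_eq_zero_iff[OF M] by simp
    next
      case False then show ?thesis using that by auto
    qed
    then show "f = f'" using f f' by (intro PiE_ext[of f "carrier G" gr f']) auto
  qed (use sub in auto)
qed

lemma graded_component_eq:
  assumes gs: "graded_sum G M gr" and F: "finite F" "F \<subseteq> carrier G" "\<And>g. g \<in> F \<Longrightarrow> f g \<in> gr g"
    and g: "g \<in> carrier G" "y \<in> gr g" and y: "y = finsum M f F"
  shows "y = (if g \<in> F then f g else \<zero>\<^bsub>M\<^esub>)" "g' \<in> F \<Longrightarrow> g' \<noteq> g \<Longrightarrow> f g' = \<zero>\<^bsub>M\<^esub>"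
proof -
  have sub: "\<And>g. g \<in> carrier G \<Longrightarrow> additive_subgroup (gr g) M" using gs by (simp add: graded_sum_def)
  note S = additive_subgroup_simps[OF M sub]
  have fc: "f g \<in> carrier M" if "g \<in> F" for g using F(2,3) that S(1) by blast
  have yc: "y \<in> carrier M" using g S(1) by blast
  define f1 where "f1 = (\<lambda>h. if h \<in> F then f h else \<zero>\<^bsub>M\<^esub>)"
  \<comment> \<open>With y subtracted from its component of degree g, the family sums to 0 and
    independence applies.\<close>
  define f2 where "f2 = (\<lambda>h. if h = g then f1 g \<ominus>\<^bsub>M\<^esub> y else f1 h)"
  have f1c: "f1 h \<in> carrier M" for h using fc by (simp add: f1_def)
  have f1g: "f1 h \<in> gr h" if "h \<in> carrier G" for h using F(3) S(2)[OF that] by (simp add: f1_def)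
  have "finsum M f1 (insert g F) = y"
    unfolding y f1_def using F fc by (intro finsum_zero_extend[OF M]) auto
  moreover have "finsum M f1 (insert g F) = f1 g \<oplus>\<^bsub>M\<^esub> finsum M f1 (F - {g})"
    using F f1c by (subst insert_Diff_single[symmetric], subst finsum_insert) auto
  ultimately have e: "f1 g \<oplus>\<^bsub>M\<^esub> finsum M f1 (F - {g}) = y" by simp
  have c: "finsum M f1 (F - {g}) \<in> carrier M" using f1c by (intro finsum_closed) auto
  have "finsum M f2 (insert g F) = f2 g \<oplus>\<^bsub>M\<^esub> finsum M f2 (F - {g})"
    using F f1c yc by (subst insert_Diff_single[symmetric], subst finsum_insert) (auto simp: f2_def)
  also have "finsum M f2 (F - {g}) = finsum M f1 (F - {g})"
    using f1c by (intro finsum_cong') (auto simp: f2_def)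
  also have "f2 g \<oplus>\<^bsub>M\<^esub> finsum M f1 (F - {g}) = (f1 g \<oplus>\<^bsub>M\<^esub> finsum M f1 (F - {g})) \<ominus>\<^bsub>M\<^esub> y"
    using f1c c yc by (simp add: f2_def minus_eq a_ac)
  also have "\<dots> = \<zero>\<^bsub>M\<^esub>" unfolding e using yc a_minus_eq_zero_iff[OF M] by simp
  finally have "finsum M f2 (insert g F) = \<zero>\<^bsub>M\<^esub>" .
  moreover have "\<forall>h\<in>insert g F. f2 h \<in> gr h"
    using f1g F(2) g S(5) by (auto simp: f2_def)
  ultimately have d: "\<forall>h\<in>insert g F. f2 h = \<zero>\<^bsub>M\<^esub>"
    using F(1,2) g(1) by (intro graded_sumD(3)[OF gs]) auto
  then have "f1 g \<ominus>\<^bsub>M\<^esub> y = \<zero>\<^bsub>M\<^esub>" by (simp add: f2_def)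
  then show "y = (if g \<in> F then f g else \<zero>\<^bsub>M\<^esub>)" using f1c[of g] yc a_minus_eq_zero_iff[OF M] by (simp add: f1_def)
  show "f g' = \<zero>\<^bsub>M\<^esub>" if "g' \<in> F" "g' \<noteq> g" using d that by (auto simp: f2_def f1_def)
qed

lemma graded_sum_induct:
  assumes gs: "graded_sum G M gr" and x: "x \<in> carrier M"
    and hom: "\<And>g y. g \<in> carrier G \<Longrightarrow> y \<in> gr g \<Longrightarrow> P y" and "P \<zero>\<^bsub>M\<^esub>"
    and add: "\<And>y z. y \<in> carrier M \<Longrightarrow> z \<in> carrier M \<Longrightarrow> P y \<Longrightarrow> P z \<Longrightarrow> P (y \<oplus>\<^bsub>M\<^esub> z)"
  shows "P x"
proof -
  have sub: "\<And>g. g \<in> carrier G \<Longrightarrow> additive_subgroup (gr g) M" using gs by (simp add: graded_sum_def)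
  obtain F f where F: "finite F" "F \<subseteq> carrier G" "\<forall>g\<in>F. f g \<in> gr g" "x = finsum M f F"
    using graded_sumD(2)[OF gs x] by blast
  have "F \<subseteq> carrier G \<Longrightarrow> \<forall>g\<in>F. f g \<in> gr g \<Longrightarrow> P (finsum M f F)"
    using F(1)
  proof (induction F rule: finite_induct)
    case (insert a F)
    have fc: "f g \<in> carrier M" if "g \<in> insert a F" for g
      using insert.prems that additive_subgroup_simps(1)[OF M sub] by blast
    then have "finsum M f (insert a F) = f a \<oplus>\<^bsub>M\<^esub> finsum M f F" using insert.hyps by (intro finsum_insert) auto
    moreover have "P (f a)" using insert.prems hom by auto
    moreover have "P (finsum M f F)" using insert by auto
    ultimately show ?case using add fc finsum_closed[of f F] by auto
  qed (simp add: assms)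
  then show ?thesis using F by simp
qed

end

text \<open>If x maps to an element of degree g, then so does its component of degree g, because all
  other components map to 0.\<close>

lemma homogeneous_preimage:
  assumes M: "abelian_group M" and N: "abelian_group N" and gM: "graded_sum G M grM" and gN: "graded_sum G N grN"
    and h: "h \<in> carrier M \<rightarrow> carrier N" "\<And>x y. x \<in> carrier M \<Longrightarrow> y \<in> carrier M \<Longrightarrow> h (x \<oplus>\<^bsub>M\<^esub> y) = h x \<oplus>\<^bsub>N\<^esub> h y"
    and hg: "\<And>g x. g \<in> carrier G \<Longrightarrow> x \<in> grM g \<Longrightarrow> h x \<in> grN g"
    and y: "g \<in> carrier G" "y \<in> grN g" and x: "x \<in> carrier M" "h x = y"
  shows "\<exists>x'\<in>grM g. h x' = y"
proof -
  interpret M: abelian_group M by fact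
  interpret N: abelian_group N by fact
  have sub: "\<And>g. g \<in> carrier G \<Longrightarrow> additive_subgroup (grM g) M" using gM by (simp add: graded_sum_def)
  obtain F f where F: "finite F" "F \<subseteq> carrier G" "\<forall>g\<in>F. f g \<in> grM g" "x = finsum M f F"
    using graded_sumD(2)[OF gM x(1)] by blast
  have fc: "f \<in> F \<rightarrow> carrier M" using F(2,3) additive_subgroup_simps(1)[OF M sub] by blast
  have e: "y = finsum N (\<lambda>g. h (f g)) F" using finsum_additive_map[OF M N h fc] F(4) x(2) by simp
  have k: "\<And>g. g \<in> F \<Longrightarrow> h (f g) \<in> grN g" using F(2,3) hg by auto
  from graded_component_eq(1)[OF N gN F(1,2) k y e] have e1: "y = (if g \<in> F then h (f g) else \<zero>\<^bsub>N\<^esub>)" .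
  show ?thesis
  proof (cases "g \<in> F")
    case True then show ?thesis using e1 F(3) by auto
  next
    case False
    have "h \<zero>\<^bsub>M\<^esub> = \<zero>\<^bsub>N\<^esub>" using finsum_additive_map[OF M N h, of "\<lambda>x. x" "{}"] by simp
    then show ?thesis using False e1 additive_subgroup_simps(2)[OF M sub[OF y(1)]] by auto
  qed
qed

text \<open>A map that preserves degrees kills an element only if it kills every component, so
  exactness has to be tested on homogeneous elements only.\<close>

lemma graded_exact:
  assumes M: "abelian_group M" and N: "abelian_group N" and Q: "abelian_group Q" and gM: "graded_sum G M grM" and gN: "graded_sum G N grN"
    and h: "h \<in> carrier M \<rightarrow> carrier N" "\<And>x y. x \<in> carrier M \<Longrightarrow> y \<in> carrier M \<Longrightarrow> h (x \<oplus>\<^bsub>M\<^esub> y) = h x \<oplus>\<^bsub>N\<^esub> h y"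
    and hg: "\<And>g x. g \<in> carrier G \<Longrightarrow> x \<in> grM g \<Longrightarrow> h x \<in> grN g"
    and d: "d \<in> carrier Q \<rightarrow> carrier M" "\<And>x y. x \<in> carrier Q \<Longrightarrow> y \<in> carrier Q \<Longrightarrow> d (x \<oplus>\<^bsub>Q\<^esub> y) = d x \<oplus>\<^bsub>M\<^esub> d y"
    and ex: "\<And>g x. g \<in> carrier G \<Longrightarrow> x \<in> grM g \<Longrightarrow> h x = \<zero>\<^bsub>N\<^esub> \<Longrightarrow> x \<in> d ` carrier Q"
    and x: "x \<in> carrier M" "h x = \<zero>\<^bsub>N\<^esub>"
  shows "x \<in> d ` carrier Q"
proof -
  interpret M: abelian_group M by fact
  interpret N: abelian_group N by fact
  interpret Q: abelian_group Q by fact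
  have sub: "\<And>g. g \<in> carrier G \<Longrightarrow> additive_subgroup (grM g) M" using gM by (simp add: graded_sum_def)
  obtain F f where F: "finite F" "F \<subseteq> carrier G" "\<forall>g\<in>F. f g \<in> grM g" "x = finsum M f F"
    using graded_sumD(2)[OF gM x(1)] by blast
  have fc: "f \<in> F \<rightarrow> carrier M" using F(2,3) additive_subgroup_simps(1)[OF M sub] by blast
  have e: "finsum N (\<lambda>g. h (f g)) F = \<zero>\<^bsub>N\<^esub>" using finsum_additive_map[OF M N h fc] F(4) x(2) by simp
  have "\<forall>g\<in>F. h (f g) \<in> grN g" using F(2,3) hg by auto
  then have "\<forall>g\<in>F. h (f g) = \<zero>\<^bsub>N\<^esub>" using e F(1,2) by (intro graded_sumD(3)[OF gN])
  then have "\<forall>g\<in>F. \<exists>q. q \<in> carrier Q \<and> f g = d q" using ex F(2,3) by blast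
  then obtain q where q: "\<And>g. g \<in> F \<Longrightarrow> q g \<in> carrier Q \<and> f g = d (q g)" by metis
  have "d (finsum Q q F) = finsum M (\<lambda>g. d (q g)) F" by (rule finsum_additive_map[OF Q M d]) (use q in auto)
  also have "\<dots> = x" unfolding F(4) using q fc by (intro M.finsum_cong') auto
  finally show ?thesis using q Q.finsum_closed[of q F] by (metis Pi_I imageI)
qed

lemma decomposition_add:
  assumes M: "abelian_group M" and sub: "\<And>g. g \<in> carrier G \<Longrightarrow> additive_subgroup (gr g) M"
    and x: "finite F" "F \<subseteq> carrier G" "\<forall>g\<in>F. f g \<in> gr g" "x = finsum M f F"
    and y: "finite F'" "F' \<subseteq> carrier G" "\<forall>g\<in>F'. f' g \<in> gr g" "y = finsum M f' F'"
  shows "\<exists>F f. finite F \<and> F \<subseteq> carrier G \<and> (\<forall>g\<in>F. f g \<in> gr g) \<and> x \<oplus>\<^bsub>M\<^esub> y = finsum M f F"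
proof -
  interpret abelian_group M by fact
  note S = additive_subgroup_simps[OF M sub]
  have fc: "f g \<in> carrier M" if "g \<in> F" for g using x(2,3) that S(1) by blast
  have fc': "f' g \<in> carrier M" if "g \<in> F'" for g using y(2,3) that S(1) by blast
  let ?f = "\<lambda>g. if g \<in> F then f g else \<zero>\<^bsub>M\<^esub>" and ?f' = "\<lambda>g. if g \<in> F' then f' g else \<zero>\<^bsub>M\<^esub>"
  have "finsum M (\<lambda>g. ?f g \<oplus>\<^bsub>M\<^esub> ?f' g) (F \<union> F') = finsum M ?f (F \<union> F') \<oplus>\<^bsub>M\<^esub> finsum M ?f' (F \<union> F')"
    using fc fc' by (intro finsum_addf) auto
  also have "finsum M ?f (F \<union> F') = x" unfolding x(4) using x y fc by (intro finsum_zero_extend[OF M]) auto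
  also have "finsum M ?f' (F \<union> F') = y" unfolding y(4) using x y fc' by (intro finsum_zero_extend[OF M]) auto
  finally have e: "x \<oplus>\<^bsub>M\<^esub> y = finsum M (\<lambda>g. ?f g \<oplus>\<^bsub>M\<^esub> ?f' g) (F \<union> F')" by simp
  have "\<forall>g\<in>F \<union> F'. ?f g \<oplus>\<^bsub>M\<^esub> ?f' g \<in> gr g"
  proof
    fix g assume g: "g \<in> F \<union> F'"
    then have gG: "g \<in> carrier G" using x(2) y(2) by blast
    have "?f g \<in> gr g" "?f' g \<in> gr g" using x(3) y(3) S(2)[OF gG] by auto
    then show "?f g \<oplus>\<^bsub>M\<^esub> ?f' g \<in> gr g" by (rule S(3)[OF gG])
  qed
  then show ?thesis using e x(1,2) y(1,2) by (intro exI[of _ "F \<union> F'"] exI[of _ "\<lambda>g. ?f g \<oplus>\<^bsub>M\<^esub> ?f' g"]) auto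
qed

section \<open>Finitely generated graded modules and graded free modules\<close>

lemma gmod_homD:
  assumes "f \<in> gmod_hom G A M N"
  shows "f \<in> gcarrier M \<rightarrow> gcarrier N"
    "x \<in> gcarrier M \<Longrightarrow> y \<in> gcarrier M \<Longrightarrow> f (x \<oplus>\<^bsub>fst M\<^esub> y) = f x \<oplus>\<^bsub>fst N\<^esub> f y"
    "a \<in> carrier A \<Longrightarrow> x \<in> gcarrier M \<Longrightarrow> f (a \<odot>\<^bsub>fst M\<^esub> x) = a \<odot>\<^bsub>fst N\<^esub> f x"
    "g \<in> carrier G \<Longrightarrow> x \<in> snd M g \<Longrightarrow> f x \<in> snd N g"
  using assms by (auto simp: gmod_hom_def split: prod.splits)

lemma fg_gmodD:
  assumes "fg_gmod G A gr M"
  shows "module A (fst M)" "graded_sum G (fst M) (snd M)" "fin_gen_module A (fst M)"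
    "g \<in> carrier G \<Longrightarrow> h \<in> carrier G \<Longrightarrow> a \<in> gr g \<Longrightarrow> x \<in> snd M h \<Longrightarrow> a \<odot>\<^bsub>fst M\<^esub> x \<in> snd M (g \<otimes>\<^bsub>G\<^esub> h)"
proof -
  have *: "module A (fst M)" "is_grading G (fst M) (snd M)" 
    "\<forall>g\<in>carrier G. \<forall>h\<in>carrier G. \<forall>a\<in>gr g. \<forall>x\<in>snd M h. a \<odot>\<^bsub>fst M\<^esub> x \<in> snd M (g \<otimes>\<^bsub>G\<^esub> h)" "fin_gen_module A (fst M)"
    using assms by (auto simp: fg_gmod_def graded_module_def split: prod.splits)
  show "module A (fst M)" "fin_gen_module A (fst M)" by fact+
  have "abelian_group (fst M)" using *(1) by (simp add: module_def)
  then show "graded_sum G (fst M) (snd M)" using *(2) is_grading_iff by blast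
  show "g \<in> carrier G \<Longrightarrow> h \<in> carrier G \<Longrightarrow> a \<in> gr g \<Longrightarrow> x \<in> snd M h \<Longrightarrow> a \<odot>\<^bsub>fst M\<^esub> x \<in> snd M (g \<otimes>\<^bsub>G\<^esub> h)" using *(3) by blast
qed

locale graded_cring =
  fixes G :: "('c, 'u) monoid_scheme" and B :: "('b, 'w) ring_scheme" and gr :: "'c \<Rightarrow> 'b set"
  assumes G: "comm_group G" and B: "cring B" and gsB: "graded_sum G B gr"
    and gr_mult: "g \<in> carrier G \<Longrightarrow> h \<in> carrier G \<Longrightarrow> a \<in> gr g \<Longrightarrow> b \<in> gr h \<Longrightarrow> a \<otimes>\<^bsub>B\<^esub> b \<in> gr (g \<otimes>\<^bsub>G\<^esub> h)"
    and gr_one: "\<one>\<^bsub>B\<^esub> \<in> gr \<one>\<^bsub>G\<^esub>" and one_not_zero': "\<one>\<^bsub>B\<^esub> \<noteq> \<zero>\<^bsub>B\<^esub>"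
begin

sublocale B: cring B by (rule B)
sublocale G: comm_group G by (rule G)

lemma B_ag: "abelian_group B" by (rule B.is_abelian_group)

lemma gr_sub: "g \<in> carrier G \<Longrightarrow> additive_subgroup (gr g) B" by (rule graded_sumD(1)[OF gsB])

lemmas gr_simps = additive_subgroup_simps[OF B_ag gr_sub]

lemma gr_carrier: "g \<in> carrier G \<Longrightarrow> b \<in> gr g \<Longrightarrow> b \<in> carrier B" using gr_simps(1) by blast

definition V :: "nat \<Rightarrow> (nat \<Rightarrow> 'b) set" where
  "V r = {v. (\<forall>i<r. v i \<in> carrier B) \<and> (\<forall>i\<ge>r. v i = \<zero>\<^bsub>B\<^esub>)}"

text \<open>The free module of rank r is realised on singletons \<open>{v}\<close> because the
  objects of \<open>fg_gmod\<close> have elements of type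
  \<open>(nat \<Rightarrow> 'b) set\<close>.\<close>

definition fm :: "nat \<Rightarrow> ('b, (nat \<Rightarrow> 'b) set) module" where
  "fm r = \<lparr>carrier = (\<lambda>v. {v}) ` V r, mult = (\<lambda>x y. x), one = {\<lambda>i. \<zero>\<^bsub>B\<^esub>}, zero = {\<lambda>i. \<zero>\<^bsub>B\<^esub>},
     add = (\<lambda>x y. {\<lambda>i. the_elem x i \<oplus>\<^bsub>B\<^esub> the_elem y i}), smult = (\<lambda>a x. {\<lambda>i. a \<otimes>\<^bsub>B\<^esub> the_elem x i})\<rparr>"

text \<open>The twisted grading in which the i-th basis vector has degree
  \<open>\<gamma> i\<close>.\<close>

definition fm_gr :: "nat \<Rightarrow> (nat \<Rightarrow> 'c) \<Rightarrow> 'c \<Rightarrow> (nat \<Rightarrow> 'b) set set" where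
  "fm_gr r \<gamma> g = {{v} |v. v \<in> V r \<and> (\<forall>i<r. v i \<in> gr (g \<otimes>\<^bsub>G\<^esub> inv\<^bsub>G\<^esub> \<gamma> i))}"

lemma V_carrier: "v \<in> V r \<Longrightarrow> v i \<in> carrier B"
  unfolding V_def by (cases "i < r") auto

lemma V_closed: "v \<in> V r \<Longrightarrow> w \<in> V r \<Longrightarrow> (\<lambda>i. v i \<oplus>\<^bsub>B\<^esub> w i) \<in> V r"
    "a \<in> carrier B \<Longrightarrow> v \<in> V r \<Longrightarrow> (\<lambda>i. a \<otimes>\<^bsub>B\<^esub> v i) \<in> V r" "(\<lambda>i. \<zero>\<^bsub>B\<^esub>) \<in> V r"
    "v \<in> V r \<Longrightarrow> (\<lambda>i. \<ominus>\<^bsub>B\<^esub> v i) \<in> V r"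
  by (auto simp: V_def)

lemma fm_simps [simp]: "zero (fm r) = {\<lambda>i. \<zero>\<^bsub>B\<^esub>}" "add (fm r) x y = {\<lambda>i. the_elem x i \<oplus>\<^bsub>B\<^esub> the_elem y i}"
   "a \<odot>\<^bsub>fm r\<^esub> x = {\<lambda>i. a \<otimes>\<^bsub>B\<^esub> the_elem x i}" "{v} \<in> carrier (fm r) \<longleftrightarrow> v \<in> V r"
  by (auto simp: fm_def)

lemma fm_cases: "x \<in> carrier (fm r) \<Longrightarrow> (\<And>v. v \<in> V r \<Longrightarrow> x = {v} \<Longrightarrow> P) \<Longrightarrow> P"
  by (auto simp: fm_def)

lemma the_elem_carrier: "x \<in> carrier (fm r) \<Longrightarrow> the_elem x i \<in> carrier B"
  by (erule fm_cases) (simp add: V_carrier)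

lemma module_fm: "module B (fm r)"
proof (rule moduleI)
  show "abelian_group (fm r)"
  proof (rule abelian_groupI)
    fix x assume "x \<in> carrier (fm r)"
    then obtain v where v: "v \<in> V r" "x = {v}" by (rule fm_cases)
    show "\<exists>y\<in>carrier (fm r). y \<oplus>\<^bsub>fm r\<^esub> x = \<zero>\<^bsub>fm r\<^esub>"
      by (rule bexI[of _ "{\<lambda>i. \<ominus>\<^bsub>B\<^esub> v i}"]) (simp_all add: v V_closed B.l_neg V_carrier[OF v(1)])
  qed (auto elim!: fm_cases simp: V_closed V_carrier B.a_ac)
qed (auto elim!: fm_cases simp: V_closed V_carrier B.r_distr B.l_distr B.m_assoc B)

lemma fm_ag: "abelian_group (fm r)" using module_fm by (simp add: module_def)

lemma fm_gr_carrier: "x \<in> fm_gr r \<gamma> g \<Longrightarrow> x \<in> carrier (fm r)" by (auto simp: fm_gr_def)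

text \<open>The linear map from the free module of rank s that sends the j-th basis vector to
  \<open>n j\<close>.\<close>

definition lmap :: "('b, 'm) module \<Rightarrow> nat \<Rightarrow> (nat \<Rightarrow> 'm) \<Rightarrow> (nat \<Rightarrow> 'b) set \<Rightarrow> 'm" where
  "lmap N s n x = finsum N (\<lambda>j. the_elem x j \<odot>\<^bsub>N\<^esub> n j) {..<s}"

definition eb :: "nat \<Rightarrow> (nat \<Rightarrow> 'b) set" where
  "eb i = {\<lambda>j. if j = i then \<one>\<^bsub>B\<^esub> else \<zero>\<^bsub>B\<^esub>}"

lemma eb_carrier: "i < r \<Longrightarrow> eb i \<in> carrier (fm r)" by (auto simp: eb_def V_def)

lemma lmap_Suc:
  assumes N: "module B N" and n: "\<And>j. j < Suc s \<Longrightarrow> n j \<in> carrier N" and x: "\<And>j. j < Suc s \<Longrightarrow> the_elem x j \<in> carrier B"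
  shows "lmap N (Suc s) n x = the_elem x s \<odot>\<^bsub>N\<^esub> n s \<oplus>\<^bsub>N\<^esub> lmap N s n x"
proof -
  interpret N: module B N by fact
  show ?thesis unfolding lmap_def using n x by (intro finsum_lessThan_Suc N.abelian_group_axioms) auto
qed

lemma lmap_closed:
  assumes N: "module B N" and n: "\<And>j. j < s \<Longrightarrow> n j \<in> carrier N" and x: "\<And>j. j < s \<Longrightarrow> the_elem x j \<in> carrier B"
  shows "lmap N s n x \<in> carrier N"
proof -
  interpret N: module B N by fact
  show ?thesis unfolding lmap_def using n x by (intro N.finsum_closed) auto
qed

lemma lmap_hom:
  assumes N: "module B N" and n: "\<And>j. j < s \<Longrightarrow> n j \<in> carrier N"
    and N': "module B N'" and h: "h \<in> carrier N \<rightarrow> carrier N'"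
    "\<And>x y. x \<in> carrier N \<Longrightarrow> y \<in> carrier N \<Longrightarrow> h (x \<oplus>\<^bsub>N\<^esub> y) = h x \<oplus>\<^bsub>N'\<^esub> h y"
    "\<And>a x. a \<in> carrier B \<Longrightarrow> x \<in> carrier N \<Longrightarrow> h (a \<odot>\<^bsub>N\<^esub> x) = a \<odot>\<^bsub>N'\<^esub> h x"
    and x: "\<And>j. the_elem x j \<in> carrier B"
  shows "h (lmap N s n x) = lmap N' s (\<lambda>j. h (n j)) x"
proof -
  interpret N: module B N by fact
  interpret N': module B N' by fact
  have "h (lmap N s n x) = finsum N' (\<lambda>j. h (the_elem x j \<odot>\<^bsub>N\<^esub> n j)) {..<s}"
    unfolding lmap_def using n x
    by (intro finsum_additive_map N.abelian_group_axioms N'.abelian_group_axioms h) auto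
  also have "\<dots> = lmap N' s (\<lambda>j. h (n j)) x" unfolding lmap_def
    using n x h by (intro N'.finsum_cong') auto
  finally show ?thesis .
qed

lemma lmap_add:
  assumes N: "module B N" and n: "\<And>j. j < s \<Longrightarrow> n j \<in> carrier N"
    and x: "\<And>j. the_elem x j \<in> carrier B" and y: "\<And>j. the_elem y j \<in> carrier B"
  shows "lmap N s n {\<lambda>i. the_elem x i \<oplus>\<^bsub>B\<^esub> the_elem y i} = lmap N s n x \<oplus>\<^bsub>N\<^esub> lmap N s n y"
proof -
  interpret N: module B N by fact
  have "lmap N s n {\<lambda>i. the_elem x i \<oplus>\<^bsub>B\<^esub> the_elem y i} =
    finsum N (\<lambda>j. the_elem x j \<odot>\<^bsub>N\<^esub> n j \<oplus>\<^bsub>N\<^esub> the_elem y j \<odot>\<^bsub>N\<^esub> n j) {..<s}"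
    unfolding lmap_def using n x y by (intro N.finsum_cong') (auto simp: N.smult_l_distr)
  then show ?thesis unfolding lmap_def using n x y by (simp add: N.finsum_addf Pi_def)
qed

lemma lmap_smult:
  assumes N: "module B N" and n: "\<And>j. j < s \<Longrightarrow> n j \<in> carrier N"
    and x: "\<And>j. the_elem x j \<in> carrier B" and a: "a \<in> carrier B"
  shows "lmap N s n {\<lambda>i. a \<otimes>\<^bsub>B\<^esub> the_elem x i} = a \<odot>\<^bsub>N\<^esub> lmap N s n x"
proof -
  interpret N: module B N by fact
  have "a \<odot>\<^bsub>N\<^esub> lmap N s n x = finsum N (\<lambda>j. a \<odot>\<^bsub>N\<^esub> (the_elem x j \<odot>\<^bsub>N\<^esub> n j)) {..<s}"
    unfolding lmap_def using n x a
    by (intro finsum_additive_map N.abelian_group_axioms) (auto simp: N.smult_r_distr)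
  also have "\<dots> = lmap N s n {\<lambda>i. a \<otimes>\<^bsub>B\<^esub> the_elem x i}" unfolding lmap_def
    using n x a by (intro N.finsum_cong') (auto simp: N.smult_assoc1)
  finally show ?thesis by simp
qed

lemma lmap_basis: "x \<in> carrier (fm r) \<Longrightarrow> lmap (fm r) r eb x = x"
proof -
  assume "x \<in> carrier (fm r)"
  then obtain v where v: "v \<in> V r" "x = {v}" by (rule fm_cases)
  have "s \<le> r \<Longrightarrow> lmap (fm r) s eb x = {\<lambda>i. if i < s then v i else \<zero>\<^bsub>B\<^esub>}" for s
  proof (induction s)
    case 0
    interpret F: module B "fm r" by (rule module_fm)
    show ?case by (simp add: lmap_def)
  next
    case (Suc s)
    have "lmap (fm r) (Suc s) eb x = the_elem x s \<odot>\<^bsub>fm r\<^esub> eb s \<oplus>\<^bsub>fm r\<^esub> lmap (fm r) s eb x"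
      using Suc.prems by (intro lmap_Suc module_fm eb_carrier) (auto simp: v V_carrier[OF v(1)])
    also have "\<dots> = {\<lambda>i. if i < Suc s then v i else \<zero>\<^bsub>B\<^esub>}"
      unfolding Suc.IH[OF Suc_leD[OF Suc.prems]] by (auto simp: v eb_def fun_eq_iff V_carrier[OF v(1)] less_Suc_eq)
    finally show ?case .
  qed
  from this[of r] show "lmap (fm r) r eb x = x" using v by (auto simp: V_def fun_eq_iff)
qed

lemma the_elem_finsum_fm:
  assumes "f \<in> F \<rightarrow> carrier (fm r)" shows "the_elem (finsum (fm r) f F) i = finsum B (\<lambda>x. the_elem (f x) i) F"
  by (rule finsum_additive_map[OF fm_ag B_ag, where h = "\<lambda>x. the_elem x i"]) (use assms in \<open>auto simp: the_elem_carrier\<close>)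

context
  fixes \<gamma> :: "nat \<Rightarrow> 'c" assumes \<gamma>: "\<And>i. \<gamma> i \<in> carrier G"
begin

lemma fm_gr_sub:
  assumes g: "g \<in> carrier G" shows "additive_subgroup (fm_gr r \<gamma> g) (fm r)"
proof -
  interpret F: module B "fm r" by (rule module_fm)
  have gi: "g \<otimes>\<^bsub>G\<^esub> inv\<^bsub>G\<^esub> \<gamma> i \<in> carrier G" for i using g \<gamma> by simp
  note S = gr_simps[OF gi]
  have inv: "\<ominus>\<^bsub>fm r\<^esub> {v} = {\<lambda>i. \<ominus>\<^bsub>B\<^esub> v i}" if "v \<in> V r" for v
    using that by (intro F.minus_equality) (auto simp: V_closed B.l_neg V_carrier)
  show ?thesis
  proof (rule additive_subgroup.intro, rule subgroup.intro)
    show "fm_gr r \<gamma> g \<subseteq> carrier (add_monoid (fm r))" using fm_gr_carrier by auto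
    fix x y assume "x \<in> fm_gr r \<gamma> g" "y \<in> fm_gr r \<gamma> g"
    then show "x \<otimes>\<^bsub>add_monoid (fm r)\<^esub> y \<in> fm_gr r \<gamma> g"
      by (auto simp: fm_gr_def V_closed S(3))
  next
    show "\<one>\<^bsub>add_monoid (fm r)\<^esub> \<in> fm_gr r \<gamma> g" by (auto simp: fm_gr_def V_closed S(2))
  next
    fix x assume "x \<in> fm_gr r \<gamma> g"
    then have "\<ominus>\<^bsub>fm r\<^esub> x \<in> fm_gr r \<gamma> g"
      by (auto simp: fm_gr_def inv V_closed S(4))
    then show "inv\<^bsub>add_monoid (fm r)\<^esub> x \<in> fm_gr r \<gamma> g" by (simp add: a_inv_def)
  qed
qed

lemma smult_eb_gr:
  assumes h: "h \<in> carrier G" "b \<in> gr h" and j: "j < r"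
  shows "b \<odot>\<^bsub>fm r\<^esub> eb j \<in> fm_gr r \<gamma> (h \<otimes>\<^bsub>G\<^esub> \<gamma> j)"
proof -
  have bc: "b \<in> carrier B" using gr_carrier h by blast
  have "h \<otimes>\<^bsub>G\<^esub> \<gamma> j \<otimes>\<^bsub>G\<^esub> inv\<^bsub>G\<^esub> \<gamma> j = h" using h \<gamma> by (simp add: G.m_assoc)
  moreover have "\<zero>\<^bsub>B\<^esub> \<in> gr (h \<otimes>\<^bsub>G\<^esub> \<gamma> j \<otimes>\<^bsub>G\<^esub> inv\<^bsub>G\<^esub> \<gamma> i)" for i using h \<gamma> by (intro gr_simps(2)) auto
  ultimately show ?thesis using bc j h by (auto simp: fm_gr_def eb_def V_def)
qed

text \<open>Existence is reduced, through the expansion in the basis, to multiples of one basis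
  vector. Independence is checked in each coordinate, where the translation of degrees by
  \<open>\<gamma> i\<close> is injective.\<close>

lemma fm_graded_sum: "graded_sum G (fm r) (fm_gr r \<gamma>)"
  unfolding graded_sum_def
proof (intro conjI ballI allI impI)
  interpret F: module B "fm r" by (rule module_fm)
  fix x assume x: "x \<in> carrier (fm r)"
  let ?D = "\<lambda>x. \<exists>F f. finite F \<and> F \<subseteq> carrier G \<and> (\<forall>g\<in>F. f g \<in> fm_gr r \<gamma> g) \<and> x = finsum (fm r) f F"
  have add: "?D (x \<oplus>\<^bsub>fm r\<^esub> y)" if xy: "?D x" "?D y" for x y
  proof -
    obtain F f F' f' where d: "finite F" "F \<subseteq> carrier G" "\<forall>g\<in>F. f g \<in> fm_gr r \<gamma> g" "x = finsum (fm r) f F"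
      "finite F'" "F' \<subseteq> carrier G" "\<forall>g\<in>F'. f' g \<in> fm_gr r \<gamma> g" "y = finsum (fm r) f' F'" using xy by metis
    show ?thesis by (rule decomposition_add[OF fm_ag _ d]) (rule fm_gr_sub)
  qed
  have hom: "?D y" if "g \<in> carrier G" "y \<in> fm_gr r \<gamma> g" for g y
    using that fm_gr_carrier[OF that(2)] by (intro exI[of _ "{g}"] exI[of _ "\<lambda>_. y"]) (auto simp del: fm_simps)
  have "\<zero>\<^bsub>fm r\<^esub> \<in> fm_gr r \<gamma> \<one>\<^bsub>G\<^esub>" by (rule additive_subgroup_simps(2)[OF fm_ag fm_gr_sub]) simp
  then have zero: "?D \<zero>\<^bsub>fm r\<^esub>" by (rule hom[OF G.one_closed])
  have single: "?D (b \<odot>\<^bsub>fm r\<^esub> eb j)" if j: "j < r" and b: "b \<in> carrier B" for b j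
  proof (rule graded_sum_induct[OF B_ag gsB b, where P = "\<lambda>b. ?D (b \<odot>\<^bsub>fm r\<^esub> eb j)"])
    fix g y assume "g \<in> carrier G" "y \<in> gr g"
    then show "?D (y \<odot>\<^bsub>fm r\<^esub> eb j)" using \<gamma> by (intro hom[OF _ smult_eb_gr[OF _ _ j]]) auto
  next
    have "\<zero>\<^bsub>B\<^esub> \<odot>\<^bsub>fm r\<^esub> eb j = \<zero>\<^bsub>fm r\<^esub>" using F.smult_l_null[OF eb_carrier[OF j]] .
    then show "?D (\<zero>\<^bsub>B\<^esub> \<odot>\<^bsub>fm r\<^esub> eb j)" using zero by (simp only:)
  next
    fix y z assume yz: "y \<in> carrier B" "z \<in> carrier B" "?D (y \<odot>\<^bsub>fm r\<^esub> eb j)" "?D (z \<odot>\<^bsub>fm r\<^esub> eb j)"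
    have "(y \<oplus>\<^bsub>B\<^esub> z) \<odot>\<^bsub>fm r\<^esub> eb j = y \<odot>\<^bsub>fm r\<^esub> eb j \<oplus>\<^bsub>fm r\<^esub> z \<odot>\<^bsub>fm r\<^esub> eb j"
      using F.smult_l_distr[OF yz(1,2) eb_carrier[OF j]] .
    then show "?D ((y \<oplus>\<^bsub>B\<^esub> z) \<odot>\<^bsub>fm r\<^esub> eb j)" using add[OF yz(3,4)] by (simp only:)
  qed
  have "s \<le> r \<Longrightarrow> ?D (lmap (fm r) s eb x)" for s
  proof (induction s)
    case 0 show ?case using zero by (simp add: lmap_def)
  next
    case (Suc s)
    have "lmap (fm r) (Suc s) eb x = the_elem x s \<odot>\<^bsub>fm r\<^esub> eb s \<oplus>\<^bsub>fm r\<^esub> lmap (fm r) s eb x"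
      using Suc.prems x by (intro lmap_Suc module_fm eb_carrier the_elem_carrier[of x r]) auto
    moreover have "?D (the_elem x s \<odot>\<^bsub>fm r\<^esub> eb s)" using Suc.prems by (intro single the_elem_carrier[OF x]) simp
    moreover have "?D (lmap (fm r) s eb x)" using Suc.prems by (intro Suc.IH) simp
    ultimately show ?case using add by (simp only:)
  qed
  then have "?D (lmap (fm r) r eb x)" by simp
  then show "?D x" unfolding lmap_basis[OF x] .
next
  fix F f g assume F: "finite F" "F \<subseteq> carrier G" "\<forall>g\<in>F. f g \<in> fm_gr r \<gamma> g" "finsum (fm r) f F = \<zero>\<^bsub>fm r\<^esub>" and g: "g \<in> F"
  obtain v where v: "f g = {v}" "v \<in> V r" using F(3) g by (auto simp: fm_gr_def)
  have fc: "f \<in> F \<rightarrow> carrier (fm r)" using F(3) fm_gr_carrier by blast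
  have "v i = \<zero>\<^bsub>B\<^esub>" for i
  proof (cases "i < r")
    case True
    let ?q = "\<lambda>g. g \<otimes>\<^bsub>G\<^esub> inv\<^bsub>G\<^esub> \<gamma> i" and ?c = "\<lambda>h. the_elem (f (h \<otimes>\<^bsub>G\<^esub> \<gamma> i)) i"
    have qi: "?q g \<otimes>\<^bsub>G\<^esub> \<gamma> i = g" if "g \<in> F" for g using that F(2) \<gamma> by (auto simp: G.m_assoc)
    have inj: "inj_on ?q F" by (rule inj_on_inverseI[where g = "\<lambda>h. h \<otimes>\<^bsub>G\<^esub> \<gamma> i"]) (rule qi)
    have cc: "?c h \<in> gr h" if hF: "h \<in> ?q ` F" for h
    proof -
      obtain g where g: "g \<in> F" "h = ?q g" using hF by blast
      have "f g \<in> fm_gr r \<gamma> g" using F(3) g by blast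
      then show ?thesis using True qi[OF g(1)] unfolding g(2) by (auto simp: fm_gr_def)
    qed
    have qG: "?q ` F \<subseteq> carrier G" using F(2) \<gamma> by auto
    have "finsum B ?c (?q ` F) = finsum B (\<lambda>g. ?c (?q g)) F"
      by (rule B.finsum_reindex[OF _ inj]) (use cc qG gr_carrier in blast)
    also have "\<dots> = finsum B (\<lambda>g. the_elem (f g) i) F"
      using the_elem_carrier[OF funcset_mem[OF fc]] by (intro B.finsum_cong') (auto simp: qi)
    also have "\<dots> = the_elem (finsum (fm r) f F) i" using the_elem_finsum_fm[OF fc] by simp
    also have "\<dots> = \<zero>\<^bsub>B\<^esub>" unfolding F(4) by simp
    finally have "\<forall>h\<in>?q ` F. ?c h = \<zero>\<^bsub>B\<^esub>" using F(1) cc qG by (intro graded_sumD(3)[OF gsB]) auto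
    then have "?c (?q g) = \<zero>\<^bsub>B\<^esub>" using g by blast
    then show ?thesis unfolding qi[OF g] v by simp
  qed (use v in \<open>simp add: V_def\<close>)
  then show "f g = \<zero>\<^bsub>fm r\<^esub>" using v by auto
qed (rule fm_gr_sub)

lemma fg_gmod_fm: "fg_gmod G B gr (fm r, fm_gr r \<gamma>)"
proof -
  interpret F: module B "fm r" by (rule module_fm)
  have "a \<odot>\<^bsub>fm r\<^esub> x \<in> fm_gr r \<gamma> (g \<otimes>\<^bsub>G\<^esub> h)" if gh: "g \<in> carrier G" "h \<in> carrier G" "a \<in> gr g" "x \<in> fm_gr r \<gamma> h" for g h a x
  proof -
    obtain v where v: "x = {v}" "v \<in> V r" "\<And>i. i < r \<Longrightarrow> v i \<in> gr (h \<otimes>\<^bsub>G\<^esub> inv\<^bsub>G\<^esub> \<gamma> i)" using gh(4) by (auto simp: fm_gr_def)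
    have "a \<otimes>\<^bsub>B\<^esub> v i \<in> gr (g \<otimes>\<^bsub>G\<^esub> h \<otimes>\<^bsub>G\<^esub> inv\<^bsub>G\<^esub> \<gamma> i)" if "i < r" for i
      using gr_mult[OF gh(1) _ gh(3) v(3)[OF that]] gh \<gamma> by (simp add: G.m_assoc)
    then show ?thesis using v gr_carrier[OF gh(1,3)] by (auto simp: fm_gr_def V_closed)
  qed
  moreover have "fin_gen_module B (fm r)"
    unfolding fin_gen_module_def
  proof (intro exI[of _ "eb ` {..<r}"] conjI ballI)
    fix x assume x: "x \<in> carrier (fm r)"
    \<comment> \<open>\<open>fin_gen_module\<close> sums over a set of generators, so the basis
      vectors have to be distinct; this is where 1 \<noteq> 0 enters.\<close>
    have ie: "inj_on eb {..<r}" using one_not_zero' by (auto simp: inj_on_def eb_def fun_eq_iff split: if_splits)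
    define c where "c = (\<lambda>e. the_elem x (the_inv_into {..<r} eb e))"
    have ce: "c (eb i) = the_elem x i" if "i < r" for i using that by (simp add: c_def the_inv_into_f_f[OF ie])
    have "(\<Oplus>\<^bsub>fm r\<^esub>e\<in>eb ` {..<r}. c e \<odot>\<^bsub>fm r\<^esub> e) = (\<Oplus>\<^bsub>fm r\<^esub>i\<in>{..<r}. c (eb i) \<odot>\<^bsub>fm r\<^esub> eb i)"
      by (rule F.finsum_reindex[OF _ ie]) (use x in \<open>auto simp: ce intro!: F.smult_closed eb_carrier the_elem_carrier simp del: fm_simps\<close>)
    also have "\<dots> = lmap (fm r) r eb x" unfolding lmap_def
      by (rule F.finsum_cong') (use x in \<open>auto simp: ce intro!: F.smult_closed eb_carrier the_elem_carrier simp del: fm_simps\<close>)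
    also have "\<dots> = x" by (rule lmap_basis[OF x])
    finally show "\<exists>c\<in>eb ` {..<r} \<rightarrow> carrier B. x = (\<Oplus>\<^bsub>fm r\<^esub>e\<in>eb ` {..<r}. c e \<odot>\<^bsub>fm r\<^esub> e)"
      using ce the_elem_carrier[OF x] by (intro bexI[of _ c]) auto
  qed (auto simp: eb_carrier)
  moreover have "is_grading G (fm r) (fm_gr r \<gamma>)" using fm_graded_sum is_grading_iff[OF fm_ag] by blast
  ultimately show ?thesis
    unfolding fg_gmod_def graded_module_def using module_fm[of r] by auto
qed

lemma lmap_gmod_hom:
  assumes N: "fg_gmod G B gr N" and n: "\<And>j. j < s \<Longrightarrow> n j \<in> snd N (\<gamma> j)"
  shows "lmap (fst N) s n \<in> gmod_hom G B (fm s, fm_gr s \<gamma>) N"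
proof -
  note D = fg_gmodD[OF N]
  interpret N: module B "fst N" by (rule D(1))
  have ag: "abelian_group (fst N)" by (rule N.abelian_group_axioms)
  have nc: "n j \<in> gcarrier N" if "j < s" for j
    using n[OF that] additive_subgroup_simps(1)[OF ag graded_sumD(1)[OF D(2) \<gamma>]] by blast
  have deg: "lmap (fst N) s n x \<in> snd N g" if g: "g \<in> carrier G" and x: "x \<in> fm_gr s \<gamma> g" for g x
    unfolding lmap_def
  proof (rule finsum_in_subgroup[OF ag graded_sumD(1)[OF D(2) g]])
    fix j assume j: "j \<in> {..<s}"
    have "the_elem x j \<in> gr (g \<otimes>\<^bsub>G\<^esub> inv\<^bsub>G\<^esub> \<gamma> j)" using x j by (auto simp: fm_gr_def)
    then have "the_elem x j \<odot>\<^bsub>fst N\<^esub> n j \<in> snd N (g \<otimes>\<^bsub>G\<^esub> inv\<^bsub>G\<^esub> \<gamma> j \<otimes>\<^bsub>G\<^esub> \<gamma> j)"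
      using g \<gamma> j n by (intro D(4)) auto
    then show "the_elem x j \<odot>\<^bsub>fst N\<^esub> n j \<in> snd N g" using g \<gamma> by (simp add: G.m_assoc)
  qed
  show ?thesis
    using deg nc the_elem_carrier lmap_closed[OF D(1) nc] lmap_add[OF D(1) nc] lmap_smult[OF D(1) nc]
    by (auto simp: gmod_hom_def split: prod.splits)
qed

text \<open>The images of the basis have homogeneous preimages by
  \<open>homogeneous_preimage\<close>, and \<open>lmap\<close> extends this choice to a morphism of
  graded modules.\<close>

lemma projective_fm: "projective_gmod G B gr (fm r, fm_gr r \<gamma>)"
  unfolding projective_gmod_def
proof (intro conjI allI impI fg_gmod_fm; elim conjE)
  fix M N :: "('c, 'b, (nat \<Rightarrow> 'b) set) gmod" and f h
  assume M: "fg_gmod G B gr M" and N: "fg_gmod G B gr N" and f: "f \<in> gmod_hom G B M N" "f ` gcarrier M = gcarrier N"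
    and h: "h \<in> gmod_hom G B (fm r, fm_gr r \<gamma>) N"
  note DM = fg_gmodD[OF M] and DN = fg_gmodD[OF N] and f' = gmod_homD[OF f(1)] and h' = gmod_homD[OF h, simplified fst_conv snd_conv]
  have ag: "abelian_group (fst M)" "abelian_group (fst N)" using DM(1) DN(1) by (simp_all add: module_def)
  have "\<exists>m. m \<in> snd M (\<gamma> i) \<and> f m = h (eb i)" if i: "i < r" for i
  proof -
    have e: "eb i \<in> fm_gr r \<gamma> (\<gamma> i)"
      using smult_eb_gr[OF G.one_closed gr_one i] \<gamma> by (simp add: eb_def if_distrib cong: if_cong)
    have he: "h (eb i) \<in> snd N (\<gamma> i)" by (rule h'(4)[OF \<gamma> e])
    have "h (eb i) \<in> gcarrier N" by (rule funcset_mem[OF h'(1) eb_carrier[OF i]])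
    then have "h (eb i) \<in> f ` gcarrier M" unfolding f(2) .
    then obtain x where "x \<in> gcarrier M" "f x = h (eb i)" by (rule imageE) simp
    from homogeneous_preimage[OF ag DM(2) DN(2) f'(1) f'(2) f'(4) \<gamma> he this] show ?thesis by blast
  qed
  then obtain m where m: "\<And>i. i < r \<Longrightarrow> m i \<in> snd M (\<gamma> i)" "\<And>i. i < r \<Longrightarrow> f (m i) = h (eb i)" by metis
  have mc: "m i \<in> gcarrier M" if "i < r" for i
    using m(1)[OF that] additive_subgroup_simps(1)[OF ag(1) graded_sumD(1)[OF DM(2) \<gamma>]] by blast
  show "\<exists>h'\<in>gmod_hom G B (fm r, fm_gr r \<gamma>) M. \<forall>x\<in>gcarrier (fm r, fm_gr r \<gamma>). f (h' x) = h x"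
  proof (intro bexI[of _ "lmap (fst M) r m"] ballI lmap_gmod_hom[OF M m(1)])
    fix x assume "x \<in> gcarrier (fm r, fm_gr r \<gamma>)"
    then have x: "x \<in> carrier (fm r)" by simp
    have "f (lmap (fst M) r m x) = lmap (fst N) r (\<lambda>j. f (m j)) x"
      by (rule lmap_hom[OF DM(1) mc DN(1) f'(1,2,3)]) (auto simp: the_elem_carrier[OF x])
    also have "\<dots> = lmap (fst N) r (\<lambda>j. h (eb j)) x"
    proof -
      interpret N: module B "fst N" by (rule DN(1))
      show ?thesis unfolding lmap_def using m(2) funcset_mem[OF h'(1) eb_carrier] the_elem_carrier[OF x]
        by (intro N.finsum_cong') auto
    qed
    also have "\<dots> = h (lmap (fm r) r eb x)"
      by (rule lmap_hom[OF module_fm eb_carrier DN(1) h'(1,2,3), symmetric]) (auto simp: the_elem_carrier[OF x] simp del: fm_simps)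
    also have "\<dots> = h x" unfolding lmap_basis[OF x] ..
    finally show "f (lmap (fst M) r m x) = h x" .
  qed auto
qed

end
end

section \<open>Transfer of resolutions from A to a graded ring B\<close>

context hom_ring begin

text \<open>Unfolds \<open>fr\<close> into infinite sequences, the form in which
  \<open>proj_dim_le\<close> wants a resolution. Position 0 is the free module that contains K, so
  it is the quotient by K that gets resolved, and the ranks vanish beyond n rather than beyond n -
  1.\<close>

lemma fr_resolution:
  assumes A: "subring_set A" and "fr A n gs K" "gsub A r gs K"
  shows "\<exists>R E Xs. R 0 = r \<and> E 0 = gs \<and> gens A (E 0) K (R 1) (Xs 0) (E 1) \<and>
    (\<forall>k. gens A (E (Suc k)) (rels A (R (Suc k)) (Xs k) (E (Suc k))) (R (Suc (Suc k))) (Xs (Suc k)) (E (Suc (Suc k)))) \<and>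
    (\<forall>k>n. R k = 0)"
  using assms(2,3)
proof (induction n arbitrary: r gs K)
  case 0
  have z: "(\<lambda>i. 0) \<in> vecs A 0" by (rule vecs_closed[OF A])
  have g: "gens A gs' K' 0 (\<lambda>_ _. 0) hs" if "\<And>h. K' h \<subseteq> {\<lambda>i. 0}" for gs' hs :: "nat \<Rightarrow> 'g" and K'
    unfolding gens_def
  proof (intro conjI allI impI ballI)
    fix h v assume "v \<in> K' h"
    then have "v = (\<lambda>i. 0)" using that by blast
    then show "\<exists>c\<in>vecs A 0. hv hs h c \<and> v = lincomb 0 (\<lambda>_ _. 0) c"
      using z by (intro bexI[of _ "\<lambda>i. 0"]) (auto simp: hv_0 lincomb_def)
  qed simp
  have "rels A 0 xs hs h \<subseteq> {\<lambda>i. 0}" for xs hs h by (auto simp: rels_def vecs_def)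
  then show ?case using 0
    by (intro exI[of _ "\<lambda>k. if k = 0 then r else 0"] exI[of _ "\<lambda>_. gs"] exI[of _ "\<lambda>_ _ _. 0"]) (auto intro!: g)
next
  case (Suc n)
  obtain s xs hs where g: "gens A gs K s xs hs" and f: "fr A n hs (rels A s xs hs)" using Suc.prems(1) by auto
  obtain R E Xs where IH: "R 0 = s" "E 0 = hs" "gens A (E 0) (rels A s xs hs) (R 1) (Xs 0) (E 1)"
    "\<forall>k. gens A (E (Suc k)) (rels A (R (Suc k)) (Xs k) (E (Suc k))) (R (Suc (Suc k))) (Xs (Suc k)) (E (Suc (Suc k)))"
    "\<forall>k>n. R k = 0" using Suc.IH[OF f rels_gsub[OF A]] by blast
  define R' where "R' = case_nat r R"
  define E' where "E' = case_nat gs E"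
  define Xs' where "Xs' = case_nat xs Xs"
  have "gens A (E' (Suc k)) (rels A (R' (Suc k)) (Xs' k) (E' (Suc k))) (R' (Suc (Suc k))) (Xs' (Suc k)) (E' (Suc (Suc k)))" for k
    using IH by (cases k) (auto simp: R'_def E'_def Xs'_def)
  moreover have "gens A (E' 0) K (R' 1) (Xs' 0) (E' 1)" using IH g by (simp add: R'_def E'_def Xs'_def)
  moreover have "\<forall>k>Suc n. R' k = 0" using IH(5) by (auto simp: R'_def split: nat.split)
  ultimately show ?case by (intro exI[of _ R'] exI[of _ E'] exI[of _ Xs']) (simp add: R'_def E'_def)
qed

end

text \<open>\<phi> maps A to B and is injective on homogeneous elements. By \<open>unit_deg\<close>
  a homogeneous unit moves any given degree into the range of D, and by \<open>fraction\<close> an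
  element whose degree lies in that range is a fraction of homogeneous elements coming from A. These
  two properties replace an equivalence between graded B-modules and localized A-modules.\<close>

locale syz_cover = graded_cring G B gr + H: hom_ring hom
  for G :: "('c, 'u) monoid_scheme" and B :: "('b, 'w) ring_scheme" and gr :: "'c \<Rightarrow> 'b set"
    and hom :: "'g::ab_group_add \<Rightarrow> 'a::comm_ring_1 \<Rightarrow> bool" +
  fixes A :: "'a set" and D :: "'g \<Rightarrow> 'c" and \<phi> :: "'a \<Rightarrow> 'b" and n :: nat
  assumes A: "subring_set A" and syz: "H.syz A n"
    and D_add: "D (a + b) = D a \<otimes>\<^bsub>G\<^esub> D b" and D_closed: "D a \<in> carrier G"
    and \<phi>_closed: "f \<in> A \<Longrightarrow> \<phi> f \<in> carrier B"
    and \<phi>_add: "f \<in> A \<Longrightarrow> f' \<in> A \<Longrightarrow> \<phi> (f + f') = \<phi> f \<oplus>\<^bsub>B\<^esub> \<phi> f'"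
    and \<phi>_mult: "f \<in> A \<Longrightarrow> f' \<in> A \<Longrightarrow> \<phi> (f * f') = \<phi> f \<otimes>\<^bsub>B\<^esub> \<phi> f'"
    and \<phi>_one: "\<phi> 1 = \<one>\<^bsub>B\<^esub>"
    and \<phi>_gr: "f \<in> A \<Longrightarrow> hom e f \<Longrightarrow> \<phi> f \<in> gr (D e)"
    and \<phi>_inj: "f \<in> A \<Longrightarrow> hom e f \<Longrightarrow> \<phi> f = \<zero>\<^bsub>B\<^esub> \<Longrightarrow> f = 0"
    and unit_deg: "g \<in> carrier G \<Longrightarrow> \<exists>u\<in>Units B. \<exists>e. u \<in> gr (D e \<otimes>\<^bsub>G\<^esub> inv\<^bsub>G\<^esub> g)"
    and fraction: "z \<in> gr (D e) \<Longrightarrow> \<exists>s\<in>A. \<exists>w\<in>A. \<exists>e'. hom e' s \<and> hom (e + e') w \<and> \<phi> s \<in> Units B \<and> \<phi> s \<otimes>\<^bsub>B\<^esub> z = \<phi> w"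
begin

lemma D_diff: "D (a - b) = D a \<otimes>\<^bsub>G\<^esub> inv\<^bsub>G\<^esub> D b"
proof -
  have "D (a - b) \<otimes>\<^bsub>G\<^esub> D b = D a" by (simp flip: D_add)
  then have "D (a - b) \<otimes>\<^bsub>G\<^esub> D b \<otimes>\<^bsub>G\<^esub> inv\<^bsub>G\<^esub> D b = D a \<otimes>\<^bsub>G\<^esub> inv\<^bsub>G\<^esub> D b" by simp
  then show ?thesis by (simp add: G.m_assoc D_closed)
qed

lemma \<phi>_0: "\<phi> 0 = \<zero>\<^bsub>B\<^esub>"
proof -
  have "\<phi> 0 \<oplus>\<^bsub>B\<^esub> \<phi> 0 = \<zero>\<^bsub>B\<^esub> \<oplus>\<^bsub>B\<^esub> \<phi> 0" using \<phi>_add[of 0 0] \<phi>_closed[of 0] subring_setD[OF A] by simp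
  then show ?thesis using a_right_cancel[OF B_ag _ _ \<phi>_closed[of 0]] subring_setD[OF A] \<phi>_closed[of 0] by blast
qed

definition ph :: "(nat \<Rightarrow> 'a) \<Rightarrow> (nat \<Rightarrow> 'b) set" where
  "ph w = {\<lambda>i. \<phi> (w i)}"

lemma ph_carrier: "w \<in> vecs A r \<Longrightarrow> ph w \<in> carrier (fm r)"
  by (auto simp: ph_def V_def vecs_def \<phi>_closed \<phi>_0)

lemma ph_gr: "w \<in> vecs A r \<Longrightarrow> H.hv gs h w \<Longrightarrow> ph w \<in> fm_gr r (\<lambda>i. D (gs i)) (D h)"
  using ph_carrier[of w r] \<phi>_gr by (auto simp: ph_def fm_gr_def vecs_def H.hv_def D_diff[symmetric])

lemma ph_add: "v \<in> vecs A r \<Longrightarrow> w \<in> vecs A r \<Longrightarrow> ph (\<lambda>i. v i + w i) = ph v \<oplus>\<^bsub>fm r\<^esub> ph w"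
  by (auto simp: ph_def vecs_def \<phi>_add)

lemma ph_mult: "f \<in> A \<Longrightarrow> w \<in> vecs A r \<Longrightarrow> ph (\<lambda>i. f * w i) = \<phi> f \<odot>\<^bsub>fm r\<^esub> ph w"
  by (auto simp: ph_def vecs_def \<phi>_mult)

lemma ph_0: "ph (\<lambda>i. 0) = \<zero>\<^bsub>fm r\<^esub>" by (simp add: ph_def \<phi>_0)

lemma lincomb_vecs: "c \<in> vecs A s' \<Longrightarrow> (\<And>j. j < s \<Longrightarrow> xs j \<in> vecs A r) \<Longrightarrow> lincomb s xs c \<in> vecs A r"
  by (auto simp: lincomb_def vecs_def intro!: subring_set_sum[OF A] subring_setD[OF A])

lemma lmap_ph:
  assumes c: "c \<in> vecs A s'" and xs: "\<And>j. j < s \<Longrightarrow> xs j \<in> vecs A r"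
  shows "lmap (fm r) s (\<lambda>j. ph (xs j)) (ph c) = ph (lincomb s xs c)"
  using xs
proof (induction s)
  case 0
  interpret F: module B "fm r" by (rule module_fm)
  show ?case using ph_0 by (simp add: lmap_def lincomb_def)
next
  case (Suc s)
  have cA: "c j \<in> A" for j using c by (simp add: vecs_def)
  have "lmap (fm r) (Suc s) (\<lambda>j. ph (xs j)) (ph c) = the_elem (ph c) s \<odot>\<^bsub>fm r\<^esub> ph (xs s) \<oplus>\<^bsub>fm r\<^esub> lmap (fm r) s (\<lambda>j. ph (xs j)) (ph c)"
    using Suc.prems cA \<phi>_closed by (intro lmap_Suc module_fm ph_carrier) (auto simp: ph_def)
  also have "the_elem (ph c) s \<odot>\<^bsub>fm r\<^esub> ph (xs s) = ph (\<lambda>i. c s * xs s i)"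
    using Suc.prems cA by (subst ph_mult[of _ _ r]) (auto simp: ph_def)
  also have "lmap (fm r) s (\<lambda>j. ph (xs j)) (ph c) = ph (lincomb s xs c)" using Suc by simp
  also have "ph (\<lambda>i. c s * xs s i) \<oplus>\<^bsub>fm r\<^esub> ph (lincomb s xs c) = ph (\<lambda>i. c s * xs s i + lincomb s xs c i)"
    using Suc.prems cA by (intro ph_add[symmetric] lincomb_vecs[OF c] H.vecs_closed[OF A]) auto
  also have "(\<lambda>i. c s * xs s i + lincomb s xs c i) = lincomb (Suc s) xs c" by (simp add: lincomb_def add.commute)
  finally show ?case .
qed

text \<open>A unit u of suitable degree first moves g into the range of D. The coordinates are then
  treated one at a time, each new denominator being multiplied into the numerators found
  before.\<close>

lemma common_denominator:
  assumes v: "v \<in> V r" "\<And>i. i < r \<Longrightarrow> v i \<in> gr (g \<otimes>\<^bsub>G\<^esub> inv\<^bsub>G\<^esub> D (gs i))" and g: "g \<in> carrier G"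
  shows "\<exists>t\<in>Units B. \<exists>w h. w \<in> vecs A r \<and> H.hv gs h w \<and> ph w = t \<odot>\<^bsub>fm r\<^esub> {v}"
proof -
  obtain u e where u: "u \<in> Units B" "u \<in> gr (D e \<otimes>\<^bsub>G\<^esub> inv\<^bsub>G\<^esub> g)" using unit_deg[OF g] by blast
  have uc: "u \<in> carrier B" using u(1) by (rule B.Units_closed)
  have uv: "u \<otimes>\<^bsub>B\<^esub> v i \<in> gr (D (e - gs i))" if "i < r" for i
  proof -
    have "u \<otimes>\<^bsub>B\<^esub> v i \<in> gr ((D e \<otimes>\<^bsub>G\<^esub> inv\<^bsub>G\<^esub> g) \<otimes>\<^bsub>G\<^esub> (g \<otimes>\<^bsub>G\<^esub> inv\<^bsub>G\<^esub> D (gs i)))"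
      using u g v(2)[OF that] D_closed by (intro gr_mult) auto
    also have "(D e \<otimes>\<^bsub>G\<^esub> inv\<^bsub>G\<^esub> g) \<otimes>\<^bsub>G\<^esub> (g \<otimes>\<^bsub>G\<^esub> inv\<^bsub>G\<^esub> D (gs i)) = D (e - gs i)"
    proof -
      have "inv\<^bsub>G\<^esub> g \<otimes>\<^bsub>G\<^esub> (g \<otimes>\<^bsub>G\<^esub> inv\<^bsub>G\<^esub> D (gs i)) = inv\<^bsub>G\<^esub> D (gs i)"
        using g D_closed by (simp add: G.m_assoc[symmetric])
      then show ?thesis using g D_closed by (simp add: G.m_assoc D_diff)
    qed
    finally show ?thesis .
  qed
  have vc: "v i \<in> carrier B" for i by (rule V_carrier[OF v(1)])
  have "k \<le> r \<Longrightarrow> \<exists>s\<in>A. \<exists>e'. hom e' s \<and> \<phi> s \<in> Units B \<and>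
     (\<exists>w. \<forall>i<k. w i \<in> A \<and> hom (e - gs i + e') (w i) \<and> \<phi> s \<otimes>\<^bsub>B\<^esub> (u \<otimes>\<^bsub>B\<^esub> v i) = \<phi> (w i))" for k
  proof (induction k)
    case 0 show ?case using H.hom_1 by (intro bexI[of _ 1]) (auto simp: \<phi>_one subring_setD[OF A])
  next
    case (Suc k)
    then obtain s e' w where s: "s \<in> A" "hom e' s" "\<phi> s \<in> Units B"
      and w: "\<forall>i<k. w i \<in> A \<and> hom (e - gs i + e') (w i) \<and> \<phi> s \<otimes>\<^bsub>B\<^esub> (u \<otimes>\<^bsub>B\<^esub> v i) = \<phi> (w i)" by auto
    obtain s1 w1 e1 where s1: "s1 \<in> A" "w1 \<in> A" "hom e1 s1" "hom (e - gs k + e1) w1" "\<phi> s1 \<in> Units B"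
      "\<phi> s1 \<otimes>\<^bsub>B\<^esub> (u \<otimes>\<^bsub>B\<^esub> v k) = \<phi> w1" using fraction[OF uv[of k]] Suc.prems by auto
    define w' where "w' i = (if i < k then w i * s1 else w1 * s)" for i
    have sc: "\<phi> s \<in> carrier B" "\<phi> s1 \<in> carrier B" using s s1 \<phi>_closed by auto
    have "w' i \<in> A \<and> hom (e - gs i + (e' + e1)) (w' i) \<and> \<phi> (s * s1) \<otimes>\<^bsub>B\<^esub> (u \<otimes>\<^bsub>B\<^esub> v i) = \<phi> (w' i)" if "i < Suc k" for i
    proof (cases "i < k")
      case True
      have "\<phi> (s * s1) \<otimes>\<^bsub>B\<^esub> (u \<otimes>\<^bsub>B\<^esub> v i) = (\<phi> s \<otimes>\<^bsub>B\<^esub> (u \<otimes>\<^bsub>B\<^esub> v i)) \<otimes>\<^bsub>B\<^esub> \<phi> s1"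
        using s s1 sc uc vc by (simp add: \<phi>_mult B.m_ac)
      then show ?thesis using w True s1 by (auto simp: w'_def \<phi>_mult subring_setD[OF A] intro!: H.hom_mult'[where e' = e1])
    next
      case False
      then have i: "i = k" using that by simp
      have "\<phi> (s * s1) \<otimes>\<^bsub>B\<^esub> (u \<otimes>\<^bsub>B\<^esub> v i) = (\<phi> s1 \<otimes>\<^bsub>B\<^esub> (u \<otimes>\<^bsub>B\<^esub> v i)) \<otimes>\<^bsub>B\<^esub> \<phi> s"
        using s s1 sc uc vc by (simp add: \<phi>_mult B.m_ac)
      then show ?thesis using s s1 unfolding i by (auto simp: w'_def \<phi>_mult subring_setD[OF A] intro!: H.hom_mult'[where e' = e'])
    qed
    moreover have "\<phi> (s * s1) \<in> Units B" using s s1 by (simp add: \<phi>_mult)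
    moreover have "s * s1 \<in> A" "hom (e' + e1) (s * s1)" using s s1 by (auto simp: subring_setD[OF A] intro: H.hom_mult)
    ultimately show ?case by blast
  qed
  then obtain s e' w where s: "s \<in> A" "hom e' s" "\<phi> s \<in> Units B"
    and w: "\<forall>i<r. w i \<in> A \<and> hom (e - gs i + e') (w i) \<and> \<phi> s \<otimes>\<^bsub>B\<^esub> (u \<otimes>\<^bsub>B\<^esub> v i) = \<phi> (w i)" by (metis order_refl)
  define w' where "w' i = (if i < r then w i else 0)" for i
  have sc: "\<phi> s \<in> carrier B" using s \<phi>_closed by auto
  have "w' \<in> vecs A r" using w by (auto simp: w'_def vecs_def subring_setD[OF A])
  moreover have "H.hv gs (e + e') w'"
    unfolding H.hv_def
  proof
    fix i
    have eq: "e + e' - gs i = e - gs i + e'" by simp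
    show "hom (e + e' - gs i) (w' i)" unfolding eq using w by (auto simp: w'_def H.hom_0)
  qed
  moreover have "\<phi> s \<otimes>\<^bsub>B\<^esub> u \<in> Units B" using s u by simp
  moreover have "ph w' = (\<phi> s \<otimes>\<^bsub>B\<^esub> u) \<odot>\<^bsub>fm r\<^esub> {v}"
    using w v(1) sc uc vc by (auto simp: ph_def w'_def fun_eq_iff \<phi>_0 B.m_assoc V_def)
  ultimately show ?thesis by blast
qed

text \<open>Exactness of localization. By \<open>graded_exact\<close> it suffices to take a
  homogeneous vector in the kernel of d; multiplied by a unit t it comes from a vector over A, which
  lies in K and is a combination of the generators, and t is divided out again.\<close>

lemma exact_step:
  fixes Q :: "('b, 'q) module"
  assumes Q: "module B Q" "graded_sum G Q grQ"
    and d: "d \<in> carrier (fm r) \<rightarrow> carrier Q"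
      "\<And>x y. x \<in> carrier (fm r) \<Longrightarrow> y \<in> carrier (fm r) \<Longrightarrow> d (x \<oplus>\<^bsub>fm r\<^esub> y) = d x \<oplus>\<^bsub>Q\<^esub> d y"
      "\<And>a x. a \<in> carrier B \<Longrightarrow> x \<in> carrier (fm r) \<Longrightarrow> d (a \<odot>\<^bsub>fm r\<^esub> x) = a \<odot>\<^bsub>Q\<^esub> d x"
      "\<And>g x. g \<in> carrier G \<Longrightarrow> x \<in> fm_gr r (\<lambda>i. D (gs i)) g \<Longrightarrow> d x \<in> grQ g"
    and K: "\<And>h w. w \<in> vecs A r \<Longrightarrow> H.hv gs h w \<Longrightarrow> w \<in> K h \<longleftrightarrow> d (ph w) = \<zero>\<^bsub>Q\<^esub>"
    and KV: "\<And>h w. w \<in> K h \<Longrightarrow> w \<in> vecs A r \<and> H.hv gs h w"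
    and gens: "H.gens A gs K s xs hs"
  shows "{x \<in> carrier (fm r). d x = \<zero>\<^bsub>Q\<^esub>} = lmap (fm r) s (\<lambda>j. ph (xs j)) ` carrier (fm s)"
proof (intro equalityI subsetI)
  interpret Q: module B Q by fact
  interpret F: module B "fm r" by (rule module_fm)
  have xsK: "xs j \<in> K (hs j)" if "j < s" for j using gens that by (simp add: H.gens_def)
  have xsV: "xs j \<in> vecs A r" if "j < s" for j using KV[OF xsK[OF that]] by blast
  have phc: "\<And>j. j < s \<Longrightarrow> ph (xs j) \<in> carrier (fm r)" by (rule ph_carrier[OF xsV])
  {
    fix x assume "x \<in> lmap (fm r) s (\<lambda>j. ph (xs j)) ` carrier (fm s)"
    then obtain y where y: "y \<in> carrier (fm s)" "x = lmap (fm r) s (\<lambda>j. ph (xs j)) y" by blast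
    note yc = the_elem_carrier[OF y(1)]
    have "d x = lmap Q s (\<lambda>j. d (ph (xs j))) y" unfolding y(2)
      by (rule lmap_hom[OF module_fm phc Q(1) d(1,2,3) yc])
    also have "\<dots> = \<zero>\<^bsub>Q\<^esub>" unfolding lmap_def
    proof (rule Q.add.finprod_one_eqI)
      fix j assume j: "j \<in> {..<s}"
      have "d (ph (xs j)) = \<zero>\<^bsub>Q\<^esub>" using K KV xsK j by blast
      then show "the_elem y j \<odot>\<^bsub>Q\<^esub> d (ph (xs j)) = \<zero>\<^bsub>Q\<^esub>" using yc by simp
    qed
    finally show "x \<in> {x \<in> carrier (fm r). d x = \<zero>\<^bsub>Q\<^esub>}"
      using lmap_closed[OF module_fm phc yc] y(2) by simp
  next
    fix x assume x: "x \<in> {x \<in> carrier (fm r). d x = \<zero>\<^bsub>Q\<^esub>}"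
    have gF: "graded_sum G (fm r) (fm_gr r (\<lambda>i. D (gs i)))" by (rule fm_graded_sum[OF D_closed])
    have lm: "lmap (fm r) s (\<lambda>j. ph (xs j)) \<in> carrier (fm s) \<rightarrow> carrier (fm r)"
      by (intro Pi_I lmap_closed[OF module_fm phc]) (auto intro: the_elem_carrier)
    have la: "lmap (fm r) s (\<lambda>j. ph (xs j)) (x \<oplus>\<^bsub>fm s\<^esub> y) = lmap (fm r) s (\<lambda>j. ph (xs j)) x \<oplus>\<^bsub>fm r\<^esub> lmap (fm r) s (\<lambda>j. ph (xs j)) y"
      if "x \<in> carrier (fm s)" "y \<in> carrier (fm s)" for x y
      using lmap_add[OF module_fm phc the_elem_carrier[OF that(1)] the_elem_carrier[OF that(2)]] by simp
    show "x \<in> lmap (fm r) s (\<lambda>j. ph (xs j)) ` carrier (fm s)"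
    proof (rule graded_exact[OF fm_ag Q.abelian_group_axioms fm_ag gF Q(2) d(1,2,4) lm la])
      fix g x assume g: "g \<in> carrier G" and x: "x \<in> fm_gr r (\<lambda>i. D (gs i)) g" and dx: "d x = \<zero>\<^bsub>Q\<^esub>"
      obtain v where v: "x = {v}" "v \<in> V r" "\<And>i. i < r \<Longrightarrow> v i \<in> gr (g \<otimes>\<^bsub>G\<^esub> inv\<^bsub>G\<^esub> D (gs i))" using x by (auto simp: fm_gr_def)
      obtain t w h where t: "t \<in> Units B" "w \<in> vecs A r" "H.hv gs h w" "ph w = t \<odot>\<^bsub>fm r\<^esub> {v}"
        using common_denominator[OF v(2,3) g] by blast
      have tc: "t \<in> carrier B" "inv\<^bsub>B\<^esub> t \<in> carrier B" using t(1) by (simp_all add: B.Units_closed)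
      have xc: "x \<in> carrier (fm r)" using v by simp
      have "d (ph w) = t \<odot>\<^bsub>Q\<^esub> d x" unfolding t(4) v(1)[symmetric] by (rule d(3)[OF tc(1) xc])
      then have "w \<in> K h" using K[OF t(2,3)] dx tc by simp
      then obtain c where c: "c \<in> vecs A s" "w = lincomb s xs c" using gens unfolding H.gens_def by blast
      have "x = inv\<^bsub>B\<^esub> t \<odot>\<^bsub>fm r\<^esub> (t \<odot>\<^bsub>fm r\<^esub> x)"
        using F.smult_assoc1[OF tc(2,1) xc] F.smult_one[OF xc] t(1) by (simp del: fm_simps)
      also have "t \<odot>\<^bsub>fm r\<^esub> x = lmap (fm r) s (\<lambda>j. ph (xs j)) (ph c)"
      proof -
        have "lmap (fm r) s (\<lambda>j. ph (xs j)) (ph c) = ph (lincomb s xs c)" by (rule lmap_ph[OF c(1) xsV])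
        then show ?thesis using t(4) c(2) v(1) by simp
      qed
      also have "inv\<^bsub>B\<^esub> t \<odot>\<^bsub>fm r\<^esub> \<dots> = lmap (fm r) s (\<lambda>j. ph (xs j)) (inv\<^bsub>B\<^esub> t \<odot>\<^bsub>fm s\<^esub> ph c)"
        using lmap_smult[OF module_fm phc the_elem_carrier[OF ph_carrier[OF c(1)]] tc(2)] by simp
      finally show "x \<in> lmap (fm r) s (\<lambda>j. ph (xs j)) ` carrier (fm s)"
        using module.smult_closed[OF module_fm tc(2) ph_carrier[OF c(1)]] by blast
    qed (use x in auto)
  }
qed

text \<open>The components of finitely many generators generate as well. Multiplying each by a
  homogeneous unit puts its degree into the range of D, where it can match a basis vector of a
  graded free module over A.\<close>

lemma homogeneous_generators:
  assumes M: "fg_gmod G B gr M"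
  shows "\<exists>r gs y. (\<forall>i<r. y i \<in> snd M (D (gs i))) \<and> (\<forall>m\<in>gcarrier M. \<exists>x\<in>carrier (fm r). lmap (fst M) r y x = m)"
proof -
  note DM = fg_gmodD[OF M]
  interpret M: module B "fst M" by (rule DM(1))
  have ag: "abelian_group (fst M)" by (rule M.abelian_group_axioms)
  have sub: "snd M g \<subseteq> gcarrier M" if "g \<in> carrier G" for g
    using additive_subgroup_simps(1)[OF ag graded_sumD(1)[OF DM(2) that]] .
  obtain X where X: "finite X" "X \<subseteq> gcarrier M"
    "\<forall>y\<in>gcarrier M. \<exists>c\<in>X \<rightarrow> carrier B. y = (\<Oplus>\<^bsub>fst M\<^esub>x\<in>X. c x \<odot>\<^bsub>fst M\<^esub> x)"
    using DM(3) unfolding fin_gen_module_def by blast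
  have "\<forall>x\<in>X. \<exists>F f. finite F \<and> F \<subseteq> carrier G \<and> (\<forall>g\<in>F. f g \<in> snd M g) \<and> x = finsum (fst M) f F"
    using graded_sumD(2)[OF DM(2)] X(2) by blast
  then obtain F f where F: "\<And>x. x \<in> X \<Longrightarrow> finite (F x) \<and> F x \<subseteq> carrier G \<and> (\<forall>g\<in>F x. f x g \<in> snd M g) \<and> x = finsum (fst M) (f x) (F x)"
    by metis
  define Y where "Y = (\<Union>x\<in>X. f x ` F x)"
  have "finite Y" using X(1) F by (auto simp: Y_def)
  then obtain b where b: "bij_betw b {0..<card Y} Y" using ex_bij_betw_nat_finite by blast
  define r where "r = card Y"
  have "\<exists>g u e. g \<in> carrier G \<and> b i \<in> snd M g \<and> u \<in> Units B \<and> u \<in> gr (D e \<otimes>\<^bsub>G\<^esub> inv\<^bsub>G\<^esub> g)" if "i < r" for i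
  proof -
    have "b i \<in> Y" using b that by (auto simp: bij_betw_def r_def)
    then obtain x h where x: "x \<in> X" "h \<in> F x" "b i = f x h" unfolding Y_def by blast
    then have h: "h \<in> carrier G" "b i \<in> snd M h" using F[OF x(1)] by auto
    obtain u e where "u \<in> Units B" "u \<in> gr (D e \<otimes>\<^bsub>G\<^esub> inv\<^bsub>G\<^esub> h)" using unit_deg[OF h(1)] by blast
    then show ?thesis using h by (intro exI[of _ h] exI[of _ u] exI[of _ e]) simp
  qed
  then obtain g u e where gu: "\<And>i. i < r \<Longrightarrow> g i \<in> carrier G \<and> b i \<in> snd M (g i) \<and> u i \<in> Units B \<and> u i \<in> gr (D (e i) \<otimes>\<^bsub>G\<^esub> inv\<^bsub>G\<^esub> g i)"
    by metis
  define y where "y i = u i \<odot>\<^bsub>fst M\<^esub> b i" for i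
  have yD: "y i \<in> snd M (D (e i))" if "i < r" for i
  proof -
    have "y i \<in> snd M ((D (e i) \<otimes>\<^bsub>G\<^esub> inv\<^bsub>G\<^esub> g i) \<otimes>\<^bsub>G\<^esub> g i)" unfolding y_def
      using gu[OF that] D_closed by (intro DM(4)) auto
    then show ?thesis using gu[OF that] D_closed by (simp add: G.m_assoc)
  qed
  have yc: "y i \<in> gcarrier M" if "i < r" for i using yD[OF that] sub D_closed by blast
  let ?L = "lmap (fst M) r y"
  define S where "S = ?L ` carrier (fm r)"
  have add: "a \<oplus>\<^bsub>fst M\<^esub> c \<in> S" if ac: "a \<in> S" "c \<in> S" for a c
  proof -
    obtain a' c' where *: "a' \<in> carrier (fm r)" "a = ?L a'" "c' \<in> carrier (fm r)" "c = ?L c'" using ac by (auto simp: S_def)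
    have "?L (a' \<oplus>\<^bsub>fm r\<^esub> c') = a \<oplus>\<^bsub>fst M\<^esub> c"
      using lmap_add[OF DM(1) yc the_elem_carrier[OF *(1)] the_elem_carrier[OF *(3)]] * by simp
    then show ?thesis using abelian_monoid.a_closed[OF abelian_group.axioms(1)[OF fm_ag] *(1,3)] unfolding S_def by blast
  qed
  have smul: "a \<odot>\<^bsub>fst M\<^esub> c \<in> S" if ac: "a \<in> carrier B" "c \<in> S" for a c
  proof -
    obtain c' where *: "c' \<in> carrier (fm r)" "c = ?L c'" using ac by (auto simp: S_def)
    have "?L (a \<odot>\<^bsub>fm r\<^esub> c') = a \<odot>\<^bsub>fst M\<^esub> c"
      using lmap_smult[OF DM(1) yc the_elem_carrier[OF *(1)] ac(1)] * by simp
    then show ?thesis using module.smult_closed[OF module_fm ac(1) *(1)] unfolding S_def by blast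
  qed
  have Sc: "S \<subseteq> gcarrier M" unfolding S_def
    by (intro image_subsetI lmap_closed[OF DM(1) yc]) (auto intro: the_elem_carrier)
  have sum: "finsum (fst M) q I \<in> S" if "finite I" "\<And>i. i \<in> I \<Longrightarrow> q i \<in> S" for q and I :: "'z set"
    using that
  proof (induction I rule: finite_induct)
    case empty
    have z: "\<zero>\<^bsub>fm r\<^esub> \<in> carrier (fm r)" by (simp add: V_closed)
    have "?L (\<zero>\<^bsub>B\<^esub> \<odot>\<^bsub>fm r\<^esub> \<zero>\<^bsub>fm r\<^esub>) = \<zero>\<^bsub>B\<^esub> \<odot>\<^bsub>fst M\<^esub> ?L \<zero>\<^bsub>fm r\<^esub>"
      using lmap_smult[OF DM(1) yc the_elem_carrier[OF z] B.zero_closed] by simp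
    also have "\<dots> = \<zero>\<^bsub>fst M\<^esub>" by (rule M.smult_l_null[OF lmap_closed[OF DM(1) yc the_elem_carrier[OF z]]])
    finally have e: "\<zero>\<^bsub>fst M\<^esub> = ?L (\<zero>\<^bsub>B\<^esub> \<odot>\<^bsub>fm r\<^esub> \<zero>\<^bsub>fm r\<^esub>)" ..
    show ?case unfolding S_def M.finsum_empty by (rule image_eqI[where f = ?L, OF e module.smult_closed[OF module_fm B.zero_closed z]])
  next
    case (insert i I)
    then have "finsum (fst M) q (insert i I) = q i \<oplus>\<^bsub>fst M\<^esub> finsum (fst M) q I"
      using Sc by (intro M.finsum_insert) auto
    then show ?case using insert add by simp
  qed
  have bS: "b i \<in> S" if i: "i < r" for i
  proof -
    have ui: "u i \<in> Units B" using gu i by blast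
    have uc: "u i \<in> carrier B" "inv\<^bsub>B\<^esub> u i \<in> carrier B" using ui by (simp_all add: B.Units_closed)
    have bc: "b i \<in> gcarrier M" using gu i sub by blast
    have "?L (eb i) = finsum (fst M) (\<lambda>j. if i = j then y j else \<zero>\<^bsub>fst M\<^esub>) {..<r}"
      unfolding lmap_def using yc by (intro M.finsum_cong') (auto simp: eb_def)
    also have "\<dots> = y i" using i yc by (intro M.add.finprod_singleton) auto
    finally have e: "y i = ?L (eb i)" ..
    have "y i \<in> S" unfolding S_def by (rule image_eqI[where f = ?L, OF e eb_carrier[OF i]])
    then have "inv\<^bsub>B\<^esub> u i \<odot>\<^bsub>fst M\<^esub> y i \<in> S" by (rule smul[OF uc(2)])
    then show ?thesis unfolding y_def using M.smult_assoc1[OF uc(2,1) bc] M.smult_one[OF bc] ui by simp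
  qed
  have YS: "Y \<subseteq> S"
  proof
    fix z assume "z \<in> Y"
    then have "z \<in> b ` {0..<r}" using b by (simp add: bij_betw_def r_def)
    then show "z \<in> S" using bS by auto
  qed
  have XS: "x \<in> S" if "x \<in> X" for x
  proof -
    have "finsum (fst M) (f x) (F x) \<in> S" using F[OF that] YS that by (intro sum) (auto simp: Y_def)
    then show ?thesis using F[OF that] by simp
  qed
  have "m \<in> S" if m: "m \<in> gcarrier M" for m
  proof -
    obtain c where c: "c \<in> X \<rightarrow> carrier B" "m = (\<Oplus>\<^bsub>fst M\<^esub>x\<in>X. c x \<odot>\<^bsub>fst M\<^esub> x)" using bspec[OF X(3) m] by blast
    show ?thesis unfolding c(2) using c(1) XS by (intro sum X(1) smul) auto
  qed
  then show ?thesis using yD unfolding S_def by (intro exI[of _ r] exI[of _ e] exI[of _ y]) blast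
qed

text \<open>K consists of the homogeneous relations over A among the generators y of M. Mapped to B
  by \<phi>, its resolution over A becomes one of M by \<open>exact_step\<close>; injectivity of
  \<phi> ensures that a vector over A is a relation as soon as its image is one.\<close>

theorem proj_dim_le: 
  assumes M: "fg_gmod G B gr M" shows "proj_dim_le G B gr n M"
proof -
  note DM = fg_gmodD[OF M]
  interpret M: module B "fst M" by (rule DM(1))
  have ag: "abelian_group (fst M)" by (rule M.abelian_group_axioms)
  from homogeneous_generators[OF M] obtain r gs y where
    hg: "(\<forall>i<r. y i \<in> snd M (D (gs i))) \<and> (\<forall>m\<in>gcarrier M. \<exists>x\<in>carrier (fm r). lmap (fst M) r y x = m)"
    by (elim exE) (rule that)
  have y: "y i \<in> snd M (D (gs i))" if "i < r" for i using hg that by simp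
  have surj: "\<exists>x\<in>carrier (fm r). lmap (fst M) r y x = m" if "m \<in> gcarrier M" for m using hg that by simp
  have yc: "y i \<in> gcarrier M" if "i < r" for i
    using y[OF that] additive_subgroup_simps(1)[OF ag graded_sumD(1)[OF DM(2) D_closed]] by blast
  let ?e = "lmap (fst M) r y"
  define K where "K h = {w \<in> vecs A r. H.hv gs h w \<and> ?e (ph w) = \<zero>\<^bsub>fst M\<^esub>}" for h
  have eh: "?e \<in> gmod_hom G B (fm r, fm_gr r (\<lambda>i. D (gs i))) M" by (rule lmap_gmod_hom[OF D_closed M y])
  note e = gmod_homD[OF eh, unfolded fst_conv snd_conv]
  have K: "H.gsub A r gs K"
    unfolding H.gsub_def
  proof (intro conjI allI impI ballI subsetI)
    fix h
    have "?e (ph (\<lambda>i. 0)) = ?e (\<zero>\<^bsub>B\<^esub> \<odot>\<^bsub>fm r\<^esub> \<zero>\<^bsub>fm r\<^esub>)" by (simp add: ph_def \<phi>_0)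
    also have "\<dots> = \<zero>\<^bsub>B\<^esub> \<odot>\<^bsub>fst M\<^esub> ?e \<zero>\<^bsub>fm r\<^esub>" by (rule e(3)) (auto simp: V_closed)
    also have "\<dots> = \<zero>\<^bsub>fst M\<^esub>" using e(1) by (intro M.smult_l_null funcset_mem[OF e(1)]) (simp add: V_closed)
    finally show "(\<lambda>i. 0) \<in> K h" by (simp add: K_def H.vecs_closed[OF A] H.hv_0)
  next
    fix h v w assume "v \<in> K h" "w \<in> K h"
    then show "(\<lambda>i. v i + w i) \<in> K h"
      using e(2)[OF ph_carrier ph_carrier] by (simp add: K_def H.vecs_closed[OF A] H.hv_add ph_add[of _ r] del: fm_simps)
  next
    fix f e' h v assume f: "f \<in> A" "v \<in> K h" "hom e' f"
    then show "(\<lambda>i. f * v i) \<in> K (e' + h)"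
      using e(3)[OF \<phi>_closed ph_carrier] H.hv_mult[OF f(3) _ refl, of gs h v] by (simp add: K_def H.vecs_closed[OF A] ph_mult[of _ _ r] \<phi>_closed del: fm_simps)
  next
    fix h h' assume "\<forall>c. hom (h + c) = hom (h' + c)"
    then have "H.hv gs h = H.hv gs h'" by (intro H.hv_shift_cong) simp
    then show "K h = K h'" by (simp add: K_def)
  qed (auto simp: K_def)
  have "H.fr A n gs K" using syz K by (simp add: H.syz_def)
  from H.fr_resolution[OF A this K] obtain R E Xs where RE: "R 0 = r \<and> E 0 = gs \<and> H.gens A (E 0) K (R 1) (Xs 0) (E 1) \<and>
    (\<forall>k. H.gens A (E (Suc k)) (H.rels A (R (Suc k)) (Xs k) (E (Suc k))) (R (Suc (Suc k))) (Xs (Suc k)) (E (Suc (Suc k)))) \<and>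
    (\<forall>k>n. R k = 0)" by (elim exE) (rule that)
  have R: "R 0 = r" "E 0 = gs" "H.gens A (E 0) K (R 1) (Xs 0) (E 1)" using RE by - (elim conjE, assumption)+
  have R4: "H.gens A (E (Suc k)) (H.rels A (R (Suc k)) (Xs k) (E (Suc k))) (R (Suc (Suc k))) (Xs (Suc k)) (E (Suc (Suc k)))" for k
    using RE by (elim conjE) (erule spec)
  have R5: "R k = 0" if "k > n" for k using RE that by (elim conjE) simp
  define P where "P k = (fm (R k), fm_gr (R k) (\<lambda>i. D (E k i)))" for k
  define \<delta> where "\<delta> k = lmap (fm (R k)) (R (Suc k)) (\<lambda>j. ph (Xs k j))" for k
  have Xs: "Xs k j \<in> vecs A (R k) \<and> H.hv (E k) (E (Suc k) j) (Xs k j)" if "j < R (Suc k)" for k j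
  proof (cases k)
    case 0
    then have "Xs 0 j \<in> K (E 1 j)" using R(3) that by (simp add: H.gens_def)
    then show ?thesis using 0 R(1,2) by (simp add: K_def)
  next
    case (Suc k')
    then have "Xs k j \<in> H.rels A (R (Suc k')) (Xs k') (E (Suc k')) (E (Suc k) j)" using R4[of k'] that by (simp add: H.gens_def)
    then show ?thesis using Suc by (simp add: H.rels_def)
  qed
  have Pfg: "fg_gmod G B gr (P k)" for k unfolding P_def by (rule fg_gmod_fm[OF D_closed])
  have \<delta>h: "\<delta> k \<in> gmod_hom G B (P (Suc k)) (P k)" for k
  proof -
    have "lmap (fst (P k)) (R (Suc k)) (\<lambda>j. ph (Xs k j)) \<in> gmod_hom G B (fm (R (Suc k)), fm_gr (R (Suc k)) (\<lambda>i. D (E (Suc k) i))) (P k)"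
      by (rule lmap_gmod_hom[OF D_closed Pfg]) (use Xs ph_gr in \<open>auto simp: P_def\<close>)
    then show ?thesis by (simp add: P_def \<delta>_def)
  qed
  have ex0: "{x \<in> carrier (fm r). ?e x = \<zero>\<^bsub>fst M\<^esub>} = \<delta> 0 ` carrier (fm (R 1))"
    unfolding \<delta>_def R(1) One_nat_def
    by (rule exact_step[OF DM(1,2) e, where K = K and hs = "E 1"]) (use R(1-3) in \<open>auto simp: K_def\<close>)
  have exk: "{x \<in> carrier (fm (R (Suc k))). \<delta> k x = \<zero>\<^bsub>fm (R k)\<^esub>} = \<delta> (Suc k) ` carrier (fm (R (Suc (Suc k))))" for k
  proof -
    note d = gmod_homD[OF \<delta>h[of k], unfolded P_def fst_conv snd_conv]
    show ?thesis unfolding \<delta>_def[of "Suc k"]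
    proof (rule exact_step[OF module_fm fm_graded_sum[OF D_closed] d _ _ R4])
      fix h w assume w: "w \<in> vecs A (R (Suc k))" "H.hv (E (Suc k)) h w"
      have l: "\<delta> k (ph w) = ph (lincomb (R (Suc k)) (Xs k) w)"
        unfolding \<delta>_def by (rule lmap_ph[OF w(1)]) (use Xs in blast)
      have lh: "H.hv (E k) h (lincomb (R (Suc k)) (Xs k) w)"
        by (rule H.hv_lincomb[OF _ w(2)]) (use Xs in blast)
      have lA: "lincomb (R (Suc k)) (Xs k) w i \<in> A" for i
        using lincomb_vecs[OF w(1), of "R (Suc k)" "Xs k" "R k"] Xs by (simp add: vecs_def)
      have "\<delta> k (ph w) = \<zero>\<^bsub>fm (R k)\<^esub> \<longleftrightarrow> lincomb (R (Suc k)) (Xs k) w = (\<lambda>i. 0)"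
      proof
        assume "\<delta> k (ph w) = \<zero>\<^bsub>fm (R k)\<^esub>"
        then have "\<phi> (lincomb (R (Suc k)) (Xs k) w i) = \<zero>\<^bsub>B\<^esub>" for i unfolding l by (simp add: ph_def fun_eq_iff)
        then show "lincomb (R (Suc k)) (Xs k) w = (\<lambda>i. 0)" using \<phi>_inj[OF lA] lh unfolding H.hv_def by blast
      qed (use l ph_0 in simp)
      then show "w \<in> H.rels A (R (Suc k)) (Xs k) (E (Suc k)) h \<longleftrightarrow> \<delta> k (ph w) = \<zero>\<^bsub>fm (R k)\<^esub>"
        using w by (simp add: H.rels_def)
    qed (auto simp: H.rels_def)
  qed
  show ?thesis
    unfolding proj_dim_le_def
  proof (intro exI[of _ P] exI[of _ \<delta>] exI[of _ ?e] conjI allI impI)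
    fix i show "projective_gmod G B gr (P i)" unfolding P_def by (rule projective_fm[OF D_closed])
  next
    fix i assume "n < i"
    then show "gcarrier (P i) = {\<zero>\<^bsub>fst (P i)\<^esub>}" using R5[of i] by (auto simp: P_def fm_def V_def)
  next
    show "?e \<in> gmod_hom G B (P 0) M" using eh by (simp add: P_def R)
    show "?e ` gcarrier (P 0) = gcarrier M" using e(1) surj by (force simp: P_def R)
    show "{x \<in> gcarrier (P 0). ?e x = \<zero>\<^bsub>fst M\<^esub>} = \<delta> 0 ` gcarrier (P 1)" using ex0 by (simp add: P_def R)
  next
    fix i show "{x \<in> gcarrier (P (Suc i)). \<delta> i x = \<zero>\<^bsub>fst (P i)\<^esub>} = \<delta> (Suc i) ` gcarrier (P (Suc (Suc i)))"
      using exk[of i] by (simp add: P_def)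
  qed (rule \<delta>h)
qed

theorem G_regular: "G_regular G B gr" unfolding G_regular_def using proj_dim_le by blast

end

section \<open>Graded localization\<close>

locale localized_cring = cring A for A :: "('a, 'w) ring_scheme" (structure) +
  fixes S :: "'a set"
  assumes S_carrier: "S \<subseteq> carrier A" and S_one: "\<one> \<in> S" and S_mult: "s \<in> S \<Longrightarrow> t \<in> S \<Longrightarrow> s \<otimes> t \<in> S"
begin

lemma Sc [simp]: "s \<in> S \<Longrightarrow> s \<in> carrier A" using S_carrier by blast

lemma frac_rel_iff: "((a, s), (b, t)) \<in> frac_rel A S \<longleftrightarrow>
  a \<in> carrier A \<and> s \<in> S \<and> b \<in> carrier A \<and> t \<in> S \<and> (\<exists>u\<in>S. u \<otimes> (a \<otimes> t) = u \<otimes> (b \<otimes> s))"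
proof -
  have "u \<otimes> (a \<otimes> t \<ominus> b \<otimes> s) = \<zero> \<longleftrightarrow> u \<otimes> (a \<otimes> t) = u \<otimes> (b \<otimes> s)"
    if "u \<in> S" "a \<in> carrier A" "b \<in> carrier A" "s \<in> S" "t \<in> S" for u
  proof -
    have "u \<otimes> (a \<otimes> t \<ominus> b \<otimes> s) = u \<otimes> (a \<otimes> t) \<ominus> u \<otimes> (b \<otimes> s)"
      using that by (simp add: minus_eq r_distr r_minus)
    then show ?thesis using a_minus_eq_zero_iff[OF is_abelian_group, of "u \<otimes> (a \<otimes> t)" "u \<otimes> (b \<otimes> s)"] that by simp
  qed
  then show ?thesis unfolding frac_rel_def by auto
qed

lemma equiv_frac_rel: "equiv (carrier A \<times> S) (frac_rel A S)"
proof (rule equivI)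
  show "frac_rel A S \<subseteq> (carrier A \<times> S) \<times> (carrier A \<times> S)" by (auto simp: frac_rel_iff)
  show "refl_on (carrier A \<times> S) (frac_rel A S)"
    unfolding refl_on_def using S_one by (auto simp: frac_rel_iff)
  show "sym (frac_rel A S)" unfolding sym_def by (auto simp: frac_rel_iff) metis
  show "trans (frac_rel A S)"
    unfolding trans_def
  proof (intro allI impI)
    fix x y z assume xy: "(x, y) \<in> frac_rel A S" and yz: "(y, z) \<in> frac_rel A S"
    obtain a s b t c r where p: "x = (a, s)" "y = (b, t)" "z = (c, r)" by (metis surj_pair)
    obtain u where u: "u \<in> S" "u \<otimes> (a \<otimes> t) = u \<otimes> (b \<otimes> s)" "a \<in> carrier A" "s \<in> S" "b \<in> carrier A" "t \<in> S"
      using xy unfolding p frac_rel_iff by blast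
    obtain v where v: "v \<in> S" "v \<otimes> (b \<otimes> r) = v \<otimes> (c \<otimes> t)" "c \<in> carrier A" "r \<in> S"
      using yz unfolding p frac_rel_iff by blast
    have "(u \<otimes> v \<otimes> t) \<otimes> (a \<otimes> r) = (u \<otimes> (a \<otimes> t)) \<otimes> (v \<otimes> r)" using u(1,3-) v(1,3-) by (simp add: m_ac)
    also have "\<dots> = (u \<otimes> s) \<otimes> (v \<otimes> (b \<otimes> r))" unfolding u(2) using u(1,3-) v(1,3-) by (simp add: m_ac)
    also have "\<dots> = (u \<otimes> v \<otimes> t) \<otimes> (c \<otimes> s)" unfolding v(2) using u(1,3-) v(1,3-) by (simp add: m_ac)
    finally show "(x, z) \<in> frac_rel A S" unfolding p frac_rel_iff using u v S_mult by blast
  qed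
qed

abbreviation "fr \<equiv> frac A S"
abbreviation "L \<equiv> localization A S"

lemma frac_eq_iff:
  assumes "a \<in> carrier A" "s \<in> S" "b \<in> carrier A" "t \<in> S"
  shows "fr a s = fr b t \<longleftrightarrow> (\<exists>u\<in>S. u \<otimes> (a \<otimes> t) = u \<otimes> (b \<otimes> s))"
proof -
  have "fr a s = fr b t \<longleftrightarrow> ((a, s), (b, t)) \<in> frac_rel A S"
    unfolding frac_def using assms by (intro eq_equiv_class_iff[OF equiv_frac_rel]) auto
  then show ?thesis using assms by (simp add: frac_rel_iff)
qed

lemma frac_eqI: "a \<in> carrier A \<Longrightarrow> s \<in> S \<Longrightarrow> b \<in> carrier A \<Longrightarrow> t \<in> S \<Longrightarrow> a \<otimes> t = b \<otimes> s \<Longrightarrow> fr a s = fr b t"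
  using S_one by (subst frac_eq_iff) (auto intro!: bexI[of _ \<one>])

lemma loc_carrier_iff: "x \<in> carrier L \<longleftrightarrow> (\<exists>a\<in>carrier A. \<exists>s\<in>S. x = fr a s)"
  by (auto simp: localization_def quotient_def frac_def)

lemma loc_cases: "x \<in> carrier L \<Longrightarrow> (\<And>a s. a \<in> carrier A \<Longrightarrow> s \<in> S \<Longrightarrow> x = fr a s \<Longrightarrow> P) \<Longrightarrow> P"
  by (auto simp: loc_carrier_iff)

lemma frac_carrier: "a \<in> carrier A \<Longrightarrow> s \<in> S \<Longrightarrow> fr a s \<in> carrier L" by (auto simp: loc_carrier_iff)

lemma in_frac_iff: "a \<in> carrier A \<Longrightarrow> s \<in> S \<Longrightarrow> (b, t) \<in> fr a s \<longleftrightarrow> b \<in> carrier A \<and> t \<in> S \<and> fr b t = fr a s"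
  unfolding frac_def using equiv_class_eq_iff[OF equiv_frac_rel, of "(a, s)" "(b, t)"] by auto

text \<open>The operations of \<open>localization\<close> are unions over all representatives; this
  lemma reduces them to the value at one representative.\<close>

lemma UN_frac:
  assumes "a \<in> carrier A" "s \<in> S" "\<And>b t. b \<in> carrier A \<Longrightarrow> t \<in> S \<Longrightarrow> fr b t = fr a s \<Longrightarrow> f b t = C"
  shows "(\<Union>(b, t)\<in>fr a s. f b t) = C"
proof -
  have "(a, s) \<in> fr a s" using assms by (simp add: in_frac_iff)
  then show ?thesis using assms in_frac_iff[OF assms(1,2)] by fastforce
qed

lemma mult_frac:
  assumes a: "a \<in> carrier A" "s \<in> S" and b: "b \<in> carrier A" "t \<in> S"
  shows "fr a s \<otimes>\<^bsub>L\<^esub> fr b t = fr (a \<otimes> b) (s \<otimes> t)"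
proof -
  have "fr a s \<otimes>\<^bsub>L\<^esub> fr b t = (\<Union>(a', s')\<in>fr a s. \<Union>(b', t')\<in>fr b t. fr (a' \<otimes> b') (s' \<otimes> t'))"
    by (simp add: localization_def)
  also have "\<dots> = fr (a \<otimes> b) (s \<otimes> t)"
  proof (intro UN_frac a b)
    fix a' s' b' t' assume a': "a' \<in> carrier A" "s' \<in> S" "fr a' s' = fr a s" and b': "b' \<in> carrier A" "t' \<in> S" "fr b' t' = fr b t"
    obtain u where u: "u \<in> S" "u \<otimes> (a' \<otimes> s) = u \<otimes> (a \<otimes> s')" using a' a by (auto simp: frac_eq_iff)
    obtain v where v: "v \<in> S" "v \<otimes> (b' \<otimes> t) = v \<otimes> (b \<otimes> t')" using b' b by (auto simp: frac_eq_iff)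
    have "(u \<otimes> v) \<otimes> ((a' \<otimes> b') \<otimes> (s \<otimes> t)) = (u \<otimes> (a' \<otimes> s)) \<otimes> (v \<otimes> (b' \<otimes> t))" using u(1) v(1) a b a'(1,2) b'(1,2) by (simp add: m_ac)
    also have "\<dots> = (u \<otimes> v) \<otimes> ((a \<otimes> b) \<otimes> (s' \<otimes> t'))" unfolding u(2) v(2) using u(1) v(1) a b a'(1,2) b'(1,2) by (simp add: m_ac)
    finally show "fr (a' \<otimes> b') (s' \<otimes> t') = fr (a \<otimes> b) (s \<otimes> t)"
      using u v a b a' b' S_mult by (subst frac_eq_iff) (auto intro!: bexI[of _ "u \<otimes> v"])
  qed
  finally show ?thesis .
qed

lemma add_frac:
  assumes a: "a \<in> carrier A" "s \<in> S" and b: "b \<in> carrier A" "t \<in> S"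
  shows "fr a s \<oplus>\<^bsub>L\<^esub> fr b t = fr (a \<otimes> t \<oplus> b \<otimes> s) (s \<otimes> t)"
proof -
  have "fr a s \<oplus>\<^bsub>L\<^esub> fr b t = (\<Union>(a', s')\<in>fr a s. \<Union>(b', t')\<in>fr b t. fr (a' \<otimes> t' \<oplus> b' \<otimes> s') (s' \<otimes> t'))"
    by (simp add: localization_def)
  also have "\<dots> = fr (a \<otimes> t \<oplus> b \<otimes> s) (s \<otimes> t)"
  proof (intro UN_frac a b)
    fix a' s' b' t' assume a': "a' \<in> carrier A" "s' \<in> S" "fr a' s' = fr a s" and b': "b' \<in> carrier A" "t' \<in> S" "fr b' t' = fr b t"
    obtain u where u: "u \<in> S" "u \<otimes> (a' \<otimes> s) = u \<otimes> (a \<otimes> s')" using a' a by (auto simp: frac_eq_iff)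
    obtain v where v: "v \<in> S" "v \<otimes> (b' \<otimes> t) = v \<otimes> (b \<otimes> t')" using b' b by (auto simp: frac_eq_iff)
    have "(u \<otimes> v) \<otimes> ((a' \<otimes> t' \<oplus> b' \<otimes> s') \<otimes> (s \<otimes> t)) =
      (u \<otimes> (a' \<otimes> s)) \<otimes> (v \<otimes> t \<otimes> t') \<oplus> (v \<otimes> (b' \<otimes> t)) \<otimes> (u \<otimes> s \<otimes> s')" using u(1) v(1) a b a'(1,2) b'(1,2) by (simp add: l_distr r_distr m_ac)
    also have "\<dots> = (u \<otimes> v) \<otimes> ((a \<otimes> t \<oplus> b \<otimes> s) \<otimes> (s' \<otimes> t'))" unfolding u(2) v(2) using u(1) v(1) a b a'(1,2) b'(1,2) by (simp add: l_distr r_distr m_ac)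
    finally show "fr (a' \<otimes> t' \<oplus> b' \<otimes> s') (s' \<otimes> t') = fr (a \<otimes> t \<oplus> b \<otimes> s) (s \<otimes> t)"
      using u v a b a' b' S_mult by (subst frac_eq_iff) (auto intro!: bexI[of _ "u \<otimes> v"])
  qed
  finally show ?thesis .
qed

lemma add_frac_same:
  assumes "a \<in> carrier A" "s \<in> S" "b \<in> carrier A"
  shows "fr a s \<oplus>\<^bsub>L\<^esub> fr b s = fr (a \<oplus> b) s"
  unfolding add_frac[OF assms assms(2)] using assms S_mult by (intro frac_eqI) (auto simp: l_distr r_distr m_ac)

lemma loc_one: "\<one>\<^bsub>L\<^esub> = fr \<one> \<one>" and loc_zero: "\<zero>\<^bsub>L\<^esub> = fr \<zero> \<one>"
  by (simp_all add: localization_def)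

lemma frac_zero: "s \<in> S \<Longrightarrow> fr \<zero> s = \<zero>\<^bsub>L\<^esub>"
  unfolding loc_zero by (rule frac_eqI) (auto simp: S_one)

lemma frac_eq_zero_iff: "a \<in> carrier A \<Longrightarrow> s \<in> S \<Longrightarrow> fr a s = \<zero>\<^bsub>L\<^esub> \<longleftrightarrow> (\<exists>u\<in>S. u \<otimes> a = \<zero>)"
  unfolding loc_zero using S_one by (subst frac_eq_iff) auto

lemma cring_loc: "cring L"
proof (rule cringI)
  show "abelian_group L"
  proof (rule abelian_groupI)
    fix x y assume "x \<in> carrier L" "y \<in> carrier L"
    then obtain a s b t where x: "x = fr a s" "a \<in> carrier A" "s \<in> S" "y = fr b t" "b \<in> carrier A" "t \<in> S" by (auto elim!: loc_cases)
    show "x \<oplus>\<^bsub>L\<^esub> y \<in> carrier L" "x \<oplus>\<^bsub>L\<^esub> y = y \<oplus>\<^bsub>L\<^esub> x" unfolding x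
      using x S_mult by (auto simp: add_frac frac_carrier a_comm m_comm)
    fix z assume "z \<in> carrier L"
    then obtain c r where z: "z = fr c r" "c \<in> carrier A" "r \<in> S" by (auto elim!: loc_cases)
    show "x \<oplus>\<^bsub>L\<^esub> y \<oplus>\<^bsub>L\<^esub> z = x \<oplus>\<^bsub>L\<^esub> (y \<oplus>\<^bsub>L\<^esub> z)" unfolding x z
      using x z S_mult by (simp add: add_frac, intro frac_eqI) (auto simp: l_distr r_distr m_ac a_ac)
  next
    show "\<zero>\<^bsub>L\<^esub> \<in> carrier L" unfolding loc_zero using S_one by (intro frac_carrier) auto
  next
    fix x assume "x \<in> carrier L"
    then obtain a s where x: "x = fr a s" "a \<in> carrier A" "s \<in> S" by (auto elim!: loc_cases)
    show "\<zero>\<^bsub>L\<^esub> \<oplus>\<^bsub>L\<^esub> x = x" unfolding x loc_zero using x S_one by (simp add: add_frac)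
    show "\<exists>y\<in>carrier L. y \<oplus>\<^bsub>L\<^esub> x = \<zero>\<^bsub>L\<^esub>"
      by (rule bexI[of _ "fr (\<ominus> a) s"]) (use x in \<open>auto simp: add_frac_same l_neg frac_zero frac_carrier\<close>)
  qed
  show "Group.comm_monoid L"
  proof (rule comm_monoidI)
    fix x y assume "x \<in> carrier L" "y \<in> carrier L"
    then obtain a s b t where x: "x = fr a s" "a \<in> carrier A" "s \<in> S" "y = fr b t" "b \<in> carrier A" "t \<in> S" by (auto elim!: loc_cases)
    show "x \<otimes>\<^bsub>L\<^esub> y \<in> carrier L" "x \<otimes>\<^bsub>L\<^esub> y = y \<otimes>\<^bsub>L\<^esub> x" unfolding x
      using x S_mult by (auto simp: mult_frac frac_carrier m_comm)
    fix z assume "z \<in> carrier L"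
    then obtain c r where z: "z = fr c r" "c \<in> carrier A" "r \<in> S" by (auto elim!: loc_cases)
    show "x \<otimes>\<^bsub>L\<^esub> y \<otimes>\<^bsub>L\<^esub> z = x \<otimes>\<^bsub>L\<^esub> (y \<otimes>\<^bsub>L\<^esub> z)" unfolding x z
      using x z S_mult by (simp add: mult_frac m_assoc)
  next
    show "\<one>\<^bsub>L\<^esub> \<in> carrier L" unfolding loc_one using S_one by (intro frac_carrier) auto
  next
    fix x assume "x \<in> carrier L"
    then obtain a s where x: "x = fr a s" "a \<in> carrier A" "s \<in> S" by (auto elim!: loc_cases)
    show "\<one>\<^bsub>L\<^esub> \<otimes>\<^bsub>L\<^esub> x = x" unfolding x loc_one using x S_one by (simp add: mult_frac)
  qed
  fix x y z assume "x \<in> carrier L" "y \<in> carrier L" "z \<in> carrier L"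
  then obtain a s b t c r where x: "x = fr a s" "a \<in> carrier A" "s \<in> S" "y = fr b t" "b \<in> carrier A" "t \<in> S"
     "z = fr c r" "c \<in> carrier A" "r \<in> S" by (auto elim!: loc_cases)
  show "(x \<oplus>\<^bsub>L\<^esub> y) \<otimes>\<^bsub>L\<^esub> z = x \<otimes>\<^bsub>L\<^esub> z \<oplus>\<^bsub>L\<^esub> y \<otimes>\<^bsub>L\<^esub> z" unfolding x
    using x S_mult by (simp add: add_frac mult_frac, intro frac_eqI) (auto simp: l_distr r_distr m_ac)
qed

lemma frac_unit: assumes "s \<in> S" "t \<in> S" shows "fr s t \<in> Units L"
proof -
  have *: "fr s t \<otimes>\<^bsub>L\<^esub> fr t s = \<one>\<^bsub>L\<^esub>" if "s \<in> S" "t \<in> S" for s t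
    using that S_mult S_one by (simp add: mult_frac loc_one, intro frac_eqI) (auto simp: m_ac)
  have "fr s t \<otimes>\<^bsub>L\<^esub> fr t s = \<one>\<^bsub>L\<^esub>" "fr t s \<otimes>\<^bsub>L\<^esub> fr s t = \<one>\<^bsub>L\<^esub>" using * assms by auto
  then show ?thesis using assms frac_carrier[of s t] frac_carrier[of t s] unfolding Units_def by auto
qed

lemma frac_uminus: assumes "a \<in> carrier A" "s \<in> S" shows "\<ominus>\<^bsub>L\<^esub> fr a s = fr (\<ominus> a) s"
proof -
  interpret L: cring L by (rule cring_loc)
  show ?thesis using assms by (intro L.minus_equality) (auto simp: add_frac_same l_neg frac_zero frac_carrier)
qed

end

text \<open>The point is independence. Finitely many homogeneous fractions are given one homogeneous
  denominator s; if their sum vanishes, some u in S kills the sum of the numerators. Multiplied by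
  u, the numerators are elements of distinct degrees of the original ring, so u kills each of them.
  Common denominators are also what closure under addition rests on.\<close>

lemma graded_cring_localization:
  fixes A :: "('a, 'w) ring_scheme"
  assumes G: "comm_group G" and A: "cring A" and gs: "graded_sum G A gr"
    and gm: "\<And>g h a b. g \<in> carrier G \<Longrightarrow> h \<in> carrier G \<Longrightarrow> a \<in> gr g \<Longrightarrow> b \<in> gr h \<Longrightarrow> a \<otimes>\<^bsub>A\<^esub> b \<in> gr (g \<otimes>\<^bsub>G\<^esub> h)"
    and g1: "\<one>\<^bsub>A\<^esub> \<in> gr \<one>\<^bsub>G\<^esub>"
    and S: "localized_cring A S" and Sh: "S \<subseteq> homogeneous_elements G gr" and S0: "\<zero>\<^bsub>A\<^esub> \<notin> S"
  shows "graded_cring G (localization A S) (loc_grading G A gr S)"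
proof -
  interpret G: comm_group G by fact
  interpret localized_cring A S by fact
  interpret L: cring L by (rule cring_loc)
  let ?g = "loc_grading G A gr S"
  have Aag: "abelian_group A" by (rule is_abelian_group)
  have Lag: "abelian_group L" by (rule L.is_abelian_group)
  note sA = additive_subgroup_simps[OF Aag graded_sumD(1)[OF gs]]
  have grc: "a \<in> carrier A" if "g \<in> carrier G" "a \<in> gr g" for a g using sA(1) that by blast
  have deg: "\<exists>h\<in>carrier G. s \<in> gr h" if "s \<in> S" for s using Sh that by (auto simp: homogeneous_elements_def)
  have gI: "fr a s \<in> ?g g" if "h \<in> carrier G" "s \<in> S" "s \<in> gr h" "a \<in> gr (g \<otimes>\<^bsub>G\<^esub> h)" for a s g h
    unfolding loc_grading_def using that by blast
  have gE: "\<exists>a s h. h \<in> carrier G \<and> s \<in> S \<and> s \<in> gr h \<and> a \<in> gr (g \<otimes>\<^bsub>G\<^esub> h) \<and> x = fr a s \<and> a \<in> carrier A"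
    if x: "x \<in> ?g g" and g: "g \<in> carrier G" for x g
  proof -
    obtain a s h where "h \<in> carrier G" "s \<in> S" "s \<in> gr h" "a \<in> gr (g \<otimes>\<^bsub>G\<^esub> h)" "x = fr a s" using x unfolding loc_grading_def by blast
    then show ?thesis using grc[of "g \<otimes>\<^bsub>G\<^esub> h" a] g by blast
  qed
  have sub: "additive_subgroup (?g g) L" if g: "g \<in> carrier G" for g
  proof (rule additive_subgroup.intro, rule subgroup.intro)
    show "?g g \<subseteq> carrier (add_monoid L)"
    proof
      fix x assume "x \<in> ?g g"
      from gE[OF this g] show "x \<in> carrier (add_monoid L)" using frac_carrier by auto
    qed
    show "\<one>\<^bsub>add_monoid L\<^esub> \<in> ?g g" unfolding loc_zero[symmetric] using gI[of "\<one>\<^bsub>G\<^esub>" "\<one>\<^bsub>A\<^esub>" "\<zero>\<^bsub>A\<^esub>" g] S_one g1 g sA(2)[OF g] by (simp add: loc_zero)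
    fix x assume "x \<in> ?g g"
    from gE[OF this g] obtain a s h where x: "h \<in> carrier G" "s \<in> S" "s \<in> gr h" "a \<in> gr (g \<otimes>\<^bsub>G\<^esub> h)" "x = fr a s" "a \<in> carrier A" by blast
    have "\<ominus>\<^bsub>L\<^esub> x \<in> ?g g" unfolding x(5) frac_uminus[OF x(6,2)] using x g by (intro gI[of h] sA(4)) auto
    then show "inv\<^bsub>add_monoid L\<^esub> x \<in> ?g g" by (simp add: a_inv_def)
    fix y assume "y \<in> ?g g"
    from gE[OF this g] obtain b t k where y: "k \<in> carrier G" "t \<in> S" "t \<in> gr k" "b \<in> gr (g \<otimes>\<^bsub>G\<^esub> k)" "y = fr b t" "b \<in> carrier A" by blast
    have e: "g \<otimes>\<^bsub>G\<^esub> h \<otimes>\<^bsub>G\<^esub> k = g \<otimes>\<^bsub>G\<^esub> (h \<otimes>\<^bsub>G\<^esub> k)" "g \<otimes>\<^bsub>G\<^esub> k \<otimes>\<^bsub>G\<^esub> h = g \<otimes>\<^bsub>G\<^esub> (h \<otimes>\<^bsub>G\<^esub> k)"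
      using x(1) y(1) g by (simp_all add: G.m_ac)
    have "a \<otimes>\<^bsub>A\<^esub> t \<in> gr (g \<otimes>\<^bsub>G\<^esub> (h \<otimes>\<^bsub>G\<^esub> k))" using gm[of "g \<otimes>\<^bsub>G\<^esub> h" k a t] x y g e by simp
    moreover have "b \<otimes>\<^bsub>A\<^esub> s \<in> gr (g \<otimes>\<^bsub>G\<^esub> (h \<otimes>\<^bsub>G\<^esub> k))" using gm[of "g \<otimes>\<^bsub>G\<^esub> k" h b s] x y g e by simp
    ultimately have "fr (a \<otimes>\<^bsub>A\<^esub> t \<oplus>\<^bsub>A\<^esub> b \<otimes>\<^bsub>A\<^esub> s) (s \<otimes>\<^bsub>A\<^esub> t) \<in> ?g g"
      using x y g S_mult gm[of h k s t] by (intro gI[of "h \<otimes>\<^bsub>G\<^esub> k"] sA(3)) auto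
    then show "x \<otimes>\<^bsub>add_monoid L\<^esub> y \<in> ?g g" using x y by (simp add: add_frac)
  qed
  have "graded_sum G L ?g"
    unfolding graded_sum_def
  proof (intro conjI ballI allI impI)
    fix x assume "x \<in> carrier L"
    then obtain a s where x: "x = fr a s" "a \<in> carrier A" "s \<in> S" by (rule loc_cases)
    obtain h where h: "h \<in> carrier G" "s \<in> gr h" using deg[OF x(3)] by blast
    let ?D = "\<lambda>x. \<exists>F f. finite F \<and> F \<subseteq> carrier G \<and> (\<forall>g\<in>F. f g \<in> ?g g) \<and> x = finsum L f F"
    have hom: "?D y" if "g \<in> carrier G" "y \<in> ?g g" for g y
      using that additive_subgroup_simps(1)[OF Lag sub[OF that(1)]]
      by (intro exI[of _ "{g}"] exI[of _ "\<lambda>_. y"]) auto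
    show "?D x" unfolding x(1)
    proof (rule graded_sum_induct[OF Aag gs x(2), where P = "\<lambda>a. ?D (fr a s)"])
      fix g y assume g: "g \<in> carrier G" "y \<in> gr g"
      have "fr y s \<in> ?g (g \<otimes>\<^bsub>G\<^esub> inv\<^bsub>G\<^esub> h)" using g h x(3) by (intro gI[of h]) (auto simp: G.m_assoc)
      then show "?D (fr y s)" using g h by (intro hom) auto
    next
      show "?D (fr \<zero>\<^bsub>A\<^esub> s)" unfolding frac_zero[OF x(3)]
        by (rule hom[OF G.one_closed]) (rule additive_subgroup_simps(2)[OF Lag sub], simp)
    next
      fix y z assume yz: "y \<in> carrier A" "z \<in> carrier A" "?D (fr y s)" "?D (fr z s)"
      obtain F f F' f' where d: "finite F" "F \<subseteq> carrier G" "\<forall>g\<in>F. f g \<in> ?g g" "fr y s = finsum L f F"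
        "finite F'" "F' \<subseteq> carrier G" "\<forall>g\<in>F'. f' g \<in> ?g g" "fr z s = finsum L f' F'" using yz(3,4) by metis
      show "?D (fr (y \<oplus>\<^bsub>A\<^esub> z) s)" unfolding add_frac_same[OF yz(1) x(3) yz(2), symmetric]
        by (rule decomposition_add[OF Lag _ d]) (rule sub)
    qed
  next
    fix F y g assume F: "finite F" "F \<subseteq> carrier G" "\<forall>g\<in>F. y g \<in> ?g g" "finsum L y F = \<zero>\<^bsub>L\<^esub>" and g: "g \<in> F"
    have "\<exists>s\<in>S. \<exists>k\<in>carrier G. s \<in> gr k \<and> (\<exists>c. \<forall>g\<in>F. c g \<in> gr (g \<otimes>\<^bsub>G\<^esub> k) \<and> y g = fr (c g) s)"
      using F(1-3)
    proof (induction F rule: finite_induct)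
      case empty show ?case using S_one g1 by blast
    next
      case (insert g F)
      then have "\<exists>s\<in>S. \<exists>k\<in>carrier G. s \<in> gr k \<and> (\<exists>c. \<forall>g\<in>F. c g \<in> gr (g \<otimes>\<^bsub>G\<^esub> k) \<and> y g = fr (c g) s)" by simp
      then obtain s k c where s: "s \<in> S" "k \<in> carrier G" "s \<in> gr k" "\<And>g. g \<in> F \<Longrightarrow> c g \<in> gr (g \<otimes>\<^bsub>G\<^esub> k)" "\<And>g. g \<in> F \<Longrightarrow> y g = fr (c g) s" by blast
      have gG: "g \<in> carrier G" using insert.prems by simp
      obtain a t h where a: "h \<in> carrier G" "t \<in> S" "t \<in> gr h" "a \<in> gr (g \<otimes>\<^bsub>G\<^esub> h)" "y g = fr a t" "a \<in> carrier A"
        using gE[of "y g" g] insert.prems by blast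
      define c' where "c' g' = (if g' = g then a \<otimes>\<^bsub>A\<^esub> s else c g' \<otimes>\<^bsub>A\<^esub> t)" for g'
      have "c' g' \<in> gr (g' \<otimes>\<^bsub>G\<^esub> (k \<otimes>\<^bsub>G\<^esub> h)) \<and> y g' = fr (c' g') (s \<otimes>\<^bsub>A\<^esub> t)" if g': "g' \<in> insert g F" for g'
      proof (cases "g' = g")
        case True
        have "a \<otimes>\<^bsub>A\<^esub> s \<in> gr (g \<otimes>\<^bsub>G\<^esub> h \<otimes>\<^bsub>G\<^esub> k)" using a s gG by (intro gm) auto
        moreover have "g \<otimes>\<^bsub>G\<^esub> h \<otimes>\<^bsub>G\<^esub> k = g \<otimes>\<^bsub>G\<^esub> (k \<otimes>\<^bsub>G\<^esub> h)" using a s gG by (simp add: G.m_ac)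
        moreover have "y g = fr (a \<otimes>\<^bsub>A\<^esub> s) (s \<otimes>\<^bsub>A\<^esub> t)" unfolding a(5) using a s S_mult by (intro frac_eqI) (auto simp: m_ac)
        ultimately show ?thesis using True by (simp add: c'_def)
      next
        case False
        then have g'F: "g' \<in> F" "g' \<in> carrier G" using g' insert.prems by auto
        have cg: "c g' \<in> carrier A" using grc[OF _ s(4)[OF g'F(1)]] g'F s(2) by simp
        have "c g' \<otimes>\<^bsub>A\<^esub> t \<in> gr (g' \<otimes>\<^bsub>G\<^esub> k \<otimes>\<^bsub>G\<^esub> h)" using a s g'F by (intro gm) auto
        moreover have "g' \<otimes>\<^bsub>G\<^esub> k \<otimes>\<^bsub>G\<^esub> h = g' \<otimes>\<^bsub>G\<^esub> (k \<otimes>\<^bsub>G\<^esub> h)" using a s g'F by (simp add: G.m_ac)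
        moreover have "y g' = fr (c g' \<otimes>\<^bsub>A\<^esub> t) (s \<otimes>\<^bsub>A\<^esub> t)" unfolding s(5)[OF g'F(1)] using a s cg S_mult by (intro frac_eqI) (auto simp: m_ac)
        ultimately show ?thesis using False by (simp add: c'_def)
      qed
      moreover have "s \<otimes>\<^bsub>A\<^esub> t \<in> gr (k \<otimes>\<^bsub>G\<^esub> h)" using a s by (intro gm) auto
      moreover have "s \<otimes>\<^bsub>A\<^esub> t \<in> S" "k \<otimes>\<^bsub>G\<^esub> h \<in> carrier G" using a s S_mult by auto
      ultimately show ?case by blast
    qed
    then obtain s k c where s: "s \<in> S" "k \<in> carrier G" "s \<in> gr k" and c: "\<And>g. g \<in> F \<Longrightarrow> c g \<in> gr (g \<otimes>\<^bsub>G\<^esub> k)" "\<And>g. g \<in> F \<Longrightarrow> y g = fr (c g) s" by blast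
    have cc: "c g \<in> carrier A" if "g \<in> F" for g using grc[OF _ c(1)[OF that]] that F(2) s(2) by auto
    have "fr (finsum A c F) s = finsum L (\<lambda>g. fr (c g) s) F"
      by (rule finsum_additive_map[OF Aag Lag, where h = "\<lambda>a. fr a s"]) (use cc s(1) in \<open>auto simp: frac_carrier add_frac_same\<close>)
    also have "\<dots> = finsum L y F" using c(2) cc s(1) by (intro L.finsum_cong') (auto simp: frac_carrier)
    finally have "fr (finsum A c F) s = \<zero>\<^bsub>L\<^esub>" unfolding F(4) .
    then obtain u where u: "u \<in> S" "u \<otimes>\<^bsub>A\<^esub> finsum A c F = \<zero>\<^bsub>A\<^esub>" using frac_eq_zero_iff[OF finsum_closed s(1), of c F] cc by auto
    obtain k' where k': "k' \<in> carrier G" "u \<in> gr k'" using deg[OF u(1)] by blast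
    \<comment> \<open>\<open>?q g\<close> is the degree of u times the numerator of the component of
      degree g; \<open>?r\<close> undoes the shift, so distinct degrees stay distinct.\<close>
    let ?q = "\<lambda>g. k' \<otimes>\<^bsub>G\<^esub> (g \<otimes>\<^bsub>G\<^esub> k)" and ?r = "\<lambda>h. inv\<^bsub>G\<^esub> k' \<otimes>\<^bsub>G\<^esub> h \<otimes>\<^bsub>G\<^esub> inv\<^bsub>G\<^esub> k"
    have rq: "?r (?q g) = g" if "g \<in> F" for g
    proof -
      have gG: "g \<in> carrier G" using that F(2) by blast
      have "?r (?q g) = (inv\<^bsub>G\<^esub> k' \<otimes>\<^bsub>G\<^esub> k') \<otimes>\<^bsub>G\<^esub> g \<otimes>\<^bsub>G\<^esub> (k \<otimes>\<^bsub>G\<^esub> inv\<^bsub>G\<^esub> k)"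
        using k'(1) s(2) gG by (simp only: G.m_assoc G.m_closed G.inv_closed)
      then show ?thesis using k'(1) s(2) gG by simp
    qed
    have inj: "inj_on ?q F" by (rule inj_on_inverseI[where g = ?r]) (rule rq)
    let ?f = "\<lambda>h. u \<otimes>\<^bsub>A\<^esub> c (?r h)"
    have fg: "?f h \<in> gr h" if hF: "h \<in> ?q ` F" for h
    proof -
      obtain g where g: "g \<in> F" "h = ?q g" using hF by blast
      have "u \<otimes>\<^bsub>A\<^esub> c g \<in> gr (?q g)" using k' c(1)[OF g(1)] g(1) F(2) s(2) by (intro gm) auto
      then show ?thesis unfolding g(2) rq[OF g(1)] .
    qed
    have qG: "?q ` F \<subseteq> carrier G" using F(2) k'(1) s(2) by auto
    have "finsum A ?f (?q ` F) = finsum A (\<lambda>g. ?f (?q g)) F"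
      by (rule finsum_reindex[OF _ inj]) (use fg qG grc in blast)
    also have "\<dots> = finsum A (\<lambda>g. u \<otimes>\<^bsub>A\<^esub> c g) F" using cc u(1) by (intro finsum_cong') (auto simp: rq)
    also have "\<dots> = u \<otimes>\<^bsub>A\<^esub> finsum A c F" using cc u(1) F(1) by (intro finsum_rdistr[symmetric]) auto
    also have "\<dots> = \<zero>\<^bsub>A\<^esub>" by (rule u(2))
    finally have "\<forall>h\<in>?q ` F. ?f h = \<zero>\<^bsub>A\<^esub>" using F(1) fg qG by (intro graded_sumD(3)[OF gs]) auto
    then have "?f (?q g) = \<zero>\<^bsub>A\<^esub>" using g by blast
    then have "u \<otimes>\<^bsub>A\<^esub> c g = \<zero>\<^bsub>A\<^esub>" unfolding rq[OF g] .
    then show "y g = \<zero>\<^bsub>L\<^esub>" unfolding c(2)[OF g] using frac_eq_zero_iff[OF cc[OF g] s(1)] u(1) by blast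
  qed (rule sub)
  moreover have "x \<otimes>\<^bsub>L\<^esub> y \<in> ?g (g \<otimes>\<^bsub>G\<^esub> g')" if xy: "g \<in> carrier G" "g' \<in> carrier G" "x \<in> ?g g" "y \<in> ?g g'" for g g' x y
  proof -
    obtain a s h where x: "h \<in> carrier G" "s \<in> S" "s \<in> gr h" "a \<in> gr (g \<otimes>\<^bsub>G\<^esub> h)" "x = fr a s" "a \<in> carrier A"
      using gE[OF xy(3,1)] by blast
    obtain b t k where y: "k \<in> carrier G" "t \<in> S" "t \<in> gr k" "b \<in> gr (g' \<otimes>\<^bsub>G\<^esub> k)" "y = fr b t" "b \<in> carrier A"
      using gE[OF xy(4,2)] by blast
    have "a \<otimes>\<^bsub>A\<^esub> b \<in> gr ((g \<otimes>\<^bsub>G\<^esub> h) \<otimes>\<^bsub>G\<^esub> (g' \<otimes>\<^bsub>G\<^esub> k))" using x y xy by (intro gm) auto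
    moreover have "(g \<otimes>\<^bsub>G\<^esub> h) \<otimes>\<^bsub>G\<^esub> (g' \<otimes>\<^bsub>G\<^esub> k) = (g \<otimes>\<^bsub>G\<^esub> g') \<otimes>\<^bsub>G\<^esub> (h \<otimes>\<^bsub>G\<^esub> k)" using x y xy by (simp add: G.m_ac)
    ultimately have "fr (a \<otimes>\<^bsub>A\<^esub> b) (s \<otimes>\<^bsub>A\<^esub> t) \<in> ?g (g \<otimes>\<^bsub>G\<^esub> g')"
      using x y S_mult gm[of h k s t] by (intro gI[of "h \<otimes>\<^bsub>G\<^esub> k"]) auto
    then show ?thesis using x y by (simp add: mult_frac)
  qed
  moreover have "\<one>\<^bsub>L\<^esub> \<in> ?g \<one>\<^bsub>G\<^esub>" unfolding loc_one using g1 S_one by (intro gI[of "\<one>\<^bsub>G\<^esub>"]) auto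
  moreover have "\<one>\<^bsub>L\<^esub> \<noteq> \<zero>\<^bsub>L\<^esub>" unfolding loc_one using frac_eq_zero_iff[OF one_closed S_one] S0 by auto
  ultimately show ?thesis using G cring_loc by (intro graded_cring.intro)
qed

section \<open>The group and the degree\<close>

text \<open>The rows of a are linear forms l_i in the coordinates T_j. The l_i with i \<in> I and
  the T_t with t \<in> J' shall be new coordinates, and c, e express the old ones: T_j = sum_i c_ji
  l_i + sum_t e_jt T_t is the first clause. The other clauses say that this substitution reproduces
  each l_i with i \<in> I and each T_t with t \<in> J'.\<close>

definition complementary :: "('i \<Rightarrow> 'j \<Rightarrow> 'k::field) \<Rightarrow> 'i set \<Rightarrow> 'j set \<Rightarrow> 'j set \<Rightarrow> ('j \<Rightarrow> 'i \<Rightarrow> 'k) \<Rightarrow> ('j \<Rightarrow> 'j \<Rightarrow> 'k) \<Rightarrow> bool" where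
  "complementary a I J J' c e \<longleftrightarrow>
    (\<forall>j\<in>J. \<forall>t\<in>J. (\<Sum>i\<in>I. c j i * a i t) + (if t \<in> J' then e j t else 0) = (if j = t then 1 else 0)) \<and>
    (\<forall>i\<in>I. \<forall>i'\<in>I. (\<Sum>j\<in>J. a i j * c j i') = (if i = i' then 1 else 0)) \<and>
    (\<forall>i\<in>I. \<forall>t\<in>J'. (\<Sum>j\<in>J. a i j * e j t) = 0) \<and>
    (\<forall>j\<in>J'. (\<forall>i\<in>I. c j i = 0) \<and> (\<forall>t\<in>J'. e j t = (if j = t then 1 else 0)))"

lemma complementaryD:
  assumes "complementary a I J J' c e"
  shows "j \<in> J \<Longrightarrow> t \<in> J \<Longrightarrow> (\<Sum>i\<in>I. c j i * a i t) + (if t \<in> J' then e j t else 0) = (if j = t then 1 else 0)"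
    and "i \<in> I \<Longrightarrow> i' \<in> I \<Longrightarrow> (\<Sum>j\<in>J. a i j * c j i') = (if i = i' then 1 else 0)"
    and "i \<in> I \<Longrightarrow> t \<in> J' \<Longrightarrow> (\<Sum>j\<in>J. a i j * e j t) = 0"
    and "j \<in> J' \<Longrightarrow> i \<in> I \<Longrightarrow> c j i = 0"
    and "j \<in> J' \<Longrightarrow> t \<in> J' \<Longrightarrow> e j t = (if j = t then 1 else 0)"
  using assms by (simp_all add: complementary_def)

text \<open>Steinitz exchange, one form at a time. In the coordinates found so far the new form
  reads sum \<gamma>_i l_i + sum \<eta>_t T_t; independence gives s with \<eta>_s \<noteq> 0, and
  T_s is exchanged for the new form.\<close>

lemma complementary_coordinates:
  fixes a :: "'i \<Rightarrow> 'j \<Rightarrow> 'k::field"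
  assumes "finite I" "finite J"
    and "\<And>b. (\<And>j. j \<in> J \<Longrightarrow> (\<Sum>i\<in>I. b i * a i j) = 0) \<Longrightarrow> \<forall>i\<in>I. b i = 0"
  shows "\<exists>J'. J' \<subseteq> J \<and> card J' + card I = card J \<and> (\<exists>c e. complementary a I J J' c e)"
  using assms(1,3)
proof (induction I rule: finite_induct)
  case empty
  show ?case by (intro exI[of _ J] conjI exI[of _ "\<lambda>_ _. 0"] exI[of _ "\<lambda>j t. if j = t then 1 else 0"]) (auto simp: complementary_def)
next
  case (insert i0 I)
  have ind: "\<forall>i\<in>I. b i = 0" if b: "\<And>j. j \<in> J \<Longrightarrow> (\<Sum>i\<in>I. b i * a i j) = 0" for b
  proof -
    have "\<forall>i\<in>insert i0 I. (if i = i0 then 0 else b i) = 0"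
    proof (rule insert.prems)
      fix j assume "j \<in> J"
      have "(\<Sum>i\<in>insert i0 I. (if i = i0 then 0 else b i) * a i j) = (\<Sum>i\<in>I. (if i = i0 then 0 else b i) * a i j)"
        using insert.hyps by simp
      also have "\<dots> = (\<Sum>i\<in>I. b i * a i j)" using insert.hyps by (intro sum.cong) auto
      finally show "(\<Sum>i\<in>insert i0 I. (if i = i0 then 0 else b i) * a i j) = 0" using b[OF \<open>j \<in> J\<close>] by simp
    qed
    then show ?thesis using insert.hyps by (metis insertI2)
  qed
  from insert.IH[OF ind] obtain J' c e where J': "J' \<subseteq> J" "card J' + card I = card J" and ce: "complementary a I J J' c e"
    by blast
  note h1 = complementaryD(1)[OF ce] and h2 = complementaryD(2)[OF ce] and h2' = complementaryD(3)[OF ce]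
    and h3 = complementaryD(4,5)[OF ce]
  define \<gamma> where "\<gamma> i = (\<Sum>j\<in>J. a i0 j * c j i)" for i
  define \<eta> where "\<eta> t = (\<Sum>j\<in>J. a i0 j * e j t)" for t
  have a0: "a i0 t = (\<Sum>i\<in>I. \<gamma> i * a i t) + (if t \<in> J' then \<eta> t else 0)" if t: "t \<in> J" for t
  proof -
    have "a i0 t = (\<Sum>j\<in>J. a i0 j * (if j = t then 1 else 0))" using assms(2) t by (simp add: if_distrib cong: if_cong)
    also have "\<dots> = (\<Sum>j\<in>J. a i0 j * ((\<Sum>i\<in>I. c j i * a i t) + (if t \<in> J' then e j t else 0)))"
      using h1 t by (intro sum.cong) auto
    also have "\<dots> = (\<Sum>j\<in>J. \<Sum>i\<in>I. a i0 j * c j i * a i t) + (if t \<in> J' then \<eta> t else 0)"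
      by (simp add: distrib_left sum.distrib sum_distrib_left \<eta>_def mult.assoc)
    also have "(\<Sum>j\<in>J. \<Sum>i\<in>I. a i0 j * c j i * a i t) = (\<Sum>i\<in>I. \<gamma> i * a i t)"
      unfolding \<gamma>_def sum_distrib_right by (rule sum.swap)
    finally show ?thesis .
  qed
  have "\<exists>s\<in>J'. \<eta> s \<noteq> 0"
  proof (rule ccontr)
    assume "\<not> (\<exists>s\<in>J'. \<eta> s \<noteq> 0)"
    then have z: "\<eta> t = 0" if "t \<in> J'" for t using that by blast
    \<comment> \<open>If all \<eta> vanish, the new form is a combination of the old ones, that is,
      there is a relation with coefficient -1 at \<open>i0\<close>.\<close>
    have "\<forall>i\<in>insert i0 I. (if i = i0 then - 1 else \<gamma> i) = 0"
    proof (rule insert.prems)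
      fix j assume j: "j \<in> J"
      have "(\<Sum>i\<in>insert i0 I. (if i = i0 then - 1 else \<gamma> i) * a i j) = - a i0 j + (\<Sum>i\<in>I. (if i = i0 then - 1 else \<gamma> i) * a i j)"
        using insert.hyps by simp
      also have "(\<Sum>i\<in>I. (if i = i0 then - 1 else \<gamma> i) * a i j) = (\<Sum>i\<in>I. \<gamma> i * a i j)"
        using insert.hyps by (intro sum.cong) auto
      finally show "(\<Sum>i\<in>insert i0 I. (if i = i0 then - 1 else \<gamma> i) * a i j) = 0" using a0[OF j] z by simp
    qed
    then show False by simp
  qed
  then obtain s where s: "s \<in> J'" "\<eta> s \<noteq> 0" by blast
  have sJ: "s \<in> J" using s J' by blast
  have fJ': "finite J'" using J'(1) assms(2) finite_subset by blast
  define J'' where "J'' = J' - {s}"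
  \<comment> \<open>Obtained by substituting T_s = (l_i0 - sum \<gamma>_i l_i - sum \<eta>_t T_t) /
    \<eta>_s, the second sum without t = s, into the expressions of the T_j.\<close>
  define c' where "c' j i = (if i = i0 then e j s / \<eta> s else c j i - e j s * \<gamma> i / \<eta> s)" for j i
  define e' where "e' j t = e j t - e j s * \<eta> t / \<eta> s" for j t
  have c'I: "c' j i = c j i - e j s * \<gamma> i / \<eta> s" if "i \<in> I" for j i using that insert.hyps by (auto simp: c'_def)
  have f1: "card J'' + card (insert i0 I) = card J"
  proof -
    have "card J' = Suc (card J'')" unfolding J''_def by (rule card.remove[OF fJ' s(1)])
    then show ?thesis using J'(2) insert.hyps by simp
  qed
  have f2: "J'' \<subseteq> J" using J' by (auto simp: J''_def)
  have f3: "(\<Sum>i\<in>insert i0 I. c' j i * a i t) + (if t \<in> J'' then e' j t else 0) = (if j = t then 1 else 0)"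
    if jt: "j \<in> J" "t \<in> J" for j t
  proof -
    have "(\<Sum>i\<in>insert i0 I. c' j i * a i t) = e j s / \<eta> s * a i0 t + (\<Sum>i\<in>I. c' j i * a i t)"
      using insert.hyps by (simp add: c'_def)
    also have "(\<Sum>i\<in>I. c' j i * a i t) = (\<Sum>i\<in>I. c j i * a i t - e j s / \<eta> s * (\<gamma> i * a i t))"
      by (intro sum.cong refl) (simp add: c'I algebra_simps)
    also have "\<dots> = (\<Sum>i\<in>I. c j i * a i t) - e j s / \<eta> s * (\<Sum>i\<in>I. \<gamma> i * a i t)"
      by (simp add: sum_subtractf sum_distrib_left)
    finally have "(\<Sum>i\<in>insert i0 I. c' j i * a i t) = (\<Sum>i\<in>I. c j i * a i t) + e j s / \<eta> s * (if t \<in> J' then \<eta> t else 0)"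
      using a0[OF jt(2)] by (simp add: algebra_simps)
    moreover have "e j s / \<eta> s * (if t \<in> J' then \<eta> t else 0) + (if t \<in> J'' then e' j t else 0) = (if t \<in> J' then e j t else 0)"
      using s by (auto simp: J''_def e'_def)
    ultimately show ?thesis using h1[OF jt] by (simp add: add.assoc)
  qed
  have f4: "(\<Sum>j\<in>J. a i j * c' j i') = (if i = i' then 1 else 0)" if i: "i \<in> insert i0 I" "i' \<in> insert i0 I" for i i'
  proof -
    have c1: "(\<Sum>j\<in>J. a i j * c' j i0) = (\<Sum>j\<in>J. a i j * e j s) / \<eta> s"
      by (simp add: c'_def sum_divide_distrib)
    have c2: "(\<Sum>j\<in>J. a i j * c' j i') = (\<Sum>j\<in>J. a i j * c j i') - (\<Sum>j\<in>J. a i j * e j s) * \<gamma> i' / \<eta> s" if "i' \<in> I"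
      by (simp add: c'I[OF that] algebra_simps sum_subtractf sum_divide_distrib sum_distrib_left)
    have e0: "(\<Sum>j\<in>J. a i j * e j s) = (if i = i0 then \<eta> s else 0)" using i(1) h2' s by (auto simp: \<eta>_def)
    show ?thesis
    proof (cases "i' = i0")
      case True then show ?thesis unfolding True c1 e0 using s by auto
    next
      case False
      then have i'I: "i' \<in> I" using i by auto
      show ?thesis unfolding c2[OF i'I] e0 using h2[OF _ i'I, of i] i(1) s False insert.hyps by (auto simp: \<gamma>_def)
    qed
  qed
  have f5: "(\<Sum>j\<in>J. a i j * e' j t) = 0" if i: "i \<in> insert i0 I" "t \<in> J''" for i t
  proof -
    have t: "t \<in> J'" using i by (simp add: J''_def)
    have "(\<Sum>j\<in>J. a i j * e' j t) = (\<Sum>j\<in>J. a i j * e j t) - (\<Sum>j\<in>J. a i j * e j s) * \<eta> t / \<eta> s"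
      by (simp add: e'_def algebra_simps sum_subtractf sum_divide_distrib sum_distrib_left)
    moreover have "(\<Sum>j\<in>J. a i j * e j s) = (if i = i0 then \<eta> s else 0)" "(\<Sum>j\<in>J. a i j * e j t) = (if i = i0 then \<eta> t else 0)"
      using i(1) t h2' s by (auto simp: \<eta>_def)
    ultimately show ?thesis using s by auto
  qed
  have f6: "(\<forall>i\<in>insert i0 I. c' j i = 0) \<and> (\<forall>t\<in>J''. e' j t = (if j = t then 1 else 0))" if j: "j \<in> J''" for j
  proof -
    have "j \<in> J'" "j \<noteq> s" using j by (auto simp: J''_def)
    then have "e j s = 0" using h3(2)[OF _ s(1)] by simp
    then show ?thesis using h3 \<open>j \<in> J'\<close> by (auto simp: c'_def e'_def J''_def)
  qed
  have "complementary a (insert i0 I) J J'' c' e'"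
    unfolding complementary_def by (intro conjI ballI f3 f4 f5 conjunct1[OF f6, rule_format] conjunct2[OF f6, rule_format])
  then show ?case using f1 f2 by blast
qed

section \<open>The group L and the degrees of monomials\<close>

locale gl_weights =
  fixes n :: nat and p :: "nat \<Rightarrow> nat"
  assumes p_pos: "i \<in> {1..n} \<Longrightarrow> 0 < p i"
begin

abbreviation "gensL \<equiv> insert gen_c (gen_x ` {1..n})"
abbreviation "F \<equiv> gl_free_group n"
abbreviation "rel \<equiv> gl_relations n p"
abbreviation "L \<equiv> gl_group n p"

definition cl :: "(gl_gen \<Rightarrow>\<^sub>0 int) \<Rightarrow> (gl_gen \<Rightarrow>\<^sub>0 int) set" where "cl f = rel #>\<^bsub>F\<^esub> f"

lemma F_comm: "comm_group F" by (simp add: gl_free_group_def abelian_free_Abelian_group)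

lemma F_simps [simp]: "f \<in> carrier F \<longleftrightarrow> Poly_Mapping.keys f \<subseteq> gensL" "f \<otimes>\<^bsub>F\<^esub> g = f + g" "\<one>\<^bsub>F\<^esub> = 0"
  by (simp_all add: gl_free_group_def)

lemma F_inv: "f \<in> carrier F \<Longrightarrow> inv\<^bsub>F\<^esub> f = - f"
  by (simp add: gl_free_group_def)

lemma rel_subset: "(\<lambda>i. frag_cmul (int (p i)) (frag_of (gen_x i)) - frag_of gen_c) ` {1..n} \<subseteq> carrier F"
proof
  fix x assume "x \<in> (\<lambda>i. frag_cmul (int (p i)) (frag_of (gen_x i)) - frag_of gen_c) ` {1..n}"
  then obtain i where i: "i \<in> {1..n}" "x = frag_cmul (int (p i)) (frag_of (gen_x i)) - frag_of gen_c" by blast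
  have "Poly_Mapping.keys x \<subseteq> Poly_Mapping.keys (frag_cmul (int (p i)) (frag_of (gen_x i))) \<union> Poly_Mapping.keys (frag_of gen_c)"
    unfolding i(2) by (rule keys_diff)
  also have "\<dots> \<subseteq> gensL" using i(1) keys_cmul[of "int (p i)" "frag_of (gen_x i)"] by auto
  finally show "x \<in> carrier F" by simp
qed

lemma rel_subgroup: "subgroup rel F"
  unfolding gl_relations_def using F_comm rel_subset by (intro group.generate_is_subgroup) (simp_all add: comm_group_def)

lemma rel_normal: "rel \<lhd> F" using comm_group.subgroup_imp_normal[OF F_comm rel_subgroup] .

lemma rel_carrier: "f \<in> rel \<Longrightarrow> f \<in> carrier F" using subgroup.subset[OF rel_subgroup] by blast

lemma rel_0: "0 \<in> rel" using subgroup.one_closed[OF rel_subgroup] by simp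

lemma rel_add: "f \<in> rel \<Longrightarrow> g \<in> rel \<Longrightarrow> f + g \<in> rel" using subgroup.m_closed[OF rel_subgroup] by simp

lemma rel_uminus: "f \<in> rel \<Longrightarrow> - f \<in> rel" using subgroup.m_inv_closed[OF rel_subgroup] F_inv rel_carrier by metis

lemma rel_diff: "f \<in> rel \<Longrightarrow> g \<in> rel \<Longrightarrow> f - g \<in> rel" using rel_add[of f "- g"] rel_uminus by simp

lemma rel_gen: "i \<in> {1..n} \<Longrightarrow> frag_cmul (int (p i)) (frag_of (gen_x i)) - frag_of gen_c \<in> rel"
  unfolding gl_relations_def by (intro generate.incl) auto

lemma cl_eq: "cl f = (\<lambda>h. h + f) ` rel"
  by (auto simp: cl_def r_coset_def)

lemma cl_eq_iff: "cl f = cl g \<longleftrightarrow> f - g \<in> rel"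
proof
  assume "cl f = cl g"
  then have "0 + f \<in> (\<lambda>h. h + g) ` rel" using rel_0 unfolding cl_eq by blast
  then show "f - g \<in> rel" by auto
next
  assume fg: "f - g \<in> rel"
  show "cl f = cl g" unfolding cl_eq
  proof (intro equalityI image_subsetI)
    fix h assume "h \<in> rel"
    then show "h + f \<in> (\<lambda>h. h + g) ` rel" using rel_add[OF _ fg, of h] by (intro image_eqI[of _ _ "h + (f - g)"]) auto
    show "h + g \<in> (\<lambda>h. h + f) ` rel" using rel_diff[OF \<open>h \<in> rel\<close> fg] by (intro image_eqI[of _ _ "h - (f - g)"]) auto
  qed
qed

lemma L_carrier: "carrier L = cl ` carrier F"
  unfolding gl_group_def FactGroup_def RCOSETS_def cl_def by auto

lemma L_mult: "f \<in> carrier F \<Longrightarrow> g \<in> carrier F \<Longrightarrow> cl f \<otimes>\<^bsub>L\<^esub> cl g = cl (f + g)"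
  using normal.rcos_sum[OF rel_normal, of f g] by (simp add: gl_group_def FactGroup_def cl_def)

lemma L_one: "\<one>\<^bsub>L\<^esub> = cl 0"
  using rel_0 by (simp add: gl_group_def FactGroup_def cl_eq)

lemma L_comm: "comm_group L"
proof -
  have "group L" unfolding gl_group_def by (rule normal.factorgroup_is_group[OF rel_normal])
  moreover have "x \<otimes>\<^bsub>L\<^esub> y = y \<otimes>\<^bsub>L\<^esub> x" if "x \<in> carrier L" "y \<in> carrier L" for x y
    using that unfolding L_carrier by (auto simp: L_mult add.commute simp del: F_simps)
  ultimately show ?thesis by (intro group.group_comm_groupI)
qed

sublocale L: comm_group L by (rule L_comm)

lemma F_closed: "f \<in> carrier F \<Longrightarrow> g \<in> carrier F \<Longrightarrow> f + g \<in> carrier F" "f \<in> carrier F \<Longrightarrow> - f \<in> carrier F"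
  "0 \<in> carrier F" "f \<in> carrier F \<Longrightarrow> frag_cmul k f \<in> carrier F" "frag_of u \<in> carrier F \<longleftrightarrow> u \<in> gensL"
  using keys_add[of f g] keys_cmul[of k f] by auto

lemma F_sum: "(\<And>i. i \<in> A \<Longrightarrow> f i \<in> carrier F) \<Longrightarrow> sum f A \<in> carrier F"
  by (induction A rule: infinite_finite_induct) (auto simp: F_closed simp del: F_simps)

text \<open>These are the invariants of classes in L: the coefficient of x_i modulo p_i, and, when
  all of these vanish, the multiple of c that remains after p_i x_i has been replaced by c. In
  particular c has infinite order. Divisibility is carried through the induction because it makes
  \<open>div\<close> additive.\<close>

lemma rel_invariant:
  assumes "f \<in> rel"
  shows "(\<forall>i\<in>{1..n}. int (p i) dvd Poly_Mapping.lookup f (gen_x i)) \<and>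
    Poly_Mapping.lookup f gen_c + (\<Sum>i=1..n. Poly_Mapping.lookup f (gen_x i) div int (p i)) = 0"
proof -
  let ?l = Poly_Mapping.lookup
  have gen: "(\<forall>i\<in>{1..n}. int (p i) dvd ?l h (gen_x i)) \<and> ?l h gen_c + (\<Sum>i=1..n. ?l h (gen_x i) div int (p i)) = 0"
    if h: "h \<in> (\<lambda>i. frag_cmul (int (p i)) (frag_of (gen_x i)) - frag_of gen_c) ` {1..n}" for h
  proof -
    obtain i where i: "i \<in> {1..n}" "h = frag_cmul (int (p i)) (frag_of (gen_x i)) - frag_of gen_c" using h by blast
    have x: "?l h (gen_x j) = (if j = i then int (p i) else 0)" for j using i by (auto simp: lookup_minus lookup_single when_def)
    have "?l h gen_c = -1" using i by (auto simp: lookup_minus lookup_single when_def)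
    moreover have "(\<Sum>j=1..n. ?l h (gen_x j) div int (p j)) = (\<Sum>j=1..n. if j = i then 1 else 0)"
      using p_pos[OF i(1)] by (intro sum.cong refl) (auto simp: x)
    ultimately show ?thesis using i(1) by (auto simp: x)
  qed
  show ?thesis using assms unfolding gl_relations_def
  proof (induction rule: generate.induct)
    case one then show ?case by simp
  next
    case (incl h) then show ?case by (rule gen)
  next
    case (inv h)
    have "inv\<^bsub>F\<^esub> h = - h" using inv rel_subset by (intro F_inv) blast
    moreover have "(\<Sum>i=1..n. - ?l h (gen_x i) div int (p i)) = - (\<Sum>i=1..n. ?l h (gen_x i) div int (p i))"
      unfolding sum_negf[symmetric] using gen[OF inv] by (intro sum.cong refl) (auto simp: dvd_neg_div)
    ultimately show ?case using gen[OF inv] by simp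
  next
    case (eng h h')
    have "(\<Sum>i=1..n. (?l h (gen_x i) + ?l h' (gen_x i)) div int (p i)) = (\<Sum>i=1..n. ?l h (gen_x i) div int (p i)) + (\<Sum>i=1..n. ?l h' (gen_x i) div int (p i))"
      unfolding sum.distrib[symmetric] using eng.IH by (intro sum.cong refl) (auto simp: div_plus_div_distrib_dvd_left)
    then show ?case using eng.IH by (auto simp: lookup_add)
  qed
qed

text \<open>Forgets the generators x_i with i outside I. It is additive on the free group, and for I
  contained in {1..n} the classes of its values form the subgroup of L generated by c and the x_i
  with i \<in> I.\<close>

definition rt :: "nat set \<Rightarrow> (gl_gen \<Rightarrow>\<^sub>0 int) \<Rightarrow> (gl_gen \<Rightarrow>\<^sub>0 int)" where
  "rt I f = frag_cmul (Poly_Mapping.lookup f gen_c) (frag_of gen_c) + (\<Sum>i\<in>I. frag_cmul (Poly_Mapping.lookup f (gen_x i)) (frag_of (gen_x i)))"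

lemma rt_add: "rt I (f + g) = rt I f + rt I g"
  by (simp add: rt_def lookup_add frag_cmul_distrib sum.distrib algebra_simps)

lemma rt_carrier: "I \<subseteq> {1..n} \<Longrightarrow> rt I f \<in> carrier F"
  unfolding rt_def by (intro F_closed(1) F_sum F_closed(4)) (auto simp: F_closed simp del: F_simps)

lemma lookup_rt: "finite I \<Longrightarrow> Poly_Mapping.lookup (rt I f) (gen_x i) = (if i \<in> I then Poly_Mapping.lookup f (gen_x i) else 0)"
  "Poly_Mapping.lookup (rt I f) gen_c = Poly_Mapping.lookup f gen_c"
proof -
  have "Poly_Mapping.lookup (\<Sum>i\<in>I. frag_cmul (Poly_Mapping.lookup f (gen_x i)) (frag_of (gen_x i))) (gen_x i) =
     (\<Sum>j\<in>I. if j = i then Poly_Mapping.lookup f (gen_x j) else 0)"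
    unfolding lookup_sum by (intro sum.cong refl) (auto simp: lookup_single when_def)
  then show "finite I \<Longrightarrow> Poly_Mapping.lookup (rt I f) (gen_x i) = (if i \<in> I then Poly_Mapping.lookup f (gen_x i) else 0)"
    by (simp add: rt_def lookup_add lookup_single)
  have "Poly_Mapping.lookup (\<Sum>i\<in>I. frag_cmul (Poly_Mapping.lookup f (gen_x i)) (frag_of (gen_x i))) gen_c = 0"
    unfolding lookup_sum by (intro sum.neutral) (auto simp: lookup_single when_def)
  then show "Poly_Mapping.lookup (rt I f) gen_c = Poly_Mapping.lookup f gen_c"
    by (simp add: rt_def lookup_add lookup_single)
qed

lemma rt_id: "finite I \<Longrightarrow> Poly_Mapping.keys f \<subseteq> insert gen_c (gen_x ` I) \<Longrightarrow> rt I f = f"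
proof (rule poly_mapping_eqI)
  fix k assume I: "finite I" "Poly_Mapping.keys f \<subseteq> insert gen_c (gen_x ` I)"
  show "Poly_Mapping.lookup (rt I f) k = Poly_Mapping.lookup f k"
  proof (cases k)
    case (gen_x i)
    then have "i \<notin> I \<Longrightarrow> Poly_Mapping.lookup f k = 0" using I(2) by (auto simp: in_keys_iff)
    then show ?thesis using gen_x lookup_rt(1)[OF I(1)] by auto
  qed (simp add: lookup_rt)
qed

fun var_gen :: "gl_var \<Rightarrow> gl_gen" where
  "var_gen (T j) = gen_c" | "var_gen (X i) = gen_x i"

text \<open>The degree of a monomial, lifted to the free abelian group. Lifts are added in a type
  with \<open>+\<close>, while L is a multiplicatively written group of cosets;
  \<open>gl_degree_eq\<close> connects the two.\<close>

definition mdeg :: "(gl_var \<Rightarrow>\<^sub>0 nat) \<Rightarrow> (gl_gen \<Rightarrow>\<^sub>0 int)" where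
  "mdeg m = (\<Sum>v\<in>Poly_Mapping.keys m. frag_cmul (int (Poly_Mapping.lookup m v)) (frag_of (var_gen v)))"

lemma mdeg_add: "mdeg (m + m') = mdeg m + mdeg m'"
  unfolding mdeg_def by (rule setsum_keys_plus_distrib) (auto simp: frag_cmul_distrib)

lemma mdeg_0 [simp]: "mdeg 0 = 0" by (simp add: mdeg_def)

lemma mdeg_single: "mdeg (Poly_Mapping.single v k) = frag_cmul (int k) (frag_of (var_gen v))"
  by (simp add: mdeg_def)

lemma mdeg_superset: "finite A \<Longrightarrow> Poly_Mapping.keys m \<subseteq> A \<Longrightarrow> mdeg m = (\<Sum>v\<in>A. frag_cmul (int (Poly_Mapping.lookup m v)) (frag_of (var_gen v)))"
  unfolding mdeg_def by (intro sum.mono_neutral_left) (auto simp: in_keys_iff)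

lemma lookup_mdeg_X: "Poly_Mapping.lookup (mdeg m) (gen_x i) = int (Poly_Mapping.lookup m (X i))"
proof -
  have e: "(var_gen v = gen_x i) = (v = X i)" "(gen_x i = var_gen v) = (v = X i)" for v by (cases v; auto)+
  have "Poly_Mapping.lookup (mdeg m) (gen_x i) = (\<Sum>v\<in>Poly_Mapping.keys m. if v = X i then int (Poly_Mapping.lookup m v) else 0)"
    unfolding mdeg_def lookup_sum by (intro sum.cong refl) (auto simp: lookup_single when_def e)
  then show ?thesis by (auto simp: in_keys_iff)
qed

lemma mdeg_carrier:
  assumes "Poly_Mapping.keys m \<subseteq> gl_vars d n" shows "mdeg m \<in> carrier F"
proof -
  have "var_gen v \<in> gensL" if "v \<in> gl_vars d n" for v using that by (auto simp: gl_vars_def)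
  then show ?thesis unfolding mdeg_def using assms by (intro F_sum F_closed(4)) (auto simp: F_closed(5) simp del: F_simps)
qed

lemma L_pow: "f \<in> carrier F \<Longrightarrow> cl f [^]\<^bsub>L\<^esub> k = cl (frag_cmul (int k) f)"
proof (induction k)
  case 0 then show ?case by (simp add: L_one)
next
  case (Suc k)
  then show ?case by (simp add: L_mult F_closed frag_cmul_distrib add.commute del: F_simps)
qed

lemma gl_degree_eq:
  assumes "Poly_Mapping.keys m \<subseteq> gl_vars d n" shows "gl_degree n p m = cl (mdeg m)"
proof -
  have vg: "frag_of (var_gen v) \<in> carrier F" if "v \<in> gl_vars d n" for v using that by (auto simp: gl_vars_def F_closed(5) simp del: F_simps)
  have vd: "gl_var_degree n p v = cl (frag_of (var_gen v))" for v by (cases v) (auto simp: gl_gen_class_def cl_def)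
  have "finprod L (\<lambda>v. gl_var_degree n p v [^]\<^bsub>L\<^esub> Poly_Mapping.lookup m v) A =
    cl (\<Sum>v\<in>A. frag_cmul (int (Poly_Mapping.lookup m v)) (frag_of (var_gen v)))" if "finite A" "A \<subseteq> gl_vars d n" for A
    using that
  proof (induction A rule: finite_induct)
    case empty then show ?case by (simp add: L_one)
  next
    case (insert v A)
    have c: "cl (frag_of (var_gen v)) \<in> carrier L" if "v \<in> gl_vars d n" for v unfolding L_carrier using vg[OF that] by blast
    have "finprod L (\<lambda>v. gl_var_degree n p v [^]\<^bsub>L\<^esub> Poly_Mapping.lookup m v) (insert v A) =
      gl_var_degree n p v [^]\<^bsub>L\<^esub> Poly_Mapping.lookup m v \<otimes>\<^bsub>L\<^esub> finprod L (\<lambda>v. gl_var_degree n p v [^]\<^bsub>L\<^esub> Poly_Mapping.lookup m v) A"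
      using insert.hyps insert.prems c by (intro L.finprod_insert) (auto simp: vd intro!: L.nat_pow_closed)
    also have "\<dots> = cl (frag_cmul (int (Poly_Mapping.lookup m v)) (frag_of (var_gen v))) \<otimes>\<^bsub>L\<^esub> cl (\<Sum>v\<in>A. frag_cmul (int (Poly_Mapping.lookup m v)) (frag_of (var_gen v)))"
      using insert vg by (simp add: vd L_pow del: F_simps)
    also have "\<dots> = cl (\<Sum>v\<in>insert v A. frag_cmul (int (Poly_Mapping.lookup m v)) (frag_of (var_gen v)))"
      using insert vg by (subst L_mult) (auto intro!: F_sum F_closed(4) simp del: F_simps)
    finally show ?case .
  qed
  then show ?thesis unfolding gl_degree_def mdeg_def using assms by simp
qed

lemma gl_poly_grading_iff: "f \<in> gl_poly_grading d n p g \<longleftrightarrow> f \<in> PV (gl_vars d n) \<and> (\<forall>m\<in>Poly_Mapping.keys f. cl (mdeg m) = g)"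
  using gl_degree_eq[of _ d] by (auto simp: gl_poly_grading_def carrier_gl_poly_ring PV_def)

lemma mon_deg_rt: "mon_deg mdeg (\<lambda>e. cl (rt I e))"
  by unfold_locales (auto simp: mdeg_add rt_add cl_eq_iff)

lemma residue_mod:
  assumes "cl (mdeg m) = cl f" "i \<in> {1..n}"
  shows "int (p i) dvd int (Poly_Mapping.lookup m (X i)) - Poly_Mapping.lookup f (gen_x i)"
proof -
  have "mdeg m - f \<in> rel" using assms(1) by (simp add: cl_eq_iff)
  then show ?thesis using rel_invariant assms(2) by (fastforce simp: lookup_minus lookup_mdeg_X)
qed

end

section \<open>The ring\<close>

lemma (in hom_ring) hom_prod: "(\<And>i. i \<in> I \<Longrightarrow> hom (e i) (f i)) \<Longrightarrow> hom (sum e I) (prod f I)"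
  by (induction I rule: infinite_finite_induct) (auto simp: hom_1 hom_mult)

lemma Var_prod: "(\<Prod>v\<in>A. Var v ^ k v) = (Poly_Mapping.single (\<Sum>v\<in>A. Poly_Mapping.single v (k v)) 1 :: 'k::field gl_poly)"
  by (induction A rule: infinite_finite_induct) (auto simp: Var_power mult_single)

lemma Const_mult_single: "Const c * Poly_Mapping.single m b = (Poly_Mapping.single m (c * b) :: 'k::field gl_poly)"
  by (simp add: Const_def mult_single)

lemma poly_mapping_sum_Const: "f = (\<Sum>m\<in>Poly_Mapping.keys f. Const (Poly_Mapping.lookup f m) * Poly_Mapping.single m (1::'k::field))"
  by (subst (1) poly_mapping_sum_single[of f]) (simp add: Const_mult_single)

context gl_weights begin

abbreviation hg :: "(gl_gen \<Rightarrow>\<^sub>0 int) \<Rightarrow> 'k::field gl_poly \<Rightarrow> bool" where "hg \<equiv> homf mdeg cl"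

lemma mon_deg_cl: "mon_deg mdeg cl"
  by unfold_locales (auto simp: mdeg_add cl_eq_iff)

sublocale H: hom_ring hg by (rule mon_deg.hom_ring_homf[OF mon_deg_cl])

lemma hg_cong: "cl e = cl e' \<Longrightarrow> hg e f = hg e' f"
  by (simp add: homf_def)

lemma hg_power: "hg e f \<Longrightarrow> hg (frag_cmul (int k) e) (f ^ k)"
proof (induction k)
  case 0 then show ?case by (simp add: H.hom_1)
next
  case (Suc k) then show ?case by (auto simp: frag_cmul_distrib intro!: H.hom_mult')
qed

lemma hg_Const: "hg e f \<Longrightarrow> hg e (Const c * f)"
  by (rule H.hom_mult'[of 0]) (auto simp: homf_def Const_def split: if_splits)

lemma hg_single: "hg (mdeg m) (Poly_Mapping.single m c)"
  by (simp add: homf_def)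

lemma hg_Var: "hg (frag_of (var_gen v)) (Var v)"
  by (simp add: homf_def Var_def mdeg_single)

lemma cl_p: "i \<in> {1..n} \<Longrightarrow> cl (frag_cmul (int (p i)) (frag_of (gen_x i))) = cl (frag_of gen_c)"
  using rel_gen by (simp add: cl_eq_iff)

lemma hg_X_p: "i \<in> {1..n} \<Longrightarrow> hg (frag_of gen_c) (Var (X i) ^ p i)"
  using hg_power[OF hg_Var[of "X i"], of "p i"] by (simp add: hg_cong[OF cl_p])

lemma rel_sum: "(\<And>i. i \<in> A \<Longrightarrow> f i \<in> rel) \<Longrightarrow> sum f A \<in> rel"
  by (induction A rule: infinite_finite_induct) (auto simp: rel_0 rel_add)

lemma rel_cmul: "f \<in> rel \<Longrightarrow> frag_cmul k f \<in> rel"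
proof -
  assume f: "f \<in> rel"
  have nn: "frag_cmul (int k) f \<in> rel" for k
  proof (induction k)
    case 0 then show ?case by (simp add: rel_0)
  next
    case (Suc k) then show ?case by (simp add: frag_cmul_distrib rel_add f)
  qed
  show "frag_cmul k f \<in> rel"
  proof (cases "0 \<le> k")
    case True then show ?thesis using nn[of "nat k"] by simp
  next
    case False then show ?thesis using rel_uminus[OF nn[of "nat (- k)"]] by simp
  qed
qed

lemma mdeg_sum: "mdeg (sum f A) = (\<Sum>i\<in>A. mdeg (f i))"
  by (induction A rule: infinite_finite_induct) (auto simp: mdeg_add)

end

locale gl_ci = gl_weights n p for n p +
  fixes d :: int and l :: "nat \<Rightarrow> 'k::field gl_poly" and la :: "nat \<Rightarrow> nat \<Rightarrow> 'k"
  assumes d_ge: "-1 \<le> d"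
    and l_eq: "i \<in> {1..n} \<Longrightarrow> l i = (\<Sum>j | int j \<le> d. Const (la i j) * Var (T j))"
    and gp: "general_position d n l"
begin

abbreviation "J \<equiv> {j::nat. int j \<le> d}"
abbreviation "vs \<equiv> gl_vars d n"
abbreviation P :: "'k gl_poly ring" where "P \<equiv> gl_poly_ring d n"
abbreviation "rid \<equiv> gl_ideal d n l p"
abbreviation "R \<equiv> gl_ring d n l p"
abbreviation "gr \<equiv> gl_grading d n l p"

definition qm :: "'k gl_poly \<Rightarrow> 'k gl_poly set" where "qm f = rid +>\<^bsub>P\<^esub> f"

lemma J_eq: "J = {..<nat (d + 1)}" by auto

lemma finite_J: "finite J" by (simp only: J_eq finite_lessThan)

lemma card_J: "card J = nat (d + 1)" by (simp only: J_eq card_lessThan)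

lemma P_simps: "carrier P = PV vs" "f \<otimes>\<^bsub>P\<^esub> g = f * g" "\<one>\<^bsub>P\<^esub> = 1" "\<zero>\<^bsub>P\<^esub> = 0" "f \<oplus>\<^bsub>P\<^esub> g = f + g"
  by (simp only: carrier_gl_poly_ring) (simp_all add: gl_poly_ring_def)

lemmas PVs = subring_setD[OF subring_PV]

lemma P_cring: "cring P"
proof (intro cringI abelian_groupI comm_monoidI)
  fix x assume "x \<in> carrier P"
  then show "\<exists>y\<in>carrier P. y \<oplus>\<^bsub>P\<^esub> x = \<zero>\<^bsub>P\<^esub>" by (intro bexI[of _ "- x"]) (auto simp: P_simps PVs)
qed (auto simp: P_simps PVs algebra_simps)

sublocale P: cring P by (rule P_cring)

lemma P_minus: "f \<in> PV vs \<Longrightarrow> g \<in> PV vs \<Longrightarrow> f \<ominus>\<^bsub>P\<^esub> g = f - g"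
  using P.minus_equality[of "- g" g] by (simp add: a_minus_def P_simps PVs)

lemma l_PV: "i \<in> {1..n} \<Longrightarrow> l i \<in> PV vs"
  by (auto simp: l_eq gl_vars_def Var_PV intro!: subring_set_sum subring_PV PVs Const_PV)

lemma gen_PV: "(\<lambda>i. Var (X i) ^ p i - l i) ` {1..n} \<subseteq> PV vs"
  by (intro image_subsetI PVs subring_set_power subring_PV l_PV) (auto simp: Var_PV gl_vars_def)

lemma Id_ideal: "ideal rid P"
  unfolding gl_ideal_def by (rule P.genideal_ideal) (use gen_PV in \<open>simp add: P_simps\<close>)

lemma Id_gen: "i \<in> {1..n} \<Longrightarrow> Var (X i) ^ p i - l i \<in> rid"
  unfolding gl_ideal_def using P.genideal_self[of "(\<lambda>i. Var (X i) ^ p i - l i) ` {1..n}"] gen_PV by (auto simp: P_simps)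

lemma Id_PV: "f \<in> rid \<Longrightarrow> f \<in> PV vs" using ideal.Icarr[OF Id_ideal] by (simp add: P_simps)

lemma Id_0: "0 \<in> rid" using additive_subgroup.zero_closed[OF ideal.axioms(1)[OF Id_ideal]] by (simp add: P_simps)

lemma Id_add: "f \<in> rid \<Longrightarrow> g \<in> rid \<Longrightarrow> f + g \<in> rid"
  using additive_subgroup.a_closed[OF ideal.axioms(1)[OF Id_ideal]] by (simp add: P_simps)

lemma Id_mult: "f \<in> PV vs \<Longrightarrow> g \<in> rid \<Longrightarrow> f * g \<in> rid"
  using ideal.I_l_closed[OF Id_ideal] by (simp add: P_simps)

lemma Id_uminus: "f \<in> rid \<Longrightarrow> - f \<in> rid"
  using Id_mult[of "- 1" f] by (simp add: PVs)

lemma Id_sum: "(\<And>i. i \<in> A \<Longrightarrow> f i \<in> rid) \<Longrightarrow> sum f A \<in> rid"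
  by (induction A rule: infinite_finite_induct) (auto simp: Id_0 Id_add)

text \<open>Used with sets Q of the form: every multiple of f has some property. Such a set is
  closed under multiplication by construction, so the work is left to the generators.\<close>

lemma Id_minimal:
  assumes "Q \<subseteq> PV vs" "0 \<in> Q" "\<And>f g. f \<in> Q \<Longrightarrow> g \<in> Q \<Longrightarrow> f + g \<in> Q" "\<And>f g. f \<in> PV vs \<Longrightarrow> g \<in> Q \<Longrightarrow> f * g \<in> Q"
    and "\<And>i. i \<in> {1..n} \<Longrightarrow> Var (X i) ^ p i - l i \<in> Q"
  shows "rid \<subseteq> Q"
proof -
  have neg: "- g \<in> Q" if "g \<in> Q" for g using assms(4)[of "- 1" g] that by (simp add: PVs)
  have r: "g * f \<in> Q" if "f \<in> PV vs" "g \<in> Q" for f g using assms(4)[OF that] by (simp add: mult.commute)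
  have "ideal Q P"
  proof (rule idealI[OF P.ring_axioms])
    show "subgroup Q (add_monoid P)"
    proof (rule P.add.subgroupI)
      fix f assume "f \<in> Q"
      then have "\<ominus>\<^bsub>P\<^esub> f = - f" using P.minus_equality[of "- f" f] assms(1) by (auto simp: P_simps PVs)
      then show "\<ominus>\<^bsub>P\<^esub> f \<in> Q" using neg \<open>f \<in> Q\<close> by simp
    qed (use assms in \<open>auto simp: P_simps\<close>)
  qed (use assms r in \<open>auto simp: P_simps\<close>)
  then show ?thesis unfolding gl_ideal_def by (rule P.genideal_minimal) (use assms(5) in auto)
qed

text \<open>Congruence modulo the defining ideal between polynomials in the given variables; with
  it, most computations in R are done on representatives instead of cosets.\<close>

definition eqv :: "'k gl_poly \<Rightarrow> 'k gl_poly \<Rightarrow> bool" where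
  "eqv f g \<longleftrightarrow> f \<in> PV vs \<and> g \<in> PV vs \<and> f - g \<in> rid"

lemma eqv_refl: "f \<in> PV vs \<Longrightarrow> eqv f f" by (simp add: eqv_def Id_0)

lemma eqv_sym: "eqv f g \<Longrightarrow> eqv g f" using Id_uminus[of "f - g"] by (simp add: eqv_def)

lemma eqv_trans: "eqv f g \<Longrightarrow> eqv g h \<Longrightarrow> eqv f h" using Id_add[of "f - g" "g - h"] by (simp add: eqv_def)

lemma eqv_add: "eqv f f' \<Longrightarrow> eqv g g' \<Longrightarrow> eqv (f + g) (f' + g')"
  using Id_add[of "f - f'" "g - g'"] by (simp add: eqv_def PVs algebra_simps)

lemma eqv_mult: "eqv f f' \<Longrightarrow> eqv g g' \<Longrightarrow> eqv (f * g) (f' * g')"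
proof -
  assume a: "eqv f f'" "eqv g g'"
  have "f * (g - g') + g' * (f - f') \<in> rid" using a by (intro Id_add Id_mult) (auto simp: eqv_def)
  then show ?thesis using a by (simp add: eqv_def PVs algebra_simps)
qed

lemma eqv_power: "eqv f g \<Longrightarrow> eqv (f ^ k) (g ^ k)"
  by (induction k) (auto simp: eqv_mult eqv_refl PVs)

lemma eqv_prod: "(\<And>i. i \<in> A \<Longrightarrow> eqv (f i) (g i)) \<Longrightarrow> eqv (prod f A) (prod g A)"
  by (induction A rule: infinite_finite_induct) (auto simp: eqv_mult eqv_refl PVs)

lemma eqv_sum: "(\<And>i. i \<in> A \<Longrightarrow> eqv (f i) (g i)) \<Longrightarrow> eqv (sum f A) (sum g A)"
  by (induction A rule: infinite_finite_induct) (auto simp: eqv_add eqv_refl PVs)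

lemma qm_eq_iff: "f \<in> PV vs \<Longrightarrow> g \<in> PV vs \<Longrightarrow> qm f = qm g \<longleftrightarrow> f - g \<in> rid"
  using P.quotient_eq_iff_same_a_r_cos[OF Id_ideal, of f g] by (simp add: P_simps P_minus qm_def)

lemma qm_eqv: "eqv f g \<Longrightarrow> qm f = qm g" using qm_eq_iff by (auto simp: eqv_def)

lemma R_cring: "cring R" unfolding gl_ring_def by (rule ideal.quotient_is_cring[OF Id_ideal P_cring])

sublocale R: cring R by (rule R_cring)

lemma qm_hom: "qm \<in> ring_hom P R"
  using ideal.rcos_ring_hom[OF Id_ideal] unfolding gl_ring_def qm_def[abs_def] .

lemma R_carrier: "carrier R = qm ` PV vs"
  by (auto simp: gl_ring_def FactRing_def A_RCOSETS_def' qm_def P_simps)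

lemma qm_carrier: "f \<in> PV vs \<Longrightarrow> qm f \<in> carrier R" by (auto simp: R_carrier)

lemma qm_mult: "f \<in> PV vs \<Longrightarrow> g \<in> PV vs \<Longrightarrow> qm (f * g) = qm f \<otimes>\<^bsub>R\<^esub> qm g"
  using ring_hom_mult[OF qm_hom, of f g] by (simp add: P_simps)

lemma qm_add: "f \<in> PV vs \<Longrightarrow> g \<in> PV vs \<Longrightarrow> qm (f + g) = qm f \<oplus>\<^bsub>R\<^esub> qm g"
  using ring_hom_add[OF qm_hom, of f g] by (simp add: P_simps)

lemma qm_one: "\<one>\<^bsub>R\<^esub> = qm 1" using ring_hom_one[OF qm_hom] by (simp add: P_simps)

lemma qm_zero: "\<zero>\<^bsub>R\<^esub> = qm 0"
  using ring_hom_zero[OF qm_hom P.ring_axioms R.ring_axioms] by (simp add: P_simps)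

lemma qm_eq_0_iff: "f \<in> PV vs \<Longrightarrow> qm f = \<zero>\<^bsub>R\<^esub> \<longleftrightarrow> f \<in> rid"
  unfolding qm_zero using qm_eq_iff[of f 0] by (simp add: PVs)

lemma gr_eq: "gr (cl e) = {qm f |f. f \<in> PV vs \<and> hg e f}"
  by (auto simp: gl_grading_def quot_grading_def gl_poly_grading_iff homf_def qm_def)

lemma gr_eq': "gr g = {qm f |f. f \<in> PV vs \<and> (\<forall>m\<in>Poly_Mapping.keys f. cl (mdeg m) = g)}"
  by (auto simp: gl_grading_def quot_grading_def gl_poly_grading_iff qm_def)

lemma grI: "f \<in> PV vs \<Longrightarrow> hg e f \<Longrightarrow> qm f \<in> gr (cl e)" by (auto simp: gr_eq)

lemma qm_finsum: "finite A \<Longrightarrow> (\<And>i. i \<in> A \<Longrightarrow> f i \<in> PV vs) \<Longrightarrow> qm (sum f A) = finsum R (\<lambda>i. qm (f i)) A"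
proof (induction A rule: finite_induct)
  case empty then show ?case by (simp add: qm_zero)
next
  case (insert a A)
  then have "finsum R (\<lambda>i. qm (f i)) (insert a A) = qm (f a) \<oplus>\<^bsub>R\<^esub> finsum R (\<lambda>i. qm (f i)) A"
    by (intro R.finsum_insert) (auto simp: qm_carrier)
  then show ?case using insert by (simp add: qm_add subring_set_sum subring_PV)
qed

section \<open>Homogeneous components and the grading of R\<close>

definition comp :: "(gl_gen \<Rightarrow>\<^sub>0 int) set \<Rightarrow> 'k gl_poly \<Rightarrow> 'k gl_poly" where
  "comp g f = (\<Sum>m\<in>Poly_Mapping.keys f. if cl (mdeg m) = g then Poly_Mapping.single m (Poly_Mapping.lookup f m) else 0)"

lemma comp_add: "comp g (f + f') = comp g f + comp g f'"
  unfolding comp_def by (rule setsum_keys_plus_distrib) (auto simp: single_add)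

lemma comp_0: "comp g 0 = 0" by (simp add: comp_def)

lemma comp_sum: "comp g (sum f A) = (\<Sum>i\<in>A. comp g (f i))"
  by (induction A rule: infinite_finite_induct) (auto simp: comp_add comp_0)

lemma comp_hom: "\<forall>m\<in>Poly_Mapping.keys f. cl (mdeg m) = h \<Longrightarrow> comp g f = (if h = g then f else 0)"
  using poly_mapping_sum_single[of f] by (auto simp: comp_def)

lemma hg_gen: "i \<in> {1..n} \<Longrightarrow> hg (frag_of gen_c) (Var (X i) ^ p i - l i)"
  using hg_Var[of "T _"] by (auto simp: l_eq intro!: H.hom_diff hg_X_p H.hom_sum hg_Const)

text \<open>The ideal is homogeneous because its generators are: the other factor of a multiple of a
  generator is split into monomials, and each piece is a homogeneous element of the ideal.\<close>

lemma comp_Id: "f \<in> rid \<Longrightarrow> comp g f \<in> rid"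
proof -
  let ?Q = "{f \<in> PV vs. \<forall>h\<in>PV vs. \<forall>g. comp g (h * f) \<in> rid}"
  have "rid \<subseteq> ?Q"
  proof (rule Id_minimal)
    fix i assume i: "i \<in> {1..n}"
    let ?f = "Var (X i) ^ p i - l i"
    have "comp g (h * ?f) \<in> rid" if h: "h \<in> PV vs" for g h
    proof -
      have s: "Poly_Mapping.single m c \<in> PV vs" if "m \<in> Poly_Mapping.keys h" for m c
        using h that by (intro single_PV) (auto simp: PV_def)
      have "h * ?f = (\<Sum>m\<in>Poly_Mapping.keys h. Poly_Mapping.single m (Poly_Mapping.lookup h m) * ?f)"
        by (subst (1) poly_mapping_sum_single[of h]) (simp add: sum_distrib_right)
      then have e: "comp g (h * ?f) = (\<Sum>m\<in>Poly_Mapping.keys h. comp g (Poly_Mapping.single m (Poly_Mapping.lookup h m) * ?f))"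
        by (simp only: comp_sum)
      show ?thesis unfolding e
      proof (rule Id_sum)
        fix m assume m: "m \<in> Poly_Mapping.keys h"
        have "hg (mdeg m + frag_of gen_c) (Poly_Mapping.single m (Poly_Mapping.lookup h m) * ?f)"
          by (rule H.hom_mult[OF hg_single hg_gen[OF i]])
        then have "comp g (Poly_Mapping.single m (Poly_Mapping.lookup h m) * ?f) =
          (if cl (mdeg m + frag_of gen_c) = g then Poly_Mapping.single m (Poly_Mapping.lookup h m) * ?f else 0)"
          by (intro comp_hom) (simp add: homf_def)
        then show "comp g (Poly_Mapping.single m (Poly_Mapping.lookup h m) * ?f) \<in> rid"
          using Id_mult[OF s[OF m] Id_gen[OF i]] Id_0 by simp
      qed
    qed
    then show "?f \<in> ?Q" using Id_PV[OF Id_gen[OF i]] by simp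
  next
    fix f g :: "'k gl_poly" assume "f \<in> PV vs" "g \<in> ?Q"
    then show "f * g \<in> ?Q" by (auto simp: PVs mult.assoc[symmetric])
  qed (auto simp: PVs Id_0 comp_0 distrib_left comp_add Id_add)
  then show "f \<in> rid \<Longrightarrow> comp g f \<in> rid" using PVs(2)[of vs] by force
qed

lemma gr_mult:
  assumes "g \<in> carrier L" "h \<in> carrier L" "a \<in> gr g" "b \<in> gr h" shows "a \<otimes>\<^bsub>R\<^esub> b \<in> gr (g \<otimes>\<^bsub>L\<^esub> h)"
proof -
  obtain e e' where e: "g = cl e" "h = cl e'" "e \<in> carrier F" "e' \<in> carrier F" using assms(1,2) unfolding L_carrier by blast
  obtain f f' where f: "a = qm f" "b = qm f'" "f \<in> PV vs" "f' \<in> PV vs" "hg e f" "hg e' f'"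
    using assms(3,4) unfolding e gr_eq by blast
  have "qm (f * f') \<in> gr (cl (e + e'))" by (intro grI H.hom_mult) (use f in \<open>auto simp: PVs\<close>)
  then show ?thesis using f e by (simp only: qm_mult L_mult)
qed

lemma gr_one: "\<one>\<^bsub>R\<^esub> \<in> gr \<one>\<^bsub>L\<^esub>"
  unfolding L_one qm_one by (intro grI H.hom_1 PVs)

lemma gr_carrier: "a \<in> gr g \<Longrightarrow> a \<in> carrier R"
  unfolding gr_eq' by (auto simp: qm_carrier)

text \<open>For existence the monomials of a representative are grouped by degree. For independence
  the component of degree h is taken of a representative of the vanishing sum; it stays in the ideal
  by \<open>comp_Id\<close>.\<close>

lemma R_graded: "graded_sum L R gr"
  unfolding graded_sum_def
proof (intro conjI ballI allI impI)
  fix g assume "g \<in> carrier L"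
  show "additive_subgroup (gr g) R"
  proof (rule additive_subgroup.intro, rule R.add.subgroupI)
    show "gr g \<subseteq> carrier R" using gr_carrier by blast
    have "qm 0 \<in> gr g" unfolding gr_eq' by (auto simp: PVs intro!: exI[of _ 0])
    then show "gr g \<noteq> {}" by blast
  next
    fix a assume "a \<in> gr g"
    then obtain f where f: "a = qm f" "f \<in> PV vs" "\<forall>m\<in>Poly_Mapping.keys f. cl (mdeg m) = g" unfolding gr_eq' by blast
    have "qm (- f) \<oplus>\<^bsub>R\<^esub> qm f = \<zero>\<^bsub>R\<^esub>" using f by (simp flip: qm_add add: PVs qm_zero)
    then have "\<ominus>\<^bsub>R\<^esub> a = qm (- f)" unfolding f(1) using f(2) by (intro R.minus_equality) (auto simp: qm_carrier PVs)
    then show "\<ominus>\<^bsub>R\<^esub> a \<in> gr g" unfolding gr_eq' using f by (auto simp: PVs intro!: exI[of _ "- f"])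
  next
    fix a b assume "a \<in> gr g" "b \<in> gr g"
    then obtain f f' where f: "a = qm f" "f \<in> PV vs" "\<forall>m\<in>Poly_Mapping.keys f. cl (mdeg m) = g"
      "b = qm f'" "f' \<in> PV vs" "\<forall>m\<in>Poly_Mapping.keys f'. cl (mdeg m) = g" unfolding gr_eq' by blast
    have "f + f' \<in> PV vs \<and> (\<forall>m\<in>Poly_Mapping.keys (f + f'). cl (mdeg m) = g)" using f keys_add[of f f'] by (auto simp: PVs)
    then show "a \<oplus>\<^bsub>R\<^esub> b \<in> gr g" unfolding gr_eq' f(1,4) using f by (auto simp flip: qm_add)
  qed
next
  fix a assume "a \<in> carrier R"
  then obtain f where f: "f \<in> PV vs" "a = qm f" by (auto simp: R_carrier)
  let ?K = "Poly_Mapping.keys f"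
  let ?G = "(\<lambda>m. cl (mdeg m)) ` ?K"
  let ?s = "\<lambda>m. Poly_Mapping.single m (Poly_Mapping.lookup f m)"
  have fg: "f = (\<Sum>g\<in>?G. \<Sum>m | m \<in> ?K \<and> cl (mdeg m) = g. ?s m)"
    using sum.image_gen[OF finite_keys[of f], of ?s "\<lambda>m. cl (mdeg m)"] poly_mapping_sum_single[of f] by simp
  have m: "Poly_Mapping.keys m \<subseteq> vs" if "m \<in> ?K" for m using f(1) that by (auto simp: PV_def)
  have c: "(\<Sum>m | m \<in> ?K \<and> cl (mdeg m) = g. ?s m) \<in> PV vs" for g
    by (intro subring_set_sum subring_PV single_PV) (use m in auto)
  have A: "a = finsum R (\<lambda>g. qm (\<Sum>m | m \<in> ?K \<and> cl (mdeg m) = g. ?s m)) ?G"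
    unfolding f(2) by (subst fg) (rule qm_finsum, auto simp: c)
  have B: "?G \<subseteq> carrier L" unfolding L_carrier using m by (intro image_subsetI imageI mdeg_carrier)
  have C: "qm (\<Sum>m | m \<in> ?K \<and> cl (mdeg m) = g. ?s m) \<in> gr g" for g
  proof -
    have "\<forall>m\<in>Poly_Mapping.keys (\<Sum>m | m \<in> ?K \<and> cl (mdeg m) = g. ?s m). cl (mdeg m) = g"
      using keys_sum[of ?s "{m. m \<in> ?K \<and> cl (mdeg m) = g}"] by (auto split: if_splits)
    then show ?thesis unfolding gr_eq' using c by blast
  qed
  show "\<exists>F f. finite F \<and> F \<subseteq> carrier L \<and> (\<forall>g\<in>F. f g \<in> gr g) \<and> a = finsum R f F"
    by (rule exI[of _ ?G], rule exI[of _ "\<lambda>g. qm (\<Sum>m | m \<in> ?K \<and> cl (mdeg m) = g. ?s m)"], intro conjI ballI C B A) simp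
next
  fix G f h assume G: "finite G" "G \<subseteq> carrier L" "\<forall>g\<in>G. f g \<in> gr g" "finsum R f G = \<zero>\<^bsub>R\<^esub>" and h: "h \<in> G"
  have "\<forall>g\<in>G. \<exists>f'. f g = qm f' \<and> f' \<in> PV vs \<and> (\<forall>m\<in>Poly_Mapping.keys f'. cl (mdeg m) = g)"
    using G(3) unfolding gr_eq' by blast
  then obtain f' where f': "\<And>g. g \<in> G \<Longrightarrow> f g = qm (f' g)" "\<And>g. g \<in> G \<Longrightarrow> f' g \<in> PV vs"
    "\<And>g. g \<in> G \<Longrightarrow> \<forall>m\<in>Poly_Mapping.keys (f' g). cl (mdeg m) = g" by metis
  have "finsum R (\<lambda>i. qm (f' i)) G = finsum R f G"
    by (rule R.finsum_cong'[OF refl]) (use f' in \<open>auto simp: qm_carrier\<close>)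
  then have "qm (sum f' G) = finsum R f G" using qm_finsum[of G f', OF G(1) f'(2)] by simp
  then have "sum f' G \<in> rid" using G(4) qm_eq_0_iff[of "sum f' G"] f'(2) by (simp add: subring_set_sum subring_PV)
  then have "comp h (sum f' G) \<in> rid" by (rule comp_Id)
  also have "comp h (sum f' G) = (\<Sum>g\<in>G. if g = h then f' g else 0)"
    unfolding comp_sum by (rule sum.cong) (use comp_hom f'(3) in auto)
  finally have "f' h \<in> rid" using G(1) h by simp
  then show "f h = \<zero>\<^bsub>R\<^esub>" using f'(1,2)[OF h] by (simp add: qm_eq_0_iff)
qed

end

section \<open>Charts\<close>

lemma frag_cmul_diff: "frag_cmul k (x - y) = frag_cmul k x - frag_cmul k y"
  by (rule poly_mapping_eqI) (simp add: lookup_minus right_diff_distrib)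

locale gl_chart = gl_ci n p d l la for n p d and l :: "nat \<Rightarrow> 'k::field gl_poly" and la +
  fixes I :: "nat set" and J' :: "nat set" and c :: "nat \<Rightarrow> nat \<Rightarrow> 'k" and e :: "nat \<Rightarrow> nat \<Rightarrow> 'k"
  assumes I: "I \<subseteq> {1..n}" and J': "J' \<subseteq> J" and ce: "complementary la I J J' c e"
begin

abbreviation "V \<equiv> X ` I \<union> T ` J'"
abbreviation "Ic \<equiv> {1..n} - I"

text \<open>What T_j becomes in A: it is a combination of the l_i with i \<in> I and the T_t with t
  \<in> J', and l_i is X_i^(p_i) modulo the ideal.\<close>

definition tau :: "nat \<Rightarrow> 'k gl_poly" where
  "tau j = (\<Sum>i\<in>I. Const (c j i) * Var (X i) ^ p i) + (\<Sum>t\<in>J'. Const (e j t) * Var (T t))"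

text \<open>What l_i becomes in A.\<close>

definition lam :: "nat \<Rightarrow> 'k gl_poly" where
  "lam i = (\<Sum>j\<in>J. Const (la i j) * tau j)"

text \<open>\<open>div\<close> discards the remainder of the exponent at X_j for j outside I, so
  this is the factor in A that is left when a power product with exponents below p_j has been split
  off.\<close>

definition rmon :: "(gl_var \<Rightarrow>\<^sub>0 nat) \<Rightarrow> 'k gl_poly" where
  "rmon m = (\<Prod>j\<in>J. tau j ^ Poly_Mapping.lookup m (T j)) * (\<Prod>i\<in>I. Var (X i) ^ Poly_Mapping.lookup m (X i)) *
     (\<Prod>j\<in>Ic. lam j ^ (Poly_Mapping.lookup m (X j) div p j))"

definition sg :: "'k gl_poly \<Rightarrow> 'k gl_poly" where
  "sg f = (\<Sum>m\<in>Poly_Mapping.keys f. Const (Poly_Mapping.lookup f m) * rmon m)"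

definition xm :: "(nat \<Rightarrow> nat) \<Rightarrow> (gl_var \<Rightarrow>\<^sub>0 nat)" where
  "xm a = (\<Sum>j\<in>Ic. Poly_Mapping.single (X j) (a j))"

abbreviation xp :: "(nat \<Rightarrow> nat) \<Rightarrow> 'k gl_poly" where "xp a \<equiv> Poly_Mapping.single (xm a) 1"

lemma finite_I: "finite I" using I finite_subset by blast

lemma finite_J': "finite J'" using J' finite_J finite_subset by blast

lemma V_vs: "V \<subseteq> vs" using I J' by (auto simp: gl_vars_def)

lemma PV_V: "f \<in> PV V \<Longrightarrow> f \<in> PV vs" using PV_mono[OF V_vs] by blast

lemma tau_PV: "tau j \<in> PV V"
  unfolding tau_def by (intro subring_setD subring_PV subring_set_sum subring_set_power Const_PV) (auto simp: Var_PV)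

lemma lam_PV: "lam j \<in> PV V"
  unfolding lam_def by (intro subring_setD subring_PV subring_set_sum tau_PV Const_PV)

lemma rmon_PV: "rmon m \<in> PV V"
  unfolding rmon_def
  by (intro subring_setD subring_PV subring_set_prod subring_set_power tau_PV lam_PV) (auto simp: Var_PV)

lemma sg_PV: "sg f \<in> PV V"
  unfolding sg_def by (intro subring_setD subring_PV subring_set_sum rmon_PV Const_PV)

lemma lam_expand: "lam i = (\<Sum>i'\<in>I. Const (\<Sum>j\<in>J. la i j * c j i') * Var (X i') ^ p i') +
   (\<Sum>t\<in>J'. Const (\<Sum>j\<in>J. la i j * e j t) * Var (T t))"
proof -
  have "lam i = (\<Sum>j\<in>J. \<Sum>i'\<in>I. Const (la i j) * Const (c j i') * Var (X i') ^ p i') +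
     (\<Sum>j\<in>J. \<Sum>t\<in>J'. Const (la i j) * Const (e j t) * Var (T t))"
    by (simp add: lam_def tau_def distrib_left sum.distrib sum_distrib_left mult.assoc)
  also have "(\<Sum>j\<in>J. \<Sum>i'\<in>I. Const (la i j) * Const (c j i') * Var (X i') ^ p i') =
    (\<Sum>i'\<in>I. Const (\<Sum>j\<in>J. la i j * c j i') * Var (X i') ^ p i')"
    unfolding Const_sum Const_simps sum_distrib_right by (rule sum.swap)
  also have "(\<Sum>j\<in>J. \<Sum>t\<in>J'. Const (la i j) * Const (e j t) * Var (T t)) =
    (\<Sum>t\<in>J'. Const (\<Sum>j\<in>J. la i j * e j t) * Var (T t))"
    unfolding Const_sum Const_simps sum_distrib_right by (rule sum.swap)
  finally show ?thesis .
qed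

lemma lam_I: assumes "i \<in> I" shows "lam i = Var (X i) ^ p i"
proof -
  have "lam i = (\<Sum>i'\<in>I. (if i = i' then Var (X i') ^ p i' else 0)) + (\<Sum>t\<in>J'. 0)"
    unfolding lam_expand using complementaryD(2,3)[OF ce] assms
    by (intro arg_cong2[where f = "(+)"] sum.cong refl) (auto simp: Const_simps)
  then show ?thesis using finite_I assms by simp
qed

lemma tau_J': assumes "j \<in> J'" shows "tau j = Var (T j)"
proof -
  have "tau j = (\<Sum>i\<in>I. 0) + (\<Sum>t\<in>J'. if j = t then Var (T t) else 0)"
    unfolding tau_def using complementaryD(4,5)[OF ce] assms
    by (intro arg_cong2[where f = "(+)"] sum.cong refl) (auto simp: Const_simps)
  then show ?thesis using finite_J' assms by simp
qed

lemma X_p_eqv: "i \<in> {1..n} \<Longrightarrow> eqv (Var (X i) ^ p i) (l i)"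
  unfolding eqv_def using Id_gen l_PV by (auto intro!: subring_set_power subring_PV simp: Var_PV gl_vars_def)

text \<open>Replacing X_i^(p_i) by l_i turns \<open>tau j\<close> into the expansion of T_j in the
  first clause of \<open>complementary\<close>.\<close>

lemma tau_eqv: assumes j: "j \<in> J" shows "eqv (tau j) (Var (T j))"
proof -
  have c: "eqv (Const k) (Const k)" for k by (simp add: eqv_refl Const_PV)
  have t: "eqv (Var (T t)) (Var (T t))" if "t \<in> J" for t using that by (intro eqv_refl) (auto simp: Var_PV gl_vars_def)
  have "eqv (tau j) ((\<Sum>i\<in>I. Const (c j i) * l i) + (\<Sum>t\<in>J'. Const (e j t) * Var (T t)))"
    unfolding tau_def by (intro eqv_add eqv_sum eqv_mult c t X_p_eqv) (use I J' in auto)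
  also have "(\<Sum>i\<in>I. Const (c j i) * l i) = (\<Sum>i\<in>I. \<Sum>t\<in>J. Const (c j i) * Const (la i t) * Var (T t))"
    using I by (intro sum.cong refl) (subst l_eq, auto simp: sum_distrib_left mult.assoc)
  also have "\<dots> = (\<Sum>t\<in>J. Const (\<Sum>i\<in>I. c j i * la i t) * Var (T t))"
    unfolding Const_sum Const_simps sum_distrib_right by (rule sum.swap)
  also have "(\<Sum>t\<in>J'. Const (e j t) * Var (T t)) = (\<Sum>t\<in>J. Const (if t \<in> J' then e j t else 0) * Var (T t))"
    using J' finite_J by (intro sum.mono_neutral_cong_left) (auto simp: Const_simps)
  also have "(\<Sum>t\<in>J. Const (\<Sum>i\<in>I. c j i * la i t) * Var (T t)) + (\<Sum>t\<in>J. Const (if t \<in> J' then e j t else 0) * Var (T t)) =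
    (\<Sum>t\<in>J. Const ((\<Sum>i\<in>I. c j i * la i t) + (if t \<in> J' then e j t else 0)) * Var (T t))"
    unfolding Const_simps distrib_right sum.distrib by (rule refl)
  also have "\<dots> = (\<Sum>t\<in>J. if j = t then Var (T t) else 0)"
    using complementaryD(1)[OF ce j] by (intro sum.cong refl) (simp add: Const_simps)
  also have "\<dots> = Var (T j)" using finite_J j by simp
  finally show ?thesis .
qed

lemma lam_eqv: assumes i: "i \<in> {1..n}" shows "eqv (l i) (lam i)"
  unfolding lam_def l_eq[OF i] by (intro eqv_sum eqv_mult eqv_refl Const_PV eqv_sym[OF tau_eqv])

lemma vs_split: "vs = T ` J \<union> (X ` I \<union> X ` Ic)" using I by (auto simp: gl_vars_def)

lemma prod_vs: "(\<Prod>v\<in>vs. f v) = (\<Prod>j\<in>J. f (T j)) * (\<Prod>i\<in>I. f (X i)) * (\<Prod>j\<in>Ic. f (X j) :: 'c::comm_monoid_mult)"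
proof -
  have "(\<Prod>v\<in>vs. f v) = (\<Prod>v\<in>T ` J. f v) * ((\<Prod>v\<in>X ` I. f v) * (\<Prod>v\<in>X ` Ic. f v))"
    unfolding vs_split using finite_J finite_I by (subst prod.union_disjoint; (subst prod.union_disjoint)?) auto
  then show ?thesis by (simp add: prod.reindex inj_on_def mult.assoc)
qed

lemma sum_vs: "(\<Sum>v\<in>vs. f v) = (\<Sum>j\<in>J. f (T j)) + (\<Sum>i\<in>I. f (X i)) + (\<Sum>j\<in>Ic. f (X j) :: 'c::comm_monoid_add)"
proof -
  have "(\<Sum>v\<in>vs. f v) = (\<Sum>v\<in>T ` J. f v) + ((\<Sum>v\<in>X ` I. f v) + (\<Sum>v\<in>X ` Ic. f v))"
    unfolding vs_split using finite_J finite_I by (subst sum.union_disjoint; (subst sum.union_disjoint)?) auto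
  then show ?thesis by (simp add: sum.reindex inj_on_def add.assoc)
qed

lemma finite_vs: "finite vs" unfolding vs_split using finite_J finite_I by auto

lemma single_split:
  assumes "Poly_Mapping.keys m \<subseteq> vs"
  shows "Poly_Mapping.single m 1 = (\<Prod>j\<in>J. Var (T j) ^ Poly_Mapping.lookup m (T j)) *
    (\<Prod>i\<in>I. Var (X i) ^ Poly_Mapping.lookup m (X i)) * (\<Prod>j\<in>Ic. Var (X j) ^ Poly_Mapping.lookup m (X j) :: 'k gl_poly)"
proof -
  have "m = (\<Sum>v\<in>vs. Poly_Mapping.single v (Poly_Mapping.lookup m v))"
    using poly_mapping_sum_single[of m] sum.mono_neutral_left[OF finite_vs assms, of "\<lambda>v. Poly_Mapping.single v (Poly_Mapping.lookup m v)"]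
    by (simp add: in_keys_iff)
  then have "Poly_Mapping.single m 1 = (\<Prod>v\<in>vs. Var v ^ Poly_Mapping.lookup m v :: 'k gl_poly)" by (simp add: Var_prod)
  then show ?thesis by (simp only: prod_vs)
qed

lemma xp_eq: "xp a = (\<Prod>j\<in>Ic. Var (X j) ^ a j)"
proof -
  have "(\<Prod>j\<in>Ic. Var (X j) ^ a j) = (\<Prod>v\<in>X ` Ic. Var v ^ (case v of X j \<Rightarrow> a j | T _ \<Rightarrow> 0) :: 'k gl_poly)"
    by (simp add: prod.reindex inj_on_def)
  also have "\<dots> = Poly_Mapping.single (\<Sum>v\<in>X ` Ic. Poly_Mapping.single v (case v of X j \<Rightarrow> a j | T _ \<Rightarrow> 0)) 1" by (rule Var_prod)
  also have "(\<Sum>v\<in>X ` Ic. Poly_Mapping.single v (case v of X j \<Rightarrow> a j | T _ \<Rightarrow> 0)) = xm a"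
    by (simp add: sum.reindex inj_on_def xm_def)
  finally show ?thesis by simp
qed

lemma lookup_xm: "Poly_Mapping.lookup (xm a) (X j) = (if j \<in> Ic then a j else 0)" "Poly_Mapping.lookup (xm a) (T j) = 0"
  by (simp_all add: xm_def lookup_sum lookup_single when_def)

lemma keys_xm: "Poly_Mapping.keys (xm a) \<subseteq> vs"
proof
  fix v assume "v \<in> Poly_Mapping.keys (xm a)"
  then show "v \<in> vs" using lookup_xm by (cases v) (auto simp: in_keys_iff gl_vars_def split: if_splits)
qed

lemma xp_PV: "xp a \<in> PV vs" by (rule single_PV[OF keys_xm])

lemma xm_add: "xm a + xm b = xm (\<lambda>j. a j + b j)" by (simp add: xm_def single_add sum.distrib)

lemma xm_0: "xm (\<lambda>j. 0) = 0" by (simp add: xm_def)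

lemma xm_cong: "(\<And>j. j \<in> Ic \<Longrightarrow> a j = b j) \<Longrightarrow> xm a = xm b" unfolding xm_def by (rule sum.cong) auto

lemma single_eqv:
  assumes m: "Poly_Mapping.keys m \<subseteq> vs"
  shows "eqv (Poly_Mapping.single m 1) (xp (\<lambda>j. Poly_Mapping.lookup m (X j) mod p j) * rmon m)"
proof -
  let ?m = "Poly_Mapping.lookup m"
  have X: "eqv (Var (X j) ^ k) (Var (X j) ^ (k mod p j) * lam j ^ (k div p j))" if "j \<in> Ic" for j k
  proof -
    have j: "j \<in> {1..n}" using that by simp
    have v: "eqv (Var (X j)) (Var (X j))" using j by (intro eqv_refl) (auto simp: Var_PV gl_vars_def)
    have "Var (X j) ^ k = (Var (X j) ^ (k mod p j) * (Var (X j) ^ p j) ^ (k div p j) :: 'k gl_poly)"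
      by (simp flip: power_mult power_add)
    then show ?thesis using eqv_mult[OF eqv_power[OF v] eqv_power[OF eqv_trans[OF X_p_eqv[OF j] lam_eqv[OF j]]]] by metis
  qed
  have "eqv (Poly_Mapping.single m 1) ((\<Prod>j\<in>J. tau j ^ ?m (T j)) * (\<Prod>i\<in>I. Var (X i) ^ ?m (X i)) *
      (\<Prod>j\<in>Ic. Var (X j) ^ (?m (X j) mod p j) * lam j ^ (?m (X j) div p j)))"
    unfolding single_split[OF m]
    by (intro eqv_mult eqv_prod eqv_power eqv_sym[OF tau_eqv] X) (use I in \<open>auto intro!: eqv_refl simp: Var_PV gl_vars_def\<close>)
  then show ?thesis by (simp add: rmon_def xp_eq prod.distrib mult_ac)
qed

lemma hg_tau: "hg (frag_of gen_c) (tau j)"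
  unfolding tau_def using hg_Var[of "T _"] I by (auto intro!: H.hom_add H.hom_sum hg_Const hg_X_p)

lemma hg_lam: "hg (frag_of gen_c) (lam j)"
  unfolding lam_def by (intro H.hom_sum hg_Const hg_tau)

text \<open>Trading X_j^(p_j) for a form of degree c changes the lifted degree by a multiple of the
  relation p_j x_j - c; the proof collects these multiples.\<close>

lemma hg_rmon:
  assumes m: "Poly_Mapping.keys m \<subseteq> vs"
  shows "hg (mdeg m - mdeg (xm (\<lambda>j. Poly_Mapping.lookup m (X j) mod p j))) (rmon m)"
proof -
  let ?m = "Poly_Mapping.lookup m"
  let ?S = "\<Sum>j\<in>J. frag_cmul (int (?m (T j))) (frag_of gen_c)" and ?S' = "\<Sum>i\<in>I. frag_cmul (int (?m (X i))) (frag_of (gen_x i))"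
  let ?E = "?S + ?S' + (\<Sum>j\<in>Ic. frag_cmul (int (?m (X j) div p j)) (frag_of gen_c))"
  have H: "hg ?E (rmon m)"
    unfolding rmon_def using hg_Var[of "X _"] by (intro H.hom_mult H.hom_prod hg_power hg_tau hg_lam) auto
  have "cl ?E = cl (mdeg m - mdeg (xm (\<lambda>j. ?m (X j) mod p j)))"
  proof -
    have "mdeg m = ?S + ?S' + (\<Sum>j\<in>Ic. frag_cmul (int (?m (X j))) (frag_of (gen_x j)))"
      using mdeg_superset[OF finite_vs m] by (simp add: sum_vs)
    moreover have "mdeg (xm (\<lambda>j. ?m (X j) mod p j)) = (\<Sum>j\<in>Ic. frag_cmul (int (?m (X j) mod p j)) (frag_of (gen_x j)))"
      by (simp add: xm_def mdeg_sum mdeg_single)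
    ultimately have "mdeg m - mdeg (xm (\<lambda>j. ?m (X j) mod p j)) - ?E = (\<Sum>j\<in>Ic. frag_cmul (int (?m (X j))) (frag_of (gen_x j)) -
       frag_cmul (int (?m (X j) mod p j)) (frag_of (gen_x j)) - frag_cmul (int (?m (X j) div p j)) (frag_of gen_c))"
      by (simp only: sum_subtractf) simp
    also have "\<dots> = (\<Sum>j\<in>Ic. frag_cmul (int (?m (X j) div p j)) (frag_cmul (int (p j)) (frag_of (gen_x j)) - frag_of gen_c))"
    proof (rule sum.cong[OF refl])
      fix j
      have "int (?m (X j)) - int (?m (X j) mod p j) = int (?m (X j) div p j) * int (p j)"
        by (metis add_diff_cancel_right' div_mult_mod_eq of_nat_add of_nat_mult)
      then show "frag_cmul (int (?m (X j))) (frag_of (gen_x j)) - frag_cmul (int (?m (X j) mod p j)) (frag_of (gen_x j)) -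
          frag_cmul (int (?m (X j) div p j)) (frag_of gen_c) =
        frag_cmul (int (?m (X j) div p j)) (frag_cmul (int (p j)) (frag_of (gen_x j)) - frag_of gen_c)"
        unfolding frag_cmul_diff frag_cmul_cmul by (simp flip: frag_cmul_diff_distrib)
    qed
    also have "\<dots> \<in> rel" by (intro rel_sum rel_cmul rel_gen) auto
    finally show ?thesis by (rule cl_eq_iff[THEN iffD2, symmetric])
  qed
  then show ?thesis using H by (simp add: homf_def)
qed

lemma sg_expand_eqv:
  assumes "f \<in> PV vs" "\<And>m. m \<in> Poly_Mapping.keys f \<Longrightarrow> xm (\<lambda>j. Poly_Mapping.lookup m (X j) mod p j) = xm a"
  shows "eqv f (xp a * sg f)"
proof -
  have "eqv (\<Sum>m\<in>Poly_Mapping.keys f. Const (Poly_Mapping.lookup f m) * Poly_Mapping.single m 1)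
    (\<Sum>m\<in>Poly_Mapping.keys f. Const (Poly_Mapping.lookup f m) * (xp a * rmon m))"
  proof (intro eqv_sum eqv_mult eqv_refl Const_PV)
    fix m assume m: "m \<in> Poly_Mapping.keys f"
    then have "Poly_Mapping.keys m \<subseteq> vs" using assms(1) by (auto simp: PV_def)
    then show "eqv (Poly_Mapping.single m 1) (xp a * rmon m)" using single_eqv[of m] assms(2)[OF m] by simp
  qed
  then show ?thesis using poly_mapping_sum_Const[of f] by (simp add: sg_def sum_distrib_left mult_ac)
qed

text \<open>The degree in L determines the exponent at X_j modulo p_j, so all monomials of a
  homogeneous polynomial split off the same power product. For f = 0 there is no monomial to read
  the exponents from, and a = 0 is taken.\<close>

lemma homogeneous_rep:
  assumes f: "f \<in> PV vs" and h: "hg e0 f"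
  obtains a w e1 where "\<And>j. j \<in> Ic \<Longrightarrow> a j < p j" "w \<in> PV V" "hg e1 w" "cl e0 = cl (mdeg (xm a) + e1)" "eqv f (xp a * w)"
proof (cases "f = 0")
  case True
  have "eqv f (xp (\<lambda>j. 0) * 0)" using True by (simp add: eqv_refl PVs)
  then show thesis using that[of "\<lambda>j. 0" 0 e0] by (simp add: PVs H.hom_0 xm_0 p_pos)
next
  case False
  then obtain m0 where m0: "m0 \<in> Poly_Mapping.keys f" by (metis ex_in_conv keys_eq_empty)
  define a where "a j = Poly_Mapping.lookup m0 (X j) mod p j" for j
  have xa: "xm (\<lambda>j. Poly_Mapping.lookup m (X j) mod p j) = xm a" if m: "m \<in> Poly_Mapping.keys f" for m
  proof (rule xm_cong)
    fix j assume j: "j \<in> Ic"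
    have "cl (mdeg m) = cl (mdeg m0)" using h m m0 by (simp add: homf_def)
    then have "int (p j) dvd int (Poly_Mapping.lookup m (X j)) - int (Poly_Mapping.lookup m0 (X j))"
      using residue_mod[of m "mdeg m0" j] j by (simp add: lookup_mdeg_X)
    then have "int (Poly_Mapping.lookup m (X j)) mod int (p j) = int (Poly_Mapping.lookup m0 (X j)) mod int (p j)"
      by (simp add: mod_eq_dvd_iff)
    then show "Poly_Mapping.lookup m (X j) mod p j = a j" unfolding a_def by (simp flip: of_nat_mod)
  qed
  have "hg (e0 - mdeg (xm a)) (sg f)"
    unfolding sg_def
  proof (intro H.hom_sum hg_Const)
    fix m assume m: "m \<in> Poly_Mapping.keys f"
    then have k: "Poly_Mapping.keys m \<subseteq> vs" using f by (auto simp: PV_def)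
    have "cl (mdeg m) = cl e0" using h m by (simp add: homf_def)
    then have "cl (mdeg m - mdeg (xm a)) = cl (e0 - mdeg (xm a))" by (simp add: cl_eq_iff)
    then show "hg (e0 - mdeg (xm a)) (rmon m)" using hg_rmon[OF k] unfolding xa[OF m] by (simp add: homf_def)
  qed
  then show thesis by (intro that[of a "sg f" "e0 - mdeg (xm a)"]) (use p_pos sg_PV sg_expand_eqv[OF f xa] in \<open>auto simp: a_def\<close>)
qed

section \<open>The reduction map \<open>sg\<close> and its partial multiplicativity\<close>

lemma sg_add: "sg (f + g) = sg f + sg g"
  unfolding sg_def by (rule setsum_keys_plus_distrib) (auto simp: Const_simps distrib_right)

lemma sg_0: "sg 0 = 0" by (simp add: sg_def)

lemma sg_diff: "sg (f - g) = sg f - sg g" using sg_add[of "f - g" g] by simp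

lemma sg_sum: "sg (sum f A) = (\<Sum>i\<in>A. sg (f i))"
  by (induction A rule: infinite_finite_induct) (auto simp: sg_add sg_0)

lemma sg_single: "sg (Poly_Mapping.single m b) = Const b * rmon m"
  by (simp add: sg_def Const_simps)

text \<open>The polynomials against which \<open>sg\<close> is multiplicative: integer quotients by
  p_j add up when one of the two divisions is exact.\<close>

definition good :: "'k gl_poly \<Rightarrow> bool" where
  "good f \<longleftrightarrow> (\<forall>m\<in>Poly_Mapping.keys f. \<forall>j\<in>Ic. p j dvd Poly_Mapping.lookup m (X j))"

lemma rmon_add: "(\<And>j. j \<in> Ic \<Longrightarrow> p j dvd Poly_Mapping.lookup m (X j)) \<Longrightarrow> rmon (m + m') = rmon m * rmon m'"
proof -
  assume a: "\<And>j. j \<in> Ic \<Longrightarrow> p j dvd Poly_Mapping.lookup m (X j)"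
  have "(\<Prod>j\<in>Ic. lam j ^ (Poly_Mapping.lookup (m + m') (X j) div p j)) =
    (\<Prod>j\<in>Ic. lam j ^ (Poly_Mapping.lookup m (X j) div p j)) * (\<Prod>j\<in>Ic. lam j ^ (Poly_Mapping.lookup m' (X j) div p j))"
    unfolding prod.distrib[symmetric] using a by (intro prod.cong refl) (simp add: lookup_add div_plus_div_distrib_dvd_left power_add)
  then show ?thesis by (simp add: rmon_def lookup_add power_add prod.distrib mult_ac)
qed

lemma sg_mult_good: "good g \<Longrightarrow> sg (g * f) = sg g * sg f"
proof -
  assume g: "good g"
  have s: "sg (Poly_Mapping.single m b * f) = Const b * rmon m * sg f" if m: "\<And>j. j \<in> Ic \<Longrightarrow> p j dvd Poly_Mapping.lookup m (X j)" for m b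
  proof (induction f rule: poly_mapping_single_induct)
    case (single m' b') then show ?case using rmon_add[OF m, of m'] by (simp add: mult_single sg_single Const_simps mult_ac add.commute)
  next
    case (add f f') then show ?case by (simp add: distrib_left sg_add)
  qed
  have "g * f = (\<Sum>m\<in>Poly_Mapping.keys g. Poly_Mapping.single m (Poly_Mapping.lookup g m) * f)"
    by (subst (1) poly_mapping_sum_single[of g]) (simp add: sum_distrib_right)
  then have "sg (g * f) = (\<Sum>m\<in>Poly_Mapping.keys g. sg (Poly_Mapping.single m (Poly_Mapping.lookup g m) * f))"
    by (simp add: sg_sum)
  also have "\<dots> = (\<Sum>m\<in>Poly_Mapping.keys g. Const (Poly_Mapping.lookup g m) * rmon m * sg f)"
    by (intro sum.cong refl s) (use g in \<open>auto simp: good_def\<close>)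
  finally have "sg (g * f) = (\<Sum>m\<in>Poly_Mapping.keys g. Const (Poly_Mapping.lookup g m) * rmon m * sg f)" .
  then show ?thesis by (simp add: sg_def sum_distrib_right)
qed

lemma rmon_V: assumes m: "Poly_Mapping.keys m \<subseteq> V" shows "rmon m = Poly_Mapping.single m 1"
proof -
  have z: "Poly_Mapping.lookup m v = 0" if "v \<notin> V" for v using m that by (auto simp: in_keys_iff)
  have zT: "Poly_Mapping.lookup m (T j) = 0" if "j \<notin> J'" for j by (rule z) (use that in auto)
  have zX: "Poly_Mapping.lookup m (X j) = 0" if "j \<notin> I" for j by (rule z) (use that in auto)
  have k: "Poly_Mapping.keys m \<subseteq> vs" using m V_vs by blast
  have "(\<Prod>j\<in>J. tau j ^ Poly_Mapping.lookup m (T j)) = (\<Prod>j\<in>J. Var (T j) ^ Poly_Mapping.lookup m (T j))"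
  proof (rule prod.cong[OF refl])
    fix j
    show "tau j ^ Poly_Mapping.lookup m (T j) = Var (T j) ^ Poly_Mapping.lookup m (T j)"
      using zT[of j] tau_J'[of j] by (cases "j \<in> J'") auto
  qed
  moreover have "(\<Prod>j\<in>Ic. lam j ^ (Poly_Mapping.lookup m (X j) div p j)) = (\<Prod>j\<in>Ic. Var (X j) ^ Poly_Mapping.lookup m (X j))"
    using zX by (intro prod.cong refl) auto
  ultimately show ?thesis unfolding rmon_def single_split[OF k] by simp
qed

lemma good_V: "w \<in> PV V \<Longrightarrow> good w"
  unfolding good_def
proof (intro ballI)
  fix m j assume "w \<in> PV V" "m \<in> Poly_Mapping.keys w" "j \<in> Ic"
  then have "X j \<notin> Poly_Mapping.keys m" by (auto simp: PV_def)
  then show "p j dvd Poly_Mapping.lookup m (X j)" by (simp add: in_keys_iff)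
qed

lemma sg_V: "w \<in> PV V \<Longrightarrow> sg w = w"
  using poly_mapping_sum_Const[of w] by (simp add: sg_def PV_def rmon_V)

lemma sg_xp: "sg (xp a) = (\<Prod>j\<in>Ic. lam j ^ (a j div p j))"
proof -
  have "(\<Prod>i\<in>I. Var (X i) ^ Poly_Mapping.lookup (xm a) (X i)) = (1 :: 'k gl_poly)"
    by (rule prod.neutral) (simp add: lookup_xm)
  moreover have "(\<Prod>j\<in>Ic. lam j ^ (Poly_Mapping.lookup (xm a) (X j) div p j)) = (\<Prod>j\<in>Ic. lam j ^ (a j div p j))"
    by (rule prod.cong) (auto simp: lookup_xm)
  ultimately show ?thesis by (simp add: sg_single rmon_def lookup_xm(2) Const_simps)
qed

text \<open>X_i^(p_i) and l_i are both \<open>good\<close>, and \<open>sg\<close> sends both to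
  \<open>lam i\<close>; hence it sends every multiple of their difference to 0.\<close>

lemma sg_Id: "f \<in> rid \<Longrightarrow> sg f = 0"
proof -
  let ?Q = "{f \<in> PV vs. \<forall>h. sg (h * f) = 0}"
  have "rid \<subseteq> ?Q"
  proof (rule Id_minimal)
    fix i assume i: "i \<in> {1..n}"
    let ?f = "Var (X i) ^ p i - l i :: 'k gl_poly"
    have "sg (?f * h) = 0" for h
    proof -
      have lx: "Poly_Mapping.lookup (Poly_Mapping.single (X i) (p i)) (X j) = (if j = i then p i else 0)"
        "Poly_Mapping.lookup (Poly_Mapping.single (X i) (p i)) (T j) = 0" for j by (simp_all add: lookup_single when_def)
      have gx: "good (Var (X i) ^ p i)" by (auto simp: good_def Var_power lx)
      have lT: "l i \<in> PV (T ` J)" unfolding l_eq[OF i]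
        by (intro subring_set_sum subring_setD subring_PV Const_PV) (auto simp: Var_PV)
      have gl: "good (l i)"
        unfolding good_def
      proof (intro ballI)
        fix m j assume "m \<in> Poly_Mapping.keys (l i)"
        then have "X j \<notin> Poly_Mapping.keys m" using lT by (auto simp: PV_def)
        then show "p j dvd Poly_Mapping.lookup m (X j)" by (simp add: in_keys_iff)
      qed
      have "sg (Var (X i) ^ p i) = rmon (Poly_Mapping.single (X i) (p i))" by (simp add: Var_power sg_single Const_simps)
      also have "\<dots> = (\<Prod>i'\<in>I. if i' = i then Var (X i) ^ p i else 1) * (\<Prod>j\<in>Ic. if j = i then lam i else 1)"
      proof -
        have "(\<Prod>i'\<in>I. Var (X i') ^ (if i' = i then p i else 0)) = (\<Prod>i'\<in>I. if i' = i then Var (X i) ^ p i else 1 :: 'k gl_poly)"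
          by (rule prod.cong) auto
        moreover have "(\<Prod>j\<in>Ic. lam j ^ ((if j = i then p i else 0) div p j)) = (\<Prod>j\<in>Ic. if j = i then lam i else 1)"
          using p_pos[OF i] by (intro prod.cong) auto
        ultimately show ?thesis unfolding rmon_def lx by simp
      qed
      also have "\<dots> = lam i" using lam_I[of i] i finite_I by (cases "i \<in> I") auto
      finally have a: "sg (Var (X i) ^ p i) = lam i" .
      have "sg (l i) = (\<Sum>j\<in>J. sg (Const (la i j) * Var (T j)))" unfolding l_eq[OF i] by (rule sg_sum)
      also have "\<dots> = lam i"
        unfolding lam_def
      proof (rule sum.cong[OF refl])
        fix j assume j: "j \<in> J"
        have lt: "Poly_Mapping.lookup (Poly_Mapping.single (T j) 1) (X j') = 0"
          "Poly_Mapping.lookup (Poly_Mapping.single (T j) 1) (T j') = (if j' = j then 1 else 0)" for j' by (simp_all add: lookup_single when_def)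
        have "rmon (Poly_Mapping.single (T j) 1) = (\<Prod>j'\<in>J. if j' = j then tau j else 1)"
          unfolding rmon_def lt by (simp, intro prod.cong refl) auto
        also have "\<dots> = tau j" using j finite_J by simp
        finally show "sg (Const (la i j) * Var (T j)) = Const (la i j) * tau j"
          by (simp add: Var_def Const_mult_single sg_single)
      qed
      finally have "sg (l i) = lam i" .
      then show ?thesis using sg_mult_good[OF gx, of h] sg_mult_good[OF gl, of h] a by (simp add: left_diff_distrib sg_diff)
    qed
    then show "?f \<in> ?Q" using Id_PV[OF Id_gen[OF i]] by (simp add: mult.commute)
  next
    fix f g :: "'k gl_poly" assume "f \<in> PV vs" "g \<in> ?Q"
    then show "f * g \<in> ?Q" by (auto simp: PVs mult.assoc[symmetric])
  qed (auto simp: PVs sg_0 distrib_left sg_add)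
  moreover assume "f \<in> rid"
  ultimately have "\<forall>h. sg (h * f) = 0" by blast
  then have "sg (1 * f) = 0" by (rule spec)
  then show "sg f = 0" by simp
qed

lemma sg_eqv: "eqv f g \<Longrightarrow> sg f = sg g"
  using sg_Id[of "f - g"] by (simp add: eqv_def sg_diff)

end

section \<open>Domains and prime elements\<close>

lemma sprime_dvd_power:
  assumes A: "subring_set A" and q: "sprime A q" and f: "f \<in> A" and d: "sdvd A q (f ^ k)"
  shows "k \<noteq> 0 \<and> sdvd A q f"
  using d
proof (induction k)
  case 0 then show ?case using q by (simp add: sprime_def)
next
  case (Suc k)
  then show ?case using q f subring_set_power[OF A f, of k] by (auto simp: sprime_def)
qed

lemma sprime_dvd_prod:
  assumes A: "subring_set A" and q: "sprime A q" and f: "\<And>j. j \<in> B \<Longrightarrow> f j \<in> A" and d: "sdvd A q (\<Prod>j\<in>B. f j ^ k j)"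
  shows "\<exists>j\<in>B. k j \<noteq> 0 \<and> sdvd A q (f j)"
  using f d
proof (induction B rule: infinite_finite_induct)
  case (insert j B)
  have "sdvd A q (f j ^ k j) \<or> sdvd A q (\<Prod>j\<in>B. f j ^ k j)"
    using q insert.prems insert.hyps by (auto simp: sprime_def intro!: subring_set_prod subring_set_power A)
  then show ?case using insert sprime_dvd_power[OF A q, of "f j" "k j"] by auto
qed (use q in \<open>auto simp: sprime_def\<close>)

lemma vcoeff_decompose:
  assumes "f \<in> PV W" "v \<in> W"
  shows "vcoeff v 0 f \<in> PV (W - {v})" "\<exists>g\<in>PV W. f = vcoeff v 0 f + Var v * g"
proof -
  have c: "vcoeff v j f \<in> PV (W - {v})" for j
    using assms by (intro vcoeff_PV) (simp add: insert_absorb)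
  then show "vcoeff v 0 f \<in> PV (W - {v})" .
  have c': "vcoeff v j f \<in> PV W" for j using c[of j] PV_mono[of "W - {v}" W] by blast
  obtain N where N: "\<And>j. j \<ge> N \<Longrightarrow> vcoeff v j f = 0" using vcoeff_eventually_0 by blast
  have "f = (\<Sum>j<Suc N. Var v ^ j * vcoeff v j f)" by (rule vcoeff_expand) (use N in auto)
  then have "f = vcoeff v 0 f + Var v * (\<Sum>j<N. Var v ^ j * vcoeff v (Suc j) f)"
    by (simp only: sum.lessThan_Suc_shift) (simp add: sum_distrib_left mult.assoc)
  moreover have "(\<Sum>j<N. Var v ^ j * vcoeff v (Suc j) f) \<in> PV W"
    by (intro subring_set_sum subring_setD(4) subring_set_power subring_PV c') (use assms in \<open>simp add: Var_PV\<close>)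
  ultimately show "\<exists>g\<in>PV W. f = vcoeff v 0 f + Var v * g" by blast
qed

lemma sdvd_Var_iff:
  assumes "f \<in> PV W" "v \<in> W" shows "sdvd (PV W) (Var v) f \<longleftrightarrow> vcoeff v 0 f = 0"
proof
  assume "sdvd (PV W) (Var v) f"
  then show "vcoeff v 0 f = 0" by (auto simp: sdvd_def vcoeff_Var_mult)
next
  assume "vcoeff v 0 f = 0"
  then show "sdvd (PV W) (Var v) f" using vcoeff_decompose(2)[OF assms] by (auto simp: sdvd_def)
qed

text \<open>Divisibility by v means that the coefficient of v^0 vanishes, and this coefficient is
  multiplicative with values in a domain.\<close>

lemma sprime_Var: assumes v: "v \<in> W" shows "sprime (PV W) (Var v :: 'k::field gl_poly)"
  unfolding sprime_def
proof (intro conjI ballI impI)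
  show "Var v \<in> PV W" using v by (simp add: Var_PV)
  show "Var v \<noteq> (0 :: 'k gl_poly)" by (metis Var_def lookup_single_eq lookup_zero one_neq_zero)
  have "vcoeff v 0 (1 :: 'k gl_poly) = 1" using vcoeff_PV_notin[of "1 :: 'k gl_poly" "{}" v 0] by (simp add: subring_setD(2)[OF subring_PV])
  then show "\<not> sdvd (PV W) (Var v) (1 :: 'k gl_poly)" using sdvd_Var_iff[OF subring_setD(2)[OF subring_PV] v, where 'a = 'k] by simp
  fix a b :: "'k gl_poly" assume ab: "a \<in> PV W" "b \<in> PV W" and "sdvd (PV W) (Var v) (a * b)"
  then have z: "vcoeff v 0 (a * b) = 0" using sdvd_Var_iff[OF _ v, of "a * b"] by (simp add: subring_setD(4)[OF subring_PV])
  obtain g where g: "a = vcoeff v 0 a + Var v * g" using vcoeff_decompose(2)[OF ab(1) v] by blast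
  have "a * b = vcoeff v 0 a * b + Var v * (g * b)" by (subst g) (simp add: distrib_right mult.assoc)
  then have "vcoeff v 0 (a * b) = vcoeff v 0 (vcoeff v 0 a * b)" by (simp add: vcoeff_add vcoeff_Var_mult)
  also have "\<dots> = vcoeff v 0 a * vcoeff v 0 b" by (rule vcoeff_mult_PV[OF vcoeff_decompose(1)[OF ab(1) v]]) simp
  finally have "vcoeff v 0 a = 0 \<or> vcoeff v 0 b = 0" using z by simp
  then show "sdvd (PV W) (Var v) a \<or> sdvd (PV W) (Var v) b" using sdvd_Var_iff[OF _ v] ab by blast
qed

section \<open>Homogeneous elements of R, quotients by graded ideals, and existence of
  charts\<close>

context gl_ci begin

abbreviation "HE \<equiv> homogeneous_elements L gr"

lemma HE_carrier: "a \<in> HE \<Longrightarrow> a \<in> carrier R"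
  by (auto simp: homogeneous_elements_def intro: gr_carrier)

lemma HE_mult: "a \<in> HE \<Longrightarrow> b \<in> HE \<Longrightarrow> a \<otimes>\<^bsub>R\<^esub> b \<in> HE"
  unfolding homogeneous_elements_def using gr_mult L.m_closed by blast

lemma HE_one: "\<one>\<^bsub>R\<^esub> \<in> HE" unfolding homogeneous_elements_def using gr_one by blast

lemma gr_HE: "g \<in> carrier L \<Longrightarrow> a \<in> gr g \<Longrightarrow> a \<in> HE" by (auto simp: homogeneous_elements_def)

lemma qm_HE: assumes f: "f \<in> PV vs" "hg e f" shows "qm f \<in> HE"
proof (cases "f = 0")
  \<comment> \<open>For f = 0 nothing is known about e, and \<open>cl e\<close> may lie outside
    \<open>carrier L\<close>; degree 0 serves instead.\<close>
  case True
  have "qm f \<in> gr (cl 0)" using True by (intro grI f) (simp add: H.hom_0)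
  then show ?thesis using F_closed(3) by (intro gr_HE[of "cl 0"]) (auto simp: L_carrier)
next
  case False
  then obtain m where m: "m \<in> Poly_Mapping.keys f" by (metis ex_in_conv keys_eq_empty)
  then have "cl (mdeg m) = cl e" "Poly_Mapping.keys m \<subseteq> vs" using f by (auto simp: homf_def PV_def)
  then have "cl e \<in> carrier L" using mdeg_carrier unfolding L_carrier by (metis imageI)
  then show ?thesis using grI[OF f] by (rule gr_HE)
qed

lemma quot_zero_iff: "ideal Q R \<Longrightarrow> a \<in> carrier R \<Longrightarrow> Q +>\<^bsub>R\<^esub> a = \<zero>\<^bsub>R Quot Q\<^esub> \<longleftrightarrow> a \<in> Q"
  using ideal.rcos_const_imp_mem[of Q R a] R.a_rcos_zero[of Q a] by (auto simp: FactRing_def)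

lemma quot_homogeneous: "homogeneous_elements L (quot_grading R Q gr) = (\<lambda>a. Q +>\<^bsub>R\<^esub> a) ` HE"
  by (auto simp: homogeneous_elements_def quot_grading_def)

lemma quot_domain_iff:
  assumes Q: "ideal Q R"
  shows "G_domain L (R Quot Q) (quot_grading R Q gr) \<longleftrightarrow>
    \<one>\<^bsub>R\<^esub> \<notin> Q \<and> (\<forall>a\<in>HE. \<forall>b\<in>HE. a \<otimes>\<^bsub>R\<^esub> b \<in> Q \<longrightarrow> a \<in> Q \<or> b \<in> Q)"
proof -
  note h = ideal.rcos_ring_hom[OF Q]
  have one: "\<one>\<^bsub>R Quot Q\<^esub> = Q +>\<^bsub>R\<^esub> \<one>\<^bsub>R\<^esub>" using ring_hom_one[OF h] by simp
  have mult: "(Q +>\<^bsub>R\<^esub> a) \<otimes>\<^bsub>R Quot Q\<^esub> (Q +>\<^bsub>R\<^esub> b) = Q +>\<^bsub>R\<^esub> (a \<otimes>\<^bsub>R\<^esub> b)" if "a \<in> HE" "b \<in> HE" for a b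
    using ring_hom_mult[OF h, of a b] HE_carrier that by simp
  have z: "Q +>\<^bsub>R\<^esub> a = \<zero>\<^bsub>R Quot Q\<^esub> \<longleftrightarrow> a \<in> Q" if "a \<in> HE" for a using quot_zero_iff[OF Q HE_carrier[OF that]] .
  show ?thesis unfolding G_domain_def quot_homogeneous one
    by (simp add: mult z HE_mult HE_one) blast
qed

lemma gpD: "K \<subseteq> {1..n} \<Longrightarrow> int (card K) \<le> d + 1 \<Longrightarrow> (\<Sum>i\<in>K. Const (b i) * l i) = 0 \<Longrightarrow> i \<in> K \<Longrightarrow> b i = 0"
  using gp unfolding general_position_def by blast

lemma l_nonzero: assumes "i \<in> {1..n}" "0 \<le> d" shows "l i \<noteq> 0"
proof
  assume "l i = 0"
  then have "(1::'k) = 0" using gpD[of "{i}" "\<lambda>_. 1" i] assms by (simp add: Const_simps)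
  then show False by simp
qed

text \<open>General position makes the l_i with i \<in> K independent, which is the hypothesis of
  the exchange lemma.\<close>

lemma chart_exists:
  assumes K: "K \<subseteq> {1..n}" "int (card K) \<le> d + 1"
  shows "\<exists>J' c e. gl_chart n p d l la K J' c e \<and> card J' + card K = card J"
proof -
  have fK: "finite K" using K(1) finite_subset by blast
  have "\<exists>J'. J' \<subseteq> J \<and> card J' + card K = card J \<and> (\<exists>c e. complementary la K J J' c e)"
  proof (rule complementary_coordinates[OF fK finite_J])
    fix b assume b: "\<And>j. j \<in> J \<Longrightarrow> (\<Sum>i\<in>K. b i * la i j) = 0"
    have "(\<Sum>i\<in>K. Const (b i) * l i) = (\<Sum>i\<in>K. \<Sum>j\<in>J. Const (b i) * Const (la i j) * Var (T j))"
      using K by (intro sum.cong refl) (subst l_eq, auto simp: sum_distrib_left mult.assoc)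
    also have "\<dots> = (\<Sum>j\<in>J. Const (\<Sum>i\<in>K. b i * la i j) * Var (T j))"
      unfolding Const_sum Const_simps sum_distrib_right by (rule sum.swap)
    also have "\<dots> = 0" using b by (intro sum.neutral) (simp add: Const_simps)
    finally show "\<forall>i\<in>K. b i = 0" using gpD[OF K] by blast
  qed
  then obtain J' c e where "J' \<subseteq> J" "card J' + card K = card J" "complementary la K J J' c e" by blast
  then show ?thesis using K(1) gl_ci_axioms by (intro exI[of _ J'] exI[of _ c] exI[of _ e] conjI gl_chart.intro gl_chart_axioms.intro)
qed

text \<open>The chart with A = k[T_0, ..., T_d], in which every T_j stands for itself and hence
  every l_i as well.\<close>

lemma empty_chart: "gl_chart n p d l la {} J (\<lambda>_ _. 0) (\<lambda>j t. if j = t then 1 else 0)"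
  by (intro gl_chart.intro gl_ci_axioms gl_chart_axioms.intro) (auto simp: complementary_def)

lemma empty_lam: "i \<in> {1..n} \<Longrightarrow> gl_chart.lam p d la {} J (\<lambda>_ _. 0) (\<lambda>j t. if j = t then 1 else 0) i = l i"
proof -
  interpret C: gl_chart n p d l la "{}" J "\<lambda>_ _. 0" "\<lambda>j t. if j = t then 1 else 0" by (rule empty_chart)
  show "i \<in> {1..n} \<Longrightarrow> C.lam i = l i" unfolding C.lam_def by (subst l_eq) (auto simp: C.tau_J')
qed

end

context gl_chart begin

lemma HE_rep:
  assumes "\<alpha> \<in> HE"
  obtains a w e1 where "\<And>j. j \<in> Ic \<Longrightarrow> a j < p j" "w \<in> PV V" "hg e1 w" "\<alpha> = qm (xp a * w)"
proof -
  obtain g where g: "g \<in> carrier L" "\<alpha> \<in> gr g" using assms by (auto simp: homogeneous_elements_def)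
  then obtain e0 where e0: "g = cl e0" unfolding L_carrier by blast
  obtain f where f: "f \<in> PV vs" "hg e0 f" "\<alpha> = qm f" using g(2) unfolding e0 gr_eq by blast
  obtain a w e1 where "\<And>j. j \<in> Ic \<Longrightarrow> a j < p j" "w \<in> PV V" "hg e1 w" "eqv f (xp a * w)"
    using homogeneous_rep[OF f(1,2)] by metis
  then show thesis by (intro that[of a w e1]) (use qm_eqv f(3) in auto)
qed

text \<open>The carry when exponents at X_j add up to p_j or more appears as a power of
  \<open>lam j\<close>.\<close>

lemma sg_xp_prod:
  assumes "w \<in> PV V" "w' \<in> PV V"
  shows "sg (xp a * w * (xp b * w')) = (\<Prod>j\<in>Ic. lam j ^ ((a j + b j) div p j)) * (w * w')"
proof -
  have ww: "w * w' \<in> PV V" using assms by (rule PVs)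
  have e: "xp a * w * (xp b * w') = (w * w') * xp (\<lambda>j. a j + b j)" using xm_add[of a b] mult_single[of "xm a" "1::'k" "xm b" 1] by (simp add: mult_ac)
  have "sg (xp a * w * (xp b * w')) = w * w' * sg (xp (\<lambda>j. a j + b j))" unfolding e using sg_mult_good[OF good_V[OF ww]] sg_V[OF ww] by simp
  also have "\<dots> = w * w' * (\<Prod>j\<in>Ic. lam j ^ ((a j + b j) div p j))" by (rule arg_cong[OF sg_xp])
  also have "\<dots> = (\<Prod>j\<in>Ic. lam j ^ ((a j + b j) div p j)) * (w * w')" by (rule mult.commute)
  finally show ?thesis .
qed

text \<open>If the product vanishes, \<open>sg\<close> turns this into an equation in the domain A,
  where w w' is multiplied by powers of the \<open>lam j\<close>. Since exponents are below p_j, no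
  such factor occurs for p_j = 1; the others are non-zero.\<close>

lemma domain:
  assumes lam: "\<And>j. j \<in> Ic \<Longrightarrow> p j \<noteq> 1 \<Longrightarrow> lam j \<noteq> 0"
    and \<alpha>: "\<alpha> \<in> HE" "\<beta> \<in> HE" "\<alpha> \<otimes>\<^bsub>R\<^esub> \<beta> = \<zero>\<^bsub>R\<^esub>"
  shows "\<alpha> = \<zero>\<^bsub>R\<^esub> \<or> \<beta> = \<zero>\<^bsub>R\<^esub>"
proof -
  obtain a w e1 where a: "\<And>j. j \<in> Ic \<Longrightarrow> a j < p j" "w \<in> PV V" "hg e1 w" "\<alpha> = qm (xp a * w)" using HE_rep[OF \<alpha>(1)] by blast
  obtain b w' e2 where b: "\<And>j. j \<in> Ic \<Longrightarrow> b j < p j" "w' \<in> PV V" "hg e2 w'" "\<beta> = qm (xp b * w')" using HE_rep[OF \<alpha>(2)] by blast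
  have c: "xp a * w \<in> PV vs" "xp b * w' \<in> PV vs" by (rule PVs(4)[OF xp_PV PV_V[OF a(2)]], rule PVs(4)[OF xp_PV PV_V[OF b(2)]])
  have "xp a * w * (xp b * w') \<in> rid" using \<alpha>(3) c unfolding a(4) b(4) by (simp add: qm_mult[symmetric] qm_eq_0_iff PVs)
  then have "sg (xp a * w * (xp b * w')) = 0" by (rule sg_Id)
  then have "(\<Prod>j\<in>Ic. lam j ^ ((a j + b j) div p j)) * (w * w') = 0" unfolding sg_xp_prod[OF a(2) b(2)] .
  moreover have "(\<Prod>j\<in>Ic. lam j ^ ((a j + b j) div p j)) \<noteq> 0"
  proof -
    have "lam j ^ ((a j + b j) div p j) \<noteq> 0" if j: "j \<in> Ic" for j
      using lam[OF j] a(1)[OF j] b(1)[OF j] by (cases "p j = 1") auto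
    then show ?thesis by simp
  qed
  ultimately have "w = 0 \<or> w' = 0" by (simp only: mult_eq_0_iff) blast
  then show ?thesis using a(4) b(4) by (auto simp: qm_zero)
qed

lemma PIdl_sdvd:
  assumes q: "q \<in> PV V" and f: "f \<in> PV vs" "qm f \<in> PIdl\<^bsub>R\<^esub> (qm q)"
  shows "sdvd (PV V) q (sg f)"
proof -
  obtain r where r: "r \<in> PV vs" "qm f = qm r \<otimes>\<^bsub>R\<^esub> qm q" using f(2) by (auto simp: cgenideal_def R_carrier)
  have "qm f = qm (q * r)" using r PV_V[OF q] by (simp add: qm_mult R.m_comm qm_carrier)
  then have "sg f = sg (q * r)" using f r PV_V[OF q] by (intro sg_eqv) (simp add: eqv_def PVs qm_eq_iff)
  also have "\<dots> = q * sg r" using sg_mult_good[OF good_V[OF q]] sg_V[OF q] by simp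
  finally show ?thesis unfolding sdvd_def using sg_PV by blast
qed

text \<open>If the product of X^a w and X^b w' lies in the ideal of q, then \<open>sg\<close> shows
  that q divides w w' times powers of the \<open>lam j\<close>. The latter are excluded by
  \<open>nd\<close>, as for p_j = 1 there is no carry, so q divides w or w'.\<close>

lemma G_prime_qm:
  assumes q: "sprime (PV V) q" and e: "hg e0 q"
    and nd: "\<And>j. j \<in> Ic \<Longrightarrow> p j \<noteq> 1 \<Longrightarrow> \<not> sdvd (PV V) q (lam j)"
  shows "G_prime_element L R gr (qm q)"
proof -
  have qV: "q \<in> PV V" using q by (simp add: sprime_def)
  have qR: "qm q \<in> carrier R" by (rule qm_carrier[OF PV_V[OF qV]])
  let ?Q = "PIdl\<^bsub>R\<^esub> (qm q)"
  have Q: "ideal ?Q R" by (rule R.cgenideal_ideal[OF qR])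
  have qH: "qm q \<in> HE" by (rule qm_HE[OF PV_V[OF qV] e])
  have "homogeneous_ideal L R gr ?Q"
    unfolding homogeneous_ideal_def using Q R.cgenideal_eq_genideal[OF qR] qH by (intro conjI exI[of _ "{qm q}"]) auto
  moreover have "G_domain L (R Quot ?Q) (quot_grading R ?Q gr)"
    unfolding quot_domain_iff[OF Q]
  proof (intro conjI ballI impI)
    show "\<one>\<^bsub>R\<^esub> \<notin> ?Q"
    proof
      assume "\<one>\<^bsub>R\<^esub> \<in> ?Q"
      then have "sdvd (PV V) q (sg 1)" unfolding qm_one by (rule PIdl_sdvd[OF qV PVs(2)])
      then show False using q sg_V[OF PVs(2)] by (simp add: sprime_def)
    qed
    fix \<alpha> \<beta> assume h: "\<alpha> \<in> HE" "\<beta> \<in> HE" "\<alpha> \<otimes>\<^bsub>R\<^esub> \<beta> \<in> ?Q"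
    obtain a w e1 where a: "\<And>j. j \<in> Ic \<Longrightarrow> a j < p j" "w \<in> PV V" "hg e1 w" "\<alpha> = qm (xp a * w)" using HE_rep[OF h(1)] by blast
    obtain b w' e2 where b: "\<And>j. j \<in> Ic \<Longrightarrow> b j < p j" "w' \<in> PV V" "hg e2 w'" "\<beta> = qm (xp b * w')" using HE_rep[OF h(2)] by blast
    have c: "xp a * w \<in> PV vs" "xp b * w' \<in> PV vs" by (rule PVs(4)[OF xp_PV PV_V[OF a(2)]], rule PVs(4)[OF xp_PV PV_V[OF b(2)]])
    have "sdvd (PV V) q (sg (xp a * w * (xp b * w')))"
      by (rule PIdl_sdvd[OF qV PVs(4)[OF c]]) (use h(3) in \<open>simp add: qm_mult c a(4) b(4)\<close>)
    then have "sdvd (PV V) q ((\<Prod>j\<in>Ic. lam j ^ ((a j + b j) div p j)) * (w * w'))" unfolding sg_xp_prod[OF a(2) b(2)] .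
    moreover have "(\<Prod>j\<in>Ic. lam j ^ ((a j + b j) div p j)) \<in> PV V" by (intro subring_set_prod subring_set_power subring_PV lam_PV)
    moreover have "\<not> sdvd (PV V) q (\<Prod>j\<in>Ic. lam j ^ ((a j + b j) div p j))"
    proof
      assume "sdvd (PV V) q (\<Prod>j\<in>Ic. lam j ^ ((a j + b j) div p j))"
      then obtain j where j: "j \<in> Ic" "(a j + b j) div p j \<noteq> 0" "sdvd (PV V) q (lam j)"
        using sprime_dvd_prod[of _ q Ic lam "\<lambda>j. (a j + b j) div p j", OF subring_PV q lam_PV] by blast
      then have "p j = 1" using nd by blast
      then show False using a(1)[OF j(1)] b(1)[OF j(1)] j(2) by simp
    qed
    ultimately have "sdvd (PV V) q w \<or> sdvd (PV V) q w'" using q a(2) b(2) PVs(4)[OF a(2) b(2)] unfolding sprime_def by blast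
    moreover have "qm (xp a' * v) \<in> ?Q" if "sdvd (PV V) q v" for a' v
    proof -
      obtain r where r: "r \<in> PV V" "v = q * r" using \<open>sdvd (PV V) q v\<close> by (auto simp: sdvd_def)
      have "qm (xp a' * v) = qm (xp a' * r) \<otimes>\<^bsub>R\<^esub> qm q"
        using r PV_V qV xp_PV by (subst qm_mult[symmetric]) (auto intro: PVs simp: mult_ac)
      then show ?thesis unfolding cgenideal_def using qm_carrier[OF PVs(4)[OF xp_PV PV_V[OF r(1)]]] by blast
    qed
    ultimately show "\<alpha> \<in> ?Q \<or> \<beta> \<in> ?Q" unfolding a(4) b(4) by blast
  qed
  moreover have "qm q \<noteq> \<zero>\<^bsub>R\<^esub>"
    using sg_Id[of q] sg_V[OF qV] q qm_eq_0_iff[OF PV_V[OF qV]] by (auto simp: sprime_def)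
  ultimately show ?thesis unfolding G_prime_element_def G_prime_ideal_def using qH by blast
qed

end

context gl_ci begin

lemma zero_divisor_free:
  assumes "0 \<le> d \<or> (\<forall>i\<in>{1..n}. p i = 1)" "a \<in> HE" "b \<in> HE" "a \<otimes>\<^bsub>R\<^esub> b = \<zero>\<^bsub>R\<^esub>"
  shows "a = \<zero>\<^bsub>R\<^esub> \<or> b = \<zero>\<^bsub>R\<^esub>"
proof -
  interpret C: gl_chart n p d l la "{}" J "\<lambda>_ _. 0" "\<lambda>j t. if j = t then 1 else 0" by (rule empty_chart)
  show ?thesis by (rule C.domain[OF _ assms(2-4)]) (use assms(1) l_nonzero empty_lam in force)
qed

text \<open>The map \<open>sg\<close> of the empty chart kills the ideal but fixes 1.\<close>

lemma one_not_zero: "\<one>\<^bsub>R\<^esub> \<noteq> \<zero>\<^bsub>R\<^esub>"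
proof
  interpret C: gl_chart n p d l la "{}" J "\<lambda>_ _. 0" "\<lambda>j t. if j = t then 1 else 0" by (rule empty_chart)
  assume "\<one>\<^bsub>R\<^esub> = \<zero>\<^bsub>R\<^esub>"
  then have "1 \<in> rid" unfolding qm_one using qm_eq_0_iff[OF PVs(2)] by simp
  then show False using C.sg_Id[of 1] C.sg_V[OF PVs(2)] by simp
qed

theorem G_domain: "0 \<le> d \<or> (\<forall>i\<in>{1..n}. p i = 1) \<Longrightarrow> G_domain L R gr"
  unfolding G_domain_def
proof (intro conjI ballI impI notI)
  fix a b assume "0 \<le> d \<or> (\<forall>i\<in>{1..n}. p i = 1)" "a \<in> HE" "b \<in> HE" "a \<noteq> \<zero>\<^bsub>R\<^esub>" "b \<noteq> \<zero>\<^bsub>R\<^esub>" "a \<otimes>\<^bsub>R\<^esub> b = \<zero>\<^bsub>R\<^esub>"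
  then show False using zero_divisor_free[of a b] by simp
qed (rule notE[OF one_not_zero])

text \<open>In the chart I = {i} the element X_i is a variable of A and hence prime. It could divide
  \<open>lam j\<close> only if l_j were a multiple of l_i, which general position excludes for two
  indices as soon as d \<ge> 1.\<close>

lemma G_prime_X:
  assumes i: "i \<in> {1..n}" "p i \<noteq> 1" and d: "0 \<le> d" and dj: "\<And>j. j \<in> {1..n} \<Longrightarrow> j \<noteq> i \<Longrightarrow> p j \<noteq> 1 \<Longrightarrow> 1 \<le> d"
  shows "G_prime_element L R gr (qm (Var (X i)))"
proof -
  obtain J' c e where ch: "gl_chart n p d l la {i} J' c e" using chart_exists[of "{i}"] i d by auto
  interpret C: gl_chart n p d l la "{i}" J' c e by (rule ch)
  interpret E: gl_chart n p d l la "{}" J "\<lambda>_ _. 0" "\<lambda>j t. if j = t then 1 else 0" by (rule empty_chart)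
  show ?thesis
  proof (rule C.G_prime_qm[OF sprime_Var hg_Var])
    fix j assume j: "j \<in> {1..n} - {i}" "p j \<noteq> 1"
    show "\<not> sdvd (PV C.V) (Var (X i)) (C.lam j)"
    proof
      assume "sdvd (PV C.V) (Var (X i)) (C.lam j)"
      then have z: "vcoeff (X i) 0 (C.lam j) = 0" using sdvd_Var_iff[OF C.lam_PV, of "X i"] by simp
      \<comment> \<open>\<open>lam j\<close> is \<gamma> X_i^(p_i) plus a linear form u in the T_t
        with t \<in> J', so its coefficient at X_i^0 is u.\<close>
      define \<gamma> where "\<gamma> = (\<Sum>t\<in>J. la j t * c t i)"
      define u where "u = (\<Sum>t\<in>J'. Const (\<Sum>j'\<in>J. la j j' * e j' t) * Var (T t))"
      have le: "C.lam j = Const \<gamma> * Var (X i) ^ p i + u" unfolding C.lam_expand u_def \<gamma>_def by simp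
      have "Var (X i) ^ p i = (Var (X i) * Var (X i) ^ (p i - 1) :: 'k gl_poly)" using p_pos[OF i(1)] by (metis Suc_diff_1 power_Suc)
      then have le2: "C.lam j = Var (X i) * (Const \<gamma> * Var (X i) ^ (p i - 1)) + u" unfolding le by (simp add: mult_ac)
      have "u \<in> PV (T ` J')" unfolding u_def by (intro subring_set_sum subring_PV PVs Const_PV) (simp add: Var_PV)
      then have "vcoeff (X i) 0 u = u" by (subst vcoeff_PV_notin) auto
      then have "u = 0" using z unfolding le2 vcoeff_add vcoeff_Var_mult by simp
      then have lj: "C.lam j = Const \<gamma> * C.lam i" using le C.lam_I by simp
      \<comment> \<open>So far this is a congruence modulo the ideal; the map \<open>sg\<close> of
        the empty chart turns it into an equation between linear forms.\<close>
      have "eqv (l j) (Const \<gamma> * l i)"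
        using eqv_trans[OF C.lam_eqv[of j], unfolded lj, OF _ eqv_mult[OF eqv_refl[OF Const_PV] eqv_sym[OF C.lam_eqv[OF i(1)]]]] j by simp
      then have "E.sg (l j) = E.sg (Const \<gamma> * l i)" by (rule E.sg_eqv)
      moreover have lE: "l i' \<in> PV E.V" if "i' \<in> {1..n}" for i' using E.lam_PV[of i'] empty_lam[OF that] by simp
      ultimately have "l j = Const \<gamma> * l i" using E.sg_V[OF lE] E.sg_V[OF PVs(4)[OF Const_PV lE]] i j by simp
      then have "(\<Sum>i'\<in>{i, j}. Const (if i' = i then \<gamma> else -1) * l i') = 0" using j by (simp add: Const_simps)
      moreover have "int (card {i, j}) \<le> d + 1" using dj j by (auto simp: card_insert_if)
      ultimately have "(if j = i then \<gamma> else -1) = 0"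
        using i(1) j(1) by (intro gpD[of "{i, j}" "\<lambda>i'. if i' = i then \<gamma> else -1"]) auto
      then show False using j by auto
    qed
  qed simp
qed

end

section \<open>Factoriality\<close>

definition tdeg :: "(gl_var \<Rightarrow>\<^sub>0 nat) \<Rightarrow> int" where
  "tdeg m = (\<Sum>v\<in>Poly_Mapping.keys m. int (Poly_Mapping.lookup m v))"

lemma tdeg_add: "tdeg (m + m') = tdeg m + tdeg m'"
  unfolding tdeg_def by (rule setsum_keys_plus_distrib) auto

lemma tdeg_nonneg: "0 \<le> tdeg m" by (simp add: tdeg_def sum_nonneg)

lemma tdeg_eq_0_iff: "tdeg m = 0 \<longleftrightarrow> m = 0"
proof
  assume "tdeg m = 0"
  then have "\<forall>v\<in>Poly_Mapping.keys m. int (Poly_Mapping.lookup m v) = 0"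
    unfolding tdeg_def by (subst (asm) sum_nonneg_eq_0_iff) auto
  then show "m = 0" by (intro poly_mapping_eqI) (auto simp: in_keys_iff)
qed (simp add: tdeg_def)

lemma frag_cmul_sum_left: "frag_cmul (\<Sum>i\<in>A. k i) x = (\<Sum>i\<in>A. frag_cmul (k i) x)"
  by (induction A rule: infinite_finite_induct) (auto simp: frag_cmul_distrib)

context gl_ci begin

lemma mdeg_T: assumes "Poly_Mapping.keys m \<subseteq> T ` J" shows "mdeg m = frag_cmul (tdeg m) (frag_of gen_c)"
  unfolding mdeg_def tdeg_def frag_cmul_sum_left using assms by (intro sum.cong refl) auto

text \<open>This is the infinite order of c, read off from \<open>rel_invariant\<close>.\<close>

lemma tdeg_T:
  assumes "Poly_Mapping.keys m \<subseteq> T ` J" "Poly_Mapping.keys m' \<subseteq> T ` J" "cl (mdeg m) = cl (mdeg m')"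
  shows "tdeg m = tdeg m'"
proof -
  have "frag_cmul (tdeg m - tdeg m') (frag_of gen_c) \<in> rel"
    using assms by (simp add: cl_eq_iff mdeg_T frag_cmul_diff_distrib)
  from conjunct2[OF rel_invariant[OF this]] show ?thesis by (simp add: lookup_single)
qed

text \<open>On polynomials in the T_j the degree is the total degree times c, so
  \<open>homogeneous_factor\<close> applies with an integer weight in spite of the torsion in
  L.\<close>

lemma T_factor_homogeneous:
  assumes ab: "a \<in> PV (T ` J)" "b \<in> PV (T ` J)" "a * b \<noteq> 0" and h: "hg e (a * b)"
  shows "\<exists>e. hg e a"
proof -
  obtain m0 where m0: "m0 \<in> Poly_Mapping.keys a" using ab(3) by (metis ex_in_conv keys_eq_empty mult_zero_left)
  have k: "Poly_Mapping.keys m \<subseteq> T ` J" if "m \<in> Poly_Mapping.keys (a * b)" for m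
    using subring_setD(4)[OF subring_PV ab(1,2)] that by (auto simp: PV_def)
  have t: "tdeg m = tdeg m0" if "m \<in> Poly_Mapping.keys a" for m
  proof (rule homogeneous_factor[OF tdeg_add ab(3) _ that m0])
    fix m m' assume "m \<in> Poly_Mapping.keys (a * b)" "m' \<in> Poly_Mapping.keys (a * b)"
    then show "tdeg m = tdeg m'" using k h by (intro tdeg_T) (auto simp: homf_def)
  qed
  have k': "Poly_Mapping.keys m \<subseteq> T ` J" if "m \<in> Poly_Mapping.keys a" for m using ab(1) that by (auto simp: PV_def)
  have "mdeg m = mdeg m0" if m: "m \<in> Poly_Mapping.keys a" for m
    by (simp only: mdeg_T[OF k'[OF m]] mdeg_T[OF k'[OF m0]] t[OF m])
  then have "hg (mdeg m0) a" unfolding homf_def by metis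
  then show ?thesis by blast
qed

text \<open>A homogeneous unit is carried along, so that such elements are closed under products and
  the constants met in factorizations do no harm.\<close>

definition up :: "'k gl_poly set \<Rightarrow> bool" where
  "up \<alpha> \<longleftrightarrow> (\<exists>v xs. v \<in> Units R \<and> v \<in> HE \<and> (\<forall>x\<in>set xs. G_prime_element L R gr x) \<and> \<alpha> = v \<otimes>\<^bsub>R\<^esub> foldr (\<otimes>\<^bsub>R\<^esub>) xs \<one>\<^bsub>R\<^esub>)"

lemma G_prime_carrier: "G_prime_element L R gr x \<Longrightarrow> x \<in> carrier R"
  unfolding G_prime_element_def using HE_carrier by blast

lemma foldr_carrier: "set xs \<subseteq> carrier R \<Longrightarrow> foldr (\<otimes>\<^bsub>R\<^esub>) xs \<one>\<^bsub>R\<^esub> \<in> carrier R"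
  by (induction xs) auto

lemma foldr_append: "set xs \<subseteq> carrier R \<Longrightarrow> set ys \<subseteq> carrier R \<Longrightarrow>
  foldr (\<otimes>\<^bsub>R\<^esub>) (xs @ ys) \<one>\<^bsub>R\<^esub> = foldr (\<otimes>\<^bsub>R\<^esub>) xs \<one>\<^bsub>R\<^esub> \<otimes>\<^bsub>R\<^esub> foldr (\<otimes>\<^bsub>R\<^esub>) ys \<one>\<^bsub>R\<^esub>"
proof (induction xs)
  case Nil then show ?case using foldr_carrier[of ys] by simp
next
  case (Cons x xs) then show ?case using foldr_carrier[of ys] foldr_carrier[of xs] by (simp add: R.m_assoc)
qed

lemma up_unit: "v \<in> Units R \<Longrightarrow> v \<in> HE \<Longrightarrow> up v"
  unfolding up_def by (rule exI[of _ v], rule exI[of _ "[]"]) (simp add: HE_carrier)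

lemma up_prime: "G_prime_element L R gr x \<Longrightarrow> up x"
  unfolding up_def by (rule exI[of _ "\<one>\<^bsub>R\<^esub>"], rule exI[of _ "[x]"]) (simp add: G_prime_carrier HE_one)

lemma up_mult: assumes "up \<alpha>" "up \<beta>" shows "up (\<alpha> \<otimes>\<^bsub>R\<^esub> \<beta>)"
proof -
  obtain v xs where a: "v \<in> Units R" "v \<in> HE" "\<forall>x\<in>set xs. G_prime_element L R gr x" "\<alpha> = v \<otimes>\<^bsub>R\<^esub> foldr (\<otimes>\<^bsub>R\<^esub>) xs \<one>\<^bsub>R\<^esub>"
    using assms(1) unfolding up_def by blast
  obtain w ys where b: "w \<in> Units R" "w \<in> HE" "\<forall>x\<in>set ys. G_prime_element L R gr x" "\<beta> = w \<otimes>\<^bsub>R\<^esub> foldr (\<otimes>\<^bsub>R\<^esub>) ys \<one>\<^bsub>R\<^esub>"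
    using assms(2) unfolding up_def by blast
  have c: "set xs \<subseteq> carrier R" "set ys \<subseteq> carrier R" using a(3) b(3) G_prime_carrier by auto
  have "\<alpha> \<otimes>\<^bsub>R\<^esub> \<beta> = (v \<otimes>\<^bsub>R\<^esub> w) \<otimes>\<^bsub>R\<^esub> foldr (\<otimes>\<^bsub>R\<^esub>) (xs @ ys) \<one>\<^bsub>R\<^esub>"
    unfolding foldr_append[OF c] a(4) b(4) using foldr_carrier[OF c(1)] foldr_carrier[OF c(2)] HE_carrier[OF a(2)] HE_carrier[OF b(2)]
    by (simp add: R.m_ac)
  moreover have "v \<otimes>\<^bsub>R\<^esub> w \<in> Units R" "v \<otimes>\<^bsub>R\<^esub> w \<in> HE" using a b by (auto intro: HE_mult)
  ultimately show ?thesis unfolding up_def using a(3) b(3)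
    by (intro exI[of _ "v \<otimes>\<^bsub>R\<^esub> w"] exI[of _ "xs @ ys"]) auto
qed

lemma up_one: "up (qm 1)" using up_unit[of "\<one>\<^bsub>R\<^esub>"] HE_one by (simp add: qm_one[symmetric])

lemma up_power: "f \<in> PV vs \<Longrightarrow> up (qm f) \<Longrightarrow> up (qm (f ^ k))"
  by (induction k) (simp_all add: up_one qm_mult up_mult subring_set_power[OF subring_PV])

lemma up_prod: "(\<And>i. i \<in> A \<Longrightarrow> f i \<in> PV vs \<and> up (qm (f i))) \<Longrightarrow> up (qm (prod f A))"
  by (induction A rule: infinite_finite_induct) (simp_all add: up_one qm_mult up_mult subring_set_prod[OF subring_PV])

lemma T_vs: "PV (T ` J) \<subseteq> PV vs" by (rule PV_mono) (auto simp: gl_vars_def)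

lemma unit_qm: assumes "u \<in> PV vs" "r \<in> PV vs" "1 = u * r" shows "qm u \<in> Units R"
proof -
  have "qm u \<otimes>\<^bsub>R\<^esub> qm r = \<one>\<^bsub>R\<^esub>" using assms by (simp add: qm_one flip: qm_mult)
  moreover have "qm r \<otimes>\<^bsub>R\<^esub> qm u = \<one>\<^bsub>R\<^esub>" using assms calculation by (simp add: R.m_comm qm_carrier)
  ultimately show ?thesis using qm_carrier[OF assms(1)] qm_carrier[OF assms(2)] unfolding Units_def by blast
qed

lemma G_prime_unit_mult:
  assumes v: "v \<in> Units R" "v \<in> HE" and x: "G_prime_element L R gr x" shows "G_prime_element L R gr (v \<otimes>\<^bsub>R\<^esub> x)"
proof -
  have xR: "x \<in> carrier R" and vR: "v \<in> carrier R" and iR: "inv\<^bsub>R\<^esub> v \<in> carrier R" using x v G_prime_carrier by auto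
  have inv: "inv\<^bsub>R\<^esub> v \<otimes>\<^bsub>R\<^esub> (v \<otimes>\<^bsub>R\<^esub> x) = x" using v(1) xR vR iR by (simp flip: R.m_assoc)
  have "PIdl\<^bsub>R\<^esub> (v \<otimes>\<^bsub>R\<^esub> x) = PIdl\<^bsub>R\<^esub> x"
  proof (intro equalityI subsetI)
    fix y assume "y \<in> PIdl\<^bsub>R\<^esub> (v \<otimes>\<^bsub>R\<^esub> x)"
    then obtain r where r: "r \<in> carrier R" "y = r \<otimes>\<^bsub>R\<^esub> (v \<otimes>\<^bsub>R\<^esub> x)" by (auto simp: cgenideal_def)
    then have "y = (r \<otimes>\<^bsub>R\<^esub> v) \<otimes>\<^bsub>R\<^esub> x" using xR vR by (simp add: R.m_assoc)
    then show "y \<in> PIdl\<^bsub>R\<^esub> x" using r(1) vR unfolding cgenideal_def by blast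
  next
    fix y assume "y \<in> PIdl\<^bsub>R\<^esub> x"
    then obtain r where r: "r \<in> carrier R" "y = r \<otimes>\<^bsub>R\<^esub> x" by (auto simp: cgenideal_def)
    then have "y = (r \<otimes>\<^bsub>R\<^esub> inv\<^bsub>R\<^esub> v) \<otimes>\<^bsub>R\<^esub> (v \<otimes>\<^bsub>R\<^esub> x)" using inv xR vR iR by (simp add: R.m_assoc)
    then show "y \<in> PIdl\<^bsub>R\<^esub> (v \<otimes>\<^bsub>R\<^esub> x)" using r(1) iR unfolding cgenideal_def by blast
  qed
  moreover have "v \<otimes>\<^bsub>R\<^esub> x \<noteq> \<zero>\<^bsub>R\<^esub>" using inv x iR by (auto simp: G_prime_element_def)
  moreover have "v \<otimes>\<^bsub>R\<^esub> x \<in> HE" using v(2) x by (auto simp: G_prime_element_def intro: HE_mult)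
  ultimately show ?thesis using x by (simp add: G_prime_element_def)
qed

text \<open>\<open>G_factorial\<close> asks for a product of primes with no unit in front. As
  \<alpha> is not a unit there is a first prime, and it absorbs the unit.\<close>

lemma up_factorization:
  assumes "up \<alpha>" "\<alpha> \<notin> Units R"
  shows "\<exists>qs. (\<forall>q\<in>set qs. G_prime_element L R gr q) \<and> \<alpha> = foldr (\<otimes>\<^bsub>R\<^esub>) qs \<one>\<^bsub>R\<^esub>"
proof -
  obtain v xs where a: "v \<in> Units R" "v \<in> HE" "\<forall>x\<in>set xs. G_prime_element L R gr x" "\<alpha> = v \<otimes>\<^bsub>R\<^esub> foldr (\<otimes>\<^bsub>R\<^esub>) xs \<one>\<^bsub>R\<^esub>"
    using assms(1) unfolding up_def by blast
  have "xs \<noteq> []" using a assms(2) by auto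
  then obtain x ys where xs: "xs = x # ys" by (cases xs) auto
  have "set ys \<subseteq> carrier R" "x \<in> carrier R" using a(3) xs G_prime_carrier by auto
  then have "\<alpha> = foldr (\<otimes>\<^bsub>R\<^esub>) ((v \<otimes>\<^bsub>R\<^esub> x) # ys) \<one>\<^bsub>R\<^esub>"
    using a(1,4) xs foldr_carrier[of ys] R.Units_closed[OF a(1)] by (simp add: R.m_assoc)
  moreover have "\<forall>q\<in>set ((v \<otimes>\<^bsub>R\<^esub> x) # ys). G_prime_element L R gr q"
    using G_prime_unit_mult[OF a(1,2)] a(3) xs by auto
  ultimately show ?thesis by blast
qed

text \<open>In l_i = q r both factors are homogeneous for the total degree. As a prime, q is not
  constant, so it has degree 1 and r has degree 0.\<close>

lemma prime_divisor_linear: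
  assumes q: "sprime (PV (T ` J)) q" "hg e q" and i: "i \<in> {1..n}" "l i \<noteq> 0" and dv: "sdvd (PV (T ` J)) q (l i)"
  shows "\<exists>k. k \<noteq> 0 \<and> q = Const k * l i"
proof -
  obtain r where r: "r \<in> PV (T ` J)" "l i = q * r" using dv by (auto simp: sdvd_def)
  have qT: "q \<in> PV (T ` J)" using q by (simp add: sprime_def)
  have li: "tdeg m = 1" if "m \<in> Poly_Mapping.keys (l i)" for m
  proof -
    have "m \<in> (\<Union>j\<in>J. Poly_Mapping.keys (Const (la i j) * Var (T j)))" using that keys_sum[of "\<lambda>j. Const (la i j) * Var (T j)" J] unfolding l_eq[OF i(1)] by blast
    then obtain j where "m = Poly_Mapping.single (T j) 1" by (auto simp: Var_def Const_mult_single split: if_splits)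
    then show ?thesis by (simp add: tdeg_def)
  qed
  obtain mq where mq: "mq \<in> Poly_Mapping.keys q" using q by (metis ex_in_conv keys_eq_empty sprime_def)
  have r0: "r \<noteq> 0" "q * r \<noteq> 0" using i(2) r(2) by auto
  have tq: "tdeg m = tdeg mq" if "m \<in> Poly_Mapping.keys q" for m
    by (rule homogeneous_factor[OF tdeg_add r0(2) _ that mq]) (use li r(2) in auto)
  have tr: "tdeg m = 1 - tdeg mq" if m: "m \<in> Poly_Mapping.keys r" for m
  proof -
    obtain ma mb mm where mm: "ma \<in> Poly_Mapping.keys r" "mb \<in> Poly_Mapping.keys q" "mm \<in> Poly_Mapping.keys (r * q)" "tdeg mm = tdeg ma + tdeg mb"
      using mult_extreme_key[of tdeg r q, OF tdeg_add r0(1)] q by (auto simp: sprime_def)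
    have "tdeg m = tdeg ma" by (rule homogeneous_factor[of tdeg r q, OF tdeg_add _ _ m mm(1)]) (use li r(2) r0(2) in \<open>auto simp: mult.commute\<close>)
    then show ?thesis using mm tq li r(2) by (auto simp: mult.commute)
  qed
  have nq: "tdeg mq \<noteq> 0"
  proof
    assume z: "tdeg mq = 0"
    have "m = 0" if "m \<in> Poly_Mapping.keys q" for m using tq[OF that] z by (simp add: tdeg_eq_0_iff[symmetric])
    then have "Poly_Mapping.keys q \<subseteq> {0}" by blast
    then have "q \<in> PV {}" by (auto simp: PV_def)
    then obtain k where k: "q = Const k" by (auto simp: PV_empty)
    then have "k \<noteq> 0" using q by (auto simp: sprime_def Const_simps)
    then have "sdvd (PV (T ` J)) q 1" unfolding sdvd_def k by (intro bexI[of _ "Const (inverse k)"]) (use Const_inverse[of k] in \<open>auto simp: Const_PV mult.commute\<close>)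
    then show False using q by (simp add: sprime_def)
  qed
  obtain mr where mr: "mr \<in> Poly_Mapping.keys r" using r0 by (metis ex_in_conv keys_eq_empty)
  have "tdeg mq = 1" using tr[OF mr] nq tdeg_nonneg[of mr] tdeg_nonneg[of mq] by linarith
  then have "Poly_Mapping.keys r \<subseteq> {0}" using tr by (auto simp: tdeg_eq_0_iff)
  then have "r \<in> PV {}" by (auto simp: PV_def)
  then obtain k where k: "r = Const k" by (auto simp: PV_empty)
  have k0: "k \<noteq> 0" using r0 k by (auto simp: Const_simps)
  have "Const (inverse k) * l i = q" unfolding r(2) k using Const_inverse[OF k0] by (simp add: mult_ac)
  then show ?thesis using k0 by (intro exI[of _ "inverse k"]) auto
qed

text \<open>A homogeneous prime q of k[T] stays prime in R unless it divides some l_i with p_i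
  \<noteq> 1. In that case q is l_i up to a constant and becomes X_i^(p_i) in R, a power of a graded
  prime.\<close>

lemma up_T:
  assumes c: "1 \<le> d \<or> int (card {i\<in>{1..n}. p i \<noteq> 1}) \<le> d + 1"
    and X: "\<And>i. i \<in> {1..n} \<Longrightarrow> p i \<noteq> 1 \<Longrightarrow> 0 \<le> d \<and> G_prime_element L R gr (qm (Var (X i)))"
    and w: "w \<in> PV (T ` J)" "w \<noteq> 0" "hg e w"
  shows "up (qm w)"
proof -
  interpret E: gl_chart n p d l la "{}" J "\<lambda>_ _. 0" "\<lambda>j t. if j = t then 1 else 0" by (rule empty_chart)
  have prime: "up (qm q)" if q: "sprime (PV (T ` J)) q" "hg e' q" for q e'
  proof (cases "\<exists>i\<in>{1..n}. p i \<noteq> 1 \<and> sdvd (PV (T ` J)) q (l i)")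
    case True
    then obtain i where i: "i \<in> {1..n}" "p i \<noteq> 1" "sdvd (PV (T ` J)) q (l i)" by blast
    obtain k where k: "k \<noteq> 0" "q = Const k * l i" using prime_divisor_linear[OF q i(1) _ i(3)] l_nonzero X i by blast
    have v: "Var (X i) \<in> PV vs" using i(1) by (auto simp: Var_PV gl_vars_def)
    have "eqv (Const k * l i) (Const k * Var (X i) ^ p i)"
      by (rule eqv_mult[OF eqv_refl[OF Const_PV] eqv_sym[OF E.X_p_eqv[OF i(1)]]])
    then have "qm q = qm (Const k) \<otimes>\<^bsub>R\<^esub> qm (Var (X i) ^ p i)"
      using qm_eqv qm_mult[OF Const_PV subring_set_power[OF subring_PV v]] unfolding k(2) by simp
    moreover have "qm (Const k) \<in> Units R"
      by (rule unit_qm[of _ "Const (inverse k)"]) (use Const_inverse[OF k(1)] in \<open>auto simp: Const_PV mult.commute\<close>)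
    moreover have "qm (Const k) \<in> HE" using hg_single[of 0 k] by (intro qm_HE[of _ "mdeg 0"] Const_PV) (simp add: Const_def)
    ultimately show ?thesis using up_power[OF v up_prime] X i by (auto intro: up_mult up_unit)
  next
    case False
    have V: "E.V = T ` J" by simp
    have "G_prime_element L R gr (qm q)"
      by (rule E.G_prime_qm[of q e']) (use False q empty_lam in \<open>auto simp: V\<close>)
    then show ?thesis by (rule up_prime)
  qed
  have "sfactors (PV (T ` J)) w" using sufd_PV[of "T ` J"] finite_J w by (auto simp: sufd_def)
  then obtain u qs where u: "sunit (PV (T ` J)) u" "\<forall>q\<in>set qs. sprime (PV (T ` J)) q" "w = u * prod_list qs" by (auto simp: sfactors_def)
  have uT: "u \<in> PV (T ` J)" using u by (simp add: sunit_def)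
  \<comment> \<open>The factors delivered by \<open>sufd\<close> are not known to be homogeneous;
    the induction splits them off one by one, and \<open>T_factor_homogeneous\<close> applies to
    each factor and each remaining product.\<close>
  have "hg e w \<Longrightarrow> w \<noteq> 0 \<Longrightarrow> w = u * prod_list qs \<Longrightarrow> up (qm w)" for w e using u(2)
  proof (induction qs arbitrary: w e)
    case Nil
    obtain r where r: "r \<in> PV (T ` J)" "1 = u * r" using u(1) by (auto simp: sunit_def sdvd_def)
    have "qm u \<in> Units R" using unit_qm[of u r] uT r T_vs by blast
    moreover have "qm u \<in> HE" using Nil uT T_vs by (intro qm_HE[of u e]) auto
    ultimately show ?case using Nil by (simp add: up_unit)
  next
    case (Cons q qs)
    let ?r = "u * prod_list qs"
    have pT: "prod_list qs \<in> PV (T ` J)" using Cons.prems(4) by (induction qs) (auto simp: PVs sprime_def)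
    have qT: "q \<in> PV (T ` J)" and rT: "?r \<in> PV (T ` J)" using Cons.prems(4) pT uT by (auto simp: sprime_def PVs)
    have wq: "w = q * ?r" "w = ?r * q" using Cons.prems(3) by (simp_all add: mult_ac)
    obtain e1 where e1: "hg e1 q" using T_factor_homogeneous[OF qT rT] Cons.prems(1,2) wq(1) by blast
    obtain e2 where e2: "hg e2 ?r" using T_factor_homogeneous[OF rT qT] Cons.prems(1,2) wq(2) by blast
    have "up (qm ?r)" by (rule Cons.IH[OF e2]) (use Cons.prems wq in auto)
    moreover have "up (qm q)" using prime[OF _ e1] Cons.prems(4) by simp
    moreover have "qm w = qm q \<otimes>\<^bsub>R\<^esub> qm ?r" unfolding wq(1) using qT rT T_vs by (intro qm_mult) auto
    ultimately show ?case by (simp add: up_mult)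
  qed
  then show ?thesis using u(3) w(2,3) by blast
qed

theorem G_factorial:
  assumes c: "1 \<le> d \<or> int (card {i\<in>{1..n}. p i \<noteq> 1}) \<le> d + 1"
  shows "G_factorial L R gr"
proof -
  let ?K = "{i\<in>{1..n}. p i \<noteq> 1}"
  have fK: "finite ?K" by simp
  \<comment> \<open>One non-trivial weight rules out d = -1, and two of them rule out d = 0, since
    they already exceed the bound d + 1 in the second alternative of \<open>c\<close>.\<close>
  have d0: "0 \<le> d" if "i \<in> ?K" for i
  proof -
    have "0 < card ?K" using fK that by (auto simp: card_gt_0_iff)
    then show ?thesis using c by linarith
  qed
  have d1: "1 \<le> d" if "i \<in> ?K" "j \<in> ?K" "j \<noteq> i" for i j
  proof -
    have "card {i, j} \<le> card ?K" by (rule card_mono[OF fK]) (use that in auto)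
    then show ?thesis using c that(3) by (auto simp: card_insert_if)
  qed
  have X: "0 \<le> d \<and> G_prime_element L R gr (qm (Var (X i)))" if "i \<in> {1..n}" "p i \<noteq> 1" for i
    using that d0[of i] d1[of i] by (auto intro!: G_prime_X)
  have dom: "0 \<le> d \<or> (\<forall>i\<in>{1..n}. p i = 1)" using d0 by blast
  interpret E: gl_chart n p d l la "{}" J "\<lambda>_ _. 0" "\<lambda>j t. if j = t then 1 else 0" by (rule empty_chart)
  show ?thesis
    unfolding G_factorial_def
  proof (intro conjI ballI impI up_factorization)
    show "G_domain L R gr" by (rule G_domain[OF dom])
    fix \<alpha> assume \<alpha>: "\<alpha> \<in> HE" "\<alpha> \<noteq> \<zero>\<^bsub>R\<^esub>"
    obtain a w e1 where a: "\<And>j. j \<in> E.Ic \<Longrightarrow> a j < p j" "w \<in> PV E.V" "hg e1 w" "\<alpha> = qm (E.xp a * w)" using E.HE_rep[OF \<alpha>(1)] by blast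
    have w: "w \<in> PV (T ` J)" using a(2) by simp
    have "w \<noteq> 0" using a(4) \<alpha>(2) by (auto simp: qm_zero)
    then have "up (qm w)" using up_T[OF c X w _ a(3)] by blast
    moreover have "up (qm (E.xp a))" unfolding E.xp_eq
    proof (rule up_prod)
      fix j assume j: "j \<in> E.Ic"
      have v: "Var (X j) \<in> PV vs" using j by (auto simp: Var_PV gl_vars_def)
      have "up (qm (Var (X j) ^ a j))"
      proof (cases "p j = 1")
        case True then show ?thesis using a(1)[OF j] by (simp add: up_one)
      next
        case False then show ?thesis using up_power[OF v up_prime] X[of j] j by auto
      qed
      then show "Var (X j) ^ a j \<in> PV vs \<and> up (qm (Var (X j) ^ a j))" using subring_set_power[OF subring_PV v] by blast
    qed
    ultimately show "up \<alpha>" unfolding a(4) using w T_vs E.xp_PV by (subst qm_mult) (auto intro: up_mult)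
  qed
qed

end

section \<open>Isolated singularities\<close>

context gl_chart begin

text \<open>The values are the degrees that can be formed from c and the x_i with i \<in> I, that
  is, from the variables of A. Precomposition with \<open>rt\<close> makes D a homomorphism on the
  whole group of lifts, as \<open>syz_cover\<close> demands.\<close>

definition D :: "(gl_gen \<Rightarrow>\<^sub>0 int) \<Rightarrow> (gl_gen \<Rightarrow>\<^sub>0 int) set" where "D f = cl (rt I f)"

lemma D_carrier: "D f \<in> carrier L" unfolding D_def L_carrier using rt_carrier[OF I] by blast

lemma D_add: "D (f + g) = D f \<otimes>\<^bsub>L\<^esub> D g"
  unfolding D_def rt_add by (rule L_mult[symmetric]) (rule rt_carrier[OF I])+

lemma rt_mdeg: assumes "Poly_Mapping.keys m \<subseteq> V" shows "rt I (mdeg m) = mdeg m"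
proof (rule rt_id[OF finite_I], rule subsetI)
  fix u assume u: "u \<in> Poly_Mapping.keys (mdeg m)"
  show "u \<in> insert gen_c (gen_x ` I)"
  proof (cases u)
    case (gen_x i)
    then have "X i \<in> Poly_Mapping.keys m" using u by (simp add: in_keys_iff lookup_mdeg_X)
    then show ?thesis using assms gen_x by auto
  qed simp
qed

lemma homf_D_iff: assumes f: "f \<in> PV V" shows "homf mdeg D e0 f \<longleftrightarrow> hg (rt I e0) f"
proof -
  have "D (mdeg m) = cl (mdeg m)" if "m \<in> Poly_Mapping.keys f" for m
    using rt_mdeg[of m] f that by (simp add: D_def PV_def)
  then show ?thesis by (simp add: homf_def D_def)
qed

text \<open>For j outside I such a degree has residue 0 modulo p_j, so the power product X^a of the
  normal form is trivial.\<close>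

lemma gr_D_rep:
  assumes \<alpha>: "\<alpha> \<in> gr (D e0)"
  shows "\<exists>w\<in>PV V. homf mdeg D e0 w \<and> \<alpha> = qm w"
proof -
  obtain f where f: "f \<in> PV vs" "hg (rt I e0) f" "\<alpha> = qm f" using \<alpha> unfolding D_def gr_eq by blast
  obtain a w e1 where a: "\<And>j. j \<in> Ic \<Longrightarrow> a j < p j" "w \<in> PV V" "hg e1 w" "cl (rt I e0) = cl (mdeg (xm a) + e1)" "eqv f (xp a * w)"
    using homogeneous_rep[OF f(1,2)] by metis
  have \<alpha>w: "\<alpha> = qm (xp a * w)" using a(5) f(3) qm_eqv by simp
  show ?thesis
  proof (cases "w = 0")
    case True
    then show ?thesis using \<alpha>w by (intro bexI[of _ 0]) (auto simp: homf_def PVs)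
  next
    case False
    then obtain m where m: "m \<in> Poly_Mapping.keys w" by (metis ex_in_conv keys_eq_empty)
    have "cl (mdeg (m + xm a)) = cl (rt I e0)"
      using a(3) m unfolding a(4) by (simp add: homf_def mdeg_add cl_eq_iff)
    then have r: "int (p j) dvd int (Poly_Mapping.lookup (m + xm a) (X j)) - Poly_Mapping.lookup (rt I e0) (gen_x j)" if "j \<in> Ic" for j
      using that by (intro residue_mod) auto
    have "a j = 0" if j: "j \<in> Ic" for j
    proof -
      have "X j \<notin> Poly_Mapping.keys m" using a(2) m j by (auto simp: PV_def)
      then have "int (p j) dvd int (a j)" using r[OF j] j by (simp add: lookup_add lookup_xm lookup_rt(1)[OF finite_I] in_keys_iff)
      then show ?thesis using a(1)[OF j] by (auto dest: dvd_imp_le)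
    qed
    then have x0: "xm a = 0" using xm_cong[of a "\<lambda>_. 0"] by (simp add: xm_0)
    then have "hg (rt I e0) w" using a(3,4) by (simp add: homf_def)
    moreover have "\<alpha> = qm w" using \<alpha>w x0 by simp
    ultimately show ?thesis using a(2) homf_D_iff by blast
  qed
qed

text \<open>The exponents \<open>a j\<close> complete the coefficients of g at the x_j with j
  outside I to multiples of p_j, and in L these become multiples of c.\<close>

lemma unit_lift:
  assumes g: "g \<in> carrier L"
  shows "\<exists>a e0. qm (xp a) \<in> gr (D e0 \<otimes>\<^bsub>L\<^esub> inv\<^bsub>L\<^esub> g)"
proof -
  obtain g0 where g0: "g0 \<in> carrier F" "g = cl g0" using g unfolding L_carrier by blast
  define a where "a j = nat ((- Poly_Mapping.lookup g0 (gen_x j)) mod int (p j))" for j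
  define k where "k j = (int (a j) + Poly_Mapping.lookup g0 (gen_x j)) div int (p j)" for j
  have ak: "int (a j) + Poly_Mapping.lookup g0 (gen_x j) = k j * int (p j)" if "j \<in> Ic" for j
  proof -
    have "0 < int (p j)" using p_pos that by simp
    then have "int (a j) = (- Poly_Mapping.lookup g0 (gen_x j)) mod int (p j)" by (simp add: a_def)
    then have "int (p j) dvd int (a j) + Poly_Mapping.lookup g0 (gen_x j)"
      by (metis diff_minus_eq_add mod_eq_dvd_iff mod_mod_trivial)
    then show ?thesis by (simp add: k_def)
  qed
  define e0 where "e0 = g0 + frag_cmul (\<Sum>j\<in>Ic. k j) (frag_of gen_c)"
  have rc: "rt I (frag_cmul K (frag_of gen_c)) = frag_cmul K (frag_of gen_c)" for K
    using keys_cmul[of K "frag_of gen_c"] by (intro rt_id finite_I) auto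
  have "g0 = rt {1..n} g0" using g0(1) by (intro rt_id[symmetric]) auto
  also have "\<dots> = rt I g0 + (\<Sum>j\<in>Ic. frag_cmul (Poly_Mapping.lookup g0 (gen_x j)) (frag_of (gen_x j)))"
    unfolding rt_def using I sum.subset_diff[OF I, of "\<lambda>j. frag_cmul (Poly_Mapping.lookup g0 (gen_x j)) (frag_of (gen_x j))"]
    by (simp add: add_ac)
  finally have "mdeg (xm a) + g0 - rt I e0 = (\<Sum>j\<in>Ic. frag_cmul (int (a j)) (frag_of (gen_x j))) +
      (\<Sum>j\<in>Ic. frag_cmul (Poly_Mapping.lookup g0 (gen_x j)) (frag_of (gen_x j))) - (\<Sum>j\<in>Ic. frag_cmul (k j) (frag_of gen_c))"
    unfolding e0_def rt_add rc by (simp add: xm_def mdeg_sum mdeg_single frag_cmul_sum_left algebra_simps)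
  also have "\<dots> = (\<Sum>j\<in>Ic. frag_cmul (k j) (frag_cmul (int (p j)) (frag_of (gen_x j)) - frag_of gen_c))"
    unfolding sum.distrib[symmetric] sum_subtractf[symmetric] using ak
    by (intro sum.cong refl) (simp add: frag_cmul_diff flip: frag_cmul_distrib)
  also have "\<dots> \<in> rel" by (intro rel_sum rel_cmul rel_gen) auto
  finally have "cl (mdeg (xm a) + g0) = D e0" by (simp add: D_def cl_eq_iff)
  then have "cl (mdeg (xm a)) \<otimes>\<^bsub>L\<^esub> g = D e0" using g0 mdeg_carrier[OF keys_xm] by (simp add: L_mult del: F_simps)
  moreover have x: "cl (mdeg (xm a)) \<in> carrier L" unfolding L_carrier using mdeg_carrier[OF keys_xm] by blast
  ultimately have "D e0 \<otimes>\<^bsub>L\<^esub> inv\<^bsub>L\<^esub> g = cl (mdeg (xm a))" using g D_carrier L.inv_solve_right[of "cl (mdeg (xm a))" "D e0" g] by simp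
  then show ?thesis using grI[OF xp_PV hg_single, of a] by (intro exI[of _ a] exI[of _ e0]) simp
qed

text \<open>Verifies the axioms of \<open>syz_cover\<close>. The power products of the X_j with j
  outside I become units and supply all degree shifts. A fraction \<alpha> / s whose degree is in
  the range of \<open>D\<close> is expanded by such a power product x, so that both x \<alpha> and x
  s come from A.\<close>

lemma localization_regular:
  assumes Q: "G_prime_ideal L R gr Q" and XQ: "\<And>j. j \<in> Ic \<Longrightarrow> qm (Var (X j)) \<notin> Q" and d0: "0 \<le> d"
  shows "G_regular L (localization R (HE - Q)) (loc_grading L R gr (HE - Q))"
proof -
  define S where "S = HE - Q"
  have Qi: "ideal Q R" using Q by (simp add: G_prime_ideal_def homogeneous_ideal_def)
  have Qd: "\<one>\<^bsub>R\<^esub> \<notin> Q" "\<And>a b. a \<in> HE \<Longrightarrow> b \<in> HE \<Longrightarrow> a \<otimes>\<^bsub>R\<^esub> b \<in> Q \<Longrightarrow> a \<in> Q \<or> b \<in> Q"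
    using Q quot_domain_iff[OF Qi] by (simp_all add: G_prime_ideal_def)
  have Q0: "\<zero>\<^bsub>R\<^esub> \<in> Q" by (rule additive_subgroup.zero_closed[OF ideal.axioms(1)[OF Qi]])
  have loc: "localized_cring R S"
    by (intro localized_cring.intro R_cring localized_cring_axioms.intro)
      (use HE_carrier HE_one HE_mult Qd(1) in \<open>auto simp: S_def dest: Qd(2)\<close>)
  interpret loc: localized_cring R S by (rule loc)
  let ?B = "localization R S" and ?g = "loc_grading L R gr S"
  have gc: "graded_cring L ?B ?g"
    by (rule graded_cring_localization[OF L_comm R_cring R_graded gr_mult gr_one loc]) (use Q0 in \<open>auto simp: S_def\<close>)
  interpret B: graded_cring L ?B ?g by (rule gc)
  have md: "mon_deg mdeg D" unfolding D_def[abs_def] by (rule mon_deg_rt)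
  have fV: "finite V" using finite_I finite_J' by simp
  obtain N where N: "hom_ring.syz (homf mdeg D) (PV V :: 'k gl_poly set) N" using mon_deg.syz_PV[OF md fV] by blast
  define \<phi> where "\<phi> w = loc.fr (qm w) \<one>\<^bsub>R\<^esub>" for w
  have SR: "\<And>s. s \<in> S \<Longrightarrow> s \<in> carrier R" by simp
  have gH: "x \<in> HE" if "x \<in> gr (D e0)" for x e0 using that D_carrier by (rule gr_HE[rotated])
  have XS: "qm (Var (X j)) \<in> S" if j: "j \<in> Ic" for j
    unfolding S_def using XQ[OF j] j qm_HE[OF _ hg_Var[of "X j"]] by (auto simp: Var_PV gl_vars_def)
  have powS: "f ^ k \<in> PV vs \<and> qm (f ^ k) \<in> S" if "f \<in> PV vs" "qm f \<in> S" for f k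
    using that loc.S_one loc.S_mult by (induction k) (auto simp: PVs qm_mult simp flip: qm_one)
  have prodS: "prod f A \<in> PV vs \<and> qm (prod f A) \<in> S" if "\<And>i. i \<in> A \<Longrightarrow> f i \<in> PV vs \<and> qm (f i) \<in> S" for f and A :: "nat set"
    using that loc.S_one loc.S_mult by (induction A rule: infinite_finite_induct) (auto simp: PVs qm_mult simp flip: qm_one)
  have xpS: "qm (xp a) \<in> S" for a
    unfolding xp_eq by (rule conjunct2[OF prodS], rule powS) (use XS in \<open>auto simp: Var_PV gl_vars_def\<close>)
  have one: "\<one>\<^bsub>R\<^esub> \<in> S" by (rule loc.S_one)
  have frg: "loc.fr x \<one>\<^bsub>R\<^esub> \<in> ?g g" if x: "x \<in> gr g" and g: "g \<in> carrier L" for x g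
  proof -
    have "x \<in> gr (g \<otimes>\<^bsub>L\<^esub> \<one>\<^bsub>L\<^esub>)" using x g by simp
    then show ?thesis unfolding loc_grading_def using one gr_one by blast
  qed
  have lift: "\<exists>x e0. x \<in> S \<and> x \<in> gr (D e0 \<otimes>\<^bsub>L\<^esub> inv\<^bsub>L\<^esub> g)" if "g \<in> carrier L" for g using unit_lift[OF that] xpS by blast
  have "syz_cover L ?B ?g (homf mdeg D) (PV V :: 'k gl_poly set) D \<phi> N"
  proof (intro syz_cover.intro gc mon_deg.hom_ring_homf[OF md] syz_cover_axioms.intro subring_PV N D_add D_carrier)
    fix f :: "'k gl_poly" assume f: "f \<in> PV V"
    note fv = PV_V[OF f]
    show "\<phi> f \<in> carrier ?B" unfolding \<phi>_def by (rule loc.frac_carrier[OF qm_carrier[OF fv] one])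
    show "\<phi> f \<in> ?g (D e0)" if "homf mdeg D e0 f" for e0
    proof -
      have "qm f \<in> gr (D e0)" unfolding D_def using that homf_D_iff[OF f] by (intro grI fv) simp
      then show ?thesis unfolding \<phi>_def by (rule frg[OF _ D_carrier])
    qed
    \<comment> \<open>For d \<ge> 0 there are no homogeneous zero divisors in R, so no non-zero
      homogeneous element is lost in the localization; \<open>sg\<close> then gives injectivity of A
      -> R.\<close>
    show "f = 0" if h: "homf mdeg D e0 f" "\<phi> f = \<zero>\<^bsub>?B\<^esub>" for e0
    proof -
      obtain u where u: "u \<in> S" "u \<otimes>\<^bsub>R\<^esub> qm f = \<zero>\<^bsub>R\<^esub>"
        using h(2) loc.frac_eq_zero_iff[OF qm_carrier[OF fv] one] unfolding \<phi>_def by blast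
      have "qm f \<in> HE" using qm_HE[OF fv] h(1) homf_D_iff[OF f] by blast
      moreover have "u \<in> HE" "u \<noteq> \<zero>\<^bsub>R\<^esub>" using u(1) Q0 by (auto simp: S_def)
      ultimately have "qm f = \<zero>\<^bsub>R\<^esub>" using zero_divisor_free[OF disjI1[OF d0], of u "qm f"] u(2) by blast
      then show ?thesis using qm_eq_0_iff[OF fv] sg_Id[of f] sg_V[OF f] by simp
    qed
    fix f' :: "'k gl_poly" assume f': "f' \<in> PV V"
    note fv' = PV_V[OF f']
    show "\<phi> (f + f') = \<phi> f \<oplus>\<^bsub>?B\<^esub> \<phi> f'"
      unfolding \<phi>_def using fv fv' one by (simp add: qm_add loc.add_frac_same qm_carrier)
    show "\<phi> (f * f') = \<phi> f \<otimes>\<^bsub>?B\<^esub> \<phi> f'"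
      unfolding \<phi>_def using fv fv' one by (simp add: qm_mult loc.mult_frac qm_carrier)
  next
    show "\<phi> 1 = \<one>\<^bsub>?B\<^esub>" unfolding \<phi>_def loc.loc_one qm_one by (rule refl)
  next
    fix g assume g: "g \<in> carrier L"
    obtain x e0 where x: "x \<in> S" "x \<in> gr (D e0 \<otimes>\<^bsub>L\<^esub> inv\<^bsub>L\<^esub> g)" using lift[OF g] by blast
    then show "\<exists>u\<in>Units ?B. \<exists>e0. u \<in> ?g (D e0 \<otimes>\<^bsub>L\<^esub> inv\<^bsub>L\<^esub> g)"
      using frg[OF x(2)] g D_carrier loc.frac_unit[OF x(1) one] by blast
  next
    fix z e0 assume "z \<in> ?g (D e0)"
    then obtain \<alpha> s h where z: "h \<in> carrier L" "s \<in> S" "s \<in> gr h" "\<alpha> \<in> gr (D e0 \<otimes>\<^bsub>L\<^esub> h)" "z = loc.fr \<alpha> s"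
      unfolding loc_grading_def by blast
    obtain x e1 where x: "x \<in> S" "x \<in> gr (D e1 \<otimes>\<^bsub>L\<^esub> inv\<^bsub>L\<^esub> h)" using lift[OF z(1)] by blast
    have c: "x \<in> carrier R" "s \<in> carrier R" "\<alpha> \<in> carrier R" using x(1) z(2) gr_carrier[OF z(4)] by auto
    have "x \<otimes>\<^bsub>R\<^esub> s \<in> gr (D e1 \<otimes>\<^bsub>L\<^esub> inv\<^bsub>L\<^esub> h \<otimes>\<^bsub>L\<^esub> h)" using x z D_carrier by (intro gr_mult) auto
    then have "x \<otimes>\<^bsub>R\<^esub> s \<in> gr (D e1)" using z(1) D_carrier by (simp add: L.m_assoc)
    then obtain ws where ws: "ws \<in> PV V" "homf mdeg D e1 ws" "x \<otimes>\<^bsub>R\<^esub> s = qm ws" using gr_D_rep by blast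
    have "x \<otimes>\<^bsub>R\<^esub> \<alpha> \<in> gr (D e1 \<otimes>\<^bsub>L\<^esub> inv\<^bsub>L\<^esub> h \<otimes>\<^bsub>L\<^esub> (D e0 \<otimes>\<^bsub>L\<^esub> h))" using x z D_carrier by (intro gr_mult) auto
    moreover have "D e1 \<otimes>\<^bsub>L\<^esub> inv\<^bsub>L\<^esub> h \<otimes>\<^bsub>L\<^esub> (D e0 \<otimes>\<^bsub>L\<^esub> h) = D (e0 + e1)"
    proof -
      have "D e1 \<otimes>\<^bsub>L\<^esub> inv\<^bsub>L\<^esub> h \<otimes>\<^bsub>L\<^esub> (D e0 \<otimes>\<^bsub>L\<^esub> h) = (D e0 \<otimes>\<^bsub>L\<^esub> D e1) \<otimes>\<^bsub>L\<^esub> (inv\<^bsub>L\<^esub> h \<otimes>\<^bsub>L\<^esub> h)"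
        using z(1) D_carrier by (simp only: L.m_ac L.m_closed L.inv_closed)
      then show ?thesis using z(1) D_carrier by (simp add: D_add)
    qed
    ultimately obtain w where w: "w \<in> PV V" "homf mdeg D (e0 + e1) w" "x \<otimes>\<^bsub>R\<^esub> \<alpha> = qm w" using gr_D_rep[of "x \<otimes>\<^bsub>R\<^esub> \<alpha>" "e0 + e1"] by auto
    have xs: "x \<otimes>\<^bsub>R\<^esub> s \<in> S" using x(1) z(2) by (rule loc.S_mult)
    have "\<phi> ws \<in> Units ?B" unfolding \<phi>_def ws(3)[symmetric] by (rule loc.frac_unit[OF xs one])
    moreover have "\<phi> ws \<otimes>\<^bsub>?B\<^esub> z = \<phi> w"
    proof -
      have "\<phi> ws \<otimes>\<^bsub>?B\<^esub> z = loc.fr (x \<otimes>\<^bsub>R\<^esub> s \<otimes>\<^bsub>R\<^esub> \<alpha>) (\<one>\<^bsub>R\<^esub> \<otimes>\<^bsub>R\<^esub> s)"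
        unfolding \<phi>_def ws(3)[symmetric] z(5) using c one z(2) by (intro loc.mult_frac) auto
      also have "\<dots> = loc.fr (x \<otimes>\<^bsub>R\<^esub> \<alpha>) \<one>\<^bsub>R\<^esub>"
        using c one z(2) by (intro loc.frac_eqI) (auto simp: R.m_ac)
      finally show ?thesis unfolding \<phi>_def w(3) .
    qed
    ultimately show "\<exists>s\<in>PV V. \<exists>w\<in>PV V. \<exists>e'. homf mdeg D e' s \<and> homf mdeg D (e0 + e') w \<and> \<phi> s \<in> Units ?B \<and> \<phi> s \<otimes>\<^bsub>?B\<^esub> z = \<phi> w"
      using ws(1,2) w(1,2) by blast
  qed
  then show ?thesis unfolding S_def[symmetric] by (rule syz_cover.G_regular)
qed

end

context gl_ci begin

text \<open>Modulo Q every polynomial is its constant term, so an element outside Q becomes a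
  non-zero constant of k and is inverted by the inverse constant.\<close>

lemma maximal_if_variables:
  assumes Q: "G_prime_ideal L R gr Q" and v: "\<And>v. v \<in> vs \<Longrightarrow> qm (Var v) \<in> Q"
  shows "G_maximal_ideal L R gr Q"
proof -
  have Qh: "homogeneous_ideal L R gr Q" and dom: "G_domain L (R Quot Q) (quot_grading R Q gr)" using Q by (simp_all add: G_prime_ideal_def)
  have Qi: "ideal Q R" using Qh by (simp add: homogeneous_ideal_def)
  interpret Q: ideal Q R by (rule Qi)
  have kf: "f - Const (Poly_Mapping.lookup f 0) \<in> PV vs \<and> qm (f - Const (Poly_Mapping.lookup f 0)) \<in> Q" if f: "f \<in> PV vs" for f
  proof -
    let ?s = "\<lambda>m. Poly_Mapping.single m (Poly_Mapping.lookup f m)"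
    let ?K = "Poly_Mapping.keys f - {0}"
    have "f = (\<Sum>m\<in>insert 0 (Poly_Mapping.keys f). ?s m)"
      using poly_mapping_sum_single[of f] sum.mono_neutral_left[of "insert 0 (Poly_Mapping.keys f)" "Poly_Mapping.keys f" ?s]
      by (auto simp: in_keys_iff)
    also have "\<dots> = Const (Poly_Mapping.lookup f 0) + (\<Sum>m\<in>?K. ?s m)"
      by (simp add: sum.insert_remove Const_def)
    finally have e: "f - Const (Poly_Mapping.lookup f 0) = (\<Sum>m\<in>?K. ?s m)" by (simp add: algebra_simps)
    have s: "?s m \<in> PV vs \<and> qm (?s m) \<in> Q" if m: "m \<in> ?K" for m
    proof -
      have "Poly_Mapping.keys m \<noteq> {}" using m by simp
      then obtain u where u: "u \<in> Poly_Mapping.keys m" by blast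
      have km: "Poly_Mapping.keys m \<subseteq> vs" using f m by (auto simp: PV_def)
      let ?m = "m - Poly_Mapping.single u 1"
      have mm: "m = Poly_Mapping.single u 1 + ?m"
        by (rule poly_mapping_eqI) (use u in \<open>auto simp: lookup_add lookup_minus lookup_single when_def in_keys_iff\<close>)
      then have "Poly_Mapping.keys ?m \<subseteq> vs" using km keys_plus_nat[of "Poly_Mapping.single u 1" ?m] by auto
      then have P1: "Poly_Mapping.single ?m (Poly_Mapping.lookup f m) \<in> PV vs" by (rule single_PV)
      have uv: "u \<in> vs" using u km by blast
      then have P2: "Var u \<in> PV vs" by (simp add: Var_PV)
      have "?s m = Poly_Mapping.single ?m (Poly_Mapping.lookup f m) * Var u" using mm by (simp add: Var_def mult_single add.commute)
      then show ?thesis using Q.I_l_closed[OF v[OF uv] qm_carrier[OF P1]] PVs(4)[OF P1 P2] qm_mult[OF P1 P2] by simp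
    qed
    have "sum ?s A \<in> PV vs \<and> qm (sum ?s A) \<in> Q" if "A \<subseteq> ?K" for A
      using that s by (induction A rule: infinite_finite_induct) (auto simp: PVs qm_add simp flip: qm_zero)
    then show ?thesis unfolding e by blast
  qed
  note h = ideal.rcos_ring_hom[OF Qi]
  have "\<beta> \<in> Units (R Quot Q)" if \<beta>: "\<beta> \<in> homogeneous_elements L (quot_grading R Q gr)" "\<beta> \<noteq> \<zero>\<^bsub>R Quot Q\<^esub>" for \<beta>
  proof -
    obtain a where a: "a \<in> HE" "\<beta> = Q +>\<^bsub>R\<^esub> a" using \<beta>(1) unfolding quot_homogeneous by blast
    obtain f where f: "f \<in> PV vs" "a = qm f" using HE_carrier[OF a(1)] unfolding R_carrier by blast
    have aQ: "a \<notin> Q" using \<beta>(2) quot_zero_iff[OF Qi HE_carrier[OF a(1)]] a(2) by simp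
    let ?k = "Poly_Mapping.lookup f 0"
    have fk: "qm f = qm (f - Const ?k) \<oplus>\<^bsub>R\<^esub> qm (Const ?k)"
      using kf[OF f(1)] qm_add[of "f - Const ?k" "Const ?k"] by (simp add: Const_PV)
    have k0: "?k \<noteq> 0"
    proof
      assume "?k = 0"
      then show False using kf[OF f(1)] aQ f(2) by (simp add: Const_simps)
    qed
    let ?b = "qm (Const (inverse ?k))"
    have cR: "qm (Const ?k) \<in> carrier R" "?b \<in> carrier R" "qm f \<in> carrier R" by (simp_all add: qm_carrier Const_PV f(1))
    have "qm f \<otimes>\<^bsub>R\<^esub> ?b \<ominus>\<^bsub>R\<^esub> \<one>\<^bsub>R\<^esub> \<in> Q"
    proof -
      have "qm (Const ?k) \<otimes>\<^bsub>R\<^esub> ?b = \<one>\<^bsub>R\<^esub>"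
        using Const_inverse[OF k0] by (simp add: qm_one Const_PV mult.commute flip: qm_mult)
      then have "qm f \<otimes>\<^bsub>R\<^esub> ?b = qm (f - Const ?k) \<otimes>\<^bsub>R\<^esub> ?b \<oplus>\<^bsub>R\<^esub> \<one>\<^bsub>R\<^esub>"
        unfolding fk using kf[OF f(1)] cR by (simp add: R.l_distr qm_carrier)
      moreover have qc: "qm (f - Const ?k) \<otimes>\<^bsub>R\<^esub> ?b \<in> Q" using kf[OF f(1)] cR by (intro Q.I_r_closed) auto
      ultimately show ?thesis using Q.Icarr[OF qc] by (simp add: R.minus_eq R.a_assoc R.r_neg)
    qed
    then have "Q +>\<^bsub>R\<^esub> (qm f \<otimes>\<^bsub>R\<^esub> ?b) = Q +>\<^bsub>R\<^esub> \<one>\<^bsub>R\<^esub>"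
      using R.quotient_eq_iff_same_a_r_cos[OF Qi, of "qm f \<otimes>\<^bsub>R\<^esub> ?b" "\<one>\<^bsub>R\<^esub>"] cR by simp
    then have r: "\<beta> \<otimes>\<^bsub>R Quot Q\<^esub> (Q +>\<^bsub>R\<^esub> ?b) = \<one>\<^bsub>R Quot Q\<^esub>"
      using ring_hom_mult[OF h cR(3,2)] ring_hom_one[OF h] a(2) f(2) by simp
    interpret RQ: cring "R Quot Q" by (rule Q.quotient_is_cring[OF R_cring])
    have c: "\<beta> \<in> carrier (R Quot Q)" "Q +>\<^bsub>R\<^esub> ?b \<in> carrier (R Quot Q)"
      using ring_hom_closed[OF h] cR a(2) f(2) by auto
    then show ?thesis using r RQ.m_comm[OF c] unfolding Units_def by auto
  qed
  then show ?thesis using Qh dom unfolding G_maximal_ideal_def G_field_def G_domain_def by blast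
qed

theorem G_isolated_singularities: "G_isolated_singularities L R gr"
  unfolding G_isolated_singularities_def Let_def
proof (intro allI impI)
  fix Q assume "G_prime_ideal L R gr Q \<and> \<not> G_maximal_ideal L R gr Q"
  then have Q: "G_prime_ideal L R gr Q" and nm: "\<not> G_maximal_ideal L R gr Q" by auto
  have Qi: "ideal Q R" using Q by (simp add: G_prime_ideal_def homogeneous_ideal_def)
  interpret Q: ideal Q R by (rule Qi)
  have Qd: "\<one>\<^bsub>R\<^esub> \<notin> Q" "\<And>a b. a \<in> HE \<Longrightarrow> b \<in> HE \<Longrightarrow> a \<otimes>\<^bsub>R\<^esub> b \<in> Q \<Longrightarrow> a \<in> Q \<or> b \<in> Q"
    using Q quot_domain_iff[OF Qi] by (simp_all add: G_prime_ideal_def)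
  let ?K = "{i\<in>{1..n}. qm (Var (X i)) \<in> Q}"
  have vX: "Var (X i) \<in> PV vs" if "i \<in> {1..n}" for i using that by (auto simp: Var_PV gl_vars_def)
  have small: "int (card ?K) \<le> d"
  proof (rule ccontr)
    assume "\<not> int (card ?K) \<le> d"
    then have "nat (d + 1) \<le> card ?K" by linarith
    then obtain I where I: "I \<subseteq> ?K" "card I = nat (d + 1)" by (meson obtain_subset_with_card_n)
    have "I \<subseteq> {1..n}" "int (card I) \<le> d + 1" using I d_ge by auto
    then obtain J' c e where ch: "gl_chart n p d l la I J' c e" "card J' + card I = card J" using chart_exists by blast
    interpret C: gl_chart n p d l la I J' c e by (rule ch(1))
    \<comment> \<open>The d + 1 forms l_i with i \<in> I are already a full set of coordinates, so
      each \<open>tau j\<close> involves only the X_i^(p_i) with X_i in Q.\<close>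
    have J'0: "J' = {}" using ch(2) I(2) card_J C.finite_J' by simp
    define QP where "QP = {f \<in> PV vs. qm f \<in> Q}"
    have QP_sum: "sum f A \<in> QP" if "\<And>i. i \<in> A \<Longrightarrow> f i \<in> QP" for f and A :: "nat set"
      using that unfolding QP_def by (induction A rule: infinite_finite_induct) (auto simp: PVs qm_add simp flip: qm_zero)
    have QP_mult: "f * g \<in> QP" if "f \<in> PV vs" "g \<in> QP" for f g
      using that Q.I_l_closed qm_carrier by (auto simp: QP_def PVs qm_mult)
    have QP_eqv: "f \<in> QP" if "eqv f g" "g \<in> QP" for f g using that qm_eqv[OF that(1)] by (auto simp: QP_def eqv_def)
    have QX: "Var (X i) ^ p i \<in> QP" if i: "i \<in> {1..n}" "qm (Var (X i)) \<in> Q" for i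
    proof -
      have "Var (X i) ^ p i = (Var (X i) ^ (p i - 1) * Var (X i) :: 'k gl_poly)" using p_pos[OF i(1)] by (metis Suc_diff_1 power_Suc2)
      moreover have "Var (X i) \<in> QP" using i vX by (simp add: QP_def)
      ultimately show ?thesis using QP_mult[OF subring_set_power[OF subring_PV vX[OF i(1)]], of "Var (X i)"] by simp
    qed
    have QT: "Var (T j) \<in> QP" if j: "j \<in> J" for j
    proof -
      have "C.tau j \<in> QP" 
      proof -
        have "(\<Sum>i\<in>I. Const (c j i) * Var (X i) ^ p i) \<in> QP" using I QX by (intro QP_sum QP_mult Const_PV) auto
        then show ?thesis unfolding C.tau_def using J'0 by simp
      qed
      then show ?thesis by (rule QP_eqv[OF eqv_sym[OF C.tau_eqv[OF j]]])
    qed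
    \<comment> \<open>Once all T_j lie in Q, so does every l_i, hence X_i^(p_i); primality of Q on
      homogeneous elements removes the exponent.\<close>
    have QXall: "Var (X i) \<in> QP" if i: "i \<in> {1..n}" for i
    proof -
      have "l i \<in> QP" unfolding l_eq[OF i] using QT by (intro QP_sum QP_mult Const_PV)
      then have "Var (X i) ^ p i \<in> QP" by (rule QP_eqv[OF C.X_p_eqv[OF i]])
      then have "qm (Var (X i) ^ p i) \<in> Q" by (simp add: QP_def)
      moreover have "qm (Var (X i)) \<in> Q" if "qm (Var (X i) ^ k) \<in> Q" for k
        using that
      proof (induction k)
        case 0 then show ?case using Qd(1) by (simp add: qm_one)
      next
        case (Suc k)
        have "qm (Var (X i)) \<otimes>\<^bsub>R\<^esub> qm (Var (X i) ^ k) \<in> Q"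
          using Suc.prems qm_mult[OF vX[OF i] subring_set_power[OF subring_PV vX[OF i]], of k] by simp
        then show ?case using Suc.IH Qd(2)[OF qm_HE[OF vX[OF i] hg_Var] qm_HE[OF subring_set_power[OF subring_PV vX[OF i]] hg_power[OF hg_Var]]] by blast
      qed
      ultimately show ?thesis using vX[OF i] by (auto simp: QP_def)
    qed
    have "qm (Var v) \<in> Q" if "v \<in> vs" for v using that QT QXall by (auto simp: gl_vars_def QP_def)
    then show False using maximal_if_variables[OF Q] nm by blast
  qed
  have "?K \<subseteq> {1..n}" "int (card ?K) \<le> d + 1" using small by auto
  then obtain J' c e where ch: "gl_chart n p d l la ?K J' c e" using chart_exists[of ?K] by blast
  \<comment> \<open>\<open>small\<close> also gives d \<ge> 0, because a cardinality is not
    negative; for d = -1 its proof shows that no graded prime fails to be maximal.\<close>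
  show "G_regular L (localization R (HE - Q)) (loc_grading L R gr (HE - Q))"
    by (rule gl_chart.localization_regular[OF ch Q]) (use small in auto)
qed

end

theorem theorem0p1:
  fixes d :: int and n :: nat
    and l :: "nat \<Rightarrow> 'k::field gl_poly" and p :: "nat \<Rightarrow> nat"
  assumes "-1 \<le> d"
    and "\<forall>i\<in>{1..n}. linear_form d (l i)"
    and "general_position d n l"
    and "\<forall>i\<in>{1..n}. 0 < p i"
  shows "(0 \<le> d \<or> (\<forall>i\<in>{1..n}. p i = 1) \<longrightarrow>
            G_domain (gl_group n p) (gl_ring d n l p) (gl_grading d n l p)) \<and>
         (1 \<le> d \<or> int (card {i \<in> {1..n}. p i \<noteq> 1}) \<le> d + 1 \<longrightarrow>
            G_factorial (gl_group n p) (gl_ring d n l p) (gl_grading d n l p)) \<and>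
         G_isolated_singularities (gl_group n p) (gl_ring d n l p) (gl_grading d n l p)"
proof -
  have "\<forall>i\<in>{1..n}. \<exists>a. l i = (\<Sum>j | int j \<le> d. Const (a j) * Var (T j))"
    using assms(2) by (simp add: linear_form_def)
  then obtain la where "\<And>i. i \<in> {1..n} \<Longrightarrow> l i = (\<Sum>j | int j \<le> d. Const (la i j) * Var (T j))" by metis
  then interpret gl_ci n p d l la using assms by unfold_locales auto
  show ?thesis using G_domain G_factorial G_isolated_singularities by blast
qed

end
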